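(* Let $n\ge2$, $1\le p\le\infty$ and $0<q\le1$. Then the distributional trace $\gamma_0$ is (defined on $B^{1/p}_{p,q}(\mathbb{R}^n)$ and) bounded $$\gamma_0\colon B^{\frac1p}_{p,q}(\mathbb{R}^n)\to L_p(\mathbb{R}^{n-1}).$$ Moreover, this operator is a surjection if $1\le p<\infty$ and $0<q\le1$.
   Context: Besov spaces. Let $\Psi\colon\mathbb{R}\to\mathbb{R}$ be a $C^\infty$ function with $\Psi(t)=1$ for $t<11/10$ and $\Psi(t)=0$ for $t>13/10$. On $\mathbb{R}^n$ put $\Psi_j(\xi)=\Psi(2^{-j}|\xi|)$ for $j\ge0$, $\Phi_0=\Psi_0$ and $\Phi_j=\Psi_j-\Psi_{j-1}$ for $j\ge1$, so that $1=\sum_{j\ge0}\Phi_j$. For $s\in\mathbb{R}$ and $p,q\in\,]0,\infty]$, $B^s_{p,q}(\mathbb{R}^n)$ is the set of $u\in\mathcal{S}'(\mathbb{R}^n)$ with $$\|u\|_{B^s_{p,q}}=\Big(\sum_{k=0}^\infty 2^{skq}\|\mathcal{F}^{-1}(\Phi_k\hat u)\|_{L_p}^q\Big)^{1/q}<\infty$$ (supremum over $k$ if $q=\infty$). The convention $1/\infty=0$ is used. Distributional trace. Let $C(\mathbb{R},\mathcal{D}'(\mathbb{R}^{n-1}))$ be the space of continuous functions $f\colon\mathbb{R}\to\mathcal{D}'(\mathbb{R}^{n-1})$, where $\mathcal{D}'(\mathbb{R}^{n-1})$ has the weak-$*$ topology. It is regarded as a subspace of $\mathcal{D}'(\mathbb{R}^n)$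 by identifying $f$ with the distribution $\varphi\mapsto\int_{\mathbb{R}}\langle f(t),\varphi(\cdot,t)\rangle\,dt$, $\varphi\in C_0^\infty(\mathbb{R}^n)$ (the variable $t$ being $x_n$). The distributional trace of $f\in C(\mathbb{R},\mathcal{D}'(\mathbb{R}^{n-1}))$ at the hyperplane $\{x_n=0\}$ is $\gamma_0f:=f(0)$. Boundedness means that $\|\gamma_0u\|_{L_p(\mathbb{R}^{n-1})}\le c\|u\|_{B^{1/p}_{p,q}(\mathbb{R}^n)}$ for a constant $c<\infty$ and all $u$ in the domain. *)

theory Defs
  imports "HOL-Probability.Essential_Supremum"
begin

section \<open>Smooth functions, test functions and Schwartz functions\<close>

text \<open>
  Multi-indices are lists \<open>vs\<close> of standard basis vectors: \<open>pderivs [v1, ..., vk] f\<close> is the iterated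
  partial derivative of \<open>f\<close> of order \<open>k\<close>. A function is smooth if all these iterated derivatives are
  (totally) differentiable everywhere, which makes all of them continuous.
\<close>

primrec pderivs :: "'a list \<Rightarrow> ('a::euclidean_space \<Rightarrow> 'b::real_normed_vector) \<Rightarrow> 'a \<Rightarrow> 'b" where
  "pderivs [] f = f"
| "pderivs (v # vs) f = (\<lambda>x. frechet_derivative (pderivs vs f) (at x) v)"

definition smooth :: "('a::euclidean_space \<Rightarrow> 'b::real_normed_vector) \<Rightarrow> bool" where
  "smooth f \<longleftrightarrow> (\<forall>vs x. set vs \<subseteq> Basis \<longrightarrow> pderivs vs f differentiable (at x))"

definition supp :: "('a::euclidean_space \<Rightarrow> complex) \<Rightarrow> 'a set" where
  "supp \<phi> = closure {x. \<phi> x \<noteq> 0}"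

definition test_functions :: "('a::euclidean_space \<Rightarrow> complex) set" where
  "test_functions = {\<phi>. smooth \<phi> \<and> compact (supp \<phi>)}"

definition schwartz_functions :: "('a::euclidean_space \<Rightarrow> complex) set" where
  "schwartz_functions = {\<phi>. smooth \<phi> \<and>
     (\<forall>k vs. set vs \<subseteq> Basis \<longrightarrow> bounded (range (\<lambda>x. (1 + norm x) ^ k *\<^sub>R pderivs vs \<phi> x)))}"

definition schwartz_seminorm :: "nat \<Rightarrow> nat \<Rightarrow> ('a::euclidean_space \<Rightarrow> complex) \<Rightarrow> real" where
  "schwartz_seminorm k N \<phi> =
     (\<Sum>vs\<in>{vs. set vs \<subseteq> Basis \<and> length vs \<le> N}. SUP x. (1 + norm x) ^ k * norm (pderivs vs \<phi> x))"

section \<open>Distributions\<close>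

text \<open>
  Distributions are functionals on the ambient function space; they are normalised to vanish outside
  the space of test (resp. Schwartz) functions, so that two distributions are equal as soon as they
  agree on it. Continuity is expressed by the usual seminorm estimates; \<open>schwartz_seminorm 0 N\<close> is
  the \<open>C^N\<close>-norm.
\<close>

definition linear_functional_on ::
    "('a \<Rightarrow> complex) set \<Rightarrow> (('a \<Rightarrow> complex) \<Rightarrow> complex) \<Rightarrow> bool" where
  "linear_functional_on S u \<longleftrightarrow>
     (\<forall>\<phi>\<in>S. \<forall>\<psi>\<in>S. u (\<lambda>x. \<phi> x + \<psi> x) = u \<phi> + u \<psi>) \<and>
     (\<forall>\<phi>\<in>S. \<forall>c. u (\<lambda>x. c * \<phi> x) = c * u \<phi>) \<and>
     (\<forall>\<phi>. \<phi> \<notin> S \<longrightarrow> u \<phi> = 0)"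

definition distributions :: "(('a::euclidean_space \<Rightarrow> complex) \<Rightarrow> complex) set" where
  "distributions = {u. linear_functional_on test_functions u \<and>
     (\<forall>K. compact K \<longrightarrow> (\<exists>C N. \<forall>\<phi>\<in>test_functions. supp \<phi> \<subseteq> K \<longrightarrow>
        norm (u \<phi>) \<le> C * schwartz_seminorm 0 N \<phi>))}"

definition tempered_distributions :: "(('a::euclidean_space \<Rightarrow> complex) \<Rightarrow> complex) set" where
  "tempered_distributions = {u. linear_functional_on schwartz_functions u \<and>
     (\<exists>C k N. \<forall>\<phi>\<in>schwartz_functions. norm (u \<phi>) \<le> C * schwartz_seminorm k N \<phi>)}"

definition locally_integrable :: "('a::euclidean_space \<Rightarrow> complex) \<Rightarrow> bool" where
  "locally_integrable g \<longleftrightarrow> g \<in> borel_measurable lborel \<and> (\<forall>K. compact K \<longrightarrow> set_integrable lborel K g)"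

definition regular_distribution ::
    "('a::euclidean_space \<Rightarrow> complex) \<Rightarrow> ('a \<Rightarrow> complex) \<Rightarrow> complex" where
  "regular_distribution g = (\<lambda>\<phi>. if \<phi> \<in> test_functions then (\<integral>x. g x * \<phi> x \<partial>lborel) else 0)"

section \<open>Lebesgue spaces\<close>

definition ennreal_powr :: "ennreal \<Rightarrow> real \<Rightarrow> ennreal" where
  "ennreal_powr x a = (if x = \<infinity> then \<infinity> else ennreal (enn2real x powr a))" \<comment> \<open>meant for \<open>a > 0\<close>\<close>

definition Lp_norm :: "ennreal \<Rightarrow> ('a::euclidean_space \<Rightarrow> complex) \<Rightarrow> ennreal" where
  "Lp_norm p g =
     (if p = \<infinity> then esssup lborel (\<lambda>x. ennreal (norm (g x)))
      else ennreal_powr (\<integral>\<^sup>+x. ennreal (norm (g x) powr enn2real p) \<partial>lborel) (1 / enn2real p))"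

text \<open>
  The \<open>L_p\<close>-norm of a distribution is that of the locally integrable function representing it
  (which is unique up to null sets), and \<open>\<infinity>\<close> if there is none. Since only test functions are
  used, this also applies to tempered distributions. For the band-limited pieces in the Besov norm
  below, the representing function is the smooth one given by the Paley-Wiener-Schwartz theorem.
\<close>

definition Lp_norm_dist :: "ennreal \<Rightarrow> (('a::euclidean_space \<Rightarrow> complex) \<Rightarrow> complex) \<Rightarrow> ennreal" where
  "Lp_norm_dist p w =
     Inf (Lp_norm p ` {g. locally_integrable g \<and> (\<forall>\<phi>\<in>test_functions. w \<phi> = regular_distribution g \<phi>)})"

text \<open>For \<open>p \<ge> 1\<close>, the space \<open>L_p\<close> as a subspace of the distributions.\<close>

definition Lp_space :: "ennreal \<Rightarrow> (('a::euclidean_space \<Rightarrow> complex) \<Rightarrow> complex) set" where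
  "Lp_space p = regular_distribution ` {g. g \<in> borel_measurable lborel \<and> Lp_norm p g < \<infinity>}"

section \<open>Fourier transform and Besov spaces\<close>

definition fourier :: "('a::euclidean_space \<Rightarrow> complex) \<Rightarrow> 'a \<Rightarrow> complex" where
  "fourier \<phi> \<xi> = (\<integral>x. exp (- \<i> * of_real (x \<bullet> \<xi>)) * \<phi> x \<partial>lborel)"

definition inv_fourier :: "('a::euclidean_space \<Rightarrow> complex) \<Rightarrow> 'a \<Rightarrow> complex" where
  "inv_fourier \<phi> x =
     of_real (1 / (2 * pi) ^ DIM('a)) * (\<integral>\<xi>. exp (\<i> * of_real (x \<bullet> \<xi>)) * \<phi> \<xi> \<partial>lborel)"

text \<open>The corresponding operations on tempered distributions, by transposition.\<close>

definition fourier_dist ::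
    "(('a::euclidean_space \<Rightarrow> complex) \<Rightarrow> complex) \<Rightarrow> ('a \<Rightarrow> complex) \<Rightarrow> complex" where
  "fourier_dist u = (\<lambda>\<phi>. if \<phi> \<in> schwartz_functions then u (fourier \<phi>) else 0)"

definition inv_fourier_dist ::
    "(('a::euclidean_space \<Rightarrow> complex) \<Rightarrow> complex) \<Rightarrow> ('a \<Rightarrow> complex) \<Rightarrow> complex" where
  "inv_fourier_dist u = (\<lambda>\<phi>. if \<phi> \<in> schwartz_functions then u (inv_fourier \<phi>) else 0)"

definition mult_dist ::
    "('a \<Rightarrow> real) \<Rightarrow> (('a::euclidean_space \<Rightarrow> complex) \<Rightarrow> complex) \<Rightarrow> ('a \<Rightarrow> complex) \<Rightarrow> complex" where
  "mult_dist m u =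
     (\<lambda>\<phi>. if \<phi> \<in> schwartz_functions then u (\<lambda>x. of_real (m x) * \<phi> x) else 0)"

definition cutoff :: "(real \<Rightarrow> real) \<Rightarrow> bool" where
  "cutoff \<Psi> \<longleftrightarrow> smooth \<Psi> \<and> (\<forall>t<11/10. \<Psi> t = 1) \<and> (\<forall>t>13/10. \<Psi> t = 0)"

definition dyadic_cutoff :: "(real \<Rightarrow> real) \<Rightarrow> nat \<Rightarrow> 'a::euclidean_space \<Rightarrow> real" where
  "dyadic_cutoff \<Psi> j \<xi> = \<Psi> (norm \<xi> / 2 ^ j)"

primrec dyadic_partition :: "(real \<Rightarrow> real) \<Rightarrow> nat \<Rightarrow> 'a::euclidean_space \<Rightarrow> real" where
  "dyadic_partition \<Psi> 0 = dyadic_cutoff \<Psi> 0"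
| "dyadic_partition \<Psi> (Suc j) = (\<lambda>\<xi>. dyadic_cutoff \<Psi> (Suc j) \<xi> - dyadic_cutoff \<Psi> j \<xi>)"

definition dyadic_piece :: "(real \<Rightarrow> real) \<Rightarrow> nat \<Rightarrow>
    (('a::euclidean_space \<Rightarrow> complex) \<Rightarrow> complex) \<Rightarrow> ('a \<Rightarrow> complex) \<Rightarrow> complex" where
  "dyadic_piece \<Psi> k u = inv_fourier_dist (mult_dist (dyadic_partition \<Psi> k) (fourier_dist u))"

definition besov_norm :: "(real \<Rightarrow> real) \<Rightarrow> real \<Rightarrow> ennreal \<Rightarrow> ennreal \<Rightarrow>
    (('a::euclidean_space \<Rightarrow> complex) \<Rightarrow> complex) \<Rightarrow> ennreal" where
  "besov_norm \<Psi> s p q u =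
     (if q = \<infinity> then (SUP k. ennreal (2 powr (s * real k)) * Lp_norm_dist p (dyadic_piece \<Psi> k u))
      else ennreal_powr
        (\<Sum>k. ennreal (2 powr (s * real k * enn2real q)) *
              ennreal_powr (Lp_norm_dist p (dyadic_piece \<Psi> k u)) (enn2real q))
        (1 / enn2real q))"

definition besov_space :: "(real \<Rightarrow> real) \<Rightarrow> real \<Rightarrow> ennreal \<Rightarrow> ennreal \<Rightarrow>
    (('a::euclidean_space \<Rightarrow> complex) \<Rightarrow> complex) set" where
  "besov_space \<Psi> s p q = {u \<in> tempered_distributions. besov_norm \<Psi> s p q u < \<infinity>}"

section \<open>The distributional trace\<close>

text \<open>Continuity with respect to the weak-* topology is continuity of \<open>t \<mapsto> \<langle>f(t), \<phi>\<rangle>\<close> for each \<open>\<phi>\<close>.\<close>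

definition continuous_distribution_paths ::
    "(real \<Rightarrow> ('a::euclidean_space \<Rightarrow> complex) \<Rightarrow> complex) set" where
  "continuous_distribution_paths =
     {f. (\<forall>t. f t \<in> distributions) \<and> (\<forall>\<phi>\<in>test_functions. continuous_on UNIV (\<lambda>t. f t \<phi>))}"

text \<open>
  Here \<open>'a\<close> is the hyperplane and \<open>'a \<times> real\<close> the whole space, the last coordinate being \<open>t\<close>.
  The condition says that \<open>u\<close>, as a distribution on \<open>'a \<times> real\<close>, is identified with the path \<open>f\<close>.
\<close>

definition represents_path :: "(real \<Rightarrow> ('a::euclidean_space \<Rightarrow> complex) \<Rightarrow> complex) \<Rightarrow>
    (('a \<times> real \<Rightarrow> complex) \<Rightarrow> complex) \<Rightarrow> bool" where
  "represents_path f u \<longleftrightarrow> f \<in> continuous_distribution_paths \<and>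
     (\<forall>\<phi>\<in>test_functions. u \<phi> = (\<integral>t. f t (\<lambda>x. \<phi> (x, t)) \<partial>lborel))"

definition trace_domain :: "(('a::euclidean_space \<times> real \<Rightarrow> complex) \<Rightarrow> complex) set" where
  "trace_domain = {u. \<exists>f. represents_path f u}"

text \<open>On \<open>trace_domain\<close> the path is unique, by testing \<open>u\<close> on products \<open>\<phi>(x) \<chi>(t)\<close>.\<close>

definition distributional_trace ::
    "(('a::euclidean_space \<times> real \<Rightarrow> complex) \<Rightarrow> complex) \<Rightarrow> ('a \<Rightarrow> complex) \<Rightarrow> complex" where
  "distributional_trace u = (THE f. represents_path f u) 0"

end

(*
  The dyadic piece u_k of u is reproduced by convolution with a kernel whose Fourier transform is a
  cut-off equal to 1 near the support of Phi_k. The L_1 norm of that kernel is bounded in k, and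
  that of its slices in the normal direction is O(2^k), so Schur's test bounds
  sup_t ||u_k(.,t)||_p by C 2^(k/p) ||u_k||_p. Since q <= 1, the Besov norm dominates the sum over
  k of 2^(k/p) ||u_k||_p, hence the slices sum absolutely in L_p, uniformly in t. Their sum is a
  continuous path of distributions that represents u; a representing path is unique, as one sees
  by testing against products phi(x) eta(t). Its value at t = 0 is therefore the trace, and it
  obeys the required bound.

  For p finite, h in L_p is a sum of pieces w_j of frequency at most about 2^(m_j), with
  ||w_j||_p = O(2^(-j)). Multiply w_j by an oscillation V_j(t) with V_j(0) = 1 whose frequency is
  close to 2^(N_j), where N_j is strictly increasing and exceeds m_j. Then w_j V_j is exactly the
  dyadic piece of index N_j of the sum u, and the L_p norm of V_j is O(2^(-N_j/p)), which cancels
  the Besov weight. So u lies in the Besov space for every q > 0, and its trace is h.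
*)
theory Submission
  imports Defs "HOL-Probability.Probability"
begin

section \<open>Partial derivatives and smooth functions\<close>

text \<open>Two obstacles shape the proof. A dyadic piece is known to be a function in L_p only when
  tested against test functions, and for \<open>p = \<infinity>\<close> Schwartz functions are not
  dense, so nothing can be proved by density in the Besov space. Identities are therefore obtained
  by moving every operator onto the argument of the functional, after the representation has been
  extended to Schwartz arguments. Secondly, slices of a class modulo null sets make no sense; the
  convolution in the reproducing formula also serves to provide a continuous representative.
  \<open>Lp_norm_dist\<close> is an infimum and Jensen's inequality is used with positive weights,
  so each piece is granted a small slack, which tends to 0 at the end while the constant stays
  fixed. Finite \<open>p\<close> enters the surjectivity through the approximation of
  \<open>h\<close> in norm by band-limited functions, which fails in general for
  \<open>p = \<infinity>\<close>. The multiplier of a product w_j V_j is supported in a shell on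
  which a single member of the partition equals 1; the numerical constants of
  \<open>bump_freq\<close> and the gap 4 between m_j and N_j are chosen to achieve this.\<close>

definition pd :: "'a \<Rightarrow> ('a::euclidean_space \<Rightarrow> 'b::real_normed_vector) \<Rightarrow> 'a \<Rightarrow> 'b" where
  "pd v f = (\<lambda>x. frechet_derivative f (at x) v)"

text \<open>Order-by-order form of \<open>smooth\<close>, made for induction on \<open>n\<close>.
  The derivatives counted are those that are themselves differentiable, so \<open>Ck_on 0\<close>
  already means differentiability. The set argument serves functions such as the norm that are
  singular at a point.\<close>

definition Ck_on :: "nat \<Rightarrow> 'a set \<Rightarrow> ('a::euclidean_space \<Rightarrow> 'b::real_normed_vector) \<Rightarrow> bool" where
  "Ck_on n S f \<longleftrightarrow> (\<forall>vs x. set vs \<subseteq> Basis \<longrightarrow> length vs \<le> n \<longrightarrow> x \<in> S \<longrightarrow> pderivs vs f differentiable (at x))"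

lemma smooth_iff_Ck: "smooth f \<longleftrightarrow> (\<forall>n. Ck_on n UNIV f)"
  by (auto simp: smooth_def Ck_on_def)

lemma pderivs_append: "pderivs (vs @ ws) f = pderivs vs (pderivs ws f)"
  by (induction vs) auto

text \<open>The recursion of \<open>pderivs\<close> exposes the derivative taken last; this form
  exposes the one taken first, so that inductions can replace \<open>f\<close> by
  \<open>pd v f\<close>.\<close>

lemma pderivs_snoc: "pderivs (vs @ [v]) f = pderivs vs (pd v f)"
  by (simp add: pderivs_append pd_def)

lemma pd_eq: "(f has_derivative D) (at x) \<Longrightarrow> pd v f x = D v"
  by (simp add: pd_def frechet_derivative_at[symmetric])

lemma Ck_on_0: "Ck_on 0 S f \<longleftrightarrow> (\<forall>x\<in>S. f differentiable (at x))"
  by (auto simp: Ck_on_def)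

lemma Ck_on_Suc:
  "Ck_on (Suc n) S f \<longleftrightarrow> (\<forall>x\<in>S. f differentiable (at x)) \<and> (\<forall>v\<in>Basis. Ck_on n S (pd v f))"
proof safe
  fix x assume "Ck_on (Suc n) S f" "x \<in> S"
  then show "f differentiable (at x)" unfolding Ck_on_def using pderivs.simps(1)[of f] by (metis empty_subsetI le0 list.set(1) list.size(3))
next
  fix v :: 'a assume A: "Ck_on (Suc n) S f" and v: "v \<in> Basis"
  show "Ck_on n S (pd v f)" unfolding Ck_on_def
  proof safe
    fix vs :: "'a list" and x assume "set vs \<subseteq> Basis" "length vs \<le> n" "x \<in> S"
    then show "pderivs vs (pd v f) differentiable (at x)"
      using A[unfolded Ck_on_def, rule_format, of "vs @ [v]" x] v by (simp add: pderivs_snoc)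
  qed
next
  assume A: "\<forall>x\<in>S. f differentiable (at x)" and B: "\<forall>v\<in>Basis. Ck_on n S (pd v f)"
  show "Ck_on (Suc n) S f" unfolding Ck_on_def
  proof safe
    fix vs :: "'a list" and x assume vs: "set vs \<subseteq> Basis" "length vs \<le> Suc n" "x \<in> S"
    show "pderivs vs f differentiable (at x)"
    proof (cases vs rule: rev_cases)
      case Nil then show ?thesis using A vs by simp
    next
      case (snoc ws w) then show ?thesis using B vs by (auto simp: pderivs_snoc Ck_on_def)
    qed
  qed
qed

lemma Ck_on_mono: "Ck_on n S f \<Longrightarrow> m \<le> n \<Longrightarrow> T \<subseteq> S \<Longrightarrow> Ck_on m T f"
  unfolding Ck_on_def by (meson order_trans subsetD)

lemma Ck_on_Un: "Ck_on n S f \<Longrightarrow> Ck_on n T f \<Longrightarrow> Ck_on n (S \<union> T) f"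
  unfolding Ck_on_def by blast

text \<open>Differentiability is not assumed: on an open set both functions have the same candidate
  derivatives at each point, so the choice inside \<open>frechet_derivative\<close> agrees even
  where there is none.\<close>

lemma pderivs_cong_open:
  assumes "open S" "\<And>x. x \<in> S \<Longrightarrow> f x = g x" "x \<in> S"
  shows "pderivs vs f x = pderivs vs g x"
  using assms(3)
proof (induction vs arbitrary: x)
  case (Cons v vs)
  have "(pderivs vs f has_derivative D) (at x) \<longleftrightarrow> (pderivs vs g has_derivative D) (at x)" for D
    using has_derivative_transform_within_open[OF _ assms(1) Cons.prems, of "pderivs vs f" D UNIV "pderivs vs g"]
      has_derivative_transform_within_open[OF _ assms(1) Cons.prems, of "pderivs vs g" D UNIV "pderivs vs f"] Cons.IH by auto
  then show ?case by (simp add: frechet_derivative_def)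
qed (use assms in auto)

lemma Ck_on_cong_open:
  fixes f g :: "'a::euclidean_space \<Rightarrow> 'b::real_normed_vector"
  assumes "open S" "\<And>x. x \<in> S \<Longrightarrow> f x = g x" "Ck_on n S f"
  shows "Ck_on n S g"
  unfolding Ck_on_def
proof safe
  fix vs :: "'a list" and x assume "set vs \<subseteq> Basis" "length vs \<le> n" "x \<in> S"
  then have "pderivs vs f differentiable (at x)" using assms by (auto simp: Ck_on_def)
  then obtain D where "(pderivs vs f has_derivative D) (at x)" by (auto simp: differentiable_def)
  then have "(pderivs vs g has_derivative D) (at x)"
    by (rule has_derivative_transform_within_open[OF _ assms(1) \<open>x \<in> S\<close>])
       (use pderivs_cong_open[OF assms(1,2)] in auto)
  then show "pderivs vs g differentiable (at x)" by (auto simp: differentiable_def)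
qed

text \<open>The engine of the closure proofs: a formula for the derivative, built from operations
  already known to preserve order \<open>n\<close>, yields order \<open>n + 1\<close>.\<close>

lemma Ck_on_SucI:
  assumes "open S" "\<And>x. x \<in> S \<Longrightarrow> (f has_derivative D x) (at x)"
    and "\<And>v. v \<in> Basis \<Longrightarrow> Ck_on n S (\<lambda>x. D x v)"
  shows "Ck_on (Suc n) S f"
  unfolding Ck_on_Suc
proof safe
  fix x assume "x \<in> S" then show "f differentiable (at x)" using assms(2) by (auto simp: differentiable_def)
next
  fix v :: 'a assume "v \<in> Basis"
  show "Ck_on n S (pd v f)"
    by (rule Ck_on_cong_open[OF assms(1) _ assms(3)[OF \<open>v \<in> Basis\<close>]]) (simp add: pd_eq[OF assms(2)])
qed

lemma Ck_on_deriv: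
  assumes "Ck_on n S f" "x \<in> S"
  shows "(f has_derivative (\<lambda>h. \<Sum>b\<in>Basis. (h \<bullet> b) *\<^sub>R pd b f x)) (at x)"
proof -
  have d: "f differentiable (at x)" using assms Ck_on_mono[of n S f 0 S] by (auto simp: Ck_on_0)
  then have D: "(f has_derivative frechet_derivative f (at x)) (at x)" by (simp add: frechet_derivative_works)
  then have l: "linear (frechet_derivative f (at x))" by (rule has_derivative_linear)
  have "frechet_derivative f (at x) = (\<lambda>h. \<Sum>b\<in>Basis. (h \<bullet> b) *\<^sub>R pd b f x)"
  proof
    fix h
    have "frechet_derivative f (at x) h = frechet_derivative f (at x) (\<Sum>b\<in>Basis. (h \<bullet> b) *\<^sub>R b)" by (simp add: euclidean_representation)
    also have "\<dots> = (\<Sum>b\<in>Basis. (h \<bullet> b) *\<^sub>R pd b f x)"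
      unfolding pd_def by (simp add: linear_sum[OF l] linear_scale[OF l])
    finally show "frechet_derivative f (at x) h = (\<Sum>b\<in>Basis. (h \<bullet> b) *\<^sub>R pd b f x)" .
  qed
  with D show ?thesis by simp
qed

lemma Ck_on_deriv_frechet:
  assumes "Ck_on n S f" "x \<in> S"
  shows "(f has_derivative frechet_derivative f (at x)) (at x)"
  using Ck_on_mono[OF assms(1), of 0 S] assms(2) by (auto simp: Ck_on_0 frechet_derivative_works[symmetric])

lemma Ck_on_pd: "Ck_on (Suc n) S f \<Longrightarrow> v \<in> Basis \<Longrightarrow> Ck_on n S (pd v f)"
  by (simp add: Ck_on_Suc)

lemma Ck_on_SucD: "Ck_on (Suc n) S f \<Longrightarrow> Ck_on n S f"
  by (rule Ck_on_mono) auto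

section \<open>Closure of the classes \<open>Ck_on\<close> under algebra and composition\<close>

lemma Ck_on_const: "open S \<Longrightarrow> Ck_on n S (\<lambda>x. c)"
proof (induction n arbitrary: c)
  case 0 then show ?case by (auto simp: Ck_on_0)
next
  case (Suc n)
  then show ?case by (intro Ck_on_SucI[where D = "\<lambda>x h. 0"]) auto
qed

lemma Ck_on_add: "open S \<Longrightarrow> Ck_on n S f \<Longrightarrow> Ck_on n S g \<Longrightarrow> Ck_on n S (\<lambda>x. f x + g x)"
proof (induction n arbitrary: f g)
  case 0 then show ?case by (auto simp: Ck_on_0)
next
  case (Suc n)
  show ?case
    by (rule Ck_on_SucI[where D = "\<lambda>x h. frechet_derivative f (at x) h + frechet_derivative g (at x) h"])
       (use Suc in \<open>auto intro!: has_derivative_add Ck_on_deriv_frechet Suc.IH simp: pd_def[symmetric] dest: Ck_on_pd\<close>)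
qed

lemma Ck_on_sum:
  "open S \<Longrightarrow> finite I \<Longrightarrow> (\<And>i. i \<in> I \<Longrightarrow> Ck_on n S (f i)) \<Longrightarrow> Ck_on n S (\<lambda>x. \<Sum>i\<in>I. f i x)"
proof (induction I rule: infinite_finite_induct)
  case (insert i I) then show ?case by (simp add: Ck_on_add)
qed (auto intro: Ck_on_const)

text \<open>One induction through the product rule covers products and scalar multiples. Each
  summand of the derivative keeps one factor undifferentiated, which is used at the lower
  order.\<close>

lemma Ck_on_bilinear:
  assumes "bounded_bilinear pr" "open S"
  shows "Ck_on n S f \<Longrightarrow> Ck_on n S g \<Longrightarrow> Ck_on n S (\<lambda>x. pr (f x) (g x))"
proof (induction n arbitrary: f g)
  case 0 then show ?case
    unfolding Ck_on_0 differentiable_def by (fast intro: bounded_bilinear.FDERIV[OF assms(1)])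
next
  case (Suc n)
  show ?case
    by (rule Ck_on_SucI[where D = "\<lambda>x h. pr (f x) (frechet_derivative g (at x) h) + pr (frechet_derivative f (at x) h) (g x)"])
       (use Suc assms in \<open>auto intro!: bounded_bilinear.FDERIV[OF assms(1)] Ck_on_deriv_frechet Ck_on_add Suc.IH
            simp: pd_def[symmetric] dest: Ck_on_pd Ck_on_SucD\<close>)
qed

lemmas Ck_on_mult = Ck_on_bilinear[OF bounded_bilinear_mult]
lemmas Ck_on_scaleR = Ck_on_bilinear[OF bounded_bilinear_scaleR]

lemma Ck_on_linear:
  fixes L :: "'a::euclidean_space \<Rightarrow> 'b::real_normed_vector"
  assumes "bounded_linear L" "open S" shows "Ck_on n S (\<lambda>x. L x)"
proof (cases n)
  case 0 then show ?thesis using assms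
    by (auto simp: Ck_on_0 bounded_linear_imp_differentiable)
next
  case (Suc m)
  show ?thesis unfolding Suc
    by (rule Ck_on_SucI[where D = "\<lambda>x h. L h"]) (use assms in \<open>auto intro: Ck_on_const bounded_linear_imp_has_derivative\<close>)
qed

lemma Ck_on_bounded_linear:
  assumes L: "bounded_linear L" and S: "open S"
  shows "Ck_on n S f \<Longrightarrow> Ck_on n S (\<lambda>x. L (f x))"
proof (induction n arbitrary: f)
  case 0 then show ?case
    unfolding Ck_on_0 differentiable_def by (fast intro: bounded_linear.has_derivative[OF L])
next
  case (Suc n)
  show ?case
    by (rule Ck_on_SucI[where D = "\<lambda>x h. L (frechet_derivative f (at x) h)"])
       (use Suc S in \<open>auto intro!: bounded_linear.has_derivative[OF L] Ck_on_deriv_frechet Suc.IH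
            simp: pd_def[symmetric] dest: Ck_on_pd\<close>)
qed

text \<open>By the chain rule the derivative is that of \<open>g\<close> times \<open>pd 1 f\<close>
  evaluated at \<open>g\<close>, so induction over \<open>f\<close> and the product rule close the
  argument. The intended use is a cut-off profile applied to the norm.\<close>

lemma Ck_on_compose_real:
  fixes g :: "'a::euclidean_space \<Rightarrow> real" and f :: "real \<Rightarrow> 'b::real_normed_vector"
  assumes S: "open S" and T: "open T" "g ` S \<subseteq> T"
  shows "Ck_on n T f \<Longrightarrow> Ck_on n S g \<Longrightarrow> Ck_on n S (\<lambda>x. f (g x))"
proof (induction n arbitrary: f)
  case 0
  show ?case unfolding Ck_on_0
  proof
    fix x assume "x \<in> S"
    then have "g differentiable at x" "f differentiable at (g x)" using 0 T by (auto simp: Ck_on_0)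
    then show "(\<lambda>x. f (g x)) differentiable at x"
      using differentiable_chain_at[of g x f] by (simp add: comp_def)
  qed
next
  case (Suc n)
  have D: "(f has_derivative (\<lambda>h. h *\<^sub>R pd 1 f y)) (at y)" if "y \<in> T" for y
    using Ck_on_deriv[OF Suc.prems(1) that] by simp
  show ?case
  proof (rule Ck_on_SucI[where D = "\<lambda>x h. frechet_derivative g (at x) h *\<^sub>R pd 1 f (g x)"])
    fix x assume "x \<in> S"
    then show "((\<lambda>x. f (g x)) has_derivative (\<lambda>h. frechet_derivative g (at x) h *\<^sub>R pd 1 f (g x))) (at x)"
      using has_derivative_compose[OF Ck_on_deriv_frechet[OF Suc.prems(2) \<open>x \<in> S\<close>] D[of "g x"]] T by auto
  next
    fix v :: 'a assume "v \<in> Basis"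
    have "Ck_on n T (pd 1 f)" using Suc.prems(1) by (auto dest: Ck_on_pd)
    then show "Ck_on n S (\<lambda>x. frechet_derivative g (at x) v *\<^sub>R pd 1 f (g x))"
      using Suc \<open>v \<in> Basis\<close> S by (intro Ck_on_scaleR) (auto simp: pd_def[symmetric] dest: Ck_on_pd Ck_on_SucD)
  qed (use S in auto)
qed

text \<open>The linear part may change the dimension: the lemma is used for dilations, for the
  projections onto a factor and for the embedding of a slice.\<close>

lemma Ck_on_affine:
  fixes f :: "'b::euclidean_space \<Rightarrow> 'c::real_normed_vector" and L :: "'a::euclidean_space \<Rightarrow> 'b"
  assumes L: "bounded_linear L"
  shows "Ck_on n UNIV f \<Longrightarrow> Ck_on n UNIV (\<lambda>x. f (L x + c))"
proof (induction n arbitrary: f)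
  case 0
  show ?case unfolding Ck_on_0
  proof
    fix x
    have "(\<lambda>x. L x + c) differentiable at x" using L by (intro differentiable_add bounded_linear_imp_differentiable differentiable_const)
    moreover have "f differentiable at (L x + c)" using 0 by (auto simp: Ck_on_0)
    ultimately show "(\<lambda>x. f (L x + c)) differentiable at x"
      using differentiable_chain_at[of "\<lambda>x. L x + c" x f] by (simp add: comp_def)
  qed
next
  case (Suc n)
  show ?case
  proof (rule Ck_on_SucI[where D = "\<lambda>x h. \<Sum>b\<in>Basis. (L h \<bullet> b) *\<^sub>R pd b f (L x + c)"])
    fix x :: 'a
    have "((\<lambda>x. L x + c) has_derivative L) (at x)"
      using bounded_linear_imp_has_derivative[OF L] by (auto intro!: derivative_eq_intros)
    from has_derivative_compose[OF this Ck_on_deriv[OF Suc.prems UNIV_I]]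
    show "((\<lambda>x. f (L x + c)) has_derivative (\<lambda>h. \<Sum>b\<in>Basis. (L h \<bullet> b) *\<^sub>R pd b f (L x + c))) (at x)" .
  next
    fix v :: 'a
    show "Ck_on n UNIV (\<lambda>x. \<Sum>b\<in>Basis. (L v \<bullet> b) *\<^sub>R pd b f (L x + c))"
      using Suc by (intro Ck_on_sum Ck_on_scaleR Ck_on_const Suc.IH) (auto dest: Ck_on_pd)
  qed auto
qed

section \<open>Smooth functions and the calculus of iterated partial derivatives\<close>

lemma smoothD: "smooth f \<Longrightarrow> Ck_on n UNIV f" by (simp add: smooth_iff_Ck)

lemma smooth_add: "smooth f \<Longrightarrow> smooth g \<Longrightarrow> smooth (\<lambda>x. f x + g x)"
  by (simp add: smooth_iff_Ck Ck_on_add)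

lemma smooth_mult:
  fixes f g :: "'a::euclidean_space \<Rightarrow> 'b::real_normed_algebra"
  shows "smooth f \<Longrightarrow> smooth g \<Longrightarrow> smooth (\<lambda>x. f x * g x)"
  by (simp add: smooth_iff_Ck Ck_on_mult)

lemma smooth_const: "smooth (\<lambda>x. c)"
  by (simp add: smooth_iff_Ck Ck_on_const)

lemma smooth_cmult:
  fixes f :: "'a::euclidean_space \<Rightarrow> 'b::real_normed_algebra"
  shows "smooth f \<Longrightarrow> smooth (\<lambda>x. c * f x)"
  by (intro smooth_mult smooth_const)

lemma smooth_pd: "smooth f \<Longrightarrow> v \<in> Basis \<Longrightarrow> smooth (pd v f)"
  unfolding smooth_iff_Ck using Ck_on_pd by blast

lemma smooth_pderivs: "smooth f \<Longrightarrow> set vs \<subseteq> Basis \<Longrightarrow> smooth (pderivs vs f)"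
  by (induction vs) (auto simp: smooth_pd[unfolded pd_def])

lemma smooth_affine:
  fixes f :: "'b::euclidean_space \<Rightarrow> 'c::real_normed_vector" and L :: "'a::euclidean_space \<Rightarrow> 'b"
  shows "smooth f \<Longrightarrow> bounded_linear L \<Longrightarrow> smooth (\<lambda>x. f (L x + c))"
  by (simp add: smooth_iff_Ck Ck_on_affine)

lemma smooth_scale:
  fixes f :: "'b::euclidean_space \<Rightarrow> 'c::real_normed_vector"
  shows "smooth f \<Longrightarrow> smooth (\<lambda>x. f (r *\<^sub>R x))"
  using smooth_affine[of f "\<lambda>x. r *\<^sub>R x" 0] by (simp add: bounded_linear_scaleR_right)

lemma smooth_linear: "bounded_linear L \<Longrightarrow> smooth L"
  by (simp add: smooth_iff_Ck Ck_on_linear)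

lemma smooth_continuous: "smooth f \<Longrightarrow> continuous_on S f"
  by (intro continuous_at_imp_continuous_on ballI has_derivative_continuous[OF Ck_on_deriv[OF smoothD UNIV_I]])

lemma smooth_deriv: "smooth f \<Longrightarrow> (f has_derivative (\<lambda>h. \<Sum>b\<in>Basis. (h \<bullet> b) *\<^sub>R pd b f x)) (at x)"
  by (rule Ck_on_deriv[OF smoothD UNIV_I])

lemma pd_add:
  "smooth f \<Longrightarrow> smooth g \<Longrightarrow> pd v (\<lambda>x. f x + g x) = (\<lambda>x. pd v f x + pd v g x)"
  by (rule ext) (subst pd_eq[OF has_derivative_add[OF smooth_deriv smooth_deriv]], auto simp: pd_eq[OF smooth_deriv])

lemma pd_mult:
  fixes f g :: "'a::euclidean_space \<Rightarrow> 'b::real_normed_algebra"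
  shows "smooth f \<Longrightarrow> smooth g \<Longrightarrow> pd v (\<lambda>x. f x * g x) = (\<lambda>x. f x * pd v g x + pd v f x * g x)"
  by (rule ext) (subst pd_eq[OF has_derivative_mult[OF smooth_deriv smooth_deriv]], auto simp: pd_eq[OF smooth_deriv])

lemma pderivs_add:
  "smooth f \<Longrightarrow> smooth g \<Longrightarrow> set vs \<subseteq> Basis \<Longrightarrow> pderivs vs (\<lambda>x. f x + g x) = (\<lambda>x. pderivs vs f x + pderivs vs g x)"
proof (induction vs arbitrary: f g rule: rev_induct)
  case (snoc v vs)
  then have "pderivs (vs @ [v]) (\<lambda>x. f x + g x) = pderivs vs (\<lambda>x. pd v f x + pd v g x)"
    by (simp only: pderivs_snoc pd_add)
  also have "\<dots> = (\<lambda>x. pderivs vs (pd v f) x + pderivs vs (pd v g) x)"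
    by (rule snoc.IH) (use snoc.prems in \<open>auto intro: smooth_pd\<close>)
  finally show ?case by (simp only: pderivs_snoc)
qed simp

lemma pd_const: "pd v (\<lambda>x. c) = (\<lambda>x. 0)"
  by (rule ext) (subst pd_eq[OF has_derivative_const], simp)

lemma pderivs_cmult:
  fixes f :: "'a::euclidean_space \<Rightarrow> 'b::real_normed_algebra"
  shows "smooth f \<Longrightarrow> set vs \<subseteq> Basis \<Longrightarrow> pderivs vs (\<lambda>x. c * f x) = (\<lambda>x. c * pderivs vs f x)"
proof (induction vs arbitrary: f rule: rev_induct)
  case (snoc v vs)
  then have "pderivs (vs @ [v]) (\<lambda>x. c * f x) = pderivs vs (\<lambda>x. c * pd v f x)"
    by (simp add: pderivs_snoc pd_mult[OF smooth_const] pd_const)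
  also have "\<dots> = (\<lambda>x. c * pderivs vs (pd v f) x)"
    by (rule snoc.IH) (use snoc.prems in \<open>auto intro: smooth_pd\<close>)
  finally show ?case by (simp only: pderivs_snoc)
qed simp

lemma pd_scale:
  assumes "smooth f" shows "pd v (\<lambda>x. f (r *\<^sub>R x)) = (\<lambda>x. r *\<^sub>R pd v f (r *\<^sub>R x))"
proof
  fix x
  have D: "((\<lambda>x. f (r *\<^sub>R x)) has_derivative (\<lambda>h. \<Sum>b\<in>Basis. (r *\<^sub>R h \<bullet> b) *\<^sub>R pd b f (r *\<^sub>R x))) (at x)"
    by (rule has_derivative_compose[OF _ smooth_deriv[OF assms]]) (auto intro!: derivative_eq_intros)
  show "pd v (\<lambda>x. f (r *\<^sub>R x)) x = r *\<^sub>R pd v f (r *\<^sub>R x)"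
    unfolding pd_eq[OF D] pd_eq[OF smooth_deriv[OF assms, of "r *\<^sub>R x"], of v] by (simp add: scaleR_sum_right)
qed

lemma pderivs_scale:
  fixes f :: "'a::euclidean_space \<Rightarrow> complex"
  assumes "smooth f" "set vs \<subseteq> Basis"
  shows "pderivs vs (\<lambda>x. f (r *\<^sub>R x)) = (\<lambda>x. r ^ length vs *\<^sub>R pderivs vs f (r *\<^sub>R x))"
  using assms
proof (induction vs arbitrary: f rule: rev_induct)
  case (snoc v vs)
  have sm: "smooth (\<lambda>x. pd v f (r *\<^sub>R x))" using snoc.prems by (auto intro: smooth_scale smooth_pd)
  have "pderivs (vs @ [v]) (\<lambda>x. f (r *\<^sub>R x)) = pderivs vs (\<lambda>x. of_real r * pd v f (r *\<^sub>R x))"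
    using snoc.prems by (simp add: pderivs_snoc pd_scale scaleR_conv_of_real)
  also have "\<dots> = (\<lambda>x. of_real r * pderivs vs (\<lambda>x. pd v f (r *\<^sub>R x)) x)"
    by (rule pderivs_cmult) (use snoc.prems sm in auto)
  also have "\<dots> = (\<lambda>x. r ^ length (vs @ [v]) *\<^sub>R pderivs (vs @ [v]) f (r *\<^sub>R x))"
    by (subst snoc.IH) (use snoc.prems in \<open>auto simp: smooth_pd pderivs_snoc scaleR_conv_of_real\<close>)
  finally show ?case .
qed auto

text \<open>Leibniz rule without multinomials: each further derivative doubles the number of terms.
  The bounds \<open>A\<close> and \<open>B\<close> concern a fixed point, so they may carry weights
  in \<open>x\<close>.\<close>

lemma pderivs_mult_bound:
  fixes f g :: "'a::euclidean_space \<Rightarrow> complex"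
  assumes "smooth f" "smooth g" "set vs \<subseteq> Basis" "length vs \<le> N"
    and "\<And>ws. set ws \<subseteq> Basis \<Longrightarrow> length ws \<le> N \<Longrightarrow> norm (pderivs ws f x) \<le> A"
    and "\<And>ws. set ws \<subseteq> Basis \<Longrightarrow> length ws \<le> N \<Longrightarrow> norm (pderivs ws g x) \<le> B"
  shows "norm (pderivs vs (\<lambda>x. f x * g x) x) \<le> 2 ^ length vs * (A * B)"
  using assms
proof (induction vs arbitrary: f g N rule: rev_induct)
  case Nil
  have "norm (f x) \<le> A" "norm (g x) \<le> B" using Nil.prems(5,6)[of "[]"] by auto
  then have "norm (f x) * norm (g x) \<le> A * B" by (intro mult_mono) (auto intro: order_trans[OF norm_ge_zero])
  then show ?case by (simp add: norm_mult)
next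
  case (snoc v vs)
  then obtain M where N: "N = Suc M" by (cases N) auto
  have v: "v \<in> Basis" and vs: "set vs \<subseteq> Basis" using snoc.prems by auto
  have 1: "norm (pderivs ws (pd v f) x) \<le> A" "norm (pderivs ws f x) \<le> A" if "set ws \<subseteq> Basis" "length ws \<le> M" for ws
    using snoc.prems(5)[of "ws @ [v]"] snoc.prems(5)[of ws] that v N by (auto simp: pderivs_snoc)
  have 2: "norm (pderivs ws (pd v g) x) \<le> B" "norm (pderivs ws g x) \<le> B" if "set ws \<subseteq> Basis" "length ws \<le> M" for ws
    using snoc.prems(6)[of "ws @ [v]"] snoc.prems(6)[of ws] that v N by (auto simp: pderivs_snoc)
  have sm: "smooth (pd v f)" "smooth (pd v g)" "smooth f" "smooth g" using snoc.prems v by (auto intro: smooth_pd)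
  have len: "length vs \<le> M" using snoc.prems(4) N by simp
  have "pderivs (vs @ [v]) (\<lambda>x. f x * g x) x = pderivs vs (\<lambda>x. f x * pd v g x) x + pderivs vs (\<lambda>x. pd v f x * g x) x"
    using snoc.prems sm by (simp add: pderivs_snoc pd_mult pderivs_add smooth_mult)
  also have "norm \<dots> \<le> 2 ^ length vs * (A * B) + 2 ^ length vs * (A * B)"
    by (intro norm_triangle_mono snoc.IH[of _ _ M] sm vs len 1 2) auto
  finally show ?case by (simp add: algebra_simps)
qed

text \<open>The derivative of 1/|x| in direction h is -(h . x) |x|^(-3), a polynomial in
  \<open>x\<close> and 1/|x| itself; hence the induction closes on this one function.\<close>

lemma Ck_on_inverse_norm: "Ck_on n (- {0}) (\<lambda>x::'a::euclidean_space. inverse (norm x))"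
proof (induction n)
  case 0
  show ?case unfolding Ck_on_0 by (auto intro!: differentiable_inverse differentiable_norm_at)
next
  case (Suc n)
  show ?case
  proof (rule Ck_on_SucI[where D = "\<lambda>x h. - ((h \<bullet> x) * (inverse (norm x) * (inverse (norm x) * inverse (norm x))))"])
    fix x :: 'a assume "x \<in> - {0}"
    then have x: "x \<noteq> 0" by simp
    show "((\<lambda>x. inverse (norm x)) has_derivative (\<lambda>h. - ((h \<bullet> x) * (inverse (norm x) * (inverse (norm x) * inverse (norm x)))))) (at x)"
    proof -
      have "((\<lambda>x. inverse (norm x)) has_derivative (\<lambda>h. - (inverse (norm x) * (h \<bullet> sgn x) * inverse (norm x)))) (at x)"
        using Deriv.has_derivative_inverse[OF _ has_derivative_norm[OF x]] x by simp
      then show ?thesis by (simp add: sgn_div_norm algebra_simps)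
    qed
  next
    fix v :: 'a
    have "Ck_on n (- {0}) (\<lambda>x. (-1) * ((v \<bullet> x) * (inverse (norm x) * (inverse (norm x) * inverse (norm x)))))"
      by (intro Ck_on_mult Suc Ck_on_linear Ck_on_const bounded_linear_inner_right) auto
    then show "Ck_on n (- {0}) (\<lambda>x. - ((v \<bullet> x) * (inverse (norm x) * (inverse (norm x) * inverse (norm x)))))" by simp
  qed auto
qed

text \<open>Away from 0 the norm is the sum of squared coordinates times
  \<open>inverse (norm x)\<close>, so the previous lemma already contains the result.\<close>

lemma Ck_on_norm: "Ck_on n (- {0}) (\<lambda>x::'a::euclidean_space. norm x)"
proof -
  have *: "Ck_on n (- {0}) (\<lambda>x::'a. (\<Sum>b\<in>Basis. (x \<bullet> b) * (x \<bullet> b)) * inverse (norm x))"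
    by (intro Ck_on_mult Ck_on_sum Ck_on_linear Ck_on_inverse_norm bounded_linear_inner_left) auto
  have **: "(\<Sum>b\<in>Basis. (x \<bullet> b) * (x \<bullet> b)) * inverse (norm x) = norm x" if "x \<noteq> 0" for x :: 'a
  proof -
    have "(\<Sum>b\<in>Basis. (x \<bullet> b) * (x \<bullet> b)) = norm x * norm x"
      by (metis euclidean_inner dot_square_norm power2_eq_square)
    then show ?thesis using that by simp
  qed
  show ?thesis
  proof (rule Ck_on_cong_open[OF _ _ *])
    show "open (- {0::'a})" by (rule open_Compl) simp
    show "(\<Sum>b\<in>Basis. (x \<bullet> b) * (x \<bullet> b)) * inverse (norm x) = norm x" if "x \<in> - {0}" for x :: 'a
      by (rule **) (use that in simp)
  qed
qed

text \<open>Away from 0 the norm is smooth; near 0 the profile is constant because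
  \<open>\<Psi>\<close> is 1 below 11/10. The two open sets cover the space.\<close>

lemma smooth_cutoff_norm:
  assumes "cutoff \<Psi>" shows "smooth (\<lambda>x::'a::euclidean_space. complex_of_real (\<Psi> (norm x)))"
  unfolding smooth_iff_Ck
proof
  fix n
  have P: "Ck_on n UNIV \<Psi>" using assms by (auto simp: cutoff_def smooth_iff_Ck)
  have "Ck_on n (- {0}) (\<lambda>x::'a. \<Psi> (norm x))"
    by (rule Ck_on_compose_real[OF _ _ _ P Ck_on_norm]) auto
  moreover have "Ck_on n (ball 0 1) (\<lambda>x::'a. \<Psi> (norm x))"
    by (rule Ck_on_cong_open[where f = "\<lambda>x. 1"]) (use assms in \<open>auto simp: cutoff_def Ck_on_const\<close>)
  ultimately have "Ck_on n (- {0} \<union> ball 0 1) (\<lambda>x::'a. \<Psi> (norm x))" by (rule Ck_on_Un)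
  moreover have "- {0} \<union> ball 0 1 = (UNIV :: 'a set)" by auto
  ultimately show "Ck_on n UNIV (\<lambda>x::'a. complex_of_real (\<Psi> (norm x)))"
    by (auto intro: Ck_on_bounded_linear[OF bounded_linear_of_real])
qed

section \<open>Inequalities in \<open>L\<^sub>p\<close>\<close>

lemma nn_integral_inverse_1_plus_square: "(\<integral>\<^sup>+s. ennreal (inverse (1 + s\<^sup>2)) \<partial>lborel) < \<infinity>"
proof -
  have "integrable lborel (\<lambda>x::real. inverse (1 + x\<^sup>2))"
    using integrable_inverse_1_plus_square by (simp add: set_integrable_def einterval_def)
  then show ?thesis by (subst nn_integral_eq_integral) auto
qed

text \<open>Each factor 1 + (x . b)^2 is at most (1 + norm x)^2, so the weight is dominated by a
  product of one-dimensional functions 1/(1 + s^2). This is where the recurring exponent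
  \<open>2 * DIM('a)\<close> comes from.\<close>

lemma integrable_weight:
  assumes "2 * DIM('a) \<le> N"
  shows "integrable lborel (\<lambda>x::'a::euclidean_space. inverse ((1 + norm x) ^ N))"
proof (rule Bochner_Integration.integrable_bound[where f = "\<lambda>x::'a. \<Prod>b\<in>Basis. inverse (1 + (x \<bullet> b)\<^sup>2)"])
  have "(\<integral>\<^sup>+x. ennreal (\<Prod>b\<in>Basis. inverse (1 + (x \<bullet> b)\<^sup>2)) \<partial>(lborel::'a measure))
      = (\<integral>\<^sup>+x. (\<Prod>b\<in>Basis. ennreal (inverse (1 + (x \<bullet> b)\<^sup>2))) \<partial>(lborel::'a measure))"
    by (simp add: prod_ennreal)
  also have "\<dots> = (\<Prod>b\<in>(Basis::'a set). (\<integral>\<^sup>+s. ennreal (inverse (1 + s\<^sup>2)) \<partial>lborel))"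
    by (rule nn_integral_lborel_prod[where f = "\<lambda>b s. ennreal (inverse (1 + s\<^sup>2))"]) auto
  also have "\<dots> < \<infinity>"
    using nn_integral_inverse_1_plus_square by (simp add: power_less_top_ennreal)
  finally show "integrable lborel (\<lambda>x::'a. \<Prod>b\<in>Basis. inverse (1 + (x \<bullet> b)\<^sup>2))"
    by (intro integrableI_bounded) (auto simp: prod_nonneg)
  show "AE x in (lborel::'a measure). norm (inverse ((1 + norm x) ^ N)) \<le> norm (\<Prod>b\<in>Basis. inverse (1 + (x \<bullet> b)\<^sup>2))"
  proof (rule AE_I2)
    fix x :: 'a
    have "(\<Prod>b\<in>(Basis::'a set). (1 + (x \<bullet> b)\<^sup>2)) \<le> (\<Prod>b\<in>(Basis::'a set). (1 + norm x)\<^sup>2)"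
    proof (rule prod_mono)
      fix b :: 'a assume "b \<in> Basis"
      then have "(x \<bullet> b)\<^sup>2 \<le> (norm x)\<^sup>2"
        using Basis_le_norm[of b x] by (simp add: abs_le_square_iff[symmetric])
      moreover have "(1 + norm x)\<^sup>2 = 1 + 2 * norm x + (norm x)\<^sup>2" by (simp add: power2_sum)
      ultimately have "1 + (x \<bullet> b)\<^sup>2 \<le> (1 + norm x)\<^sup>2" using norm_ge_zero[of x] by linarith
      then show "0 \<le> 1 + (x \<bullet> b)\<^sup>2 \<and> 1 + (x \<bullet> b)\<^sup>2 \<le> (1 + norm x)\<^sup>2" by simp
    qed
    also have "\<dots> = (1 + norm x) ^ (2 * DIM('a))" by (simp add: power_mult)
    also have "\<dots> \<le> (1 + norm x) ^ N" using assms by (intro power_increasing) auto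
    finally have *: "(\<Prod>b\<in>(Basis::'a set). (1 + (x \<bullet> b)\<^sup>2)) \<le> (1 + norm x) ^ N" .
    have "0 < (\<Prod>b\<in>(Basis::'a set). (1 + (x \<bullet> b)\<^sup>2))" by (intro prod_pos) (auto intro: add_pos_nonneg)
    with * have "inverse ((1 + norm x) ^ N) \<le> inverse (\<Prod>b\<in>(Basis::'a set). (1 + (x \<bullet> b)\<^sup>2))"
      by (rule le_imp_inverse_le)
    then show "norm (inverse ((1 + norm x) ^ N)) \<le> norm (\<Prod>b\<in>Basis. inverse (1 + (x \<bullet> b)\<^sup>2))"
      using prod_inversef[of "\<lambda>b. 1 + (x \<bullet> b)\<^sup>2" "Basis::'a set"] by (simp add: comp_def prod_nonneg)
  qed
qed (auto intro: measurable)

section \<open>Affine substitutions and inequalities of Jensen type\<close>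

lemma nn_integral_affine:
  fixes f :: "'a::euclidean_space \<Rightarrow> ennreal"
  assumes [measurable]: "f \<in> borel_measurable borel" and c: "c \<noteq> 0"
  shows "(\<integral>\<^sup>+x. f x \<partial>lborel) = ennreal (\<bar>c\<bar> ^ DIM('a)) * (\<integral>\<^sup>+x. f (t + c *\<^sub>R x) \<partial>lborel)"
  by (subst lborel_affine[OF c, of t])
     (simp add: nn_integral_density nn_integral_distr nn_integral_cmult)

lemma integrable_affine:
  fixes f :: "'a::euclidean_space \<Rightarrow> 'b :: {banach, second_countable_topology}"
  assumes f: "integrable lborel f" and c: "c \<noteq> 0"
  shows "integrable lborel (\<lambda>x. f (t + c *\<^sub>R x))"
proof -
  have [measurable]: "f \<in> borel_measurable borel" using f by auto
  have "(\<integral>\<^sup>+x. norm (f x) \<partial>lborel) < \<infinity>" using f by (simp add: integrable_iff_bounded)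
  then have "(\<integral>\<^sup>+x. norm (f (t + c *\<^sub>R x)) \<partial>lborel) < \<infinity>"
    using c by (subst (asm) nn_integral_affine[OF _ c, of _ t]) (auto simp: ennreal_mult_less_top)
  then show ?thesis by (simp add: integrable_iff_bounded)
qed

lemma integral_affine:
  fixes f :: "'a::euclidean_space \<Rightarrow> 'b :: {banach, second_countable_topology}"
  assumes c: "c \<noteq> 0" and f: "f \<in> borel_measurable borel"
  shows "(\<integral>x. f x \<partial>lborel) = \<bar>c\<bar> ^ DIM('a) *\<^sub>R (\<integral>x. f (t + c *\<^sub>R x) \<partial>lborel)"
  using f by (subst lborel_affine[OF c, of t])
     (simp add: integral_density integral_distr)

text \<open>The graph of t^p lies above its tangent at \<open>m\<close>. This is Young's inequality
  with weights 1/p and 1 - 1/p applied to t^p and m^p; being affine in \<open>t\<close>, it can be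
  integrated.\<close>

lemma powr_tangent:
  fixes t m p :: real
  assumes "t \<ge> 0" "m > 0" "p \<ge> 1"
  shows "p * m powr (p - 1) * t \<le> t powr p + (p - 1) * m powr p"
proof (cases "t = 0")
  case False
  have "(t powr p) powr (1/p) * (m powr p) powr (1 - 1/p) \<le> (1/p) * t powr p + (1 - 1/p) * m powr p"
    using assms False by (intro Youngs_inequality_0) auto
  moreover have "(t powr p) powr (1/p) = t" using assms by (simp add: powr_powr)
  moreover have "(m powr p) powr (1 - 1/p) = m powr (p - 1)"
    using assms by (simp add: powr_powr right_diff_distrib)
  ultimately have "t * m powr (p - 1) \<le> (1/p) * t powr p + (1 - 1/p) * m powr p" by simp
  then have "p * (t * m powr (p - 1)) \<le> p * ((1/p) * t powr p + (1 - 1/p) * m powr p)"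
    using assms by (intro mult_left_mono) auto
  also have "\<dots> = t powr p + (p - 1) * m powr p" using assms by (simp add: field_simps)
  finally show ?thesis by (simp add: mult_ac)
qed (use assms in auto)

text \<open>The tangent inequality is integrated against the weight \<open>K\<close>, whose mass is
  merely bounded by \<open>A\<close>; likewise \<open>y\<close> need only lie below the weighted
  integral. The measure is arbitrary, so one statement serves both sums and integrals.\<close>

lemma nn_Jensen:
  fixes F :: "'a \<Rightarrow> real" and K :: "'a \<Rightarrow> ennreal" and p A y :: real
  assumes [measurable]: "F \<in> borel_measurable M" "K \<in> borel_measurable M"
    and F0: "\<And>x. 0 \<le> F x" and p: "p \<ge> 1" and A: "A > 0" "(\<integral>\<^sup>+x. K x \<partial>M) \<le> ennreal A"
    and y: "0 \<le> y" "ennreal y \<le> (\<integral>\<^sup>+x. ennreal (F x) * K x \<partial>M)"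
  shows "ennreal (y powr p) \<le> ennreal (A powr (p - 1)) * (\<integral>\<^sup>+x. ennreal (F x powr p) * K x \<partial>M)"
proof (cases "y = 0 \<or> (\<integral>\<^sup>+x. ennreal (F x powr p) * K x \<partial>M) = \<infinity>")
  case True then show ?thesis using A p by (auto simp: ennreal_mult_top)
next
  case False
  then have y0: "y > 0" and fin: "(\<integral>\<^sup>+x. ennreal (F x powr p) * K x \<partial>M) \<noteq> \<infinity>" using y by auto
  then obtain r where r: "(\<integral>\<^sup>+x. ennreal (F x powr p) * K x \<partial>M) = ennreal r" "r \<ge> 0"
    by (metis ennreal_cases infinity_ennreal_def)
  \<comment> \<open>The tangent is taken at the mean value that belongs to total mass
    \<open>A\<close> and integral \<open>y\<close>; with this choice the terms recombine to
    \<open>y powr p\<close>.\<close>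
  define m where "m = y / A"
  have m: "m > 0" using y0 A by (simp add: m_def)
  have "ennreal (p * m powr (p - 1) * y) = ennreal (p * m powr (p - 1)) * ennreal y"
    using p y by (simp add: ennreal_mult')
  also have "\<dots> \<le> ennreal (p * m powr (p - 1)) * (\<integral>\<^sup>+x. ennreal (F x) * K x \<partial>M)"
    using y by (intro mult_left_mono) auto
  also have "\<dots> = (\<integral>\<^sup>+x. ennreal (p * m powr (p - 1) * F x) * K x \<partial>M)"
    using p F0 by (subst nn_integral_cmult[symmetric]) (auto simp: ennreal_mult' mult_ac)
  also have "\<dots> \<le> (\<integral>\<^sup>+x. ennreal (F x powr p) * K x + ennreal ((p - 1) * m powr p) * K x \<partial>M)"
  proof (rule nn_integral_mono)
    fix x
    have "ennreal (p * m powr (p - 1) * F x) \<le> ennreal (F x powr p + (p - 1) * m powr p)"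
      by (intro ennreal_leI powr_tangent) (use F0 m p in auto)
    also have "\<dots> = ennreal (F x powr p) + ennreal ((p - 1) * m powr p)" using p by (subst ennreal_plus) auto
    finally have "ennreal (p * m powr (p - 1) * F x) * K x \<le> (ennreal (F x powr p) + ennreal ((p - 1) * m powr p)) * K x"
      by (intro mult_right_mono) auto
    then show "ennreal (p * m powr (p - 1) * F x) * K x \<le> ennreal (F x powr p) * K x + ennreal ((p - 1) * m powr p) * K x"
      by (simp add: distrib_right)
  qed
  also have "\<dots> = ennreal r + ennreal ((p - 1) * m powr p) * (\<integral>\<^sup>+x. K x \<partial>M)"
    by (subst nn_integral_add) (auto simp: r nn_integral_cmult)
  also have "\<dots> \<le> ennreal r + ennreal ((p - 1) * m powr p) * ennreal A"
    using A by (intro add_left_mono mult_left_mono) auto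
  also have "\<dots> = ennreal (r + (p - 1) * m powr p * A)"
    using r p A by (simp add: ennreal_mult'[symmetric] ennreal_plus)
  finally have "p * m powr (p - 1) * y \<le> r + (p - 1) * m powr p * A"
    using r p A by (subst (asm) ennreal_le_iff) auto
  moreover have "m powr (p - 1) * y = m powr p * A"
  proof -
    have "y = m * A" using A by (simp add: m_def)
    then show ?thesis using m by (simp add: powr_diff)
  qed
  ultimately have "m powr p * A \<le> r" by (simp add: mult.assoc algebra_simps)
  moreover have "A powr (p - 1) * (m powr p * A) = y powr p"
  proof -
    have "A powr (p - 1) * (m powr p * A) = (A powr (p - 1) * A) * m powr p" by simp
    also have "\<dots> = A powr p * m powr p" using A by (simp add: powr_diff)
    also have "\<dots> = y powr p" using A y0 by (simp add: powr_mult[symmetric] m_def)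
    finally show ?thesis .
  qed
  ultimately have "y powr p \<le> A powr (p - 1) * r"
    using mult_left_mono[of "m powr p * A" r "A powr (p - 1)"] by simp
  then have "ennreal (y powr p) \<le> ennreal (A powr (p - 1) * r)" by (rule ennreal_leI)
  then show ?thesis using r by (simp add: ennreal_mult')
qed

lemma enn2real_inverse:
  assumes "1 \<le> p" "p \<noteq> \<infinity>" shows "enn2real (1 / p) = 1 / enn2real p" "1 \<le> enn2real p"
proof -
  obtain r where r: "p = ennreal r" "r \<ge> 0" using assms by (cases p) auto
  have "r \<ge> 1" using assms r by (simp flip: ennreal_1)
  then show "enn2real (1 / p) = 1 / enn2real p" "1 \<le> enn2real p"
    using r by (auto simp: divide_ennreal simp flip: ennreal_1)
qed

lemma Lp_norm_le_iff:
  assumes "1 \<le> p" "p \<noteq> \<infinity>" "0 \<le> a"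
  shows "Lp_norm p g \<le> ennreal a \<longleftrightarrow>
    (\<integral>\<^sup>+x. ennreal (norm (g x) powr enn2real p) \<partial>lborel) \<le> ennreal (a powr enn2real p)"
proof (cases "(\<integral>\<^sup>+x. ennreal (norm (g x) powr enn2real p) \<partial>lborel) = \<infinity>")
  case True then show ?thesis using assms by (simp add: Lp_norm_def ennreal_powr_def top_unique)
next
  case False
  then obtain r where r: "(\<integral>\<^sup>+x. ennreal (norm (g x) powr enn2real p) \<partial>lborel) = ennreal r" "r \<ge> 0"
    by (metis ennreal_cases infinity_ennreal_def)
  have p: "enn2real p \<ge> 1" using enn2real_inverse assms by blast
  have "r powr (1 / enn2real p) \<le> a \<longleftrightarrow> r \<le> a powr enn2real p"
    using powr_mono2[of "enn2real p" "r powr (1 / enn2real p)" a] powr_mono2[of "1 / enn2real p" r "a powr enn2real p"] p r assms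
    by (auto simp: powr_powr)
  then show ?thesis using assms r by (simp add: Lp_norm_def ennreal_powr_def)
qed

lemma Lp_norm_top_iff:
  assumes "g \<in> borel_measurable lborel" "0 \<le> a"
  shows "Lp_norm \<infinity> g \<le> ennreal a \<longleftrightarrow> (AE x in lborel. norm (g x) \<le> a)"
proof
  assume "Lp_norm \<infinity> g \<le> ennreal a"
  then have le: "esssup lborel (\<lambda>x. ennreal (norm (g x))) \<le> ennreal a" by (simp add: Lp_norm_def)
  show "AE x in lborel. norm (g x) \<le> a"
    using esssup_AE[of "\<lambda>x. ennreal (norm (g x))" lborel]
  proof (rule AE_mp, intro AE_I2 impI)
    fix x assume "ennreal (norm (g x)) \<le> esssup lborel (\<lambda>x. ennreal (norm (g x)))"
    with le have "ennreal (norm (g x)) \<le> ennreal a" by (rule order_trans[rotated])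
    then show "norm (g x) \<le> a" using assms by simp
  qed
next
  assume "AE x in lborel. norm (g x) \<le> a"
  then have "AE x in lborel. ennreal (norm (g x)) \<le> ennreal a" by (auto simp: ennreal_leI)
  then show "Lp_norm \<infinity> g \<le> ennreal a" using assms by (auto simp: Lp_norm_def intro!: esssup_I)
qed

text \<open>A Hoelder estimate obtained by splitting at the level \<open>a\<close>: where |g| is at
  most \<open>a\<close> the integrand is at most a W, and elsewhere |g| is at most a^(1-p) |g|^p
  while W is at most \<open>C\<close>.\<close>

lemma Lp_norm_weighted_L1:
  fixes g :: "'a::euclidean_space \<Rightarrow> complex" and W :: "'a \<Rightarrow> real"
  assumes p: "1 \<le> p" and g[measurable]: "g \<in> borel_measurable lborel" and a: "a > 0" "Lp_norm p g \<le> ennreal a"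
    and W[measurable]: "W \<in> borel_measurable lborel" "\<And>x. 0 \<le> W x" "\<And>x. W x \<le> C" "(\<integral>\<^sup>+x. ennreal (W x) \<partial>lborel) \<le> ennreal D"
    and D: "D \<ge> 0"
  shows "(\<integral>\<^sup>+x. ennreal (norm (g x) * W x) \<partial>lborel) \<le> ennreal (a * (C + D))"
proof (cases "p = \<infinity>")
  case True
  have C: "C \<ge> 0" using W(2,3) order_trans by blast
  have "AE x in lborel. norm (g x) \<le> a" using a g True by (simp add: Lp_norm_top_iff[symmetric])
  then have "(\<integral>\<^sup>+x. ennreal (norm (g x) * W x) \<partial>lborel) \<le> (\<integral>\<^sup>+x. ennreal a * ennreal (W x) \<partial>lborel)"
    using W a by (intro nn_integral_mono_AE) (auto simp flip: ennreal_mult' intro!: ennreal_leI mult_right_mono)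
  also have "\<dots> \<le> ennreal a * ennreal D"
    using W by (subst nn_integral_cmult) (auto intro: mult_left_mono)
  also have "\<dots> \<le> ennreal (a * (C + D))" using a C D by (simp flip: ennreal_mult')
  finally show ?thesis .
next
  case False
  define P where "P = enn2real p"
  have P: "P \<ge> 1" using enn2real_inverse[OF p False] by (simp add: P_def)
  have C: "C \<ge> 0" using W(2,3) order_trans by blast
  have I: "(\<integral>\<^sup>+x. ennreal (norm (g x) powr P) \<partial>lborel) \<le> ennreal (a powr P)"
    using Lp_norm_le_iff[OF p False less_imp_le[OF a(1)]] a by (auto simp: P_def)
  have pt: "norm (g x) * W x \<le> a * W x + a powr (1 - P) * C * norm (g x) powr P" for x
  proof (cases "norm (g x) \<le> a")
    case True
    then have "norm (g x) * W x \<le> a * W x" using W by (intro mult_right_mono) auto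
    moreover have "0 \<le> a powr (1 - P) * C * norm (g x) powr P" using C by simp
    ultimately show ?thesis by linarith
  next
    case False
    then have gx: "norm (g x) > a" by simp
    have "norm (g x) = norm (g x) powr P * norm (g x) powr (1 - P)" using gx a by (simp add: powr_add[symmetric])
    also have "\<dots> \<le> norm (g x) powr P * a powr (1 - P)"
      using gx a P by (intro mult_left_mono powr_mono2') auto
    finally have "norm (g x) * W x \<le> norm (g x) powr P * a powr (1 - P) * C"
      using W C by (intro mult_mono) auto
    moreover have "0 \<le> a * W x" using a W by simp
    ultimately show ?thesis by (simp add: mult_ac)
  qed
  have "(\<integral>\<^sup>+x. ennreal (norm (g x) * W x) \<partial>lborel)
      \<le> (\<integral>\<^sup>+x. ennreal a * ennreal (W x) + ennreal (a powr (1 - P) * C) * ennreal (norm (g x) powr P) \<partial>lborel)"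
    using a W C by (intro nn_integral_mono) (auto simp flip: ennreal_mult' ennreal_plus intro!: ennreal_leI pt)
  also have "\<dots> = ennreal a * (\<integral>\<^sup>+x. ennreal (W x) \<partial>lborel) + ennreal (a powr (1 - P) * C) * (\<integral>\<^sup>+x. ennreal (norm (g x) powr P) \<partial>lborel)"
    by (subst nn_integral_add) (auto simp: nn_integral_cmult)
  also have "\<dots> \<le> ennreal a * ennreal D + ennreal (a powr (1 - P) * C) * ennreal (a powr P)"
    using W I by (intro add_mono mult_left_mono) auto
  also have "\<dots> = ennreal (a * D + a powr (1 - P) * C * a powr P)"
    using a C D by (simp flip: ennreal_mult' ennreal_plus)
  also have "a * D + a powr (1 - P) * C * a powr P = a * (C + D)"
    using a by (simp add: powr_add[symmetric] distrib_left mult.commute[of _ C] mult.assoc)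
  finally show ?thesis .
qed

lemma norm_suminf_le_ennreal:
  fixes z :: "nat \<Rightarrow> complex"
  shows "ennreal (norm (\<Sum>k. z k)) \<le> (\<Sum>k. ennreal (norm (z k)))"
proof (cases "(\<Sum>k. ennreal (norm (z k))) = \<infinity>")
  case False
  then have s: "summable (\<lambda>k. norm (z k))" by (intro summable_suminf_not_top) auto
  then have "norm (\<Sum>k. z k) \<le> (\<Sum>k. norm (z k))" by (rule summable_norm)
  then have "ennreal (norm (\<Sum>k. z k)) \<le> ennreal (\<Sum>k. norm (z k))" by (rule ennreal_leI)
  also have "\<dots> = (\<Sum>k. ennreal (norm (z k)))" using s by (simp add: suminf_ennreal2)
  finally show ?thesis .
qed simp

text \<open>Minkowski's inequality for series, from Jensen's inequality on the natural numbers with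
  weights \<open>a k\<close> applied to the quotients |G k| / a k. This division is the reason for
  asking that all \<open>a k\<close> be positive.\<close>

lemma Lp_norm_suminf:
  fixes G :: "nat \<Rightarrow> 'a::euclidean_space \<Rightarrow> complex"
  assumes p: "1 \<le> p" and G[measurable]: "\<And>k. G k \<in> borel_measurable lborel"
    and a: "\<And>k. a k > 0" "summable a" "\<And>k. Lp_norm p (G k) \<le> ennreal (a k)"
  shows "Lp_norm p (\<lambda>x. \<Sum>k. G k x) \<le> ennreal (\<Sum>k. a k)"
proof -
  define A where "A = (\<Sum>k. a k)"
  have A: "A > 0" unfolding A_def using a by (intro suminf_pos) auto
  have sA: "(\<Sum>k. ennreal (a k)) = ennreal A" unfolding A_def using a by (intro suminf_ennreal2) (auto intro: less_imp_le)
  show ?thesis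
  proof (cases "p = \<infinity>")
    case True
    have "AE x in lborel. \<forall>k. norm (G k x) \<le> a k"
      using a True less_imp_le[OF a(1)] unfolding AE_all_countable by (auto simp: Lp_norm_top_iff[symmetric])
    then have "AE x in lborel. norm (\<Sum>k. G k x) \<le> A"
    proof (rule AE_mp, intro AE_I2 impI)
      fix x assume *: "\<forall>k. norm (G k x) \<le> a k"
      show "norm (\<Sum>k. G k x) \<le> A"
        unfolding A_def using * a by (intro norm_suminf_le) auto
    qed
    then show ?thesis unfolding True A_def[symmetric] using A by (subst Lp_norm_top_iff) auto
  next
    case False
    define P where "P = enn2real p"
    have P: "P \<ge> 1" using enn2real_inverse[OF p False] by (simp add: P_def)
    have I: "(\<integral>\<^sup>+x. ennreal (norm (G k x) powr P) \<partial>lborel) \<le> ennreal (a k powr P)" for k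
      using Lp_norm_le_iff[OF p False less_imp_le[OF a(1)[of k]], of "G k"] a(3)[of k] by (simp add: P_def)
    have pt: "ennreal (norm (\<Sum>k. G k x) powr P) \<le> ennreal (A powr (P - 1)) * (\<Sum>k. ennreal (a k powr (1 - P)) * ennreal (norm (G k x) powr P))" for x
    proof -
      have eq: "ennreal (norm (G k x) / a k) * ennreal (a k) = ennreal (norm (G k x))" for k
        using a(1)[of k] by (simp flip: ennreal_mult')
      have "ennreal (norm (\<Sum>k. G k x)) \<le> (\<Sum>k. ennreal (norm (G k x)))" by (rule norm_suminf_le_ennreal)
      also have "\<dots> = (\<integral>\<^sup>+k. ennreal (norm (G k x) / a k) * ennreal (a k) \<partial>count_space UNIV)"
        by (simp add: nn_integral_count_space_nat eq)
      finally have "ennreal (norm (\<Sum>k. G k x) powr P) \<le> ennreal (A powr (P - 1)) * (\<integral>\<^sup>+k. ennreal ((norm (G k x) / a k) powr P) * ennreal (a k) \<partial>count_space UNIV)"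
        using a(1)[THEN less_imp_le] A P sA by (intro nn_Jensen) (auto simp: nn_integral_count_space_nat)
      also have "(\<integral>\<^sup>+k. ennreal ((norm (G k x) / a k) powr P) * ennreal (a k) \<partial>count_space UNIV) = (\<Sum>k. ennreal (a k powr (1 - P)) * ennreal (norm (G k x) powr P))"
        unfolding nn_integral_count_space_nat
      proof (rule arg_cong[where f = suminf], rule ext)
        fix k
        have "(norm (G k x) / a k) powr P * a k = a k powr (1 - P) * norm (G k x) powr P"
          using a(1)[of k] by (simp add: powr_divide powr_diff)
        then show "ennreal ((norm (G k x) / a k) powr P) * ennreal (a k) = ennreal (a k powr (1 - P)) * ennreal (norm (G k x) powr P)"
          using a(1)[of k] by (simp flip: ennreal_mult')
      qed
      finally show ?thesis .
    qed
    have "(\<integral>\<^sup>+x. ennreal (norm (\<Sum>k. G k x) powr P) \<partial>lborel)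
        \<le> (\<integral>\<^sup>+x. ennreal (A powr (P - 1)) * (\<Sum>k. ennreal (a k powr (1 - P)) * ennreal (norm (G k x) powr P)) \<partial>lborel)"
      by (intro nn_integral_mono pt)
    also have "\<dots> = ennreal (A powr (P - 1)) * (\<Sum>k. ennreal (a k powr (1 - P)) * (\<integral>\<^sup>+x. ennreal (norm (G k x) powr P) \<partial>lborel))"
      by (simp add: nn_integral_cmult nn_integral_suminf)
    also have "\<dots> \<le> ennreal (A powr (P - 1)) * (\<Sum>k. ennreal (a k))"
    proof (intro mult_left_mono suminf_le)
      fix k
      have "ennreal (a k powr (1 - P)) * (\<integral>\<^sup>+x. ennreal (norm (G k x) powr P) \<partial>lborel) \<le> ennreal (a k powr (1 - P)) * ennreal (a k powr P)"
        by (intro mult_left_mono I) auto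
      also have "\<dots> = ennreal (a k)" using a(1)[of k] by (simp add: powr_add[symmetric] flip: ennreal_mult')
      finally show "ennreal (a k powr (1 - P)) * (\<integral>\<^sup>+x. ennreal (norm (G k x) powr P) \<partial>lborel) \<le> ennreal (a k)" .
    qed auto
    also have "\<dots> = ennreal (A powr (P - 1) * A)" using A by (simp add: sA ennreal_mult')
    also have "A powr (P - 1) * A = A powr P" using A by (simp add: powr_diff)
    finally show ?thesis
      unfolding A_def[symmetric] by (subst Lp_norm_le_iff[OF p False]) (use A in \<open>simp_all add: P_def[symmetric]\<close>)
  qed
qed

lemma enn_norm_integral_le:
  fixes f :: "'a \<Rightarrow> 'b::{banach, second_countable_topology}"
  shows "ennreal (norm (integral\<^sup>L M f)) \<le> (\<integral>\<^sup>+x. ennreal (norm (f x)) \<partial>M)"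
  by (cases "integrable M f") (auto simp: integral_norm_bound_ennreal not_integrable_integral_eq)

text \<open>Jensen's inequality in \<open>x\<close> with weight |K(x,y)| of mass at most
  \<open>A\<close>, followed by Tonelli, where integration over \<open>y\<close> contributes
  \<open>B\<close>. The two variables may live in spaces of different dimension, as restriction to a
  hyperplane requires.\<close>

lemma Schur_test:
  fixes g :: "'a::euclidean_space \<Rightarrow> complex" and K :: "'a \<Rightarrow> 'b::euclidean_space \<Rightarrow> complex"
  assumes p: "1 \<le> p" and g[measurable]: "g \<in> borel_measurable lborel" and a: "a > 0" "Lp_norm p g \<le> ennreal a"
    and K[measurable]: "(\<lambda>(x, y). K x y) \<in> borel_measurable (lborel \<Otimes>\<^sub>M lborel)"
    and A: "A > 0" "\<And>y. (\<integral>\<^sup>+x. ennreal (norm (K x y)) \<partial>lborel) \<le> ennreal A"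
    and B: "B > 0" "\<And>x. (\<integral>\<^sup>+y. ennreal (norm (K x y)) \<partial>lborel) \<le> ennreal B"
  shows "(\<lambda>y. \<integral>x. g x * K x y \<partial>lborel) \<in> borel_measurable lborel"
    and "Lp_norm p (\<lambda>y. \<integral>x. g x * K x y \<partial>lborel) \<le> ennreal (A powr (1 - enn2real (1 / p)) * B powr enn2real (1 / p) * a)"
proof -
  have [measurable]: "(\<lambda>(x, y). K y x) \<in> borel_measurable (lborel \<Otimes>\<^sub>M lborel)"
    using measurable_pair_swap[OF K] by simp
  have [measurable]: "(\<lambda>x. K x y) \<in> borel_measurable borel" for y
    using measurable_Pair2[of "\<lambda>(y, x). K x y" lborel lborel borel y] by simp
  show meas[measurable]: "(\<lambda>y. \<integral>x. g x * K x y \<partial>lborel) \<in> borel_measurable lborel"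
    by measurable
  show "Lp_norm p (\<lambda>y. \<integral>x. g x * K x y \<partial>lborel) \<le> ennreal (A powr (1 - enn2real (1 / p)) * B powr enn2real (1 / p) * a)"
  proof (cases "p = \<infinity>")
    case True
    have ae: "AE x in lborel. norm (g x) \<le> a" using a g True by (simp add: Lp_norm_top_iff[symmetric])
    have "norm (\<integral>x. g x * K x y \<partial>lborel) \<le> A * a" for y
    proof -
      have "ennreal (norm (\<integral>x. g x * K x y \<partial>lborel)) \<le> (\<integral>\<^sup>+x. ennreal (norm (g x * K x y)) \<partial>lborel)"
        by (rule enn_norm_integral_le)
      also have "\<dots> \<le> (\<integral>\<^sup>+x. ennreal a * ennreal (norm (K x y)) \<partial>lborel)"
        using ae a by (intro nn_integral_mono_AE) (auto simp: norm_mult simp flip: ennreal_mult' intro!: ennreal_leI mult_right_mono)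
      also have "\<dots> \<le> ennreal a * ennreal A" using A by (subst nn_integral_cmult) (auto intro: mult_left_mono)
      also have "\<dots> = ennreal (A * a)" using a A(1) by (simp add: mult.commute ennreal_mult)
      finally show ?thesis using a A by (subst (asm) ennreal_le_iff) auto
    qed
    then show ?thesis using A B a unfolding True by (subst Lp_norm_top_iff) auto
  next
    case False
    define P where "P = enn2real p"
    have P: "P \<ge> 1" "enn2real (1 / p) = 1 / P" using enn2real_inverse[OF p False] by (auto simp: P_def)
    have I: "(\<integral>\<^sup>+x. ennreal (norm (g x) powr P) \<partial>lborel) \<le> ennreal (a powr P)"
      using Lp_norm_le_iff[OF p False less_imp_le[OF a(1)]] a by (auto simp: P_def)
    have pt: "ennreal (norm (\<integral>x. g x * K x y \<partial>lborel) powr P) \<le>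
        ennreal (A powr (P - 1)) * (\<integral>\<^sup>+x. ennreal (norm (g x) powr P) * ennreal (norm (K x y)) \<partial>lborel)" for y
    proof (rule nn_Jensen)
      show "ennreal (norm (\<integral>x. g x * K x y \<partial>lborel)) \<le> (\<integral>\<^sup>+x. ennreal (norm (g x)) * ennreal (norm (K x y)) \<partial>lborel)"
        using enn_norm_integral_le[of lborel "\<lambda>x. g x * K x y"] by (simp add: norm_mult ennreal_mult')
    qed (use P A in auto)
    have "(\<integral>\<^sup>+y. \<integral>\<^sup>+x. ennreal (norm (g x) powr P) * ennreal (norm (K x y)) \<partial>lborel \<partial>lborel)
       = (\<integral>\<^sup>+x. \<integral>\<^sup>+y. ennreal (norm (g x) powr P) * ennreal (norm (K x y)) \<partial>lborel \<partial>lborel)"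
      by (rule lborel_pair.Fubini') measurable
    also have "\<dots> = (\<integral>\<^sup>+x. ennreal (norm (g x) powr P) * (\<integral>\<^sup>+y. ennreal (norm (K x y)) \<partial>lborel) \<partial>lborel)"
      by (intro nn_integral_cong nn_integral_cmult) measurable
    also have "\<dots> \<le> (\<integral>\<^sup>+x. ennreal (norm (g x) powr P) * ennreal B \<partial>lborel)"
      using B by (intro nn_integral_mono mult_left_mono) auto
    also have "\<dots> \<le> ennreal (a powr P) * ennreal B"
      using I by (subst nn_integral_multc) (auto intro: mult_right_mono)
    finally have le: "(\<integral>\<^sup>+y. \<integral>\<^sup>+x. ennreal (norm (g x) powr P) * ennreal (norm (K x y)) \<partial>lborel \<partial>lborel) \<le> ennreal (a powr P) * ennreal B" .
    have "(\<integral>\<^sup>+y. ennreal (norm (\<integral>x. g x * K x y \<partial>lborel) powr P) \<partial>lborel)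
        \<le> (\<integral>\<^sup>+y. ennreal (A powr (P - 1)) * (\<integral>\<^sup>+x. ennreal (norm (g x) powr P) * ennreal (norm (K x y)) \<partial>lborel) \<partial>lborel)"
      by (intro nn_integral_mono pt)
    also have "\<dots> = ennreal (A powr (P - 1)) * (\<integral>\<^sup>+y. \<integral>\<^sup>+x. ennreal (norm (g x) powr P) * ennreal (norm (K x y)) \<partial>lborel \<partial>lborel)"
      by (rule nn_integral_cmult) measurable
    also have "\<dots> \<le> ennreal (A powr (P - 1)) * (ennreal (a powr P) * ennreal B)"
      by (intro mult_left_mono le) simp
    also have "\<dots> = ennreal (A powr (P - 1) * (a powr P * B))" using B by (simp add: ennreal_mult')
    also have "A powr (P - 1) * (a powr P * B) = (A powr (1 - 1 / P) * B powr (1 / P) * a) powr P"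
    proof -
      have "(1 - 1 / P) * P = P - 1" "1 / P * P = 1" using P by (auto simp: field_simps)
      then show ?thesis using A B a by (simp only: powr_mult powr_powr) simp
    qed
    finally show ?thesis
      unfolding P(2) by (subst Lp_norm_le_iff[OF p False]) (use a in \<open>simp_all add: P_def[symmetric]\<close>)
  qed
qed

section \<open>Schwartz functions and the Fourier transform\<close>

text \<open>A common bound for all weighted derivatives, used in place of
  \<open>schwartz_seminorm\<close>: unlike a supremum of reals it carries its own boundedness, and
  it passes through linear estimates with explicit constants.\<close>

definition sb :: "nat \<Rightarrow> nat \<Rightarrow> real \<Rightarrow> ('a::euclidean_space \<Rightarrow> complex) \<Rightarrow> bool" where
  "sb k N B f \<longleftrightarrow> (\<forall>vs x. set vs \<subseteq> Basis \<longrightarrow> length vs \<le> N \<longrightarrow> (1 + norm x) ^ k * norm (pderivs vs f x) \<le> B)"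

lemma finite_multiindices: "finite {vs :: 'a::euclidean_space list. set vs \<subseteq> Basis \<and> length vs \<le> N}"
  by (rule finite_lists_length_le) simp

lemma sbD: "sb k N B f \<Longrightarrow> set vs \<subseteq> Basis \<Longrightarrow> length vs \<le> N \<Longrightarrow> (1 + norm x) ^ k * norm (pderivs vs f x) \<le> B"
  by (simp add: sb_def)

lemma sb_nonneg: "sb k N B f \<Longrightarrow> 0 \<le> B"
  using sbD[of k N B f "[]" 0] by (auto intro: order_trans[OF norm_ge_zero])

lemma sb_mono: "sb k N B f \<Longrightarrow> k' \<le> k \<Longrightarrow> N' \<le> N \<Longrightarrow> B \<le> B' \<Longrightarrow> sb k' N' B' f"
  unfolding sb_def
proof (intro allI impI)
  fix vs :: "'a list" and x
  assume *: "\<forall>vs x. set vs \<subseteq> Basis \<longrightarrow> length vs \<le> N \<longrightarrow> (1 + norm x) ^ k * norm (pderivs vs f x) \<le> B"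
    "k' \<le> k" "N' \<le> N" "B \<le> B'" "set vs \<subseteq> Basis" "length vs \<le> N'"
  have "(1 + norm x) ^ k' * norm (pderivs vs f x) \<le> (1 + norm x) ^ k * norm (pderivs vs f x)"
    using * by (intro mult_right_mono power_increasing) auto
  also have "\<dots> \<le> B" using * by auto
  finally show "(1 + norm x) ^ k' * norm (pderivs vs f x) \<le> B'" using * by simp
qed

lemma sb_Suc_iff:
  fixes f :: "'a::euclidean_space \<Rightarrow> complex"
  shows
  "sb k (Suc N) B f \<longleftrightarrow> sb k N B f \<and> (\<forall>v\<in>Basis. sb k N B (pd v f))"
proof safe
  assume "sb k (Suc N) B f" then show "sb k N B f" by (rule sb_mono) auto
next
  fix v :: 'a assume "sb k (Suc N) B f" "v \<in> Basis"
  then show "sb k N B (pd v f)"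
    using sbD[of k "Suc N" B f "vs @ [v]" for vs] unfolding sb_def[of k N] by (auto simp: pderivs_snoc)
next
  assume *: "sb k N B f" "\<forall>v\<in>Basis. sb k N B (pd v f)"
  show "sb k (Suc N) B f" unfolding sb_def
  proof (intro allI impI)
    fix vs :: "'a list" and x assume vs: "set vs \<subseteq> Basis" "length vs \<le> Suc N"
    show "(1 + norm x) ^ k * norm (pderivs vs f x) \<le> B"
    proof (cases vs rule: rev_cases)
      case Nil then show ?thesis using sbD[OF *(1), of "[]"] by simp
    next
      case (snoc ws w)
      then show ?thesis using sbD[of k N B "pd w f" ws] *(2) vs by (simp add: pderivs_snoc)
    qed
  qed
qed

text \<open>There are finitely many multi-indices of length at most \<open>N\<close>, so the
  separate bounds of the definition add up to a common one.\<close>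

lemma schwartz_iff: "f \<in> schwartz_functions \<longleftrightarrow> smooth f \<and> (\<forall>k N. \<exists>B. sb k N B f)"
proof safe
  assume f: "f \<in> schwartz_functions"
  then show "smooth f" by (simp add: schwartz_functions_def)
  fix k N
  have "\<forall>vs\<in>{vs. set vs \<subseteq> Basis \<and> length vs \<le> N}. \<exists>B. \<forall>x. (1 + norm x) ^ k * norm (pderivs vs f x) \<le> B"
    using f by (auto simp: schwartz_functions_def bounded_iff)
  from bchoice[OF this] obtain B where
    "\<forall>vs\<in>{vs. set vs \<subseteq> Basis \<and> length vs \<le> N}. \<forall>x. (1 + norm x) ^ k * norm (pderivs vs f x) \<le> B vs" by blast
  then have B: "\<And>vs x. set vs \<subseteq> Basis \<Longrightarrow> length vs \<le> N \<Longrightarrow> (1 + norm x) ^ k * norm (pderivs vs f x) \<le> B vs"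
    by blast
  have "sb k N (\<Sum>vs\<in>{vs. set vs \<subseteq> Basis \<and> length vs \<le> N}. B vs) f"
    unfolding sb_def
  proof (intro allI impI)
    fix vs :: "'a list" and x assume vs: "set vs \<subseteq> Basis" "length vs \<le> N"
    have pos: "0 \<le> B ws" if "set ws \<subseteq> Basis" "length ws \<le> N" for ws
      using B[OF that, of 0] by (auto intro: order_trans[OF norm_ge_zero])
    have "(1 + norm x) ^ k * norm (pderivs vs f x) \<le> B vs" by (rule B[OF vs])
    also have "\<dots> \<le> (\<Sum>vs\<in>{vs. set vs \<subseteq> Basis \<and> length vs \<le> N}. B vs)"
      using vs pos by (intro member_le_sum finite_multiindices) auto
    finally show "(1 + norm x) ^ k * norm (pderivs vs f x) \<le> (\<Sum>vs\<in>{vs. set vs \<subseteq> Basis \<and> length vs \<le> N}. B vs)" .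
  qed
  then show "\<exists>B. sb k N B f" by blast
next
  assume f: "smooth f" "\<forall>k N. \<exists>B. sb k N B f"
  have "bounded (range (\<lambda>x. (1 + norm x) ^ k *\<^sub>R pderivs vs f x))" if "set vs \<subseteq> Basis" for k vs
  proof -
    obtain B where "sb k (length vs) B f" using f by blast
    then have "norm ((1 + norm x) ^ k *\<^sub>R pderivs vs f x) \<le> B" for x
      using sbD[of k "length vs" B f vs x] that by simp
    then show ?thesis by (auto simp: bounded_iff)
  qed
  then show "f \<in> schwartz_functions" using f by (simp add: schwartz_functions_def)
qed

lemma schwartz_sb: "f \<in> schwartz_functions \<Longrightarrow> \<exists>B. sb k N B f" by (simp add: schwartz_iff)
lemma schwartz_smooth: "f \<in> schwartz_functions \<Longrightarrow> smooth f" by (simp add: schwartz_iff)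

lemma sb_seminorm_le:
  fixes f :: "'a::euclidean_space \<Rightarrow> complex"
  assumes "sb k N B f"
  shows "schwartz_seminorm k N f \<le> real (card {vs :: 'a list. set vs \<subseteq> Basis \<and> length vs \<le> N}) * B"
  unfolding schwartz_seminorm_def
  by (rule sum_bounded_above) (use sbD[OF assms] in \<open>auto intro!: cSUP_least\<close>)

text \<open>A supremum of reals is meaningful only for a bounded set; the Schwartz property supplies
  the bound. The other summands are nonnegative, since each supremum dominates its value at
  0.\<close>

lemma seminorm_upper:
  fixes f :: "'a::euclidean_space \<Rightarrow> complex"
  assumes f: "f \<in> schwartz_functions" and vs: "set vs \<subseteq> Basis" "length vs \<le> N"
  shows "(1 + norm x) ^ k * norm (pderivs vs f x) \<le> schwartz_seminorm k N f"
proof -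
  obtain B where B: "sb k N B f" using schwartz_sb[OF f] by blast
  have bd: "bdd_above (range (\<lambda>x. (1 + norm x) ^ k * norm (pderivs ws f x)))" if "set ws \<subseteq> Basis" "length ws \<le> N" for ws
    using sbD[OF B that] by (intro bdd_aboveI[of _ B]) auto
  have "(1 + norm x) ^ k * norm (pderivs vs f x) \<le> (SUP x. (1 + norm x) ^ k * norm (pderivs vs f x))"
    using bd[OF vs] by (rule cSUP_upper[rotated]) simp
  also have "\<dots> \<le> schwartz_seminorm k N f"
    unfolding schwartz_seminorm_def
  proof (rule member_le_sum[where f = "\<lambda>vs. SUP x. (1 + norm x) ^ k * norm (pderivs vs f x)"])
    fix ws assume "ws \<in> {vs :: 'a list. set vs \<subseteq> Basis \<and> length vs \<le> N} - {vs}"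
    then have "(1 + norm (0::'a)) ^ k * norm (pderivs ws f 0) \<le> (SUP x. (1 + norm x) ^ k * norm (pderivs ws f x))"
      by (intro cSUP_upper[OF UNIV_I bd]) auto
    moreover have "0 \<le> (1 + norm (0::'a)) ^ k * norm (pderivs ws f 0)" by simp
    ultimately show "0 \<le> (SUP x. (1 + norm x) ^ k * norm (pderivs ws f x))" by linarith
  qed (use vs finite_multiindices in auto)
  finally show ?thesis .
qed

text \<open>Continuity restated through \<open>sb\<close>. The constant becomes |C| times the number
  of multi-indices, hence nonnegative.\<close>

lemma tempered_bound:
  fixes u :: "('a::euclidean_space \<Rightarrow> complex) \<Rightarrow> complex"
  assumes "u \<in> tempered_distributions"
  obtains C k N where "C \<ge> 0" "\<And>\<phi> B. \<phi> \<in> schwartz_functions \<Longrightarrow> sb k N B \<phi> \<Longrightarrow> norm (u \<phi>) \<le> C * B"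
proof -
  obtain C k N where *: "\<And>\<phi>. \<phi> \<in> schwartz_functions \<Longrightarrow> norm (u \<phi>) \<le> C * schwartz_seminorm k N \<phi>"
    using assms by (auto simp: tempered_distributions_def)
  let ?c = "real (card {vs :: 'a list. set vs \<subseteq> Basis \<and> length vs \<le> N})"
  have "norm (u \<phi>) \<le> (\<bar>C\<bar> * ?c) * B" if "\<phi> \<in> schwartz_functions" "sb k N B \<phi>" for \<phi> B
  proof -
    have "0 \<le> schwartz_seminorm k N \<phi>" using seminorm_upper[OF that(1), of "[]" N 0 k] by (auto intro: order_trans[OF norm_ge_zero])
    then have "norm (u \<phi>) \<le> \<bar>C\<bar> * schwartz_seminorm k N \<phi>"
      using *[OF that(1)] by (meson abs_ge_self mult_right_mono order_trans)
    also have "\<dots> \<le> \<bar>C\<bar> * (?c * B)" by (intro mult_left_mono sb_seminorm_le that) simp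
    finally show ?thesis by (simp add: mult.assoc)
  qed
  then show ?thesis using that[of "\<bar>C\<bar> * ?c" k N] by simp
qed

text \<open>A multiplier growing like (1 + norm x)^j consumes \<open>j\<close> powers of the decay
  of \<open>f\<close>; the factor 2^N counts the terms of the Leibniz rule.\<close>

lemma sb_mult:
  assumes f: "smooth f" "sb (k + j) N B f" and m: "smooth m" "M \<ge> 0"
    and b: "\<And>ws x. set ws \<subseteq> Basis \<Longrightarrow> length ws \<le> N \<Longrightarrow> norm (pderivs ws m x) \<le> M * (1 + norm x) ^ j"
  shows "sb k N (2 ^ N * M * B) (\<lambda>x. m x * f x)"
  unfolding sb_def
proof (intro allI impI)
  fix vs :: "'a list" and x assume vs: "set vs \<subseteq> Basis" "length vs \<le> N"
  have "norm (pderivs vs (\<lambda>x. m x * f x) x) \<le> 2 ^ length vs * ((M * (1 + norm x) ^ j) * (B / (1 + norm x) ^ (k + j)))"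
  proof (rule pderivs_mult_bound[OF m(1) f(1) vs b])
    fix ws :: "'a list" assume "set ws \<subseteq> Basis" "length ws \<le> N"
    from sbD[OF f(2) this, of x] show "norm (pderivs ws f x) \<le> B / (1 + norm x) ^ (k + j)"
      by (simp add: field_simps add_pos_nonneg)
  qed auto
  also have "\<dots> \<le> 2 ^ N * ((M * (1 + norm x) ^ j) * (B / (1 + norm x) ^ (k + j)))"
    using vs m sb_nonneg[OF f(2)] by (intro mult_right_mono power_increasing) auto
  finally have "(1 + norm x) ^ k * norm (pderivs vs (\<lambda>x. m x * f x) x)
      \<le> (1 + norm x) ^ k * (2 ^ N * ((M * (1 + norm x) ^ j) * (B / (1 + norm x) ^ (k + j))))"
    by (rule mult_left_mono) simp
  also have "\<dots> = 2 ^ N * M * B"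
  proof -
    have "1 + norm x \<noteq> 0" using norm_ge_zero[of x] by linarith
    then show ?thesis by (simp add: power_add field_simps)
  qed
  finally show "(1 + norm x) ^ k * norm (pderivs vs (\<lambda>x. m x * f x) x) \<le> 2 ^ N * M * B" .
qed

lemma pderivs_const:
  fixes c :: "'b::real_normed_vector" shows "pderivs vs (\<lambda>x::'a::euclidean_space. c) x = (if vs = [] then c else 0)"
proof (cases vs rule: rev_cases)
  case (snoc ws w)
  have "pderivs ws (\<lambda>x::'a. 0::'b) = (\<lambda>x. 0)" by (induction ws) auto
  then show ?thesis using snoc by (simp add: pderivs_snoc pd_const)
qed simp

lemma smooth_coord: "smooth (\<lambda>x. complex_of_real (x \<bullet> b))"
  by (intro smooth_linear bounded_linear_compose[OF bounded_linear_of_real bounded_linear_inner_left])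

lemma coord_bound:
  assumes "b \<in> Basis" "set ws \<subseteq> Basis"
  shows "norm (pderivs ws (\<lambda>x. complex_of_real (x \<bullet> b)) x) \<le> 1 * (1 + norm x) ^ 1"
proof (cases ws rule: rev_cases)
  case Nil then show ?thesis using Basis_le_norm[OF assms(1), of x] by simp
next
  case (snoc vs v)
  have "((\<lambda>x. complex_of_real (x \<bullet> b)) has_derivative (\<lambda>h. complex_of_real (h \<bullet> b))) (at y)" for y
    by (intro bounded_linear_imp_has_derivative bounded_linear_compose[OF bounded_linear_of_real bounded_linear_inner_left])
  then have "pd v (\<lambda>x. complex_of_real (x \<bullet> b)) = (\<lambda>x. complex_of_real (v \<bullet> b))" using pd_eq by blast
  moreover have "\<bar>v \<bullet> b\<bar> \<le> 1" using assms snoc by (auto simp: inner_Basis)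
  then have "\<bar>v \<bullet> b\<bar> \<le> 1 + norm x" using norm_ge_zero[of x] by linarith
  with calculation show ?thesis using snoc by (simp add: pderivs_snoc pderivs_const)
qed

lemma sb_coord:
  assumes "smooth f" "sb (Suc k) N B f" "b \<in> Basis"
  shows "sb k N (2 ^ N * B) (\<lambda>x. of_real (x \<bullet> b) * f x)"
  using sb_mult[of f k 1 N B "\<lambda>x. of_real (x \<bullet> b)" 1] assms coord_bound smooth_coord by auto

lemma sb_cmult:
  assumes "smooth f" "sb k N B f"
  shows "sb k N (norm c * B) (\<lambda>x. c * f x)"
  unfolding sb_def
proof (intro allI impI)
  fix vs :: "'a list" and x assume vs: "set vs \<subseteq> Basis" "length vs \<le> N"
  have "norm c * ((1 + norm x) ^ k * norm (pderivs vs f x)) \<le> norm c * B"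
    by (intro mult_left_mono sbD[OF assms(2) vs]) simp
  then show "(1 + norm x) ^ k * norm (pderivs vs (\<lambda>x. c * f x) x) \<le> norm c * B"
    by (simp add: pderivs_cmult assms vs norm_mult mult_ac)
qed

lemma sb_add:
  assumes "smooth f" "smooth g" "sb k N B f" "sb k N B' g"
  shows "sb k N (B + B') (\<lambda>x. f x + g x)"
  unfolding sb_def
proof (intro allI impI)
  fix vs :: "'a list" and x assume vs: "set vs \<subseteq> Basis" "length vs \<le> N"
  have "(1 + norm x) ^ k * norm (pderivs vs f x + pderivs vs g x)
     \<le> (1 + norm x) ^ k * (norm (pderivs vs f x) + norm (pderivs vs g x))"
    by (intro mult_left_mono norm_triangle_ineq) simp
  also have "\<dots> \<le> B + B'" using sbD[OF assms(3) vs, of x] sbD[OF assms(4) vs, of x] by (simp add: distrib_left)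
  finally show "(1 + norm x) ^ k * norm (pderivs vs (\<lambda>x. f x + g x) x) \<le> B + B'"
    by (simp add: pderivs_add assms vs)
qed

lemma schwartz_add: "f \<in> schwartz_functions \<Longrightarrow> g \<in> schwartz_functions \<Longrightarrow> (\<lambda>x. f x + g x) \<in> schwartz_functions"
  unfolding schwartz_iff using smooth_add sb_add by metis

lemma schwartz_cmult: "f \<in> schwartz_functions \<Longrightarrow> (\<lambda>x. c * f x) \<in> schwartz_functions"
  unfolding schwartz_iff using smooth_cmult sb_cmult by metis

lemma schwartz_coord: "f \<in> schwartz_functions \<Longrightarrow> b \<in> Basis \<Longrightarrow> (\<lambda>x. of_real (x \<bullet> b) * f x) \<in> schwartz_functions"
  unfolding schwartz_iff using smooth_mult[OF smooth_coord] sb_coord by metis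

lemma schwartz_pd: "f \<in> schwartz_functions \<Longrightarrow> b \<in> Basis \<Longrightarrow> pd b f \<in> schwartz_functions"
  unfolding schwartz_iff using smooth_pd sb_Suc_iff by metis

lemma sb_le_weight:
  assumes "sb k 0 B f" shows "norm (f x) \<le> B * inverse ((1 + norm x) ^ k)"
  using sbD[OF assms, of "[]" x] by (simp add: field_simps add_pos_nonneg)

lemma schwartz_measurable[measurable_dest]: "f \<in> schwartz_functions \<Longrightarrow> f \<in> borel_measurable borel"
  using smooth_continuous[OF schwartz_smooth, of f UNIV] by (rule borel_measurable_continuous_onI)

lemma sb_integrable:
  fixes f :: "'a::euclidean_space \<Rightarrow> complex"
  assumes "smooth f" "sb (2 * DIM('a)) 0 B f"
  shows "integrable lborel f" "(\<integral>x. norm (f x) \<partial>lborel) \<le> B * (\<integral>x. inverse ((1 + norm (x::'a)) ^ (2 * DIM('a))) \<partial>lborel)"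
proof -
  have i: "integrable lborel (\<lambda>x::'a. B * inverse ((1 + norm x) ^ (2 * DIM('a))))"
    by (intro integrable_mult_right integrable_weight) simp
  have [measurable]: "f \<in> borel_measurable borel"
    using smooth_continuous[OF assms(1), of UNIV] by (rule borel_measurable_continuous_onI)
  have le: "norm (f x) \<le> B * inverse ((1 + norm x) ^ (2 * DIM('a)))" for x by (rule sb_le_weight[OF assms(2)])
  show int: "integrable lborel f"
    by (rule Bochner_Integration.integrable_bound[OF i]) (auto intro!: AE_I2 order_trans[OF le])
  have "(\<integral>x. norm (f x) \<partial>lborel) \<le> (\<integral>x. B * inverse ((1 + norm (x::'a)) ^ (2 * DIM('a))) \<partial>lborel)"
    by (rule integral_mono) (use i int le in auto)
  then show "(\<integral>x. norm (f x) \<partial>lborel) \<le> B * (\<integral>x. inverse ((1 + norm (x::'a)) ^ (2 * DIM('a))) \<partial>lborel)" by simp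
qed

lemma schwartz_integrable: "f \<in> schwartz_functions \<Longrightarrow> integrable lborel f"
  using sb_integrable(1) schwartz_iff by metis

text \<open>Unnormalised transform with a sign: \<open>\<sigma> = -1\<close> is
  \<open>fourier\<close> and \<open>\<sigma> = 1\<close> is \<open>inv_fourier\<close> without its
  factor (2 pi)^(-n), so each estimate is proved once for both.\<close>

definition FT :: "real \<Rightarrow> ('a::euclidean_space \<Rightarrow> complex) \<Rightarrow> 'a \<Rightarrow> complex" where
  "FT \<sigma> g \<xi> = (\<integral>x. exp (\<i> * of_real (\<sigma> * (x \<bullet> \<xi>))) * g x \<partial>lborel)"

lemma integrable_exp_mult:
  assumes "integrable lborel (g :: 'a::euclidean_space \<Rightarrow> complex)"
  shows "integrable lborel (\<lambda>x. exp (\<i> * of_real (\<sigma> * (x \<bullet> \<xi>))) * g x)"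
proof -
  have [measurable]: "g \<in> borel_measurable lborel" using assms by auto
  show ?thesis by (rule Bochner_Integration.integrable_bound[OF assms]) (auto simp: norm_mult)
qed

lemma norm_FT_le: "integrable lborel g \<Longrightarrow> norm (FT \<sigma> g \<xi>) \<le> (\<integral>x. norm (g x) \<partial>lborel)"
  unfolding FT_def using integral_norm_bound[of lborel "\<lambda>x. exp (\<i> * of_real (\<sigma> * (x \<bullet> \<xi>))) * g x"]
  by (simp add: norm_mult)

lemma has_derivative_quadratic:
  assumes D: "bounded_linear D" and q: "\<And>y. norm (f y - f x - D (y - x)) \<le> C * (norm (y - x))\<^sup>2"
  shows "(f has_derivative D) (at x)"
  unfolding has_derivative_iff_norm
proof
  have "((\<lambda>y. C * norm (y - x)) \<longlongrightarrow> C * norm (x - x)) (at x)" by (intro tendsto_intros)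
  then have lim: "((\<lambda>y. C * norm (y - x)) \<longlongrightarrow> 0) (at x)" by simp
  show "((\<lambda>y. norm (f y - f x - D (y - x)) / norm (y - x)) \<longlongrightarrow> 0) (at x)"
  proof (rule tendsto_sandwich[OF _ _ tendsto_const lim])
    show "\<forall>\<^sub>F y in at x. norm (f y - f x - D (y - x)) / norm (y - x) \<le> C * norm (y - x)"
      unfolding eventually_at_filter using q by (intro always_eventually allI impI) (simp add: divide_le_eq power2_eq_square mult.assoc)
  qed (auto intro!: always_eventually)
qed (rule D)

text \<open>Differentiation under the integral is carried out by hand with |e^(is) - 1 - is| \<le>
  s^2/2: the error is quadratic in the increment, and the second moment of \<open>g\<close> enters
  the constant.\<close>

lemma FT_has_derivative:
  assumes g: "g \<in> schwartz_functions"
  shows "(FT \<sigma> g has_derivative (\<lambda>h. \<Sum>b\<in>Basis. (h \<bullet> b) *\<^sub>R FT \<sigma> (\<lambda>x. \<i> * of_real \<sigma> * (of_real (x \<bullet> b) * g x)) \<xi>)) (at \<xi>)"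
proof (rule has_derivative_quadratic)
  show "bounded_linear (\<lambda>h. \<Sum>b\<in>Basis. (h \<bullet> b) *\<^sub>R FT \<sigma> (\<lambda>x. \<i> * of_real \<sigma> * (of_real (x \<bullet> b) * g x)) \<xi>)"
    by (intro bounded_linear_intros)
next
  fix y
  let ?e = "\<lambda>x \<xi>. exp (\<i> * complex_of_real (\<sigma> * (x \<bullet> \<xi>)))"
  define h where "h = y - \<xi>"
  have ii: "integrable lborel (\<lambda>x. ?e x \<xi> * (\<i> * of_real \<sigma> * (of_real (x \<bullet> b) * g x)))" if "b \<in> Basis" for b
    by (intro integrable_exp_mult schwartz_integrable schwartz_cmult schwartz_coord g that)
  have ig: "integrable lborel g" using g by (rule schwartz_integrable)
  have sq: "integrable lborel (\<lambda>x. (norm x)\<^sup>2 * norm (g x))"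
  proof -
    have "integrable lborel (\<lambda>x. \<Sum>b\<in>Basis. norm (of_real (x \<bullet> b) * (of_real (x \<bullet> b) * g x)))"
      by (intro Bochner_Integration.integrable_sum integrable_norm schwartz_integrable schwartz_coord g)
    moreover have "(\<Sum>b\<in>Basis. norm (of_real (x \<bullet> b) * (of_real (x \<bullet> b) * g x))) = (norm x)\<^sup>2 * norm (g x)" for x
    proof -
      have *: "(norm x)\<^sup>2 = (\<Sum>b\<in>Basis. (x \<bullet> b) * (x \<bullet> b))"
        by (simp only: power2_norm_eq_inner euclidean_inner[of x x])
      have "norm (of_real (x \<bullet> b) * (of_real (x \<bullet> b) * g x)) = (x \<bullet> b) * (x \<bullet> b) * norm (g x)" for b
        by (simp only: norm_mult norm_of_real mult.assoc[symmetric] abs_mult_self_eq)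
      then show ?thesis unfolding * sum_distrib_right by (intro sum.cong) auto
    qed
    ultimately show ?thesis by simp
  qed
  have "(\<Sum>b\<in>Basis. (h \<bullet> b) *\<^sub>R FT \<sigma> (\<lambda>x. \<i> * of_real \<sigma> * (of_real (x \<bullet> b) * g x)) \<xi>)
     = (\<integral>x. (\<Sum>b\<in>Basis. (h \<bullet> b) *\<^sub>R (?e x \<xi> * (\<i> * of_real \<sigma> * (of_real (x \<bullet> b) * g x)))) \<partial>lborel)"
    unfolding FT_def using ii by (subst Bochner_Integration.integral_sum) auto
  also have "\<dots> = (\<integral>x. ?e x \<xi> * (\<i> * of_real \<sigma> * of_real (x \<bullet> h)) * g x \<partial>lborel)"
  proof (intro Bochner_Integration.integral_cong refl)
    fix x
    have "complex_of_real (x \<bullet> h) = (\<Sum>b\<in>Basis. of_real (h \<bullet> b) * of_real (x \<bullet> b))"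
      by (subst euclidean_inner) (simp add: mult.commute)
    then show "(\<Sum>b\<in>Basis. (h \<bullet> b) *\<^sub>R (?e x \<xi> * (\<i> * of_real \<sigma> * (of_real (x \<bullet> b) * g x))))
       = ?e x \<xi> * (\<i> * of_real \<sigma> * of_real (x \<bullet> h)) * g x"
      by (simp add: sum_distrib_left sum_distrib_right scaleR_conv_of_real mult_ac)
  qed
  finally have D: "(\<Sum>b\<in>Basis. (h \<bullet> b) *\<^sub>R FT \<sigma> (\<lambda>x. \<i> * of_real \<sigma> * (of_real (x \<bullet> b) * g x)) \<xi>)
     = (\<integral>x. ?e x \<xi> * (\<i> * of_real \<sigma> * of_real (x \<bullet> h)) * g x \<partial>lborel)" .
  have i3: "integrable lborel (\<lambda>x. ?e x \<xi> * (\<i> * of_real \<sigma> * of_real (x \<bullet> h)) * g x)"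
  proof -
    have "integrable lborel (\<lambda>x. \<Sum>b\<in>Basis. (h \<bullet> b) *\<^sub>R (?e x \<xi> * (\<i> * of_real \<sigma> * (of_real (x \<bullet> b) * g x))))"
      by (intro Bochner_Integration.integrable_sum integrable_scaleR_right ii)
    moreover have "(\<Sum>b\<in>Basis. (h \<bullet> b) *\<^sub>R (?e x \<xi> * (\<i> * of_real \<sigma> * (of_real (x \<bullet> b) * g x))))
       = ?e x \<xi> * (\<i> * of_real \<sigma> * of_real (x \<bullet> h)) * g x" for x
    proof -
      have "complex_of_real (x \<bullet> h) = (\<Sum>b\<in>Basis. of_real (h \<bullet> b) * of_real (x \<bullet> b))"
        by (subst euclidean_inner) (simp add: mult.commute)
      then show ?thesis by (simp add: sum_distrib_left sum_distrib_right scaleR_conv_of_real mult_ac)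
    qed
    ultimately show ?thesis by simp
  qed
  have "FT \<sigma> g y - FT \<sigma> g \<xi> - (\<Sum>b\<in>Basis. (h \<bullet> b) *\<^sub>R FT \<sigma> (\<lambda>x. \<i> * of_real \<sigma> * (of_real (x \<bullet> b) * g x)) \<xi>)
     = (\<integral>x. ?e x y * g x - ?e x \<xi> * g x - ?e x \<xi> * (\<i> * of_real \<sigma> * of_real (x \<bullet> h)) * g x \<partial>lborel)"
    unfolding D unfolding FT_def by (subst Bochner_Integration.integral_diff Bochner_Integration.integral_diff | intro Bochner_Integration.integrable_diff integrable_exp_mult ig i3 refl)+
  also have "norm \<dots> \<le> (\<integral>x. (\<sigma>\<^sup>2 * (norm h)\<^sup>2 / 2) * ((norm x)\<^sup>2 * norm (g x)) \<partial>lborel)"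
  proof (rule Bochner_Integration.integral_norm_bound_integral)
    fix x
    have "?e x y * g x - ?e x \<xi> * g x - ?e x \<xi> * (\<i> * of_real \<sigma> * of_real (x \<bullet> h)) * g x
       = ?e x \<xi> * (exp (\<i> * of_real (\<sigma> * (x \<bullet> h))) - (1 + \<i> * of_real (\<sigma> * (x \<bullet> h)))) * g x"
    proof -
      have "?e x y = ?e x \<xi> * exp (\<i> * of_real (\<sigma> * (x \<bullet> h)))"
        by (simp add: h_def exp_add[symmetric] inner_diff_right algebra_simps)
      then show ?thesis by (simp add: algebra_simps)
    qed
    then have "norm (?e x y * g x - ?e x \<xi> * g x - ?e x \<xi> * (\<i> * of_real \<sigma> * of_real (x \<bullet> h)) * g x)
       = norm (exp (\<i> * of_real (\<sigma> * (x \<bullet> h))) - (1 + \<i> * of_real (\<sigma> * (x \<bullet> h)))) * norm (g x)"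
      by (simp add: norm_mult)
    also have "\<dots> \<le> (\<bar>\<sigma> * (x \<bullet> h)\<bar>\<^sup>2 / 2) * norm (g x)"
      using iexp_approx1[of "\<sigma> * (x \<bullet> h)" 1] by (intro mult_right_mono) (auto simp: numeral_2_eq_2)
    also have "\<dots> \<le> (\<sigma>\<^sup>2 * (norm x * norm h)\<^sup>2 / 2) * norm (g x)"
    proof -
      have "\<bar>x \<bullet> h\<bar>\<^sup>2 \<le> (norm x * norm h)\<^sup>2" by (intro power_mono Cauchy_Schwarz_ineq2) simp
      then have "\<sigma>\<^sup>2 * (x \<bullet> h)\<^sup>2 \<le> \<sigma>\<^sup>2 * (norm x * norm h)\<^sup>2" by (intro mult_left_mono) auto
      then show ?thesis by (intro mult_right_mono divide_right_mono) (auto simp: power_mult_distrib)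
    qed
    finally show "norm (?e x y * g x - ?e x \<xi> * g x - ?e x \<xi> * (\<i> * of_real \<sigma> * of_real (x \<bullet> h)) * g x)
       \<le> (\<sigma>\<^sup>2 * (norm h)\<^sup>2 / 2) * ((norm x)\<^sup>2 * norm (g x))"
      by (simp add: power_mult_distrib mult_ac)
  qed (intro Bochner_Integration.integrable_diff integrable_exp_mult ig i3 integrable_mult_right sq)+
  also have "\<dots> = (\<sigma>\<^sup>2 / 2 * (\<integral>x. (norm x)\<^sup>2 * norm (g x) \<partial>lborel)) * (norm h)\<^sup>2" by simp
  finally show "norm (FT \<sigma> g y - FT \<sigma> g \<xi> - (\<Sum>b\<in>Basis. ((y - \<xi>) \<bullet> b) *\<^sub>R FT \<sigma> (\<lambda>x. \<i> * of_real \<sigma> * (of_real (x \<bullet> b) * g x)) \<xi>))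
     \<le> (\<sigma>\<^sup>2 / 2 * (\<integral>x. (norm x)\<^sup>2 * norm (g x) \<partial>lborel)) * (norm (y - \<xi>))\<^sup>2"
    by (simp only: h_def)
qed

lemma sum_inner_Basis_scaleR:
  fixes c :: "'a::euclidean_space \<Rightarrow> 'b::real_vector"
  assumes "v \<in> Basis" shows "(\<Sum>b\<in>Basis. (v \<bullet> b) *\<^sub>R c b) = c v"
proof -
  have "(\<Sum>b\<in>Basis. (v \<bullet> b) *\<^sub>R c b) = (\<Sum>b\<in>Basis. if v = b then c v else 0)"
    by (rule sum.cong) (use assms in \<open>auto simp: inner_Basis\<close>)
  then show ?thesis using assms by (simp add: sum.delta)
qed

lemma pd_FT:
  assumes "g \<in> schwartz_functions" "v \<in> Basis"
  shows "pd v (FT \<sigma> g) = FT \<sigma> (\<lambda>x. \<i> * of_real \<sigma> * (of_real (x \<bullet> v) * g x))"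
  by (rule ext) (use assms in \<open>simp add: pd_eq[OF FT_has_derivative] sum_inner_Basis_scaleR\<close>)

lemma FT_smooth: "g \<in> schwartz_functions \<Longrightarrow> smooth (FT \<sigma> g)"
  unfolding smooth_iff_Ck
proof
  fix n show "g \<in> schwartz_functions \<Longrightarrow> Ck_on n UNIV (FT \<sigma> g)"
  proof (induction n arbitrary: g)
    case 0 then show ?case using FT_has_derivative unfolding Ck_on_0 differentiable_def by blast
  next
    case (Suc n)
    show ?case unfolding Ck_on_Suc
    proof (intro conjI ballI)
      show "FT \<sigma> g differentiable at x" for x using FT_has_derivative[OF Suc.prems] unfolding differentiable_def by blast
      show "Ck_on n UNIV (pd v (FT \<sigma> g))" if "v \<in> Basis" for v
        using that by (simp add: pd_FT Suc schwartz_cmult schwartz_coord)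
    qed
  qed
qed

lemma has_vector_derivative_quotient:
  assumes "(f has_vector_derivative v) (at 0)"
  shows "((\<lambda>s. (f s - f 0) /\<^sub>R s) \<longlongrightarrow> v) (at 0)"
proof -
  have "(\<lambda>s. norm (f s - f 0 - s *\<^sub>R v) / norm s) \<midarrow>0\<rightarrow> 0"
    using assms by (simp add: has_vector_derivative_def has_derivative_at)
  moreover have "\<forall>\<^sub>F s in at 0. norm (f s - f 0 - s *\<^sub>R v) / norm s = norm ((f s - f 0) /\<^sub>R s - v)"
    unfolding eventually_at_filter
  proof (intro always_eventually allI impI)
    fix s :: real assume "s \<noteq> 0"
    then have "(f s - f 0) /\<^sub>R s - v = inverse s *\<^sub>R (f s - f 0 - s *\<^sub>R v)" by (simp add: scaleR_diff_right)
    then show "norm (f s - f 0 - s *\<^sub>R v) / norm s = norm ((f s - f 0) /\<^sub>R s - v)" by (simp add: divide_inverse mult.commute)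
  qed
  ultimately have "(\<lambda>s. norm ((f s - f 0) /\<^sub>R s - v)) \<midarrow>0\<rightarrow> 0" by (rule Lim_transform_eventually)
  then show ?thesis by (simp add: tendsto_norm_zero_iff LIM_zero_iff)
qed

text \<open>Translation invariance makes the integral of every difference quotient vanish. The mean
  value inequality dominates the quotients by an integrable weight, so the limit may be taken
  inside.\<close>

lemma integral_directional_derivative_zero:
  fixes F :: "'a::euclidean_space \<Rightarrow> complex"
  assumes D: "\<And>x. (F has_derivative F' x) (at x)" and iF: "integrable lborel F"
    and b: "norm b \<le> 1" and B: "\<And>x. norm (F' x b) \<le> B * inverse ((1 + norm x) ^ N)" and N: "2 * DIM('a) \<le> N"
  shows "(\<integral>x. F' x b \<partial>lborel) = 0"
proof -
  have [measurable]: "F \<in> borel_measurable borel" using iF by auto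
  have B0: "B \<ge> 0" using order_trans[OF norm_ge_zero B[of 0]] by simp
  define f where "f n x = (F (x + inverse (real (Suc n)) *\<^sub>R b) - F x) * of_real (real (Suc n))" for n x
  have lim: "(\<lambda>n. f n x) \<longlonglongrightarrow> F' x b" for x
  proof -
    have "((\<lambda>s. x + s *\<^sub>R b) has_derivative (\<lambda>s. s *\<^sub>R b)) (at 0)" by (auto intro!: derivative_eq_intros)
    moreover have "(F has_derivative F' x) (at (x + 0 *\<^sub>R b))" using D by simp
    ultimately have "((\<lambda>s. F (x + s *\<^sub>R b)) has_derivative (\<lambda>s. F' x (s *\<^sub>R b))) (at 0)"
      by (rule has_derivative_compose)
    then have "((\<lambda>s. F (x + s *\<^sub>R b)) has_vector_derivative F' x b) (at 0)"
      using linear_scale[OF has_derivative_linear[OF D]] by (simp add: has_vector_derivative_def)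
    from has_vector_derivative_quotient[OF this]
    have "((\<lambda>s. (F (x + s *\<^sub>R b) - F x) /\<^sub>R s) \<longlongrightarrow> F' x b) (at 0)" by simp
    moreover have "filterlim (\<lambda>n. inverse (real (Suc n))) (at 0) sequentially"
      unfolding filterlim_at using LIMSEQ_inverse_real_of_nat by simp
    ultimately have "((\<lambda>n. (F (x + inverse (real (Suc n)) *\<^sub>R b) - F x) /\<^sub>R inverse (real (Suc n))) \<longlongrightarrow> F' x b) sequentially"
      by (rule filterlim_compose)
    then show ?thesis by (simp add: f_def scaleR_conv_of_real mult.commute)
  qed
  have bound: "norm (f n x) \<le> B * 2 ^ N * inverse ((1 + norm x) ^ N)" for n x
  proof -
    let ?h = "inverse (real (Suc n))"
    have h: "0 \<le> ?h" "?h \<le> 1" by (auto simp: field_simps)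
    have "norm (F (x + ?h *\<^sub>R b) - F (x + 0 *\<^sub>R b)) \<le> (B * 2 ^ N * inverse ((1 + norm x) ^ N)) * norm (?h - 0)"
    proof (rule differentiable_bound[of "{0..1}" "\<lambda>s. F (x + s *\<^sub>R b)" "\<lambda>s t. F' (x + s *\<^sub>R b) (t *\<^sub>R b)"])
      fix s :: real assume s: "s \<in> {0..1}"
      have "((\<lambda>s. x + s *\<^sub>R b) has_derivative (\<lambda>s. s *\<^sub>R b)) (at s within {0..1})" by (auto intro!: derivative_eq_intros)
      from has_derivative_compose[OF this D]
      show "((\<lambda>s. F (x + s *\<^sub>R b)) has_derivative (\<lambda>t. F' (x + s *\<^sub>R b) (t *\<^sub>R b))) (at s within {0..1})" .
      \<comment> \<open>A shift of length at most 1 changes 1 + norm x by at most a factor 2; this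
        is the origin of 2^N in the majorant.\<close>
      have nb: "norm (s *\<^sub>R b) \<le> 1" using s b by (auto intro: mult_le_one)
      have "norm x \<le> norm (x + s *\<^sub>R b) + norm (s *\<^sub>R b)" using norm_triangle_ineq4[of "x + s *\<^sub>R b" "s *\<^sub>R b"] by simp
      then have "norm x \<le> norm (x + s *\<^sub>R b) + 1" by (rule order_trans[OF _ add_left_mono[OF nb]])
      moreover have "1 + a \<le> 2 * (1 + c)" if "a \<le> c + 1" "0 \<le> c" for a c :: real using that by (simp add: distrib_left)
      ultimately have le2: "1 + norm x \<le> 2 * (1 + norm (x + s *\<^sub>R b))" using norm_ge_zero by blast
      have le3: "(1 + norm x) ^ N \<le> 2 ^ N * (1 + norm (x + s *\<^sub>R b)) ^ N"
        unfolding power_mult_distrib[symmetric] using le2 by (rule power_mono) simp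
      have "inverse Y \<le> k * inverse X" if "X \<le> k * Y" "0 < X" "0 < Y" for k X Y :: real
        using that by (simp add: field_simps)
      from this[OF le3] have inv: "inverse ((1 + norm (x + s *\<^sub>R b)) ^ N) \<le> 2 ^ N * inverse ((1 + norm x) ^ N)"
        by (simp add: add_pos_nonneg)
      show "onorm (\<lambda>t. F' (x + s *\<^sub>R b) (t *\<^sub>R b)) \<le> B * 2 ^ N * inverse ((1 + norm x) ^ N)"
      proof (rule onorm_bound)
        fix t :: real
        have "norm (F' (x + s *\<^sub>R b) (t *\<^sub>R b)) = \<bar>t\<bar> * norm (F' (x + s *\<^sub>R b) b)"
          using linear_scale[OF has_derivative_linear[OF D[of "x + s *\<^sub>R b"]]] by simp
        also have "\<dots> \<le> \<bar>t\<bar> * (B * (2 ^ N * inverse ((1 + norm x) ^ N)))"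
          using B[of "x + s *\<^sub>R b"] mult_left_mono[OF inv B0] by (intro mult_left_mono) auto
        finally show "norm (F' (x + s *\<^sub>R b) (t *\<^sub>R b)) \<le> B * 2 ^ N * inverse ((1 + norm x) ^ N) * norm t"
          by (simp add: mult_ac)
      qed (use B0 in auto)
    qed (use h in auto)
    then have "norm (F (x + ?h *\<^sub>R b) - F x) * real (Suc n) \<le> (B * 2 ^ N * inverse ((1 + norm x) ^ N)) * ?h * real (Suc n)"
      by (intro mult_right_mono) auto
    moreover have "norm (?h - 0) = ?h" "?h * real (Suc n) = 1" "x + 0 *\<^sub>R b = x" by auto
    moreover have "norm (f n x) = norm (F (x + ?h *\<^sub>R b) - F x) * real (Suc n)"
      by (simp only: f_def norm_mult norm_of_real abs_of_nat)
    ultimately show ?thesis by (simp only: mult.assoc mult_1_right)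
  qed
  have "(\<lambda>n. \<integral>x. f n x \<partial>lborel) \<longlonglongrightarrow> (\<integral>x. F' x b \<partial>lborel)"
  proof (rule integral_dominated_convergence[where w = "\<lambda>x. B * 2 ^ N * inverse ((1 + norm x) ^ N)"])
    show f[measurable]: "f n \<in> borel_measurable lborel" for n unfolding f_def by measurable
    show "(\<lambda>x. F' x b) \<in> borel_measurable lborel" by (rule borel_measurable_LIMSEQ_metric[OF f lim])
  qed (use lim bound N in \<open>auto intro!: integrable_weight\<close>)
  moreover have "(\<integral>x. f n x \<partial>lborel) = 0" for n
  proof -
    have t: "integrable lborel (\<lambda>x. F (x + inverse (real (Suc n)) *\<^sub>R b))"
      using integrable_affine[OF iF, of 1 "inverse (real (Suc n)) *\<^sub>R b"] by (simp add: add.commute)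
    have "(\<integral>x. F x \<partial>lborel) = (\<integral>x. F (x + inverse (real (Suc n)) *\<^sub>R b) \<partial>lborel)"
      using integral_affine[of 1 F "inverse (real (Suc n)) *\<^sub>R b"] by (simp add: add.commute)
    then show ?thesis unfolding f_def using t iF by simp
  qed
  ultimately show ?thesis by (simp add: LIMSEQ_const_iff)
qed

text \<open>Integration by parts: the derivative of e^(i \<sigma> x . \<xi>) g(x) in direction
  \<open>b\<close> has integral 0, and its two terms give the two sides.\<close>

lemma FT_pd:
  assumes g: "g \<in> schwartz_functions" and b: "b \<in> Basis"
  shows "FT \<sigma> (pd b g) \<xi> = - (\<i> * of_real (\<sigma> * (\<xi> \<bullet> b)) * FT \<sigma> g \<xi>)"
proof -
  let ?e = "\<lambda>x. exp (\<i> * complex_of_real (\<sigma> * (x \<bullet> \<xi>)))"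
  let ?D = "\<lambda>x h. ?e x * (\<Sum>b\<in>Basis. (h \<bullet> b) *\<^sub>R pd b g x) + ?e x * (\<i> * of_real (\<sigma> * (h \<bullet> \<xi>))) * g x"
  have pdg: "pd b g \<in> schwartz_functions" by (rule schwartz_pd[OF g b])
  have Db: "?D x b = ?e x * pd b g x + (\<i> * of_real (\<sigma> * (\<xi> \<bullet> b))) * (?e x * g x)" for x
    using b by (simp add: sum_inner_Basis_scaleR inner_commute mult_ac)
  have "(\<integral>x. ?D x b \<partial>lborel) = 0"
  proof -
    obtain B1 where B1: "sb (2 * DIM('a)) 0 B1 g" using schwartz_sb[OF g] by blast
    obtain B2 where B2: "sb (2 * DIM('a)) 0 B2 (pd b g)" using schwartz_sb[OF pdg] by blast
    show ?thesis
    proof (rule integral_directional_derivative_zero[where F = "\<lambda>x. ?e x * g x" and F' = ?D])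
      fix x
      have "((\<lambda>x. \<i> * complex_of_real (\<sigma> * (x \<bullet> \<xi>))) has_derivative (\<lambda>h. \<i> * complex_of_real (\<sigma> * (h \<bullet> \<xi>)))) (at x)"
        by (auto intro!: derivative_eq_intros)
      from has_derivative_compose[OF this DERIV_exp[THEN has_field_derivative_imp_has_derivative]]
      have "(?e has_derivative (\<lambda>h. ?e x * (\<i> * complex_of_real (\<sigma> * (h \<bullet> \<xi>))))) (at x)" .
      from has_derivative_mult[OF this smooth_deriv[OF schwartz_smooth[OF g]]]
      show "((\<lambda>x. ?e x * g x) has_derivative ?D x) (at x)" .
      have "norm (?D x b) \<le> norm (pd b g x) + \<bar>\<sigma> * (\<xi> \<bullet> b)\<bar> * norm (g x)"
        unfolding Db by (rule order_trans[OF norm_triangle_ineq]) (simp add: norm_mult abs_mult)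
      also have "\<dots> \<le> B2 * inverse ((1 + norm x) ^ (2 * DIM('a))) + \<bar>\<sigma> * (\<xi> \<bullet> b)\<bar> * (B1 * inverse ((1 + norm x) ^ (2 * DIM('a))))"
        by (intro add_mono mult_left_mono sb_le_weight B1 B2) auto
      finally show "norm (?D x b) \<le> (B2 + \<bar>\<sigma> * (\<xi> \<bullet> b)\<bar> * B1) * inverse ((1 + norm x) ^ (2 * DIM('a)))"
        by (simp add: algebra_simps)
      show "integrable lborel (\<lambda>x. ?e x * g x)" by (intro integrable_exp_mult schwartz_integrable g)
    qed (use b in auto)
  qed
  moreover have "(\<integral>x. ?D x b \<partial>lborel) = FT \<sigma> (pd b g) \<xi> + (\<i> * of_real (\<sigma> * (\<xi> \<bullet> b))) * FT \<sigma> g \<xi>"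
  proof -
    have i1: "integrable lborel (\<lambda>x. ?e x * pd b g x)" by (intro integrable_exp_mult schwartz_integrable pdg)
    have i2: "integrable lborel (\<lambda>x. ?e x * g x)" by (intro integrable_exp_mult schwartz_integrable g)
    show ?thesis
      unfolding Db FT_def Bochner_Integration.integral_add[OF i1 integrable_mult_right[OF i2]] integral_mult_right_zero ..
  qed
  ultimately show ?thesis by (simp add: eq_neg_iff_add_eq_0)
qed

text \<open>Multiplying the transform by a frequency coordinate amounts to differentiating
  \<open>g\<close>. Since the norm is at most the sum of the absolute coordinates, each power of 1 +
  norm \<xi> costs one derivative of \<open>g\<close>.\<close>

lemma FT_decay:
  assumes \<sigma>: "\<bar>\<sigma>\<bar> = 1"
  shows "\<exists>C m M. C \<ge> 0 \<and> (\<forall>g :: 'a::euclidean_space \<Rightarrow> complex. \<forall>B \<xi>. g \<in> schwartz_functions \<longrightarrow> sb m M B g \<longrightarrow> (1 + norm \<xi>) ^ k * norm (FT \<sigma> g \<xi>) \<le> C * B)"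
proof (induction k)
  case 0
  let ?I = "(\<integral>x. inverse ((1 + norm (x::'a)) ^ (2 * DIM('a))) \<partial>lborel)"
  have "norm (FT \<sigma> g \<xi>) \<le> ?I * B" if "g \<in> schwartz_functions" "sb (2 * DIM('a)) 0 B g" for g B and \<xi> :: 'a
    using order_trans[OF norm_FT_le[OF schwartz_integrable[OF that(1)]] sb_integrable(2)[OF schwartz_smooth[OF that(1)] that(2)]]
    by (simp add: mult.commute)
  then show ?case by (intro exI[of _ ?I] exI[of _ "2 * DIM('a)"] exI[of _ 0]) auto
next
  case (Suc k)
  then obtain C m M where C: "C \<ge> 0" and *: "\<And>(g :: 'a \<Rightarrow> complex) B \<xi>. g \<in> schwartz_functions \<Longrightarrow> sb m M B g \<Longrightarrow> (1 + norm \<xi>) ^ k * norm (FT \<sigma> g \<xi>) \<le> C * B"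
    by blast
  have "(1 + norm \<xi>) ^ Suc k * norm (FT \<sigma> g \<xi>) \<le> ((1 + real DIM('a)) * C) * B"
    if g: "g \<in> schwartz_functions" and B: "sb m (Suc M) B g" for g :: "'a \<Rightarrow> complex" and B \<xi>
  proof -
    have B': "sb m M B g" "\<And>b. b \<in> Basis \<Longrightarrow> sb m M B (pd b g)" using B by (auto simp: sb_Suc_iff)
    have "(1 + norm \<xi>) * ((1 + norm \<xi>) ^ k * norm (FT \<sigma> g \<xi>)) \<le> (1 + (\<Sum>b\<in>Basis. \<bar>\<xi> \<bullet> b\<bar>)) * ((1 + norm \<xi>) ^ k * norm (FT \<sigma> g \<xi>))"
      using norm_le_l1[of \<xi>] by (intro mult_right_mono) auto
    also have "\<dots> = (1 + norm \<xi>) ^ k * norm (FT \<sigma> g \<xi>) + (\<Sum>b\<in>Basis. (1 + norm \<xi>) ^ k * norm (FT \<sigma> (pd b g) \<xi>))"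
    proof -
      have "norm (FT \<sigma> (pd b g) \<xi>) = \<bar>\<xi> \<bullet> b\<bar> * norm (FT \<sigma> g \<xi>)" if "b \<in> Basis" for b
        using \<sigma> by (simp add: FT_pd[OF g that] norm_mult abs_mult)
      then have "(\<Sum>b\<in>Basis. (1 + norm \<xi>) ^ k * norm (FT \<sigma> (pd b g) \<xi>))
          = (\<Sum>b\<in>Basis. \<bar>\<xi> \<bullet> b\<bar> * ((1 + norm \<xi>) ^ k * norm (FT \<sigma> g \<xi>)))"
        by (intro sum.cong) auto
      then show ?thesis by (simp only: distrib_right sum_distrib_right mult_1_left)
    qed
    also have "\<dots> \<le> C * B + (\<Sum>b\<in>(Basis::'a set). C * B)"
      by (intro add_mono sum_mono * g schwartz_pd B')
    finally show ?thesis by (simp add: algebra_simps)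
  qed
  then show ?case using C by (intro exI[of _ "(1 + real DIM('a)) * C"] exI[of _ m] exI[of _ "Suc M"]) auto
qed

text \<open>A derivative in frequency is multiplication by a coordinate before the transform, which
  costs one weight and a factor 2^M. The constants do not depend on \<open>g\<close>, as continuity
  of the transposed map requires.\<close>

lemma FT_sb:
  assumes \<sigma>: "\<bar>\<sigma>\<bar> = 1"
  shows "\<exists>C m M. C \<ge> 0 \<and> (\<forall>g :: 'a::euclidean_space \<Rightarrow> complex. \<forall>B. g \<in> schwartz_functions \<longrightarrow> sb m M B g \<longrightarrow> sb k N (C * B) (FT \<sigma> g))"
proof (induction N)
  case 0
  show ?case using FT_decay[OF \<sigma>, of k, where 'a = 'a] by (auto simp: sb_def)
next
  case (Suc N)
  then obtain C m M where C: "C \<ge> 0" and *: "\<And>(g :: 'a \<Rightarrow> complex) B. g \<in> schwartz_functions \<Longrightarrow> sb m M B g \<Longrightarrow> sb k N (C * B) (FT \<sigma> g)"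
    by blast
  have "sb k (Suc N) ((C * 2 ^ M) * B) (FT \<sigma> g)"
    if g: "g \<in> schwartz_functions" and B: "sb (Suc m) M B g" for g :: "'a \<Rightarrow> complex" and B
    unfolding sb_Suc_iff
  proof (intro conjI ballI)
    have B0: "B \<ge> 0" using sb_nonneg[OF B] .
    have "sb k N (C * B) (FT \<sigma> g)" by (rule *[OF g sb_mono[OF B]]) auto
    then show "sb k N ((C * 2 ^ M) * B) (FT \<sigma> g)"
      using C B0 mult_left_mono[of 1 "2 ^ M" "C * B"] by (elim sb_mono) (auto simp: mult_ac)
    fix v :: 'a assume v: "v \<in> Basis"
    have "sb m M (norm (\<i> * complex_of_real \<sigma>) * (2 ^ M * B)) (\<lambda>x. (\<i> * of_real \<sigma>) * (of_real (x \<bullet> v) * g x))"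
      by (intro sb_cmult sb_coord smooth_mult smooth_coord schwartz_smooth g B v)
    then have "sb m M (2 ^ M * B) (\<lambda>x. (\<i> * of_real \<sigma>) * (of_real (x \<bullet> v) * g x))"
      using \<sigma> by (simp add: norm_mult)
    from *[OF schwartz_cmult[OF schwartz_coord[OF g v]] this] show "sb k N ((C * 2 ^ M) * B) (pd v (FT \<sigma> g))"
      by (simp only: pd_FT[OF g v] mult.assoc)
  qed
  then show ?case using C by (intro exI[of _ "C * 2 ^ M"] exI[of _ "Suc m"] exI[of _ M]) auto
qed

lemma FT_schwartz: "\<bar>\<sigma>\<bar> = 1 \<Longrightarrow> g \<in> schwartz_functions \<Longrightarrow> FT \<sigma> g \<in> schwartz_functions"
  using FT_sb[of \<sigma>, where 'a = 'a] FT_smooth schwartz_iff by metis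

lemma fourier_FT: "fourier g = FT (-1) g"
  by (rule ext) (simp add: fourier_def FT_def)

lemma inv_fourier_FT: "inv_fourier (g :: 'a::euclidean_space \<Rightarrow> complex) = (\<lambda>x. of_real (1 / (2 * pi) ^ DIM('a)) * FT 1 g x)"
  by (rule ext) (simp add: inv_fourier_def FT_def inner_commute)

section \<open>Fourier inversion\<close>

lemma integrable_pair_nn:
  fixes F :: "'a::euclidean_space \<Rightarrow> 'b::euclidean_space \<Rightarrow> complex"
  assumes [measurable]: "(\<lambda>(x, y). F x y) \<in> borel_measurable (lborel \<Otimes>\<^sub>M lborel)"
    and fin: "(\<integral>\<^sup>+x. \<integral>\<^sup>+y. ennreal (norm (F x y)) \<partial>lborel \<partial>lborel) < \<infinity>"
  shows "integrable (lborel \<Otimes>\<^sub>M lborel) (\<lambda>(x, y). F x y)"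
proof (rule integrableI_bounded)
  have "(\<integral>\<^sup>+z. ennreal (norm (case z of (x, y) \<Rightarrow> F x y)) \<partial>(lborel \<Otimes>\<^sub>M lborel))
     = (\<integral>\<^sup>+x. \<integral>\<^sup>+y. ennreal (norm (F x y)) \<partial>lborel \<partial>lborel)"
    by (subst lborel.nn_integral_fst[symmetric]) auto
  then show "(\<integral>\<^sup>+z. ennreal (norm (case z of (x, y) \<Rightarrow> F x y)) \<partial>(lborel \<Otimes>\<^sub>M lborel)) < \<infinity>" using fin by simp
qed simp

lemma Fubini_nn:
  fixes F :: "'a::euclidean_space \<Rightarrow> 'b::euclidean_space \<Rightarrow> complex"
  assumes "(\<lambda>(x, y). F x y) \<in> borel_measurable (lborel \<Otimes>\<^sub>M lborel)"
    and "(\<integral>\<^sup>+x. \<integral>\<^sup>+y. ennreal (norm (F x y)) \<partial>lborel \<partial>lborel) < \<infinity>"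
  shows "(\<integral>x. \<integral>y. F x y \<partial>lborel \<partial>lborel) = (\<integral>y. \<integral>x. F x y \<partial>lborel \<partial>lborel)"
  using lborel_pair.Fubini_integral[OF integrable_pair_nn[OF assms]] by simp

text \<open>The exponential is symmetric in its two arguments, so Fubini obtains both sides from one
  double integral.\<close>

lemma FT_multiplication:
  assumes f: "integrable lborel f" and g: "integrable lborel (g :: 'a::euclidean_space \<Rightarrow> complex)"
  shows "(\<integral>\<xi>. FT \<sigma> f \<xi> * g \<xi> \<partial>lborel) = (\<integral>x. f x * FT \<sigma> g x \<partial>lborel)"
proof -
  have [measurable]: "f \<in> borel_measurable lborel" "g \<in> borel_measurable lborel" using f g by auto
  let ?F = "\<lambda>x \<xi>. exp (\<i> * complex_of_real (\<sigma> * (x \<bullet> \<xi>))) * f x * g \<xi>"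
  have "(\<integral>\<^sup>+x. \<integral>\<^sup>+\<xi>. ennreal (norm (?F x \<xi>)) \<partial>lborel \<partial>lborel) = (\<integral>\<^sup>+x. \<integral>\<^sup>+\<xi>. ennreal (norm (f x)) * ennreal (norm (g \<xi>)) \<partial>lborel \<partial>lborel)"
    by (simp add: norm_mult ennreal_mult')
  also have "\<dots> = (\<integral>\<^sup>+x. ennreal (norm (f x)) \<partial>lborel) * (\<integral>\<^sup>+x. ennreal (norm (g x)) \<partial>lborel)"
    by (simp add: nn_integral_cmult nn_integral_multc)
  also have "\<dots> < \<infinity>" using f g by (simp add: integrable_iff_bounded ennreal_mult_less_top)
  finally have fin: "(\<integral>\<^sup>+x. \<integral>\<^sup>+\<xi>. ennreal (norm (?F x \<xi>)) \<partial>lborel \<partial>lborel) < \<infinity>" .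
  have "(\<integral>x. (\<lambda>x. \<integral>\<xi>. ?F x \<xi> \<partial>lborel) x \<partial>lborel) = (\<integral>\<xi>. (\<lambda>\<xi>. \<integral>x. ?F x \<xi> \<partial>lborel) \<xi> \<partial>lborel)"
    by (rule Fubini_nn[OF _ fin]) measurable
  also have "(\<lambda>x. (\<integral>\<xi>. ?F x \<xi> \<partial>lborel)) = (\<lambda>x. f x * FT \<sigma> g x)"
    unfolding FT_def by (rule ext, subst integral_mult_right_zero[symmetric]) (simp add: inner_commute mult_ac)
  also have "(\<lambda>\<xi>. (\<integral>x. ?F x \<xi> \<partial>lborel)) = (\<lambda>\<xi>. FT \<sigma> f \<xi> * g \<xi>)"
    unfolding FT_def integral_mult_left_zero ..
  finally show ?thesis by simp
qed

section \<open>The Gaussian and its Fourier transform\<close>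

lemma integral_lborel_prod_complex:
  fixes h :: "'a::euclidean_space \<Rightarrow> real \<Rightarrow> complex"
  assumes h: "\<And>b. b \<in> Basis \<Longrightarrow> integrable lborel (h b)"
  shows "integrable lborel (\<lambda>x. \<Prod>b\<in>Basis. h b (x \<bullet> b))"
    and "(\<integral>x. (\<Prod>b\<in>Basis. h b (x \<bullet> b)) \<partial>lborel) = (\<Prod>b\<in>Basis. \<integral>s. h b s \<partial>lborel)"
proof -
  interpret product_sigma_finite "\<lambda>_::'a. lborel :: real measure" by standard
  have m: "\<And>b. b \<in> Basis \<Longrightarrow> h b \<in> borel_measurable borel" using h by auto
  have [measurable]: "(\<lambda>x. \<Prod>b\<in>(Basis::'a set). h b (x \<bullet> b)) \<in> borel_measurable borel"
    by (intro borel_measurable_prod measurable_compose[OF _ m]) auto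
  have eq: "(\<Prod>b\<in>Basis. h b ((\<Sum>b\<in>Basis. f b *\<^sub>R b) \<bullet> b)) = (\<Prod>b\<in>Basis. h b (f b))" for f
    by (intro prod.cong refl) simp
  show "integrable lborel (\<lambda>x. \<Prod>b\<in>Basis. h b (x \<bullet> b))"
    unfolding lborel_eq[where 'a='a] by (subst integrable_distr_eq) (simp_all add: eq product_integrable_prod h)
  show "(\<integral>x. (\<Prod>b\<in>Basis. h b (x \<bullet> b)) \<partial>lborel) = (\<Prod>b\<in>Basis. \<integral>s. h b s \<partial>lborel)"
    unfolding lborel_eq[where 'a='a] by (subst integral_distr) (simp_all add: eq product_integral_prod h)
qed

text \<open>Density of the standard normal distribution in all coordinates: its mass is 1 and its
  transform factorises into characteristic functions.\<close>

definition gauss :: "'a::euclidean_space \<Rightarrow> complex" where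
  "gauss x = (\<Prod>b\<in>Basis. complex_of_real (std_normal_density (x \<bullet> b)))"

lemma gauss_integral_aux: "(\<integral>s. exp (\<i> * complex_of_real (t * s)) * of_real (std_normal_density s) \<partial>lborel) = of_real (exp (- t\<^sup>2 / 2))"
proof -
  have "of_real (exp (- t\<^sup>2 / 2)) = char std_normal_distribution t" by (simp add: char_std_normal_distribution)
  also have "\<dots> = (\<integral>s. std_normal_density s *\<^sub>R exp (\<i> * complex_of_real (t * s)) \<partial>lborel)"
    unfolding char_def by (subst integral_density) (auto simp: normal_density_nonneg)
  finally show ?thesis by (simp add: scaleR_conv_of_real mult.commute)
qed

lemma gauss_integrable: "integrable lborel gauss" and gauss_integral: "(\<integral>x. gauss x \<partial>lborel) = 1"
proof -
  have i: "integrable lborel (\<lambda>s. complex_of_real (std_normal_density s))" by simp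
  have "(\<integral>s. complex_of_real (std_normal_density s) \<partial>lborel) = of_real (\<integral>s. std_normal_density s \<partial>lborel)"
    by (rule integral_complex_of_real)
  then have "(\<integral>s. complex_of_real (std_normal_density s) \<partial>lborel) = 1" by simp
  then show "integrable lborel gauss" "(\<integral>x. gauss x \<partial>lborel) = 1"
    using integral_lborel_prod_complex[of "\<lambda>_ s. complex_of_real (std_normal_density s)"] i
    by (auto simp: gauss_def[abs_def])
qed

lemma FT_gauss:
  assumes "\<bar>\<sigma>\<bar> = 1"
  shows "FT \<sigma> gauss (\<xi>::'a::euclidean_space) = of_real (sqrt (2 * pi) ^ DIM('a)) * gauss \<xi>"
proof -
  let ?h = "\<lambda>(b::'a) s. exp (\<i> * complex_of_real ((\<sigma> * (\<xi> \<bullet> b)) * s)) * of_real (std_normal_density s)"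
  have i: "integrable lborel (?h b)" for b
  proof -
    have "integrable lborel (\<lambda>s. exp (\<i> * of_real ((\<sigma> * (\<xi> \<bullet> b)) * (s \<bullet> 1))) * complex_of_real (std_normal_density s))"
      by (rule integrable_exp_mult) simp
    then show ?thesis by simp
  qed
  have e: "exp (\<i> * of_real (\<sigma> * (x \<bullet> \<xi>))) * gauss x = (\<Prod>b\<in>Basis. ?h b (x \<bullet> b))" for x
  proof -
    have "\<i> * complex_of_real (\<sigma> * (x \<bullet> \<xi>)) = (\<Sum>b\<in>Basis. \<i> * complex_of_real ((\<sigma> * (\<xi> \<bullet> b)) * (x \<bullet> b)))"
      by (subst euclidean_inner) (simp add: sum_distrib_left mult_ac)
    then show ?thesis by (simp add: exp_sum prod.distrib gauss_def)
  qed
  have "FT \<sigma> gauss \<xi> = (\<Prod>b\<in>Basis. \<integral>s. ?h b s \<partial>lborel)"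
    unfolding FT_def e by (rule integral_lborel_prod_complex(2)) (rule i)
  also have "\<dots> = (\<Prod>b\<in>Basis. of_real (sqrt (2 * pi)) * complex_of_real (std_normal_density (\<xi> \<bullet> b)))"
  proof (rule prod.cong[OF refl])
    fix b :: 'a
    have "\<sigma>\<^sup>2 = 1" using assms by (simp add: abs_square_eq_1)
    then have "(\<sigma> * (\<xi> \<bullet> b))\<^sup>2 = (\<xi> \<bullet> b)\<^sup>2" by (simp add: power_mult_distrib)
    then show "(\<integral>s. ?h b s \<partial>lborel) = of_real (sqrt (2 * pi)) * complex_of_real (std_normal_density (\<xi> \<bullet> b))"
      unfolding gauss_integral_aux by (simp add: std_normal_density_def)
  qed
  also have "\<dots> = of_real (sqrt (2 * pi) ^ DIM('a)) * gauss \<xi>" by (simp add: prod.distrib gauss_def)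
  finally show ?thesis .
qed

lemma gauss_le: "norm (gauss (x::'a::euclidean_space)) \<le> 1"
proof -
  have "std_normal_density s \<le> 1" for s
  proof -
    have "1 \<le> sqrt (2 * pi)" using pi_gt3 by (intro real_le_rsqrt) simp
    then have "1 / sqrt (2 * pi) * exp (- s\<^sup>2 / 2) \<le> 1 * 1" by (intro mult_mono) (auto simp: field_simps)
    then show ?thesis by (simp add: std_normal_density_def)
  qed
  then show ?thesis unfolding gauss_def by (auto simp: prod_norm[symmetric] intro!: prod_le_1)
qed

lemma gauss_0: "gauss (0::'a::euclidean_space) * of_real (sqrt (2 * pi) ^ DIM('a)) = 1"
proof -
  have "gauss (0::'a) = (of_real (1 / sqrt (2 * pi))) ^ DIM('a)" by (simp add: gauss_def std_normal_density_def)
  moreover have "complex_of_real (1 / sqrt (2 * pi)) * of_real (sqrt (2 * pi)) = 1"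
    unfolding of_real_mult[symmetric] by simp
  ultimately show ?thesis by (simp only: of_real_power power_mult_distrib[symmetric] power_one)
qed

lemma gauss_cont: "continuous_on UNIV (gauss :: 'a::euclidean_space \<Rightarrow> complex)"
  unfolding gauss_def[abs_def] std_normal_density_def by (intro continuous_intros) auto

text \<open>Gaussian summation. The damping factor gauss(\<epsilon> \<xi>) makes the exponential
  integrable, the multiplication formula moves the transform onto the damped exponential, and what
  remains is a Gaussian average of \<open>g\<close> near \<open>x\<close>. As \<epsilon> tends to 0
  both sides converge by domination.\<close>

theorem FT_inversion:
  fixes g :: "'a::euclidean_space \<Rightarrow> complex"
  assumes \<sigma>: "\<bar>\<sigma>\<bar> = 1" and g: "g \<in> schwartz_functions"
  shows "FT (- \<sigma>) (FT \<sigma> g) x = of_real ((2 * pi) ^ DIM('a)) * g x"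
proof -
  let ?s = "complex_of_real (sqrt (2 * pi) ^ DIM('a))"
  define \<epsilon> where "\<epsilon> n = inverse (real (Suc n))" for n
  have e0: "\<epsilon> n > 0" for n by (simp add: \<epsilon>_def)
  have elim: "\<epsilon> \<longlonglongrightarrow> 0" unfolding \<epsilon>_def by (rule LIMSEQ_inverse_real_of_nat)
  define E where "E \<xi> = exp (\<i> * complex_of_real (- \<sigma> * (\<xi> \<bullet> x)))" for \<xi>
  have nE: "norm (E \<xi>) = 1" for \<xi> by (simp add: E_def)
  have ig: "integrable lborel g" by (rule schwartz_integrable[OF g])
  have [measurable]: "g \<in> borel_measurable borel" by (rule schwartz_measurable[OF g])
  have gm[measurable]: "gauss \<in> borel_measurable (borel :: 'a measure)"
    by (rule borel_measurable_continuous_onI[OF gauss_cont])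
  have Em[measurable]: "E \<in> borel_measurable borel" unfolding E_def by measurable
  have iFg: "integrable lborel (FT \<sigma> g)" by (intro schwartz_integrable FT_schwartz \<sigma> g)
  have [measurable]: "FT \<sigma> g \<in> borel_measurable borel" using iFg by auto
  have ih: "integrable lborel (\<lambda>\<xi>. E \<xi> * gauss (\<epsilon> n *\<^sub>R \<xi>))" for n
  proof -
    have "integrable lborel (\<lambda>\<xi>::'a. gauss (\<epsilon> n *\<^sub>R \<xi>))"
      using integrable_affine[OF gauss_integrable, of "\<epsilon> n" 0] e0[of n] by simp
    from Bochner_Integration.integrable_bound[OF this, of "\<lambda>\<xi>. E \<xi> * gauss (\<epsilon> n *\<^sub>R \<xi>)"]
    show ?thesis by (simp add: norm_mult nE)
  qed
  \<comment> \<open>The transform of the damped exponential is a Gaussian centred at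
    \<open>x\<close> of width \<epsilon>; the substitution y = x + \<epsilon> z absorbs the power of
    \<epsilon>.\<close>
  have Fh: "FT \<sigma> (\<lambda>\<xi>. E \<xi> * gauss (\<epsilon> n *\<^sub>R \<xi>)) (x + \<epsilon> n *\<^sub>R z) * of_real (\<epsilon> n ^ DIM('a)) = ?s * gauss z" for n z
  proof -
    have "FT \<sigma> (\<lambda>\<xi>. E \<xi> * gauss (\<epsilon> n *\<^sub>R \<xi>)) (x + \<epsilon> n *\<^sub>R z)
       = (\<integral>\<xi>. exp (\<i> * of_real (\<sigma> * ((\<epsilon> n *\<^sub>R \<xi>) \<bullet> z))) * gauss (\<epsilon> n *\<^sub>R \<xi>) \<partial>lborel)"
      unfolding FT_def E_def mult.assoc[symmetric] exp_add[symmetric]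
      by (simp add: inner_add_right algebra_simps)
    moreover have "(\<integral>\<xi>. exp (\<i> * of_real (\<sigma> * (\<xi> \<bullet> z))) * gauss \<xi> \<partial>lborel)
        = \<bar>\<epsilon> n\<bar> ^ DIM('a) *\<^sub>R (\<integral>\<xi>. exp (\<i> * of_real (\<sigma> * ((0 + \<epsilon> n *\<^sub>R \<xi>) \<bullet> z))) * gauss (0 + \<epsilon> n *\<^sub>R \<xi>) \<partial>lborel)"
      by (rule integral_affine) (use e0[of n] in auto)
    moreover have "(\<integral>\<xi>. exp (\<i> * of_real (\<sigma> * (\<xi> \<bullet> z))) * gauss \<xi> \<partial>lborel) = ?s * gauss z"
      using FT_gauss[OF \<sigma>, of z] by (simp add: FT_def)
    ultimately show ?thesis using e0[of n] by (simp add: scaleR_conv_of_real mult.commute)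
  qed
  have key: "(\<integral>\<xi>. FT \<sigma> g \<xi> * (E \<xi> * gauss (\<epsilon> n *\<^sub>R \<xi>)) \<partial>lborel) = ?s * (\<integral>z. g (x + \<epsilon> n *\<^sub>R z) * gauss z \<partial>lborel)" for n
  proof -
    have [measurable]: "FT \<sigma> (\<lambda>\<xi>. E \<xi> * gauss (\<epsilon> n *\<^sub>R \<xi>)) \<in> borel_measurable borel"
      unfolding FT_def by measurable
    have "(\<integral>\<xi>. FT \<sigma> g \<xi> * (E \<xi> * gauss (\<epsilon> n *\<^sub>R \<xi>)) \<partial>lborel) = (\<integral>y. g y * FT \<sigma> (\<lambda>\<xi>. E \<xi> * gauss (\<epsilon> n *\<^sub>R \<xi>)) y \<partial>lborel)"
      by (rule FT_multiplication[OF ig ih])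
    also have "\<dots> = \<bar>\<epsilon> n\<bar> ^ DIM('a) *\<^sub>R (\<integral>z. g (x + \<epsilon> n *\<^sub>R z) * FT \<sigma> (\<lambda>\<xi>. E \<xi> * gauss (\<epsilon> n *\<^sub>R \<xi>)) (x + \<epsilon> n *\<^sub>R z) \<partial>lborel)"
      by (rule integral_affine) (use e0[of n] in auto)
    also have "\<dots> = (\<integral>z. of_real (\<epsilon> n ^ DIM('a)) * (g (x + \<epsilon> n *\<^sub>R z) * FT \<sigma> (\<lambda>\<xi>. E \<xi> * gauss (\<epsilon> n *\<^sub>R \<xi>)) (x + \<epsilon> n *\<^sub>R z)) \<partial>lborel)"
      using e0[of n] by (simp add: scaleR_conv_of_real)
    also have "\<dots> = (\<integral>z. ?s * (g (x + \<epsilon> n *\<^sub>R z) * gauss z) \<partial>lborel)"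
    proof (rule Bochner_Integration.integral_cong[OF refl])
      fix z
      show "of_real (\<epsilon> n ^ DIM('a)) * (g (x + \<epsilon> n *\<^sub>R z) * FT \<sigma> (\<lambda>\<xi>. E \<xi> * gauss (\<epsilon> n *\<^sub>R \<xi>)) (x + \<epsilon> n *\<^sub>R z)) = ?s * (g (x + \<epsilon> n *\<^sub>R z) * gauss z)"
      proof -
        have "of_real (\<epsilon> n ^ DIM('a)) * (g (x + \<epsilon> n *\<^sub>R z) * FT \<sigma> (\<lambda>\<xi>. E \<xi> * gauss (\<epsilon> n *\<^sub>R \<xi>)) (x + \<epsilon> n *\<^sub>R z))
          = g (x + \<epsilon> n *\<^sub>R z) * (FT \<sigma> (\<lambda>\<xi>. E \<xi> * gauss (\<epsilon> n *\<^sub>R \<xi>)) (x + \<epsilon> n *\<^sub>R z) * of_real (\<epsilon> n ^ DIM('a)))"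
          by (simp only: mult_ac)
        then show ?thesis unfolding Fh by (simp only: mult_ac)
      qed
    qed
    finally show ?thesis by simp
  qed
  have L: "(\<lambda>n. \<integral>\<xi>. FT \<sigma> g \<xi> * (E \<xi> * gauss (\<epsilon> n *\<^sub>R \<xi>)) \<partial>lborel) \<longlonglongrightarrow> (\<integral>\<xi>. FT \<sigma> g \<xi> * (E \<xi> * gauss (0::'a)) \<partial>lborel)"
  proof (rule integral_dominated_convergence[where w = "\<lambda>\<xi>. norm (FT \<sigma> g \<xi>)"])
    show "AE \<xi> in lborel. (\<lambda>n. FT \<sigma> g \<xi> * (E \<xi> * gauss (\<epsilon> n *\<^sub>R \<xi>))) \<longlonglongrightarrow> FT \<sigma> g \<xi> * (E \<xi> * gauss (0::'a))"
    proof (rule AE_I2)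
      fix \<xi> :: 'a
      have "(\<lambda>n. \<epsilon> n *\<^sub>R \<xi>) \<longlonglongrightarrow> 0 *\<^sub>R \<xi>" by (intro tendsto_intros elim)
      then have "(\<lambda>n. gauss (\<epsilon> n *\<^sub>R \<xi>)) \<longlonglongrightarrow> gauss (0 *\<^sub>R \<xi>)"
        using gauss_cont by (intro isCont_tendsto_compose[of _ gauss]) (auto simp: continuous_on_eq_continuous_at)
      then show "(\<lambda>n. FT \<sigma> g \<xi> * (E \<xi> * gauss (\<epsilon> n *\<^sub>R \<xi>))) \<longlonglongrightarrow> FT \<sigma> g \<xi> * (E \<xi> * gauss (0::'a))"
        by (intro tendsto_mult tendsto_const) simp
    qed
    show "AE \<xi> in lborel. norm (FT \<sigma> g \<xi> * (E \<xi> * gauss (\<epsilon> n *\<^sub>R \<xi>))) \<le> norm (FT \<sigma> g \<xi>)" for n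
      by (auto simp: norm_mult nE intro!: AE_I2 mult_left_le gauss_le)
  qed (use iFg in auto)
  obtain B where B: "sb 0 0 B g" using schwartz_sb[OF g] by blast
  have gB: "norm (g y) \<le> B" for y using sbD[OF B, of "[]" y] by simp
  have R: "(\<lambda>n. \<integral>z. g (x + \<epsilon> n *\<^sub>R z) * gauss z \<partial>lborel) \<longlonglongrightarrow> (\<integral>z. g x * gauss z \<partial>(lborel::'a measure))"
  proof (rule integral_dominated_convergence[where w = "\<lambda>z. B * norm (gauss z)"])
    show "AE z in lborel. (\<lambda>n. g (x + \<epsilon> n *\<^sub>R z) * gauss z) \<longlonglongrightarrow> g x * gauss z"
    proof (rule AE_I2)
      fix z :: 'a
      have "(\<lambda>n. x + \<epsilon> n *\<^sub>R z) \<longlonglongrightarrow> x + 0 *\<^sub>R z" by (intro tendsto_intros elim)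
      then have "(\<lambda>n. g (x + \<epsilon> n *\<^sub>R z)) \<longlonglongrightarrow> g (x + 0 *\<^sub>R z)"
        using smooth_continuous[OF schwartz_smooth[OF g], of UNIV] by (intro isCont_tendsto_compose[of _ g]) (auto simp: continuous_on_eq_continuous_at)
      then show "(\<lambda>n. g (x + \<epsilon> n *\<^sub>R z) * gauss z) \<longlonglongrightarrow> g x * gauss z"
        by (intro tendsto_mult tendsto_const) simp
    qed
    show "integrable lborel (\<lambda>z::'a. B * norm (gauss z))" by (intro integrable_mult_right integrable_norm gauss_integrable)
    show "AE z in lborel. norm (g (x + \<epsilon> n *\<^sub>R z) * gauss z) \<le> B * norm (gauss z)" for n
      by (auto simp: norm_mult intro!: AE_I2 mult_right_mono gB)
  qed auto
  have "(\<integral>\<xi>. FT \<sigma> g \<xi> * (E \<xi> * gauss (0::'a)) \<partial>lborel) = ?s * (\<integral>z. g x * gauss z \<partial>(lborel::'a measure))"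
    using L tendsto_mult[OF tendsto_const[of ?s] R] unfolding key by (rule LIMSEQ_unique)
  also have "\<dots> = ?s * g x" by (simp add: gauss_integral)
  also have "(\<integral>\<xi>. FT \<sigma> g \<xi> * (E \<xi> * gauss (0::'a)) \<partial>lborel) = gauss (0::'a) * FT (- \<sigma>) (FT \<sigma> g) x"
    unfolding FT_def[of "- \<sigma>"] E_def by (subst integral_mult_right_zero[symmetric]) (simp only: mult_ac)
  finally have e: "gauss (0::'a) * FT (- \<sigma>) (FT \<sigma> g) x = ?s * g x" .
  \<comment> \<open>The limit identity carries the factor \<open>gauss 0\<close>, which is the
    inverse of \<open>?s\<close>. Multiplication by \<open>?s\<close> removes it and leaves
    \<open>?s\<close> squared, that is (2 pi)^n.\<close>
  have "(gauss (0::'a) * ?s) * FT (- \<sigma>) (FT \<sigma> g) x = ?s * (gauss (0::'a) * FT (- \<sigma>) (FT \<sigma> g) x)" by (simp only: mult_ac)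
  then have "(gauss (0::'a) * ?s) * FT (- \<sigma>) (FT \<sigma> g) x = (?s * ?s) * g x" by (simp only: e mult.assoc)
  moreover have "?s * ?s = of_real ((2 * pi) ^ DIM('a))"
    unfolding of_real_mult[symmetric] power_mult_distrib[symmetric] by simp
  ultimately show ?thesis by (simp only: gauss_0 mult_1_left)
qed

lemma fourier_inv_fourier: "g \<in> schwartz_functions \<Longrightarrow> fourier (inv_fourier g) = g"
proof
  fix x assume g: "(g :: 'a::euclidean_space \<Rightarrow> complex) \<in> schwartz_functions"
  have "fourier (inv_fourier g) x = of_real (1 / (2 * pi) ^ DIM('a)) * FT (-1) (FT 1 g) x"
    unfolding fourier_FT inv_fourier_FT FT_def[of "-1"] by (subst integral_mult_right_zero[symmetric]) (simp only: mult_ac)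
  then show "fourier (inv_fourier g) x = g x" using FT_inversion[of 1 g x] g by simp
qed

lemma inv_fourier_fourier: "g \<in> schwartz_functions \<Longrightarrow> inv_fourier (fourier g) = g"
proof
  fix x assume g: "(g :: 'a::euclidean_space \<Rightarrow> complex) \<in> schwartz_functions"
  show "inv_fourier (fourier g) x = g x"
    unfolding fourier_FT inv_fourier_FT using FT_inversion[of "-1" g x] g by simp
qed

lemma fourier_schwartz: "g \<in> schwartz_functions \<Longrightarrow> fourier g \<in> schwartz_functions"
  by (simp add: fourier_FT FT_schwartz)

lemma inv_fourier_schwartz: "g \<in> schwartz_functions \<Longrightarrow> inv_fourier g \<in> schwartz_functions"
  unfolding inv_fourier_FT by (intro schwartz_cmult FT_schwartz) auto

section \<open>Dyadic cut-offs, uniformly in the scale\<close>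

definition cut :: "(real \<Rightarrow> real) \<Rightarrow> nat \<Rightarrow> 'a::euclidean_space \<Rightarrow> complex" where
  "cut \<Psi> j x = of_real (dyadic_cutoff \<Psi> j x)"

lemma cut_scale: "cut \<Psi> j x = cut \<Psi> 0 ((1 / 2 ^ j) *\<^sub>R x)"
  by (simp add: cut_def dyadic_cutoff_def)

lemma smooth_cut: "cutoff \<Psi> \<Longrightarrow> smooth (cut \<Psi> j :: 'a::euclidean_space \<Rightarrow> complex)"
  using smooth_scale[OF smooth_cutoff_norm, of \<Psi> "1 / 2 ^ j"] by (simp add: cut_def[abs_def] dyadic_cutoff_def)

lemma cut_1: "cutoff \<Psi> \<Longrightarrow> norm x < 11/10 * 2 ^ j \<Longrightarrow> cut \<Psi> j x = 1"
  by (simp add: cut_def dyadic_cutoff_def cutoff_def field_simps)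

lemma cut_0: "cutoff \<Psi> \<Longrightarrow> 13/10 * 2 ^ j < norm x \<Longrightarrow> cut \<Psi> j x = 0"
  by (simp add: cut_def dyadic_cutoff_def cutoff_def field_simps)

lemma pderivs_vanish:
  assumes "open S" "\<And>x. x \<in> S \<Longrightarrow> f x = 0" "x \<in> S" shows "pderivs vs f x = 0"
  using pderivs_cong_open[OF assms(1) _ assms(3), of f "\<lambda>x. 0" vs] assms(2) by (simp add: pderivs_const)

text \<open>The weighted derivatives are continuous, hence bounded on \<open>K\<close>; the
  complement of \<open>K\<close> is open and the function vanishes there, so all derivatives are
  0.\<close>

lemma compact_support_bounded:
  fixes f :: "'a::euclidean_space \<Rightarrow> complex"
  assumes "smooth f" "compact K" "\<And>x. x \<notin> K \<Longrightarrow> f x = 0"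
  shows "\<exists>B. sb k N B f"
proof -
  have "\<exists>B. \<forall>x. (1 + norm x) ^ k * norm (pderivs vs f x) \<le> B" if vs: "set vs \<subseteq> Basis" for vs k
  proof -
    have "continuous_on K (\<lambda>x. (1 + norm x) ^ k * norm (pderivs vs f x))"
      by (intro continuous_intros smooth_continuous smooth_pderivs assms vs)
    then have "bounded ((\<lambda>x. (1 + norm x) ^ k * norm (pderivs vs f x)) ` K)"
      using assms(2) compact_continuous_image compact_imp_bounded by blast
    then obtain B where B: "\<And>x. x \<in> K \<Longrightarrow> norm ((1 + norm x) ^ k * norm (pderivs vs f x)) \<le> B"
      by (auto simp: bounded_iff)
    have "(1 + norm x) ^ k * norm (pderivs vs f x) \<le> \<bar>B\<bar>" for x
    proof (cases "x \<in> K")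
      case True then show ?thesis using B[OF True] by (simp add: abs_mult)
    next
      case False
      then have "pderivs vs f x = 0"
        using pderivs_vanish[of "- K" f x vs] compact_imp_closed[OF assms(2)] assms(3) by auto
      then show ?thesis by simp
    qed
    then show ?thesis by blast
  qed
  then have "f \<in> schwartz_functions"
    using assms(1) by (auto simp: schwartz_functions_def bounded_iff)
  then show ?thesis by (rule schwartz_sb)
qed

lemma test_schwartz: "f \<in> test_functions \<Longrightarrow> f \<in> schwartz_functions"
  unfolding schwartz_iff
proof safe
  assume f: "f \<in> test_functions"
  then show "smooth f" by (simp add: test_functions_def)
  fix k N
  show "\<exists>B. sb k N B f"
    by (rule compact_support_bounded[of _ "supp f"]) (use f closure_subset[of "{x. f x \<noteq> 0}"] in \<open>auto simp: test_functions_def supp_def\<close>)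
qed

lemma test_functionsI:
  assumes "smooth f" "\<And>x. norm x > R \<Longrightarrow> f x = 0" shows "f \<in> test_functions"
proof -
  have "supp f \<subseteq> cball 0 R" unfolding supp_def
    by (rule closure_minimal) (use assms(2) in \<open>auto simp: not_less[symmetric]\<close>)
  then have "compact (supp f)" unfolding supp_def
    by (metis bounded_cball bounded_subset closed_closure compact_eq_bounded_closed)
  then show ?thesis using assms by (simp add: test_functions_def)
qed

lemma cut_mult_test: "cutoff \<Psi> \<Longrightarrow> smooth f \<Longrightarrow> (\<lambda>x. cut \<Psi> j x * f x) \<in> test_functions"
  by (rule test_functionsI[of _ "13/10 * 2 ^ j"]) (auto intro!: smooth_mult smooth_cut simp: cut_0)

lemma cut_test: "cutoff \<Psi> \<Longrightarrow> cut \<Psi> j \<in> test_functions"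
  by (rule test_functionsI[of _ "13/10 * 2 ^ j"]) (auto intro!: smooth_cut simp: cut_0)

text \<open>Dilation by 2^(-j) multiplies a derivative of order l by 2^(-jl), which is at most 1, so
  the bound for scale 0 serves all scales.\<close>

lemma cut_bounded:
  assumes \<Psi>: "cutoff \<Psi>"
  shows "\<exists>M\<ge>0. \<forall>j vs x. set vs \<subseteq> Basis \<longrightarrow> length vs \<le> N \<longrightarrow> norm (pderivs vs (cut \<Psi> j) (x::'a::euclidean_space)) \<le> M"
proof -
  obtain M where M: "sb 0 N M (cut \<Psi> 0 :: 'a \<Rightarrow> complex)"
    using schwartz_sb[OF test_schwartz[OF cut_test[OF \<Psi>]]] by blast
  have "norm (pderivs vs (cut \<Psi> j) x) \<le> M" if vs: "set vs \<subseteq> Basis" "length vs \<le> N" for j vs and x :: 'a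
  proof -
    have "pderivs vs (cut \<Psi> j) x = (1 / 2 ^ j) ^ length vs *\<^sub>R pderivs vs (cut \<Psi> 0) ((1 / 2 ^ j) *\<^sub>R x)"
      using pderivs_scale[OF smooth_cut[OF \<Psi>] vs(1), of 0 "1 / 2 ^ j"] by (simp add: cut_scale[symmetric])
    also have "norm \<dots> \<le> 1 * norm (pderivs vs (cut \<Psi> 0) ((1 / 2 ^ j) *\<^sub>R x))"
      unfolding norm_scaleR by (intro mult_right_mono) (auto simp: power_le_one)
    also have "\<dots> \<le> M" using sbD[OF M vs] by simp
    finally show ?thesis .
  qed
  then show ?thesis using sb_nonneg[OF M] by blast
qed

text \<open>The factor \<open>1 - cut \<Psi> j x\<close> vanishes for norm x < 11/10 * 2^j, so
  wherever the product lives one spare power of 1 + norm x is at least 2^j. Giving up that power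
  yields the geometric rate.\<close>

lemma sb_cut_tail:
  assumes \<Psi>: "cutoff \<Psi>"
  shows "\<exists>C\<ge>0. \<forall>\<theta> B j. (\<theta> :: 'a::euclidean_space \<Rightarrow> complex) \<in> schwartz_functions \<longrightarrow> sb (Suc m) N B \<theta> \<longrightarrow>
           sb m N (C * B / 2 ^ j) (\<lambda>x. (1 - cut \<Psi> j x) * \<theta> x)"
proof -
  obtain M where M: "M \<ge> 0" "\<And>j vs x. set vs \<subseteq> Basis \<Longrightarrow> length vs \<le> N \<Longrightarrow> norm (pderivs vs (cut \<Psi> j) (x::'a)) \<le> M"
    using cut_bounded[OF \<Psi>] by blast
  have "sb m N ((2 ^ N * (M + 1)) * B / 2 ^ j) (\<lambda>x. (1 - cut \<Psi> j x) * \<theta> x)"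
    if \<theta>: "\<theta> \<in> schwartz_functions" and B: "sb (Suc m) N B \<theta>" for \<theta> :: "'a \<Rightarrow> complex" and B j
    unfolding sb_def
  proof (intro allI impI)
    fix vs :: "'a list" and x assume vs: "set vs \<subseteq> Basis" "length vs \<le> N"
    have B0: "B \<ge> 0" using sb_nonneg[OF B] .
    have sm: "smooth (\<lambda>x. 1 + (-1) * cut \<Psi> j x :: complex)" by (intro smooth_add smooth_cmult smooth_const smooth_cut \<Psi>)
    show "(1 + norm x) ^ m * norm (pderivs vs (\<lambda>x. (1 - cut \<Psi> j x) * \<theta> x) x) \<le> (2 ^ N * (M + 1)) * B / 2 ^ j"
    proof (cases "norm x < 11/10 * 2 ^ j")
      case True
      have "pderivs vs (\<lambda>x. (1 - cut \<Psi> j x) * \<theta> x) x = 0"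
        by (rule pderivs_vanish[of "ball 0 (11/10 * 2 ^ j)"]) (use True in \<open>auto simp: cut_1[OF \<Psi>]\<close>)
      then show ?thesis using M B0 by simp
    next
      case False
      moreover have "(2::real) ^ j \<le> 11/10 * 2 ^ j" by simp
      ultimately have x: "2 ^ j \<le> 1 + norm x" by linarith
      have b: "norm (pderivs ws (\<lambda>x. 1 + (-1) * cut \<Psi> j x) x) \<le> M + 1" if ws: "set ws \<subseteq> Basis" "length ws \<le> N" for ws
      proof -
        have "pderivs ws (\<lambda>x. 1 + (-1) * cut \<Psi> j x) x = pderivs ws (\<lambda>x. 1) x + (-1) * pderivs ws (cut \<Psi> j) x"
          using ws by (simp only: pderivs_add smooth_const smooth_cmult smooth_cut[OF \<Psi>] pderivs_cmult)
        also have "norm \<dots> \<le> norm (pderivs ws (\<lambda>x. 1 :: complex) x) + norm ((-1) * pderivs ws (cut \<Psi> j) x)"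
          by (rule norm_triangle_ineq)
        also have "\<dots> \<le> 1 + M" using M(2)[OF ws, of j x]
          by (intro add_mono) (simp_all only: norm_mult norm_minus_cancel norm_one mult_1_left, simp add: pderivs_const)
        finally show ?thesis by simp
      qed
      have "norm (pderivs vs (\<lambda>x. (1 + (-1) * cut \<Psi> j x) * \<theta> x) x) \<le> 2 ^ length vs * ((M + 1) * (B / (1 + norm x) ^ Suc m))"
      proof (rule pderivs_mult_bound[OF sm schwartz_smooth[OF \<theta>] vs b])
        fix ws :: "'a list" assume "set ws \<subseteq> Basis" "length ws \<le> N"
        from sbD[OF B this, of x] show "norm (pderivs ws \<theta> x) \<le> B / (1 + norm x) ^ Suc m"
          by (simp add: field_simps add_pos_nonneg)
      qed auto
      also have "\<dots> \<le> 2 ^ N * ((M + 1) * (B / (1 + norm x) ^ Suc m))"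
        using vs M B0 by (intro mult_right_mono power_increasing) auto
      finally have "(1 + norm x) ^ m * norm (pderivs vs (\<lambda>x. (1 + (-1) * cut \<Psi> j x) * \<theta> x) x)
         \<le> (1 + norm x) ^ m * (2 ^ N * ((M + 1) * (B / (1 + norm x) ^ Suc m)))"
        by (rule mult_left_mono) simp
      also have "\<dots> = (2 ^ N * (M + 1)) * B / (1 + norm x)"
      proof -
        have "1 + norm x \<noteq> 0" using norm_ge_zero[of x] by linarith
        moreover have "d ^ m * (2 ^ N * ((M + 1) * (B / d ^ Suc m))) = (2 ^ N * (M + 1)) * B / d" if "d \<noteq> 0" for d :: real
          using that by simp
        ultimately show ?thesis by blast
      qed
      also have "\<dots> \<le> (2 ^ N * (M + 1)) * B / 2 ^ j"
        using x M B0 by (intro divide_left_mono) (auto intro!: mult_pos_pos add_pos_nonneg)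
      finally show ?thesis by simp
    qed
  qed
  then show ?thesis using M by (intro exI[of _ "2 ^ N * (M + 1)"]) auto
qed

section \<open>Tempered distributions and dyadic pieces\<close>

lemma temperedI:
  fixes w :: "('a::euclidean_space \<Rightarrow> complex) \<Rightarrow> complex"
  assumes "linear_functional_on schwartz_functions w" "C \<ge> 0"
    and "\<And>\<phi> B. \<phi> \<in> schwartz_functions \<Longrightarrow> sb k N B \<phi> \<Longrightarrow> norm (w \<phi>) \<le> C * B"
  shows "w \<in> tempered_distributions"
proof -
  have "norm (w \<phi>) \<le> C * schwartz_seminorm k N \<phi>" if "\<phi> \<in> schwartz_functions" for \<phi>
    using seminorm_upper[OF that] by (intro assms that) (simp add: sb_def)
  then show ?thesis using assms(1) unfolding tempered_distributions_def by blast
qed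

lemma tempered_add:
  "u \<in> tempered_distributions \<Longrightarrow> \<phi> \<in> schwartz_functions \<Longrightarrow> \<psi> \<in> schwartz_functions \<Longrightarrow> u (\<lambda>x. \<phi> x + \<psi> x) = u \<phi> + u \<psi>"
  by (simp add: tempered_distributions_def linear_functional_on_def)

lemma tempered_cmult:
  "u \<in> tempered_distributions \<Longrightarrow> \<phi> \<in> schwartz_functions \<Longrightarrow> u (\<lambda>x. c * \<phi> x) = c * u \<phi>"
  by (simp add: tempered_distributions_def linear_functional_on_def)

lemma FT_add: "integrable lborel f \<Longrightarrow> integrable lborel g \<Longrightarrow> FT \<sigma> (\<lambda>x. f x + g x) = (\<lambda>\<xi>. FT \<sigma> f \<xi> + FT \<sigma> g \<xi>)"
  by (rule ext) (simp add: FT_def distrib_left Bochner_Integration.integral_add[OF integrable_exp_mult integrable_exp_mult, simplified])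

lemma FT_cmult: "FT \<sigma> (\<lambda>x. c * f x) = (\<lambda>\<xi>. c * FT \<sigma> f \<xi>)"
  unfolding FT_def by (rule ext, subst integral_mult_right_zero[symmetric]) (simp only: mult_ac)

text \<open>The common pattern behind \<open>fourier_dist\<close>, \<open>inv_fourier_dist\<close>
  and \<open>mult_dist\<close>: a linear map of Schwartz functions that is continuous in the sense
  of \<open>sb\<close> transposes to tempered distributions.\<close>

lemma tempered_comp:
  fixes T :: "('a::euclidean_space \<Rightarrow> complex) \<Rightarrow> 'a \<Rightarrow> complex" and u :: "('a::euclidean_space \<Rightarrow> complex) \<Rightarrow> complex"
  assumes u: "u \<in> tempered_distributions"
    and S: "\<And>\<phi>. \<phi> \<in> schwartz_functions \<Longrightarrow> T \<phi> \<in> schwartz_functions"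
    and add: "\<And>\<phi> \<psi>. \<phi> \<in> schwartz_functions \<Longrightarrow> \<psi> \<in> schwartz_functions \<Longrightarrow> T (\<lambda>x. \<phi> x + \<psi> x) = (\<lambda>x. T \<phi> x + T \<psi> x)"
    and cm: "\<And>\<phi> c. \<phi> \<in> schwartz_functions \<Longrightarrow> T (\<lambda>x. c * \<phi> x) = (\<lambda>x. c * T \<phi> x)"
    and b: "\<And>k N. \<exists>C m M. C \<ge> 0 \<and> (\<forall>g B. g \<in> schwartz_functions \<longrightarrow> sb m M B g \<longrightarrow> sb k N (C * B) (T g))"
  shows "(\<lambda>\<phi>. if \<phi> \<in> schwartz_functions then u (T \<phi>) else 0) \<in> tempered_distributions"
proof -
  obtain C k N where C: "C \<ge> 0" "\<And>\<phi> B. \<phi> \<in> schwartz_functions \<Longrightarrow> sb k N B \<phi> \<Longrightarrow> norm (u \<phi>) \<le> C * B"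
    using tempered_bound[OF u] by metis
  obtain D m M where D: "D \<ge> 0" "\<And>g B. g \<in> schwartz_functions \<Longrightarrow> sb m M B g \<Longrightarrow> sb k N (D * B) (T g)"
    using b[of k N] by metis
  show ?thesis
  proof (rule temperedI[of _ "C * D" m M])
    show "linear_functional_on schwartz_functions (\<lambda>\<phi>. if \<phi> \<in> schwartz_functions then u (T \<phi>) else 0)"
      unfolding linear_functional_on_def
      by (auto simp: schwartz_add schwartz_cmult add cm S tempered_add[OF u] tempered_cmult[OF u])
    fix \<phi> :: "'a \<Rightarrow> complex" and B assume "\<phi> \<in> schwartz_functions" "sb m M B \<phi>"
    then show "norm (if \<phi> \<in> schwartz_functions then u (T \<phi>) else 0) \<le> C * D * B"
      using C(2)[OF S D(2)] by (simp add: mult.assoc)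
  qed (use C D in auto)
qed

lemma fourier_sb:
  "\<exists>C m M. C \<ge> 0 \<and> (\<forall>g :: 'a::euclidean_space \<Rightarrow> complex. \<forall>B. g \<in> schwartz_functions \<longrightarrow> sb m M B g \<longrightarrow> sb k N (C * B) (fourier g))"
  unfolding fourier_FT by (rule FT_sb) simp

lemma fourier_dist_tempered:
  "u \<in> tempered_distributions \<Longrightarrow> fourier_dist u \<in> tempered_distributions"
  unfolding fourier_dist_def
  by (rule tempered_comp[where T = fourier, OF _ _ _ _ fourier_sb])
     (auto simp: fourier_FT FT_schwartz FT_add FT_cmult schwartz_integrable)

lemma inv_fourier_add:
  "\<phi> \<in> schwartz_functions \<Longrightarrow> \<psi> \<in> schwartz_functions \<Longrightarrow> inv_fourier (\<lambda>x. \<phi> x + \<psi> x) = (\<lambda>x. inv_fourier \<phi> x + inv_fourier \<psi> x)"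
  by (simp add: inv_fourier_FT FT_add schwartz_integrable distrib_left)

lemma inv_fourier_cmult: "inv_fourier (\<lambda>x. c * \<phi> x) = (\<lambda>x. c * inv_fourier \<phi> x)"
  by (simp add: inv_fourier_FT FT_cmult mult.left_commute)

lemma inv_fourier_sb:
  "\<exists>C m M. C \<ge> 0 \<and> (\<forall>g :: 'a::euclidean_space \<Rightarrow> complex. \<forall>B. g \<in> schwartz_functions \<longrightarrow> sb m M B g \<longrightarrow> sb k N (C * B) (inv_fourier g))"
proof -
  obtain C m M where C: "C \<ge> 0" and *: "\<And>(g :: 'a \<Rightarrow> complex) B. g \<in> schwartz_functions \<Longrightarrow> sb m M B g \<Longrightarrow> sb k N (C * B) (FT 1 g)"
    using FT_sb[of 1 k N, where 'a='a] by (metis abs_one)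
  let ?c = "complex_of_real (1 / (2 * pi) ^ DIM('a))"
  have "sb k N ((norm ?c * C) * B) (inv_fourier g)" if "g \<in> schwartz_functions" "sb m M B g" for g :: "'a \<Rightarrow> complex" and B
    unfolding inv_fourier_FT mult.assoc by (intro sb_cmult * that schwartz_smooth FT_schwartz) auto
  then show ?thesis using C by (intro exI[of _ "norm ?c * C"] exI[of _ m] exI[of _ M]) auto
qed

lemma inv_fourier_dist_tempered:
  "u \<in> tempered_distributions \<Longrightarrow> inv_fourier_dist u \<in> tempered_distributions"
  unfolding inv_fourier_dist_def
  by (rule tempered_comp[where T = inv_fourier, OF _ _ _ _ inv_fourier_sb])
     (auto simp: inv_fourier_schwartz inv_fourier_add inv_fourier_cmult)

section \<open>The dyadic partition and the dyadic series\<close>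

definition part :: "(real \<Rightarrow> real) \<Rightarrow> nat \<Rightarrow> 'a::euclidean_space \<Rightarrow> complex" where
  "part \<Psi> k x = of_real (dyadic_partition \<Psi> k x)"

lemma part_0: "part \<Psi> 0 = cut \<Psi> 0" by (rule ext) (simp add: part_def cut_def)
lemma part_Suc: "part \<Psi> (Suc k) = (\<lambda>x. cut \<Psi> (Suc k) x + (-1) * cut \<Psi> k x)" by (rule ext) (simp add: part_def cut_def)

lemma smooth_part: assumes "cutoff \<Psi>" shows "smooth (part \<Psi> k)"
proof (cases k)
  case 0 then show ?thesis using assms by (simp add: part_0 smooth_cut)
next
  case (Suc n) then show ?thesis unfolding Suc part_Suc by (intro smooth_add smooth_cmult smooth_cut assms)
qed

text \<open>\<open>part \<Psi> k\<close> vanishes beyond 1.3 * 2^k, while the next cut-off is 1 up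
  to 2.2 * 2^k. This reproducing identity is the reason for the index \<open>Suc k\<close> in every
  kernel attached to piece \<open>k\<close>.\<close>

lemma part_cut: assumes "cutoff \<Psi>" shows "part \<Psi> k x * cut \<Psi> (Suc k) x = part \<Psi> k x"
proof (cases "norm x < 11/10 * 2 ^ Suc k")
  case True then show ?thesis by (simp add: cut_1[OF assms])
next
  case False
  then have "11/10 * (2 * 2 ^ k) \<le> norm x" by (simp only: not_less power_Suc)
  \<comment> \<open>The truncated \<open>k - 1\<close> lets both cut-offs occurring in
    \<open>part \<Psi> k\<close> be handled together; for \<open>k = 0\<close> it merely repeats the
    index 0.\<close>
  moreover have "(2::real) ^ (k - 1) \<le> 2 ^ k" by (rule power_increasing) auto
  moreover have "(0::real) < 2 ^ k" by simp
  ultimately have "norm x > 13/10 * 2 ^ k" "norm x > 13/10 * 2 ^ (k - 1)" by linarith+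
  then have "cut \<Psi> k x = 0" "cut \<Psi> (k - 1) x = 0" using cut_0[OF assms] by auto
  then have "part \<Psi> k x = 0" by (cases k) (simp_all add: part_0 part_Suc)
  then show ?thesis by simp
qed

lemma part_schwartz: assumes "cutoff \<Psi>" shows "part \<Psi> k \<in> schwartz_functions"
proof (cases k)
  case 0 then show ?thesis using assms by (simp add: part_0 test_schwartz cut_test)
next
  case (Suc n) then show ?thesis unfolding Suc part_Suc by (intro schwartz_add schwartz_cmult test_schwartz cut_test assms)
qed

lemma sb_part_mult:
  assumes "cutoff \<Psi>"
  shows "\<exists>C m M. C \<ge> 0 \<and> (\<forall>g :: 'a::euclidean_space \<Rightarrow> complex. \<forall>B. g \<in> schwartz_functions \<longrightarrow> sb m M B g \<longrightarrow> sb k N (C * B) (\<lambda>x. part \<Psi> j x * g x))"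
proof -
  obtain M where M: "sb 0 N M (part \<Psi> j :: 'a \<Rightarrow> complex)"
    using schwartz_sb[OF part_schwartz[OF assms]] by blast
  have "sb k N ((2 ^ N * M) * B) (\<lambda>x. part \<Psi> j x * g x)" if "g \<in> schwartz_functions" "sb k N B g" for g :: "'a \<Rightarrow> complex" and B
    by (rule sb_mult[of g k 0]) (use that sbD[OF M] sb_nonneg[OF M] smooth_part[OF assms] schwartz_smooth in auto)
  then show ?thesis using sb_nonneg[OF M] by (intro exI[of _ "2 ^ N * M"] exI[of _ k] exI[of _ N]) auto
qed

lemma part_mult_schwartz:
  assumes "cutoff \<Psi>" "g \<in> schwartz_functions" shows "(\<lambda>x. part \<Psi> j x * g x) \<in> schwartz_functions"
  unfolding schwartz_iff
proof safe
  show "smooth (\<lambda>x. part \<Psi> j x * g x)" by (intro smooth_mult smooth_part schwartz_smooth assms)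
  fix k N show "\<exists>B. sb k N B (\<lambda>x. part \<Psi> j x * g x)"
    using sb_part_mult[OF assms(1), of k N j] schwartz_sb[OF assms(2)] assms(2) by metis
qed

lemma mult_dist_tempered:
  assumes "cutoff \<Psi>" "u \<in> tempered_distributions"
  shows "mult_dist (dyadic_partition \<Psi> k) u \<in> tempered_distributions"
  unfolding mult_dist_def part_def[symmetric]
  by (rule tempered_comp[OF assms(2), where T = "\<lambda>\<phi> x. part \<Psi> k x * \<phi> x", OF _ _ _ sb_part_mult[OF assms(1)]])
     (auto simp: part_mult_schwartz assms(1) distrib_left mult.left_commute)

lemma dyadic_piece_tempered:
  "cutoff \<Psi> \<Longrightarrow> u \<in> tempered_distributions \<Longrightarrow> dyadic_piece \<Psi> k u \<in> tempered_distributions"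
  unfolding dyadic_piece_def by (intro inv_fourier_dist_tempered mult_dist_tempered fourier_dist_tempered)

lemma dyadic_piece_eq:
  assumes "cutoff \<Psi>" "\<phi> \<in> schwartz_functions"
  shows "dyadic_piece \<Psi> k u \<phi> = u (fourier (\<lambda>\<xi>. part \<Psi> k \<xi> * inv_fourier \<phi> \<xi>))"
  using assms part_mult_schwartz[OF assms(1) inv_fourier_schwartz[OF assms(2)], of k]
  by (simp add: dyadic_piece_def inv_fourier_dist_def mult_dist_def fourier_dist_def inv_fourier_schwartz part_def)

text \<open>By \<open>sb_cut_tail\<close> the error is O(2^(-j)) in the bounds that control
  \<open>w\<close>. This is the passage from test functions to Schwartz functions.\<close>

lemma tempered_cut:
  assumes \<Psi>: "cutoff \<Psi>" and w: "w \<in> tempered_distributions" and \<theta>: "\<theta> \<in> schwartz_functions"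
  shows "(\<lambda>j. w (\<lambda>x. cut \<Psi> j x * \<theta> x)) \<longlonglongrightarrow> w \<theta>"
proof -
  obtain C k N where C: "C \<ge> 0" "\<And>\<phi> B. \<phi> \<in> schwartz_functions \<Longrightarrow> sb k N B \<phi> \<Longrightarrow> norm (w \<phi>) \<le> C * B"
    using tempered_bound[OF w] by metis
  obtain D where D: "D \<ge> 0" "\<And>B j. sb (Suc k) N B \<theta> \<Longrightarrow> sb k N (D * B / 2 ^ j) (\<lambda>x. (1 - cut \<Psi> j x) * \<theta> x)"
    using sb_cut_tail[OF \<Psi>, where 'a='a] \<theta> by metis
  obtain B where B: "sb (Suc k) N B \<theta>" using schwartz_sb[OF \<theta>] by blast
  have bound: "norm (w (\<lambda>x. cut \<Psi> j x * \<theta> x) - w \<theta>) \<le> C * (D * B) * (1 / 2) ^ j" for j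
  proof -
    have c: "(\<lambda>x. cut \<Psi> j x * \<theta> x) \<in> schwartz_functions"
      by (rule test_schwartz[OF cut_mult_test[OF \<Psi> schwartz_smooth[OF \<theta>]]])
    have d: "(\<lambda>x. \<theta> x + (-1) * (cut \<Psi> j x * \<theta> x)) \<in> schwartz_functions"
      by (intro schwartz_add schwartz_cmult \<theta> c)
    have e: "w (\<lambda>x. \<theta> x + (-1) * (cut \<Psi> j x * \<theta> x)) = w \<theta> + (-1) * w (\<lambda>x. cut \<Psi> j x * \<theta> x)"
      by (simp only: tempered_add[OF w \<theta> schwartz_cmult[OF c]] tempered_cmult[OF w c])
    have f: "(\<lambda>x. (1 - cut \<Psi> j x) * \<theta> x) = (\<lambda>x. \<theta> x + (-1) * (cut \<Psi> j x * \<theta> x))"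
      by (rule ext) (simp add: left_diff_distrib)
    have "norm (w \<theta> + (-1) * w (\<lambda>x. cut \<Psi> j x * \<theta> x)) \<le> C * (D * B / 2 ^ j)"
      using C(2)[OF d D(2)[OF B, of j, unfolded f]] unfolding e .
    moreover have "norm (w \<theta> + (-1) * w (\<lambda>x. cut \<Psi> j x * \<theta> x)) = norm (w (\<lambda>x. cut \<Psi> j x * \<theta> x) - w \<theta>)"
      by (subst norm_minus_commute) simp
    ultimately show ?thesis by (simp add: power_one_over field_simps)
  qed
  have lim: "(\<lambda>j. C * (D * B) * (1 / 2) ^ j) \<longlonglongrightarrow> 0"
    using tendsto_mult[OF tendsto_const[of "C * (D * B)"] LIMSEQ_realpow_zero[of "1/2::real"]] by simp
  have "(\<lambda>j. w (\<lambda>x. cut \<Psi> j x * \<theta> x) - w \<theta>) \<longlonglongrightarrow> 0"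
    by (rule Lim_null_comparison[OF _ lim]) (rule always_eventually, rule allI, rule bound)
  then show ?thesis by (simp add: LIM_zero_iff)
qed

text \<open>On the Fourier side the partial sums telescope to multiplication by the cut-off of the
  last index, and \<open>tempered_cut\<close> applied to \<open>fourier_dist u\<close> gives the
  limit.\<close>

lemma dyadic_sums:
  assumes \<Psi>: "cutoff \<Psi>" and u: "u \<in> tempered_distributions" and \<phi>: "\<phi> \<in> schwartz_functions"
  shows "(\<lambda>k. dyadic_piece \<Psi> k u \<phi>) sums u \<phi>"
proof -
  have F: "fourier_dist u \<in> tempered_distributions" by (rule fourier_dist_tempered[OF u])
  have \<psi>: "inv_fourier \<phi> \<in> schwartz_functions" by (rule inv_fourier_schwartz[OF \<phi>])
  have pm: "(\<lambda>\<xi>. part \<Psi> k \<xi> * inv_fourier \<phi> \<xi>) \<in> schwartz_functions" for k by (rule part_mult_schwartz[OF \<Psi> \<psi>])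
  have cm: "(\<lambda>\<xi>. cut \<Psi> k \<xi> * inv_fourier \<phi> \<xi>) \<in> schwartz_functions" for k
    by (rule test_schwartz[OF cut_mult_test[OF \<Psi> schwartz_smooth[OF \<psi>]]])
  have piece: "dyadic_piece \<Psi> k u \<phi> = fourier_dist u (\<lambda>\<xi>. part \<Psi> k \<xi> * inv_fourier \<phi> \<xi>)" for k
    using dyadic_piece_eq[OF \<Psi> \<phi>] pm by (simp add: fourier_dist_def)
  have "(\<Sum>k\<le>K. dyadic_piece \<Psi> k u \<phi>) = fourier_dist u (\<lambda>\<xi>. cut \<Psi> K \<xi> * inv_fourier \<phi> \<xi>)" for K
  proof (induction K)
    case 0 then show ?case by (simp add: piece part_0)
  next
    case (Suc K)
    have "(\<lambda>\<xi>. cut \<Psi> (Suc K) \<xi> * inv_fourier \<phi> \<xi>) = (\<lambda>\<xi>. cut \<Psi> K \<xi> * inv_fourier \<phi> \<xi> + part \<Psi> (Suc K) \<xi> * inv_fourier \<phi> \<xi>)"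
      by (rule ext) (simp add: part_Suc algebra_simps)
    then show ?case using Suc tempered_add[OF F cm pm] by (simp add: piece)
  qed
  moreover have "(\<lambda>K. fourier_dist u (\<lambda>\<xi>. cut \<Psi> K \<xi> * inv_fourier \<phi> \<xi>)) \<longlonglongrightarrow> fourier_dist u (inv_fourier \<phi>)"
    by (rule tempered_cut[OF \<Psi> F \<psi>])
  moreover have "fourier_dist u (inv_fourier \<phi>) = u \<phi>"
    using \<psi> fourier_inv_fourier[OF \<phi>] by (simp add: fourier_dist_def)
  ultimately show ?thesis by (simp add: sums_def_le)
qed

text \<open>The inverse Fourier transform of \<open>cut \<Psi> j\<close>; the cut-off is radial, so
  either sign gives the same function, and -1 is the one that comes out of
  \<open>fourier_cut_inv_fourier\<close> directly.\<close>

definition bump_kernel :: "(real \<Rightarrow> real) \<Rightarrow> nat \<Rightarrow> 'a::euclidean_space \<Rightarrow> complex" where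
  "bump_kernel \<Psi> j z = of_real (1 / (2 * pi) ^ DIM('a)) * FT (-1) (cut \<Psi> j) z"

lemma cut_integrable: "cutoff \<Psi> \<Longrightarrow> integrable lborel (cut \<Psi> j)"
  by (intro schwartz_integrable test_schwartz cut_test)

lemma cut_measurable: "cutoff \<Psi> \<Longrightarrow> cut \<Psi> j \<in> borel_measurable borel"
  by (intro schwartz_measurable test_schwartz cut_test)

lemma bump_kernel_schwartz: "cutoff \<Psi> \<Longrightarrow> bump_kernel \<Psi> j \<in> schwartz_functions"
  unfolding bump_kernel_def[abs_def] by (intro schwartz_cmult FT_schwartz test_schwartz cut_test) auto

text \<open>All cut-offs are dilates of that of index 0, hence all kernels are dilates, with fixed
  integral, of a single Schwartz function.\<close>

lemma bump_kernel_scale: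
  assumes "cutoff \<Psi>"
  shows "bump_kernel \<Psi> j (z::'a::euclidean_space) = of_real ((2 ^ j) ^ DIM('a)) * bump_kernel \<Psi> 0 ((2 ^ j) *\<^sub>R z)"
proof -
  have [measurable]: "cut \<Psi> j \<in> borel_measurable (borel::'a measure)" by (rule cut_measurable[OF assms])
  have "FT (-1) (cut \<Psi> j) z = \<bar>2 ^ j\<bar> ^ DIM('a) *\<^sub>R (\<integral>x. exp (\<i> * of_real (-1 * ((0 + 2 ^ j *\<^sub>R x) \<bullet> z))) * cut \<Psi> j (0 + 2 ^ j *\<^sub>R x) \<partial>lborel)"
    unfolding FT_def by (rule integral_affine) auto
  also have "(\<lambda>x. cut \<Psi> j (0 + 2 ^ j *\<^sub>R (x::'a))) = cut \<Psi> 0"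
    by (rule ext, subst cut_scale) simp
  finally have "FT (-1) (cut \<Psi> j) z = of_real ((2 ^ j) ^ DIM('a)) * FT (-1) (cut \<Psi> 0) ((2 ^ j) *\<^sub>R z)"
    by (simp add: FT_def scaleR_conv_of_real cut_scale[of \<Psi> j, symmetric])
  then show ?thesis by (simp add: bump_kernel_def)
qed

text \<open>The outer exponential times the cut-off is an integrable function \<open>h\<close>. The
  multiplication formula moves the inner transform from \<phi> to \<open>h\<close>, and the
  transform of \<open>h\<close> is a reflected translate of the kernel.\<close>

lemma fourier_cut_inv_fourier:
  fixes \<phi> :: "'a::euclidean_space \<Rightarrow> complex"
  assumes \<Psi>: "cutoff \<Psi>" and \<phi>: "\<phi> \<in> schwartz_functions"
  shows "fourier (\<lambda>\<xi>. cut \<Psi> j \<xi> * inv_fourier \<phi> \<xi>) x = (\<integral>y. \<phi> y * bump_kernel \<Psi> j (x - y) \<partial>lborel)"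
proof -
  let ?c = "complex_of_real (1 / (2 * pi) ^ DIM('a))"
  define h where "h \<xi> = exp (\<i> * complex_of_real (-1 * (\<xi> \<bullet> x))) * cut \<Psi> j \<xi>" for \<xi>
  have ih: "integrable lborel h" unfolding h_def by (intro integrable_exp_mult cut_integrable \<Psi>)
  have "fourier (\<lambda>\<xi>. cut \<Psi> j \<xi> * inv_fourier \<phi> \<xi>) x = ?c * (\<integral>\<xi>. FT 1 \<phi> \<xi> * h \<xi> \<partial>lborel)"
    unfolding fourier_FT inv_fourier_FT FT_def[of "-1"] h_def
    by (subst integral_mult_right_zero[symmetric]) (simp only: mult_ac)
  also have "(\<integral>\<xi>. FT 1 \<phi> \<xi> * h \<xi> \<partial>lborel) = (\<integral>y. \<phi> y * FT 1 h y \<partial>lborel)"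
    by (rule FT_multiplication[OF schwartz_integrable[OF \<phi>] ih])
  also have "FT 1 h = (\<lambda>y. FT (-1) (cut \<Psi> j) (x - y))"
    unfolding FT_def h_def mult.assoc[symmetric] exp_add[symmetric]
    by (simp add: inner_diff_right algebra_simps)
  finally show ?thesis
    unfolding bump_kernel_def by (subst (asm) integral_mult_right_zero[symmetric]) (simp only: mult_ac)
qed

text \<open>The transposed form of \<open>part_cut\<close>: inserting the wider cut-off beside
  \<open>part \<Psi> k\<close> changes nothing.\<close>

lemma dyadic_piece_reproduce:
  assumes \<Psi>: "cutoff \<Psi>" and \<phi>: "\<phi> \<in> schwartz_functions"
  shows "dyadic_piece \<Psi> k u \<phi> = dyadic_piece \<Psi> k u (fourier (\<lambda>\<xi>. cut \<Psi> (Suc k) \<xi> * inv_fourier \<phi> \<xi>))"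
proof -
  have \<psi>: "inv_fourier \<phi> \<in> schwartz_functions" by (rule inv_fourier_schwartz[OF \<phi>])
  have cm: "(\<lambda>\<xi>. cut \<Psi> (Suc k) \<xi> * inv_fourier \<phi> \<xi>) \<in> schwartz_functions"
    by (rule test_schwartz[OF cut_mult_test[OF \<Psi> schwartz_smooth[OF \<psi>]]])
  have "(\<lambda>\<xi>. part \<Psi> k \<xi> * (cut \<Psi> (Suc k) \<xi> * inv_fourier \<phi> \<xi>)) = (\<lambda>\<xi>. part \<Psi> k \<xi> * inv_fourier \<phi> \<xi>)"
    by (rule ext) (simp add: mult.assoc[symmetric] part_cut[OF \<Psi>])
  then show ?thesis
    by (simp add: dyadic_piece_eq[OF \<Psi> \<phi>] dyadic_piece_eq[OF \<Psi> fourier_schwartz[OF cm]] inv_fourier_fourier[OF cm])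
qed

lemma Lp_times_schwartz:
  fixes g \<theta> :: "'a::euclidean_space \<Rightarrow> complex"
  assumes p: "1 \<le> p" and g[measurable]: "g \<in> borel_measurable lborel" and a: "Lp_norm p g < \<infinity>" and \<theta>: "\<theta> \<in> schwartz_functions"
  shows "integrable lborel (\<lambda>x. g x * \<theta> x)"
proof (rule integrableI_bounded)
  have [measurable]: "\<theta> \<in> borel_measurable borel" by (rule schwartz_measurable[OF \<theta>])
  show "(\<lambda>x. g x * \<theta> x) \<in> borel_measurable lborel" by measurable
  obtain B where "sb 0 0 B \<theta>" using schwartz_sb[OF \<theta>] by blast
  then have B: "norm (\<theta> x) \<le> B" for x using sbD[of 0 0 B \<theta> "[]" x] by simp
  obtain r where r: "Lp_norm p g = ennreal r" "r \<ge> 0" using a by (cases "Lp_norm p g") auto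
  have I: "(\<integral>\<^sup>+x. ennreal (norm (\<theta> x)) \<partial>lborel) = ennreal (\<integral>x. norm (\<theta> x) \<partial>lborel)"
    by (intro nn_integral_eq_integral integrable_norm schwartz_integrable \<theta>) auto
  have "(\<integral>\<^sup>+x. ennreal (norm (g x) * norm (\<theta> x)) \<partial>lborel) \<le> ennreal ((r + 1) * (B + (\<integral>x. norm (\<theta> x) \<partial>lborel)))"
    by (rule Lp_norm_weighted_L1[OF p g]) (use r B I in auto)
  also have "\<dots> < \<infinity>" by simp
  finally show "(\<integral>\<^sup>+x. ennreal (norm (g x * \<theta> x)) \<partial>lborel) < \<infinity>" by (simp add: norm_mult)
qed

text \<open>The representation by \<open>g\<close> is given on test functions, whereas the
  reproducing formula pairs a piece with a function that is only Schwartz. The cut-offs are inserted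
  and released: the left side converges by continuity of \<open>w\<close>, the right one by
  domination.\<close>

lemma tempered_Lp_schwartz:
  fixes g \<theta> :: "'a::euclidean_space \<Rightarrow> complex"
  assumes \<Psi>: "cutoff \<Psi>" and p: "1 \<le> p" and w: "w \<in> tempered_distributions"
    and g[measurable]: "g \<in> borel_measurable lborel" and a: "Lp_norm p g < \<infinity>"
    and eq: "\<And>\<phi>. \<phi> \<in> test_functions \<Longrightarrow> w \<phi> = (\<integral>x. g x * \<phi> x \<partial>lborel)"
    and \<theta>: "\<theta> \<in> schwartz_functions"
  shows "w \<theta> = (\<integral>x. g x * \<theta> x \<partial>lborel)"
proof -
  have [measurable]: "\<theta> \<in> borel_measurable borel" by (rule schwartz_measurable[OF \<theta>])
  have cm[measurable]: "cut \<Psi> j \<in> borel_measurable (borel :: 'a measure)" for j by (rule cut_measurable[OF \<Psi>])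
  obtain M where M: "\<And>j (x::'a). norm (cut \<Psi> j x) \<le> M"
    using cut_bounded[OF \<Psi>, of 0, where 'a='a] by (metis empty_subsetI list.set(1) list.size(3) order_refl pderivs.simps(1))
  have i: "integrable lborel (\<lambda>x. g x * \<theta> x)" by (rule Lp_times_schwartz[OF p g a \<theta>])
  have "(\<lambda>j. \<integral>x. g x * (cut \<Psi> j x * \<theta> x) \<partial>lborel) \<longlonglongrightarrow> (\<integral>x. g x * \<theta> x \<partial>lborel)"
  proof (rule integral_dominated_convergence[where w = "\<lambda>x. M * norm (g x * \<theta> x)"])
    show "integrable lborel (\<lambda>x. M * norm (g x * \<theta> x))" by (intro integrable_mult_right integrable_norm i)
    show "AE x in lborel. norm (g x * (cut \<Psi> j x * \<theta> x)) \<le> M * norm (g x * \<theta> x)" for j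
    proof (rule AE_I2)
      fix x
      have "norm (cut \<Psi> j x) * norm (g x * \<theta> x) \<le> M * norm (g x * \<theta> x)" by (intro mult_right_mono M) simp
      then show "norm (g x * (cut \<Psi> j x * \<theta> x)) \<le> M * norm (g x * \<theta> x)" by (simp add: norm_mult mult_ac)
    qed
    show "AE x in lborel. (\<lambda>j. g x * (cut \<Psi> j x * \<theta> x)) \<longlonglongrightarrow> g x * \<theta> x"
    proof (rule AE_I2)
      fix x :: 'a
      obtain n where n: "norm x < 2 ^ n" using real_arch_pow[of 2 "norm x"] by auto
      have "cut \<Psi> j x = 1" if "j \<ge> n" for j
      proof (rule cut_1[OF \<Psi>])
        have "(2::real) ^ n \<le> 2 ^ j" using that by simp
        then show "norm x < 11/10 * 2 ^ j" using n zero_less_power[of "2::real" j] by linarith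
      qed
      then have "eventually (\<lambda>j. g x * (cut \<Psi> j x * \<theta> x) = g x * \<theta> x) sequentially"
        by (auto simp: eventually_sequentially)
      then show "(\<lambda>j. g x * (cut \<Psi> j x * \<theta> x)) \<longlonglongrightarrow> g x * \<theta> x" by (rule tendsto_eventually)
    qed
  qed measurable
  moreover have "(\<integral>x. g x * (cut \<Psi> j x * \<theta> x) \<partial>lborel) = w (\<lambda>x. cut \<Psi> j x * \<theta> x)" for j
    by (rule eq[symmetric], rule cut_mult_test[OF \<Psi> schwartz_smooth[OF \<theta>]])
  ultimately have "(\<lambda>j. w (\<lambda>x. cut \<Psi> j x * \<theta> x)) \<longlonglongrightarrow> (\<integral>x. g x * \<theta> x \<partial>lborel)" by simp
  then show ?thesis using tempered_cut[OF \<Psi> w \<theta>] LIMSEQ_unique by blast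
qed

section \<open>Paths of distributions\<close>

lemma test_smooth: "\<phi> \<in> test_functions \<Longrightarrow> smooth \<phi>" by (simp add: test_functions_def)

lemma test_support:
  assumes "\<phi> \<in> test_functions" obtains R where "R > 0" "\<And>x. norm x > R \<Longrightarrow> \<phi> x = 0"
proof -
  have "bounded (supp \<phi>)" using assms by (simp add: test_functions_def compact_imp_bounded)
  then obtain R where R: "R > 0" "\<And>x. x \<in> supp \<phi> \<Longrightarrow> norm x \<le> R" by (auto simp: bounded_pos)
  have "\<phi> x = 0" if "norm x > R" for x
    using R(2)[of x] that closure_subset[of "{x. \<phi> x \<noteq> 0}"] unfolding supp_def by force
  with R(1) show ?thesis using that by blast
qed

lemma test_bounded:
  assumes "\<phi> \<in> test_functions" obtains M where "M \<ge> 0" "\<And>x. norm (\<phi> x) \<le> M"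
proof -
  obtain M where M: "sb 0 0 M \<phi>" using schwartz_sb[OF test_schwartz[OF assms]] by blast
  show ?thesis using that[of M] sb_nonneg[OF M] sbD[OF M, of "[]"] by simp
qed

lemma test_add: "\<phi> \<in> test_functions \<Longrightarrow> \<psi> \<in> test_functions \<Longrightarrow> (\<lambda>x. \<phi> x + \<psi> x) \<in> test_functions"
proof -
  assume a: "\<phi> \<in> test_functions" "\<psi> \<in> test_functions"
  obtain R where R: "\<And>x. norm x > R \<Longrightarrow> \<phi> x = 0" using test_support[OF a(1)] by metis
  obtain R' where R': "\<And>x. norm x > R' \<Longrightarrow> \<psi> x = 0" using test_support[OF a(2)] by metis
  show ?thesis by (rule test_functionsI[of _ "max R R'"]) (use a R R' in \<open>auto intro: smooth_add test_smooth\<close>)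
qed

lemma test_cmult: "\<phi> \<in> test_functions \<Longrightarrow> (\<lambda>x. c * \<phi> x) \<in> test_functions"
proof -
  assume a: "\<phi> \<in> test_functions"
  obtain R where R: "\<And>x. norm x > R \<Longrightarrow> \<phi> x = 0" using test_support[OF a(1)] by metis
  show ?thesis by (rule test_functionsI[of _ R]) (use a R in \<open>auto intro: smooth_cmult test_smooth\<close>)
qed

lemma test_measurable[measurable_dest]: "\<phi> \<in> test_functions \<Longrightarrow> \<phi> \<in> borel_measurable borel"
  by (intro schwartz_measurable test_schwartz)

lemma test_tensor:
  assumes \<phi>: "\<phi> \<in> test_functions" and \<eta>: "\<eta> \<in> test_functions"
  shows "(\<lambda>z :: 'a::euclidean_space \<times> 'b::euclidean_space. \<phi> (fst z) * \<eta> (snd z)) \<in> test_functions"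
proof -
  obtain R where R: "\<And>x. norm x > R \<Longrightarrow> \<phi> x = 0" using test_support[OF \<phi>] by metis
  obtain R' where R': "\<And>x. norm x > R' \<Longrightarrow> \<eta> x = 0" using test_support[OF \<eta>] by metis
  have "smooth (\<lambda>z :: 'a \<times> 'b. \<phi> (fst z + 0))" "smooth (\<lambda>z :: 'a \<times> 'b. \<eta> (snd z + 0))"
    by (intro smooth_affine test_smooth \<phi> \<eta> bounded_linear_fst bounded_linear_snd)+
  then have "smooth (\<lambda>z :: 'a \<times> 'b. \<phi> (fst z) * \<eta> (snd z))" by (intro smooth_mult) auto
  moreover have "\<phi> (fst z) * \<eta> (snd z) = 0" if "norm z > R + R'" for z :: "'a \<times> 'b"
    using that norm_Pair_le[of "fst z" "snd z"] R[of "fst z"] R'[of "snd z"] by fastforce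
  ultimately show ?thesis by (rule test_functionsI)
qed

lemma test_slice:
  assumes \<phi>: "(\<phi> :: 'a::euclidean_space \<times> 'b::euclidean_space \<Rightarrow> complex) \<in> test_functions"
  shows "(\<lambda>x. \<phi> (x, t)) \<in> test_functions"
proof -
  obtain R where R: "\<And>x. norm x > R \<Longrightarrow> \<phi> x = 0" using test_support[OF \<phi>] by metis
  have "smooth (\<lambda>x. \<phi> ((x, 0) + (0, t)))"
    by (intro smooth_affine test_smooth \<phi> bounded_linear_Pair bounded_linear_ident bounded_linear_zero)
  then have "smooth (\<lambda>x. \<phi> (x, t))" by simp
  moreover have "\<phi> (x, t) = 0" if "norm x > R" for x
    using that norm_fst_le[of x t] by (intro R) linarith
  ultimately show ?thesis by (rule test_functionsI)
qed

text \<open>The square of a real function, hence nonnegative whatever sign \<open>\<Psi>\<close>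
  takes between 11/10 and 13/10; this secures a nonzero integral.\<close>

definition bump :: "(real \<Rightarrow> real) \<Rightarrow> real \<Rightarrow> complex" where
  "bump \<Psi> s = cut \<Psi> 0 s * cut \<Psi> 0 s"

lemma bump_test: "cutoff \<Psi> \<Longrightarrow> bump \<Psi> \<in> test_functions"
  unfolding bump_def[abs_def] by (intro cut_mult_test smooth_cut)

lemma bump_integrable: "cutoff \<Psi> \<Longrightarrow> integrable lborel (bump \<Psi>)"
  by (intro schwartz_integrable test_schwartz bump_test)

lemma bump_integral_nonzero:
  assumes \<Psi>: "cutoff \<Psi>" shows "(\<integral>s. bump \<Psi> s \<partial>lborel) \<noteq> 0"
proof
  assume 0: "(\<integral>s. bump \<Psi> s \<partial>lborel) = 0"
  have \<rho>r: "bump \<Psi> s = of_real ((dyadic_cutoff \<Psi> 0 s)\<^sup>2)" for s by (simp add: bump_def cut_def power2_eq_square)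
  have ir: "integrable lborel (\<lambda>s::real. (dyadic_cutoff \<Psi> 0 s)\<^sup>2)"
    using integrable_norm[OF bump_integrable[OF \<Psi>]] by (simp add: \<rho>r norm_power)
  have "of_real (\<integral>s. (dyadic_cutoff \<Psi> 0 s)\<^sup>2 \<partial>(lborel::real measure)) = (\<integral>s. bump \<Psi> s \<partial>lborel)"
    unfolding \<rho>r by (rule integral_complex_of_real[symmetric])
  then have "(\<integral>s. (dyadic_cutoff \<Psi> 0 s)\<^sup>2 \<partial>(lborel::real measure)) = 0" using 0 by simp
  moreover have "(\<integral>s. indicator {-1..1} s \<partial>(lborel::real measure)) \<le> (\<integral>s. (dyadic_cutoff \<Psi> 0 s)\<^sup>2 \<partial>(lborel::real measure))"
  proof (rule integral_mono[OF _ ir])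
    fix s :: real
    show "indicator {-1..1} s \<le> (dyadic_cutoff \<Psi> 0 s)\<^sup>2"
      using \<Psi> by (auto simp: dyadic_cutoff_def cutoff_def indicator_def)
  qed simp
  ultimately show False by simp
qed

text \<open>Bumps shrinking to \<open>t0\<close> are admissible tests, so the corresponding averages
  of \<open>h\<close> vanish; by continuity they tend to \<open>h t0\<close> times the nonzero
  integral of the bump.\<close>

lemma continuous_zero_by_testing:
  assumes \<Psi>: "cutoff \<Psi>" and h: "continuous_on UNIV (h :: real \<Rightarrow> complex)"
    and 0: "\<And>\<eta>. \<eta> \<in> test_functions \<Longrightarrow> (\<integral>t. h t * \<eta> t \<partial>lborel) = 0"
  shows "h t0 = 0"
proof -
  define \<rho> where "\<rho> = bump \<Psi>"
  have \<rho>t: "\<rho> \<in> test_functions" unfolding \<rho>_def by (rule bump_test[OF \<Psi>])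
  have \<rho>i: "integrable lborel \<rho>" by (intro schwartz_integrable test_schwartz \<rho>t)
  have [measurable]: "h \<in> borel_measurable borel" by (rule borel_measurable_continuous_onI[OF h])
  have [measurable]: "\<rho> \<in> borel_measurable borel" by (rule test_measurable[OF \<rho>t])
  obtain R where R: "R > 0" "\<And>s. norm s > R \<Longrightarrow> \<rho> s = 0" using test_support[OF \<rho>t] by metis
  have "compact (h ` cball t0 R)" by (intro compact_continuous_image continuous_on_subset[OF h]) auto
  then have "\<exists>M. \<forall>t\<in>cball t0 R. norm (h t) \<le> M"
    by (auto dest!: compact_imp_bounded simp: bounded_iff simp del: mem_cball)
  then obtain M where "\<forall>t\<in>cball t0 R. norm (h t) \<le> M" ..
  then have M: "\<And>t. t \<in> cball t0 R \<Longrightarrow> norm (h t) \<le> M" by (rule bspec)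
  define c :: "nat \<Rightarrow> real" where "c j = (1 / 2) ^ j" for j
  have c: "c j > 0" "c j \<le> 1" "c j \<noteq> 0" for j by (auto simp: c_def power_le_one)
  have clim: "c \<longlonglongrightarrow> 0" unfolding c_def by (rule LIMSEQ_realpow_zero) auto
  have z: "(\<integral>s. h (t0 + c j * s) * \<rho> s \<partial>lborel) = 0" for j
  proof -
    have "smooth (\<lambda>t. \<rho> ((1 / c j) *\<^sub>R t + (- t0 / c j)))"
      by (intro smooth_affine test_smooth \<rho>t bounded_linear_scaleR_right)
    moreover have "\<rho> ((1 / c j) *\<^sub>R t + (- t0 / c j)) = 0" if "norm t > \<bar>t0\<bar> + c j * R" for t
    proof (rule R(2))
      have "c j * R < \<bar>t - t0\<bar>" using that by (auto simp: abs_if split: if_splits)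
      moreover have "(1 / c j) *\<^sub>R t + (- t0 / c j) = (t - t0) / c j" by (simp add: diff_divide_distrib)
      ultimately show "R < norm ((1 / c j) *\<^sub>R t + (- t0 / c j))" using c[of j] by (simp add: field_simps)
    qed
    ultimately have "(\<lambda>t. \<rho> ((1 / c j) *\<^sub>R t + (- t0 / c j))) \<in> test_functions" by (rule test_functionsI)
    from 0[OF this] have "(\<integral>t. h t * \<rho> ((t - t0) / c j) \<partial>lborel) = 0" by (simp add: diff_divide_distrib)
    then have "\<bar>c j\<bar> *\<^sub>R (\<integral>s. h (t0 + c j * s) * \<rho> ((t0 + c j * s - t0) / c j) \<partial>lborel) = 0"
      by (subst (asm) lborel_integral_real_affine[OF c(3), of _ j t0])
    then show ?thesis using c[of j] by simp
  qed
  have "(\<lambda>j. \<integral>s. h (t0 + c j * s) * \<rho> s \<partial>lborel) \<longlonglongrightarrow> (\<integral>s. h t0 * \<rho> s \<partial>lborel)"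
  proof (rule integral_dominated_convergence[where w = "\<lambda>s. M * norm (\<rho> s)"])
    show "integrable lborel (\<lambda>s. M * norm (\<rho> s))" by (intro integrable_mult_right integrable_norm \<rho>i)
    show "AE s in lborel. norm (h (t0 + c j * s) * \<rho> s) \<le> M * norm (\<rho> s)" for j
    proof (rule AE_I2)
      fix s
      show "norm (h (t0 + c j * s) * \<rho> s) \<le> M * norm (\<rho> s)"
      proof (cases "norm s > R")
        case False
        then have "\<bar>c j * s\<bar> \<le> 1 * R" unfolding abs_mult using c[of j] by (intro mult_mono) auto
        then have "t0 + c j * s \<in> cball t0 R" by (simp add: dist_real_def)
        then show ?thesis unfolding norm_mult by (intro mult_right_mono M) auto
      qed (simp add: R)
    qed
    show "AE s in lborel. (\<lambda>j. h (t0 + c j * s) * \<rho> s) \<longlonglongrightarrow> h t0 * \<rho> s"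
    proof (rule AE_I2)
      fix s
      have "(\<lambda>j. t0 + c j * s) \<longlonglongrightarrow> t0 + 0 * s" by (intro tendsto_intros clim)
      moreover have "isCont h t0" using h by (simp add: continuous_on_eq_continuous_at)
      ultimately have "(\<lambda>j. h (t0 + c j * s)) \<longlonglongrightarrow> h t0" by (intro isCont_tendsto_compose[of t0 h]) auto
      then show "(\<lambda>j. h (t0 + c j * s) * \<rho> s) \<longlonglongrightarrow> h t0 * \<rho> s" by (intro tendsto_mult tendsto_const)
    qed
  qed measurable
  then have "h t0 * (\<integral>s. \<rho> s \<partial>lborel) = 0" unfolding z by (simp add: LIMSEQ_const_iff)
  moreover have "(\<integral>s. \<rho> s \<partial>lborel) \<noteq> 0" unfolding \<rho>_def by (rule bump_integral_nonzero[OF \<Psi>])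
  ultimately show ?thesis by simp
qed

text \<open>On products \<phi>(x) \<eta>(t) linearity pulls out \<eta>(t), so the continuous
  function \<open>f t \<phi> - g t \<phi>\<close> of \<open>t\<close> integrates to 0 against every
  \<eta>. Outside the test functions both paths are 0 by the normalisation of distributions.\<close>

lemma represents_path_unique:
  assumes \<Psi>: "cutoff \<Psi>" and f: "represents_path f u" and g: "represents_path g u"
  shows "f = g"
proof (intro ext)
  fix t0 and \<phi> :: "'a \<Rightarrow> complex"
  have d: "linear_functional_on test_functions (f t)" "linear_functional_on test_functions (g t)" for t
    using f g by (auto simp: represents_path_def continuous_distribution_paths_def distributions_def)
  show "f t0 \<phi> = g t0 \<phi>"
  proof (cases "\<phi> \<in> test_functions")
    case False then show ?thesis using d by (simp add: linear_functional_on_def)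
  next
    case \<phi>: True
    have c: "continuous_on UNIV (\<lambda>t. f t \<phi>)" "continuous_on UNIV (\<lambda>t. g t \<phi>)"
      using f g \<phi> by (auto simp: represents_path_def continuous_distribution_paths_def)
    have "f t0 \<phi> - g t0 \<phi> = 0"
    proof (rule continuous_zero_by_testing[OF \<Psi>, where h = "\<lambda>t. f t \<phi> - g t \<phi>"])
      show "continuous_on UNIV (\<lambda>t. f t \<phi> - g t \<phi>)" by (intro continuous_intros c)
      fix \<eta> :: "real \<Rightarrow> complex" assume \<eta>: "\<eta> \<in> test_functions"
      have tt: "(\<lambda>z. \<phi> (fst z) * \<eta> (snd z)) \<in> test_functions" by (rule test_tensor[OF \<phi> \<eta>])
      have e: "F t (\<lambda>x. \<phi> x * \<eta> t) = F t \<phi> * \<eta> t" if "linear_functional_on test_functions (F t)" for F :: "real \<Rightarrow> ('a \<Rightarrow> complex) \<Rightarrow> complex" and t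
        using that \<phi> unfolding linear_functional_on_def by (simp add: mult.commute[of _ "\<eta> t"])
      have "u (\<lambda>z. \<phi> (fst z) * \<eta> (snd z)) = (\<integral>t. f t \<phi> * \<eta> t \<partial>lborel)"
        using f tt by (simp add: represents_path_def e d)
      moreover have "u (\<lambda>z. \<phi> (fst z) * \<eta> (snd z)) = (\<integral>t. g t \<phi> * \<eta> t \<partial>lborel)"
        using g tt by (simp add: represents_path_def e d)
      moreover have "integrable lborel (\<lambda>t. F t * \<eta> t)" if F: "continuous_on UNIV F" for F :: "real \<Rightarrow> complex"
      proof -
        obtain R where R: "\<And>s. norm s > R \<Longrightarrow> \<eta> s = 0" using test_support[OF \<eta>] by metis
        have "continuous_on {-R..R} (\<lambda>t. F t * \<eta> t)"
          by (intro continuous_intros continuous_on_subset[OF F] smooth_continuous test_smooth \<eta>) auto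
        then have "integrable lborel (\<lambda>t. indicator {-R..R} t *\<^sub>R (F t * \<eta> t))"
          using borel_integrable_atLeastAtMost'[of "-R" R "\<lambda>t. F t * \<eta> t"] by (simp add: set_integrable_def)
        moreover have "indicator {-R..R} t *\<^sub>R (F t * \<eta> t) = F t * \<eta> t" for t
          using R[of t] by (cases "R < \<bar>t\<bar>") (auto simp: indicator_def)
        ultimately show ?thesis by simp
      qed
      ultimately show "(\<integral>t. (f t \<phi> - g t \<phi>) * \<eta> t \<partial>lborel) = 0"
        using c by (simp add: left_diff_distrib)
    qed
    then show ?thesis by simp
  qed
qed

lemma distributional_trace_eq:
  assumes "cutoff \<Psi>" "represents_path f u" shows "distributional_trace u = f 0"
proof -
  have "(THE f. represents_path f u) = f"
    using represents_path_unique[OF assms(1)] assms(2) by (intro the_equality) auto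
  then show ?thesis by (simp add: distributional_trace_def)
qed

section \<open>Functions in L_p as distributions\<close>

lemma Lp_norm_L1_ball:
  fixes g :: "'a::euclidean_space \<Rightarrow> complex"
  assumes p: "1 \<le> p" and g: "g \<in> borel_measurable lborel" and a: "a > 0" "Lp_norm p g \<le> ennreal a"
  shows "(\<integral>\<^sup>+x. ennreal (norm (g x) * indicator (cball 0 R) x) \<partial>lborel) \<le> ennreal (a * (1 + measure lborel (cball (0::'a) R)))"
proof (rule Lp_norm_weighted_L1[OF p g a, where W = "indicator (cball 0 R)" and C = 1])
  have "emeasure lborel (cball (0::'a) R) \<noteq> top"
    using emeasure_lborel_cball_finite[of "0::'a" R] by (simp add: less_top[symmetric])
  then have "emeasure lborel (cball (0::'a) R) = ennreal (measure lborel (cball (0::'a) R))"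
    by (rule emeasure_eq_ennreal_measure)
  moreover have "(\<integral>\<^sup>+x. ennreal (indicator (cball (0::'a) R) x) \<partial>lborel) = emeasure lborel (cball (0::'a) R)"
    unfolding ennreal_indicator by (rule nn_integral_indicator) simp
  ultimately show "(\<integral>\<^sup>+x. ennreal (indicator (cball (0::'a) R) x) \<partial>lborel) \<le> ennreal (measure lborel (cball (0::'a) R))"
    by (simp only: order_refl)
  show "(indicator (cball (0::'a) R) :: 'a \<Rightarrow> real) \<in> borel_measurable lborel"
    by (rule borel_measurable_indicator) simp
qed (simp_all only: indicator_pos_le indicator_le_1 measure_nonneg)

lemma compact_ball_superset:
  fixes K :: "'a::real_normed_vector set"
  assumes "compact K" shows "\<exists>R. K \<subseteq> cball 0 R"
proof -
  obtain R where "\<forall>x\<in>K. norm x \<le> R" using compact_imp_bounded[OF assms] unfolding bounded_iff ..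
  then show ?thesis by (intro exI[of _ R]) auto
qed

lemma Lp_locally_integrable:
  fixes g :: "'a::euclidean_space \<Rightarrow> complex"
  assumes p: "1 \<le> p" and g[measurable]: "g \<in> borel_measurable lborel" and a: "Lp_norm p g < \<infinity>"
  shows "locally_integrable g"
  unfolding locally_integrable_def
proof safe
  fix K :: "'a set" assume K: "compact K"
  then obtain R where R: "K \<subseteq> cball 0 R" using compact_ball_superset by metis
  have [measurable]: "K \<in> sets borel" using K by (simp add: borel_compact)
  obtain r where r: "Lp_norm p g = ennreal r" "r \<ge> 0" using a by (cases "Lp_norm p g") auto
  have "(\<integral>\<^sup>+x. ennreal (norm (indicator K x *\<^sub>R g x)) \<partial>lborel) \<le> (\<integral>\<^sup>+x. ennreal (norm (g x) * indicator (cball 0 R) x) \<partial>lborel)"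
    using R by (intro nn_integral_mono) (auto simp: indicator_def)
  also have "\<dots> \<le> ennreal ((r + 1) * (1 + measure lborel (cball (0::'a) R)))"
    by (rule Lp_norm_L1_ball[OF p g]) (use r in auto)
  also have "\<dots> < \<infinity>" by simp
  finally show "set_integrable lborel K g" unfolding set_integrable_def by (intro integrableI_bounded) auto
qed simp

lemma Lp_norm_dist_regular:
  assumes p: "1 \<le> p" and g: "g \<in> borel_measurable lborel"
  shows "Lp_norm_dist p (regular_distribution g) \<le> Lp_norm p g"
proof (cases "Lp_norm p g = \<infinity>")
  case False
  then have "locally_integrable g" by (intro Lp_locally_integrable[OF p g]) (simp add: less_top)
  then show ?thesis unfolding Lp_norm_dist_def by (intro Inf_lower) auto
qed simp

text \<open>Common setting of both halves of the theorem: functions whose slices are bounded in L_p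
  by a summable sequence, uniformly in \<open>t\<close>. It is interpreted with the smooth dyadic
  pieces for boundedness and with the products w_j V_j for surjectivity.\<close>

locale trace_series =
  fixes p :: ennreal and G :: "nat \<Rightarrow> 'a::euclidean_space \<Rightarrow> real \<Rightarrow> complex" and a :: "nat \<Rightarrow> real"
    and u :: "('a \<times> real \<Rightarrow> complex) \<Rightarrow> complex"
  assumes p: "1 \<le> p"
    and meas: "\<And>k. (\<lambda>(x, t). G k x t) \<in> borel_measurable (lborel \<Otimes>\<^sub>M lborel)"
    and a: "\<And>k. a k > 0" "summable a"
    and Lp: "\<And>k t. Lp_norm p (\<lambda>x. G k x t) \<le> ennreal (a k)"
    and cont: "\<And>k \<phi>. \<phi> \<in> test_functions \<Longrightarrow> continuous_on UNIV (\<lambda>t. \<integral>x. G k x t * \<phi> x \<partial>lborel)"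
    and rep: "\<And>\<phi>. \<phi> \<in> test_functions \<Longrightarrow> (\<lambda>k. \<integral>z. G k (fst z) (snd z) * \<phi> z \<partial>lborel) sums u \<phi>"
begin

definition path :: "real \<Rightarrow> ('a \<Rightarrow> complex) \<Rightarrow> complex" where
  "path t \<phi> = (if \<phi> \<in> test_functions then \<Sum>k. \<integral>x. G k x t * \<phi> x \<partial>lborel else 0)"

lemma slice_measurable[measurable]: "(\<lambda>x. G k x t) \<in> borel_measurable borel"
  using measurable_Pair1[OF meas[of k], of t] by simp

text \<open>The estimate on which the interchanges of sum and integral in this locale rest: uniform
  in \<open>t\<close> and summable in \<open>k\<close>.\<close>

lemma nn_bound:
  assumes \<phi>: "\<phi> \<in> borel_measurable borel" "\<And>x. norm (\<phi> x) \<le> M" "\<And>x. norm x > R \<Longrightarrow> \<phi> x = 0"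
  shows "(\<integral>\<^sup>+x. ennreal (norm (G k x t * \<phi> x)) \<partial>lborel) \<le> ennreal (M * (1 + measure lborel (cball (0::'a) R)) * a k)"
proof -
  have [measurable]: "cball (0::'a) R \<in> sets borel" by simp
  have M: "M \<ge> 0" using \<phi>(2) order_trans[OF norm_ge_zero] by blast
  have "(\<integral>\<^sup>+x. ennreal (norm (G k x t * \<phi> x)) \<partial>lborel) \<le> (\<integral>\<^sup>+x. ennreal M * ennreal (norm (G k x t) * indicator (cball 0 R) x) \<partial>lborel)"
  proof (rule nn_integral_mono)
    fix x
    have "norm (G k x t * \<phi> x) \<le> M * (norm (G k x t) * indicator (cball 0 R) x)"
    proof (cases "norm x > R")
      case False
      then show ?thesis using mult_left_mono[OF \<phi>(2)[of x] norm_ge_zero[of "G k x t"]] by (simp add: norm_mult mult.commute)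
    qed (use \<phi>(3) M in auto)
    then show "ennreal (norm (G k x t * \<phi> x)) \<le> ennreal M * ennreal (norm (G k x t) * indicator (cball 0 R) x)"
      using M by (simp add: ennreal_leI flip: ennreal_mult')
  qed
  also have "\<dots> = ennreal M * (\<integral>\<^sup>+x. ennreal (norm (G k x t) * indicator (cball 0 R) x) \<partial>lborel)"
    by (rule nn_integral_cmult) measurable
  also have "\<dots> \<le> ennreal M * ennreal (a k * (1 + measure lborel (cball (0::'a) R)))"
    by (intro mult_left_mono Lp_norm_L1_ball[OF p _ a(1) Lp]) auto
  also have "\<dots> = ennreal (M * (1 + measure lborel (cball (0::'a) R)) * a k)"
    using M by (simp add: mult_ac flip: ennreal_mult')
  finally show ?thesis .
qed

lemma slice_integrable:
  assumes "\<phi> \<in> test_functions" shows "integrable lborel (\<lambda>x. G k x t * \<phi> x)"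
proof -
  obtain R where R: "\<And>x. norm x > R \<Longrightarrow> \<phi> x = 0" using test_support[OF assms] by metis
  obtain M where M: "\<And>x. norm (\<phi> x) \<le> M" using test_bounded[OF assms] by metis
  have [measurable]: "\<phi> \<in> borel_measurable borel" by (rule test_measurable[OF assms])
  have "(\<integral>\<^sup>+x. ennreal (norm (G k x t * \<phi> x)) \<partial>lborel) < \<infinity>"
    using nn_bound[of \<phi> M R k t] M R by (auto intro: le_less_trans)
  then show ?thesis by (intro integrableI_bounded) auto
qed

lemma slice_bound:
  assumes "\<phi> \<in> test_functions" "\<And>x. norm (\<phi> x) \<le> M" "\<And>x. norm x > R \<Longrightarrow> \<phi> x = 0"
  shows "norm (\<integral>x. G k x t * \<phi> x \<partial>lborel) \<le> M * (1 + measure lborel (cball (0::'a) R)) * a k"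
proof -
  have M: "M \<ge> 0" using assms(2) order_trans[OF norm_ge_zero] by blast
  have "ennreal (norm (\<integral>x. G k x t * \<phi> x \<partial>lborel)) \<le> ennreal (M * (1 + measure lborel (cball (0::'a) R)) * a k)"
    by (rule order_trans[OF enn_norm_integral_le nn_bound[OF test_measurable[OF assms(1)] assms(2,3)]])
  moreover have "0 \<le> M * (1 + measure lborel (cball (0::'a) R)) * a k" using M a(1)[of k] by simp
  ultimately show ?thesis by (simp add: ennreal_le_iff)
qed

lemma slice_summable:
  assumes "\<phi> \<in> test_functions" shows "summable (\<lambda>k. \<integral>x. G k x t * \<phi> x \<partial>lborel)"
proof -
  obtain R where R: "\<And>x. norm x > R \<Longrightarrow> \<phi> x = 0" using test_support[OF assms] by metis
  obtain M where M: "\<And>x. norm (\<phi> x) \<le> M" using test_bounded[OF assms] by metis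
  show ?thesis
    by (rule summable_comparison_test'[OF summable_mult[OF a(2)]]) (rule slice_bound[OF assms M R])
qed

lemma path_bound:
  assumes "\<phi> \<in> test_functions" "\<And>x. norm (\<phi> x) \<le> M" "\<And>x. norm x > R \<Longrightarrow> \<phi> x = 0"
  shows "norm (path t \<phi>) \<le> M * (1 + measure lborel (cball (0::'a) R)) * (\<Sum>k. a k)"
proof -
  have "norm (path t \<phi>) \<le> (\<Sum>k. M * (1 + measure lborel (cball (0::'a) R)) * a k)"
    unfolding path_def using assms by (auto intro!: norm_suminf_le slice_bound summable_mult a)
  then show ?thesis using a by (simp add: suminf_mult)
qed

text \<open>The estimate involves only the supremum of |\<phi>|, so each value of the path is a
  distribution of order 0.\<close>

lemma path_distribution: "path t \<in> distributions"
  unfolding distributions_def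
proof safe
  show "linear_functional_on test_functions (path t)"
    unfolding linear_functional_on_def
  proof safe
    fix \<phi> \<psi> :: "'a \<Rightarrow> complex" assume *: "\<phi> \<in> test_functions" "\<psi> \<in> test_functions"
    show "path t (\<lambda>x. \<phi> x + \<psi> x) = path t \<phi> + path t \<psi>"
      using * test_add[OF *] slice_integrable[OF *(1)] slice_integrable[OF *(2)]
      by (simp add: path_def distrib_left suminf_add[OF slice_summable slice_summable])
  next
    fix \<phi> :: "'a \<Rightarrow> complex" and c assume *: "\<phi> \<in> test_functions"
    have "(\<integral>x. G k x t * (c * \<phi> x) \<partial>lborel) = c * (\<integral>x. G k x t * \<phi> x \<partial>lborel)" for k
      by (subst integral_mult_right_zero[symmetric]) (simp only: mult_ac)
    then show "path t (\<lambda>x. c * \<phi> x) = c * path t \<phi>"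
      using * test_cmult[OF *] by (simp add: path_def suminf_mult[OF slice_summable])
  qed (simp add: path_def)
next
  fix K :: "'a set" assume "compact K"
  then obtain R where R: "K \<subseteq> cball 0 R" using compact_ball_superset by metis
  have "norm (path t \<phi>) \<le> ((1 + measure lborel (cball (0::'a) R)) * (\<Sum>k. a k)) * schwartz_seminorm 0 0 \<phi>"
    if \<phi>: "\<phi> \<in> test_functions" "supp \<phi> \<subseteq> K" for \<phi>
  proof -
    have "norm (\<phi> x) \<le> schwartz_seminorm 0 0 \<phi>" for x
      using seminorm_upper[OF test_schwartz[OF \<phi>(1)], of "[]" 0 x 0] by simp
    moreover have "\<phi> x = 0" if "norm x > R" for x
    proof (rule ccontr)
      assume "\<phi> x \<noteq> 0"
      then have "x \<in> supp \<phi>" unfolding supp_def using closure_subset[of "{x. \<phi> x \<noteq> 0}"] by auto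
      then show False using \<phi>(2) R that by auto
    qed
    ultimately have "norm (path t \<phi>) \<le> schwartz_seminorm 0 0 \<phi> * (1 + measure lborel (cball (0::'a) R)) * (\<Sum>k. a k)"
      by (rule path_bound[OF \<phi>(1)])
    then show ?thesis by (simp add: mult_ac)
  qed
  then show "\<exists>C N. \<forall>\<phi>\<in>test_functions. supp \<phi> \<subseteq> K \<longrightarrow> norm (path t \<phi>) \<le> C * schwartz_seminorm 0 N \<phi>" by blast
qed

text \<open>Each term is continuous in \<open>t\<close> by assumption, and
  \<open>slice_bound\<close> is uniform in \<open>t\<close>, so the Weierstrass test gives uniform
  convergence.\<close>

lemma path_continuous:
  assumes "\<phi> \<in> test_functions" shows "continuous_on UNIV (\<lambda>t. path t \<phi>)"
proof -
  obtain R where R: "\<And>x. norm x > R \<Longrightarrow> \<phi> x = 0" using test_support[OF assms] by metis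
  obtain M where M: "\<And>x. norm (\<phi> x) \<le> M" using test_bounded[OF assms] by metis
  have "uniform_limit UNIV (\<lambda>n t. \<Sum>k<n. \<integral>x. G k x t * \<phi> x \<partial>lborel) (\<lambda>t. \<Sum>k. \<integral>x. G k x t * \<phi> x \<partial>lborel) sequentially"
    by (rule Weierstrass_m_test[OF _ summable_mult[OF a(2)]]) (rule slice_bound[OF assms M R])
  then have "continuous_on UNIV (\<lambda>t. \<Sum>k. \<integral>x. G k x t * \<phi> x \<partial>lborel)"
    by (rule uniform_limit_theorem[rotated]) (auto intro!: always_eventually continuous_on_sum cont assms)
  then show ?thesis using assms by (simp add: path_def)
qed

text \<open>For each \<open>k\<close> Fubini turns the integral over the product space into an
  integral over slices. Since \<phi> has bounded support in \<open>t\<close>, the slice bounds are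
  integrable in \<open>t\<close> and summable in \<open>k\<close>, so sum and integral may be
  exchanged.\<close>

lemma represents: "represents_path path u"
  unfolding represents_path_def
proof safe
  show "path \<in> continuous_distribution_paths"
    by (auto simp: continuous_distribution_paths_def path_distribution path_continuous)
  fix \<phi> :: "'a \<times> real \<Rightarrow> complex" assume \<phi>: "\<phi> \<in> test_functions"
  obtain R where R0: "R > 0" and R: "\<And>x. norm x > R \<Longrightarrow> \<phi> x = 0" using test_support[OF \<phi>] by metis
  obtain M where M: "\<And>x. norm (\<phi> x) \<le> M" using test_bounded[OF \<phi>] by metis
  have M0: "M \<ge> 0" using M order_trans[OF norm_ge_zero] by blast
  let ?C = "M * (1 + measure lborel (cball (0::'a) R))"
  have C0: "?C \<ge> 0" using M0 by simp
  have [measurable]: "\<phi> \<in> borel_measurable borel" by (rule test_measurable[OF \<phi>])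
  have [measurable]: "(\<lambda>(x, t). \<phi> (x, t)) \<in> borel_measurable (lborel \<Otimes>\<^sub>M lborel)" by (simp add: lborel_prod)
  note meas[measurable]
  have swap[measurable]: "(\<lambda>(t, x). G k x t) \<in> borel_measurable (lborel \<Otimes>\<^sub>M lborel)" for k
    using measurable_pair_swap[OF meas[of k]] by simp
  have swap2[measurable]: "(\<lambda>(t, x). \<phi> (x, t)) \<in> borel_measurable (lborel \<Otimes>\<^sub>M lborel)"
    using measurable_pair_swap[of "\<lambda>(x, t). \<phi> (x, t)" lborel lborel borel] by simp
  have R1: "\<phi> (x, t) = 0" if "norm x > R" for x t using that norm_fst_le[of x t] by (intro R) linarith
  have R2: "\<phi> (x, t) = 0" if "\<bar>t\<bar> > R" for x t using that norm_snd_le[of t x] by (intro R) auto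
  \<comment> \<open>The indicator records that the slice of \<phi> is 0 for |t| > R; it is what
    makes the bound integrable in \<open>t\<close>.\<close>
  have nnb: "(\<integral>\<^sup>+x. ennreal (norm (G k x t * \<phi> (x, t))) \<partial>lborel) \<le> ennreal (?C * a k * indicator {-R..R} t)" for k t
  proof (cases "\<bar>t\<bar> > R")
    case False
    have "(\<lambda>x. \<phi> (x, t)) \<in> borel_measurable borel" by (rule test_measurable[OF test_slice[OF \<phi>]])
    from nn_bound[OF this M R1, where k = k and t = t] False show ?thesis by (auto simp: indicator_def)
  qed (simp add: R2)
  have Cint: "integrable lborel (\<lambda>t::real. ?C * a k * indicator {-R..R} t)" for k
  proof -
    have "integrable lborel (indicator {-R..R} :: real \<Rightarrow> real)"
      by (rule integrable_real_indicator) (use R0 in auto)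
    then show ?thesis by (rule integrable_mult_right)
  qed
  have Cnn: "(\<integral>\<^sup>+t. ennreal (?C * a k * indicator {-R..R} t) \<partial>lborel) = ennreal (?C * a k * (2 * R))" for k
  proof -
    have "(\<integral>\<^sup>+t. ennreal (?C * a k * indicator {-R..R} t) \<partial>lborel) = (\<integral>\<^sup>+t. ennreal (?C * a k) * indicator {-R..R} t \<partial>lborel)"
      by (intro nn_integral_cong) (simp add: indicator_def)
    also have "\<dots> = ennreal (?C * a k) * ennreal (2 * R)" using R0 by (simp add: nn_integral_cmult_indicator)
    also have "\<dots> = ennreal (?C * a k * (2 * R))" using C0 a(1)[of k] by (simp flip: ennreal_mult')
    finally show ?thesis .
  qed
  define I :: "nat \<Rightarrow> real \<Rightarrow> complex" where "I k t = (\<integral>x. G k x t * \<phi> (x, t) \<partial>lborel)" for k t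
  have Im[measurable]: "I k \<in> borel_measurable lborel" for k unfolding I_def by measurable
  have Ib: "norm (I k t) \<le> ?C * a k * indicator {-R..R} t" for k t
  proof -
    have "ennreal (norm (I k t)) \<le> ennreal (?C * a k * indicator {-R..R} t)"
      unfolding I_def by (rule order_trans[OF enn_norm_integral_le nnb])
    moreover have "0 \<le> ?C * a k * indicator {-R..R} t" using C0 a(1)[of k] by simp
    ultimately show ?thesis by (simp add: ennreal_le_iff)
  qed
  have Ii: "integrable lborel (I k)" for k
    by (rule Bochner_Integration.integrable_bound[OF Cint[of k]]) (use Ib in \<open>auto intro!: AE_I2 order_trans[OF Ib] abs_ge_self\<close>)
  have fub: "(\<integral>z. G k (fst z) (snd z) * \<phi> z \<partial>lborel) = (\<integral>t. I k t \<partial>lborel)" for k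
  proof -
    have "(\<integral>\<^sup>+t. \<integral>\<^sup>+x. ennreal (norm (G k x t * \<phi> (x, t))) \<partial>lborel \<partial>lborel) \<le> ennreal (?C * a k * (2 * R))"
      unfolding Cnn[symmetric] by (intro nn_integral_mono nnb)
    then have fin: "(\<integral>\<^sup>+t. \<integral>\<^sup>+x. ennreal (norm (G k x t * \<phi> (x, t))) \<partial>lborel \<partial>lborel) < \<infinity>"
      by (rule le_less_trans) simp
    have "integrable (lborel \<Otimes>\<^sub>M lborel) (\<lambda>(t, x). G k x t * \<phi> (x, t))"
      by (rule integrable_pair_nn[OF _ fin]) measurable
    then have "integrable (lborel \<Otimes>\<^sub>M lborel) (\<lambda>(x, t). G k x t * \<phi> (x, t))"
      using lborel_pair.integrable_product_swap by fastforce
    from lborel_pair.integral_snd[OF this]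
    have "(\<integral>t. I k t \<partial>lborel) = (\<integral>z. (case z of (x, t) \<Rightarrow> G k x t * \<phi> (x, t)) \<partial>(lborel \<Otimes>\<^sub>M lborel))"
      by (simp add: I_def)
    then show ?thesis by (simp add: lborel_prod case_prod_beta)
  qed
  have "(\<lambda>k. \<integral>t. I k t \<partial>lborel) sums (\<integral>t. (\<Sum>k. I k t) \<partial>lborel)"
  proof (rule sums_integral[OF Ii])
    show "AE t in lborel. summable (\<lambda>k. norm (I k t))"
    proof (rule AE_I2)
      fix t show "summable (\<lambda>k. norm (I k t))"
        by (rule summable_comparison_test'[OF summable_mult2[OF summable_mult[OF a(2)]]]) (subst real_norm_def, subst abs_norm_cancel, rule Ib)
    qed
    show "summable (\<lambda>k. \<integral>t. norm (I k t) \<partial>lborel)"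
    proof (rule summable_comparison_test'[OF summable_mult2[OF summable_mult[OF a(2), of ?C], of "2 * R"]])
      fix k
      have "(\<integral>t. norm (I k t) \<partial>lborel) \<le> (\<integral>t. ?C * a k * indicator {-R..R} t \<partial>lborel)"
        by (intro integral_mono integrable_norm Ii Cint Ib)
      also have "\<dots> = ?C * a k * (2 * R)" using R0 by simp
      finally show "norm (\<integral>t. norm (I k t) \<partial>lborel) \<le> ?C * a k * (2 * R)" by simp
    qed
  qed
  moreover have "(\<Sum>k. I k t) = path t (\<lambda>x. \<phi> (x, t))" for t
    using test_slice[OF \<phi>] by (simp add: path_def I_def)
  ultimately have "(\<lambda>k. \<integral>t. I k t \<partial>lborel) sums (\<integral>t. path t (\<lambda>x. \<phi> (x, t)) \<partial>lborel)" by simp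
  with rep[OF \<phi>] show "u \<phi> = (\<integral>t. path t (\<lambda>x. \<phi> (x, t)) \<partial>lborel)"
    unfolding fub by (rule sums_unique2)
qed

lemma trace_domain: "u \<in> trace_domain"
  using represents by (auto simp: trace_domain_def)

lemma trace_eq: "cutoff \<Psi> \<Longrightarrow> distributional_trace u = path 0"
  by (rule distributional_trace_eq[OF _ represents])

text \<open>\<open>path 0\<close> is a sum of integrals, whereas the function sought is a pointwise
  sum. The integrals of the absolute values have a finite total, so after multiplication by \<phi>
  the series converges absolutely almost everywhere and may be integrated termwise.\<close>

lemma trace_Lp:
  assumes "cutoff \<Psi>"
  shows "distributional_trace u = regular_distribution (\<lambda>x. \<Sum>k. G k x 0)"
    and "Lp_norm p (\<lambda>x. \<Sum>k. G k x 0) \<le> ennreal (\<Sum>k. a k)"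
proof -
  show "Lp_norm p (\<lambda>x. \<Sum>k. G k x 0) \<le> ennreal (\<Sum>k. a k)"
    by (rule Lp_norm_suminf[OF p _ a Lp]) simp
  have "path 0 \<phi> = (\<integral>x. (\<Sum>k. G k x 0) * \<phi> x \<partial>lborel)" if \<phi>: "\<phi> \<in> test_functions" for \<phi>
  proof -
    obtain R where R: "\<And>x. norm x > R \<Longrightarrow> \<phi> x = 0" using test_support[OF \<phi>] by metis
    obtain M where M: "\<And>x. norm (\<phi> x) \<le> M" using test_bounded[OF \<phi>] by metis
    have M0: "M \<ge> 0" using M order_trans[OF norm_ge_zero] by blast
    let ?C = "M * (1 + measure lborel (cball (0::'a) R))"
    have C0: "?C \<ge> 0" using M0 by simp
    have [measurable]: "\<phi> \<in> borel_measurable borel" by (rule test_measurable[OF \<phi>])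
    have nb: "(\<integral>\<^sup>+x. ennreal (norm (G k x 0 * \<phi> x)) \<partial>lborel) \<le> ennreal (?C * a k)" for k
      using nn_bound[OF _ M R] by simp
    have sC: "(\<Sum>k. ennreal (?C * a k)) < \<infinity>"
      using summable_mult[OF a(2), of ?C] C0 a(1)[THEN less_imp_le] by (simp add: suminf_ennreal2)
    have "(\<integral>\<^sup>+x. (\<Sum>k. ennreal (norm (G k x 0 * \<phi> x))) \<partial>lborel) = (\<Sum>k. \<integral>\<^sup>+x. ennreal (norm (G k x 0 * \<phi> x)) \<partial>lborel)"
      by (rule nn_integral_suminf) measurable
    also have "\<dots> \<le> (\<Sum>k. ennreal (?C * a k))" by (intro suminf_le nb) auto
    finally have "(\<integral>\<^sup>+x. (\<Sum>k. ennreal (norm (G k x 0 * \<phi> x))) \<partial>lborel) \<noteq> \<infinity>" using sC by auto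
    then have "AE x in lborel. (\<Sum>k. ennreal (norm (G k x 0 * \<phi> x))) \<noteq> \<infinity>"
      by (intro nn_integral_PInf_AE) measurable
    then have ae: "AE x in lborel. summable (\<lambda>k. norm (G k x 0 * \<phi> x))"
    proof (rule AE_mp, intro AE_I2 impI)
      fix x assume "(\<Sum>k. ennreal (norm (G k x 0 * \<phi> x))) \<noteq> \<infinity>"
      then show "summable (\<lambda>k. norm (G k x 0 * \<phi> x))" by (intro summable_suminf_not_top) simp_all
    qed
    have "(\<lambda>k. \<integral>x. G k x 0 * \<phi> x \<partial>lborel) sums (\<integral>x. (\<Sum>k. G k x 0 * \<phi> x) \<partial>lborel)"
    proof (rule sums_integral[OF slice_integrable[OF \<phi>] ae])
      show "summable (\<lambda>k. \<integral>x. norm (G k x 0 * \<phi> x) \<partial>lborel)"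
      proof (rule summable_comparison_test'[OF summable_mult[OF a(2), of ?C]])
        fix k
        have "ennreal (\<integral>x. norm (G k x 0 * \<phi> x) \<partial>lborel) \<le> ennreal (?C * a k)"
          using nb[of k] nn_integral_eq_integral[OF integrable_norm[OF slice_integrable[OF \<phi>, of k 0]]] by simp
        then show "norm (\<integral>x. norm (G k x 0 * \<phi> x) \<partial>lborel) \<le> ?C * a k"
          using C0 a(1)[of k] by (simp add: ennreal_le_iff)
      qed
    qed
    then have "path 0 \<phi> = (\<integral>x. (\<Sum>k. G k x 0 * \<phi> x) \<partial>lborel)"
      using \<phi> by (simp add: path_def sums_iff)
    also have "\<dots> = (\<integral>x. (\<Sum>k. G k x 0) * \<phi> x \<partial>lborel)"
    proof (rule integral_cong_AE)
      show "AE x in lborel. (\<Sum>k. G k x 0 * \<phi> x) = (\<Sum>k. G k x 0) * \<phi> x"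
        using ae
      proof (rule AE_mp, intro AE_I2 impI)
        fix x assume "summable (\<lambda>k. norm (G k x 0 * \<phi> x))"
        then have s: "summable (\<lambda>k. G k x 0 * \<phi> x)" by (rule summable_norm_cancel)
        \<comment> \<open>Where \<phi> is 0 the series of \<open>G k x 0\<close> may diverge, but
          both sides are 0; elsewhere its summability follows on dividing by \<phi>.\<close>
        show "(\<Sum>k. G k x 0 * \<phi> x) = (\<Sum>k. G k x 0) * \<phi> x"
        proof (cases "\<phi> x = 0")
          case False
          then have "summable (\<lambda>k. G k x 0)" using s by (simp add: summable_cmult_iff mult.commute[of _ "\<phi> x"])
          then show ?thesis by (simp add: suminf_mult2)
        qed simp
      qed
    qed measurable
    finally show ?thesis .
  qed
  then have "path 0 = regular_distribution (\<lambda>x. \<Sum>k. G k x 0)"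
    by (intro ext) (auto simp: regular_distribution_def path_def)
  then show "distributional_trace u = regular_distribution (\<lambda>x. \<Sum>k. G k x 0)" by (simp add: trace_eq[OF assms])
qed

end

section \<open>Boundedness of the trace\<close>

lemma schwartz_kernel_measurable:
  assumes "\<eta> \<in> schwartz_functions"
  shows "(\<lambda>(x, y). \<eta> (x - y :: 'a::euclidean_space)) \<in> borel_measurable (lborel \<Otimes>\<^sub>M lborel)"
proof -
  have [measurable]: "\<eta> \<in> borel_measurable borel" by (rule schwartz_measurable[OF assms])
  show ?thesis by measurable
qed

text \<open>The dilations keep the L_1 norm, so substitution reduces every scale to scale 0. Both
  orders of the difference are recorded because Schur's test asks for both marginals.\<close>

lemma bump_kernel_L1:
  assumes \<Psi>: "cutoff \<Psi>"
  shows "\<exists>A>0. \<forall>j (z::'a::euclidean_space). (\<integral>\<^sup>+x. ennreal (norm (bump_kernel \<Psi> j (x - z))) \<partial>lborel) \<le> ennreal A \<and>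
     (\<integral>\<^sup>+x. ennreal (norm (bump_kernel \<Psi> j (z - x))) \<partial>lborel) \<le> ennreal A"
proof -
  let ?I = "\<integral>x. norm (bump_kernel \<Psi> 0 (x::'a)) \<partial>lborel"
  have I: "(\<integral>\<^sup>+x. ennreal (norm (bump_kernel \<Psi> 0 (x::'a))) \<partial>lborel) = ennreal ?I"
    by (intro nn_integral_eq_integral integrable_norm schwartz_integrable bump_kernel_schwartz \<Psi>) auto
  have m[measurable]: "bump_kernel \<Psi> j \<in> borel_measurable (borel :: 'a measure)" for j
    by (rule schwartz_measurable[OF bump_kernel_schwartz[OF \<Psi>]])
  have sc: "ennreal ((inverse (2 ^ j)) ^ DIM('a)) * (\<integral>\<^sup>+x. ennreal (norm (bump_kernel \<Psi> j (inverse (2 ^ j) *\<^sub>R (x::'a)))) \<partial>lborel)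
      = ennreal ?I" for j
  proof -
    have "ennreal ((inverse (2 ^ j)) ^ DIM('a)) * ennreal (norm (bump_kernel \<Psi> j (inverse (2 ^ j) *\<^sub>R x))) = ennreal (norm (bump_kernel \<Psi> 0 x))" for x :: 'a
    proof -
      have "norm (bump_kernel \<Psi> j (inverse (2 ^ j) *\<^sub>R x)) = (2 ^ j) ^ DIM('a) * norm (bump_kernel \<Psi> 0 x)"
        by (subst bump_kernel_scale[OF \<Psi>]) (simp add: norm_mult norm_power)
      moreover have "(inverse (2 ^ j)) ^ DIM('a) * (2 ^ j) ^ DIM('a) = (1::real)"
        by (subst power_mult_distrib[symmetric]) simp
      ultimately have "(inverse (2 ^ j)) ^ DIM('a) * norm (bump_kernel \<Psi> j (inverse (2 ^ j) *\<^sub>R x)) = norm (bump_kernel \<Psi> 0 x)"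
        by (simp only: mult.assoc[symmetric] mult_1_left)
      moreover have "(0::real) \<le> (inverse (2 ^ j)) ^ DIM('a)" by simp
      ultimately show ?thesis by (simp only: ennreal_mult'[symmetric])
    qed
    then show ?thesis by (simp add: I[symmetric] flip: nn_integral_cmult)
  qed
  have 1: "(\<integral>\<^sup>+x. ennreal (norm (bump_kernel \<Psi> j (x - z))) \<partial>lborel) = ennreal ?I" for j and z :: 'a
  proof -
    have "(\<integral>\<^sup>+x. ennreal (norm (bump_kernel \<Psi> j (x - z))) \<partial>lborel) = ennreal (\<bar>inverse (2 ^ j)\<bar> ^ DIM('a)) *
        (\<integral>\<^sup>+x. ennreal (norm (bump_kernel \<Psi> j ((z + inverse (2 ^ j) *\<^sub>R x) - z))) \<partial>lborel)"
      by (rule nn_integral_affine) auto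
    then show ?thesis using sc[of j] by simp
  qed
  have 2: "(\<integral>\<^sup>+x. ennreal (norm (bump_kernel \<Psi> j (z - x))) \<partial>lborel) = ennreal ?I" for j and z :: 'a
  proof -
    have "(\<integral>\<^sup>+x. ennreal (norm (bump_kernel \<Psi> j (z - x))) \<partial>lborel) = ennreal (\<bar>- inverse (2 ^ j)\<bar> ^ DIM('a)) *
        (\<integral>\<^sup>+x. ennreal (norm (bump_kernel \<Psi> j (z - (z + (- inverse (2 ^ j)) *\<^sub>R x)))) \<partial>lborel)"
      by (rule nn_integral_affine) auto
    then show ?thesis using sc[of j] by simp
  qed
  have "0 < ?I + 1" by (intro add_nonneg_pos Bochner_Integration.integral_nonneg) auto
  then show ?thesis unfolding 1 2 by (intro exI[of _ "?I + 1"]) (auto intro!: ennreal_leI)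
qed

text \<open>With n = DIM('a) + 1 the kernel at scale \<open>j\<close> carries the factor 2^(jn),
  while integration over the hyperplane gives back only 2^(-j(n-1)). The remaining 2^j is the price
  of restriction.\<close>

lemma bump_kernel_slice_L1:
  assumes \<Psi>: "cutoff \<Psi>"
  shows "\<exists>B>0. \<forall>j (z::'a::euclidean_space \<times> real) t.
     (\<integral>\<^sup>+y. ennreal (norm (bump_kernel \<Psi> j (z - (y, t)))) \<partial>lborel) \<le> ennreal (2 ^ j * B)"
proof -
  let ?w = "\<lambda>y::'a. inverse ((1 + norm y) ^ (2 * DIM('a)))"
  obtain B where B: "sb (2 * DIM('a)) 0 B (bump_kernel \<Psi> 0 :: 'a \<times> real \<Rightarrow> complex)"
    using schwartz_sb[OF bump_kernel_schwartz[OF \<Psi>]] by blast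
  have B0: "B \<ge> 0" using sb_nonneg[OF B] .
  let ?I = "\<integral>y. ?w y \<partial>lborel"
  have I: "(\<integral>\<^sup>+y. ennreal (?w y) \<partial>lborel) = ennreal ?I"
    by (intro nn_integral_eq_integral integrable_weight) auto
  \<comment> \<open>The decay in the normal variable is discarded, which makes the bound independent
    of \<open>t\<close>.\<close>
  have bound: "norm (bump_kernel \<Psi> j (z - (fst z + (- inverse (2 ^ j)) *\<^sub>R y, t))) \<le> (2 ^ j) ^ DIM('a \<times> real) * (B * ?w y)"
    for j and z :: "'a \<times> real" and t y
  proof -
    have e: "2 ^ j *\<^sub>R (z - (fst z + (- inverse (2 ^ j)) *\<^sub>R y, t)) = (y, 2 ^ j * (snd z - t))"
      by (cases z) (simp add: scaleR_Pair)
    have "norm (bump_kernel \<Psi> 0 (y, 2 ^ j * (snd z - t))) \<le> B * inverse ((1 + norm (y, 2 ^ j * (snd z - t))) ^ (2 * DIM('a)))"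
      by (rule sb_le_weight[OF B])
    also have "\<dots> \<le> B * ?w y"
      using B0 norm_fst_le[of y "2 ^ j * (snd z - t)"]
      by (intro mult_left_mono le_imp_inverse_le power_mono) (auto intro!: zero_less_power add_pos_nonneg)
    finally show ?thesis
      by (subst bump_kernel_scale[OF \<Psi>], unfold e) (simp add: norm_mult norm_power)
  qed
  have [measurable]: "bump_kernel \<Psi> j \<in> borel_measurable (borel :: ('a \<times> real) measure)" for j
    by (rule schwartz_measurable[OF bump_kernel_schwartz[OF \<Psi>]])
  have "(\<integral>\<^sup>+y. ennreal (norm (bump_kernel \<Psi> j (z - (y, t)))) \<partial>lborel) \<le> ennreal (2 ^ j * (B * ?I + 1))" for j and z :: "'a \<times> real" and t
  proof -
    have "(\<integral>\<^sup>+y. ennreal (norm (bump_kernel \<Psi> j (z - (y, t)))) \<partial>lborel) = ennreal (\<bar>- inverse (2 ^ j)\<bar> ^ DIM('a)) *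
        (\<integral>\<^sup>+y. ennreal (norm (bump_kernel \<Psi> j (z - (fst z + (- inverse (2 ^ j)) *\<^sub>R y, t)))) \<partial>lborel)"
      by (rule nn_integral_affine) auto
    also have "\<dots> \<le> ennreal (inverse (2 ^ j) ^ DIM('a)) * (\<integral>\<^sup>+y. ennreal ((2 ^ j) ^ DIM('a \<times> real) * B) * ennreal (?w y) \<partial>lborel)"
      using B0 bound[of j z _ t] by (intro mult_mono nn_integral_mono) (auto intro!: ennreal_leI simp: mult.assoc simp flip: ennreal_mult')
    also have "\<dots> = ennreal (inverse (2 ^ j) ^ DIM('a)) * (ennreal ((2 ^ j) ^ DIM('a \<times> real) * B) * ennreal ?I)"
      by (subst nn_integral_cmult) (auto simp: I)
    also have "\<dots> = ennreal (inverse (2 ^ j) ^ DIM('a) * ((2 ^ j) ^ DIM('a \<times> real) * B * ?I))"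
      using B0 by (simp add: ennreal_mult')
    also have "inverse (2 ^ j) ^ DIM('a) * ((2 ^ j) ^ DIM('a \<times> real) * B * ?I) = 2 ^ j * (B * ?I)"
      by (simp add: power_add field_simps)
    also have "ennreal (2 ^ j * (B * ?I)) \<le> ennreal (2 ^ j * (B * ?I + 1))" by (intro ennreal_leI) simp
    finally show ?thesis .
  qed
  moreover have "B * ?I + 1 > 0" using B0 by (intro add_nonneg_pos mult_nonneg_nonneg) auto
  ultimately show ?thesis by blast
qed

section \<open>Convolution of functions in L_p with Schwartz functions\<close>

lemma translated_weight:
  fixes y :: "'a::euclidean_space"
  assumes "c \<ge> 0"
  shows "(\<integral>\<^sup>+x. ennreal (c * inverse ((1 + norm (x - y)) ^ (2 * DIM('a)))) \<partial>lborel)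
    = ennreal (c * (\<integral>x. inverse ((1 + norm (x::'a)) ^ (2 * DIM('a))) \<partial>lborel))"
proof -
  have i: "integrable lborel (\<lambda>x::'a. c * inverse ((1 + norm x) ^ (2 * DIM('a))))"
    by (intro integrable_mult_right integrable_weight) simp
  have "(\<integral>\<^sup>+x. ennreal (c * inverse ((1 + norm (x - y)) ^ (2 * DIM('a)))) \<partial>lborel)
     = ennreal (\<bar>1\<bar> ^ DIM('a)) * (\<integral>\<^sup>+x. ennreal (c * inverse ((1 + norm ((y + 1 *\<^sub>R x) - y)) ^ (2 * DIM('a)))) \<partial>lborel)"
    by (rule nn_integral_affine) auto
  also have "\<dots> = (\<integral>\<^sup>+x. ennreal (c * inverse ((1 + norm (x::'a)) ^ (2 * DIM('a)))) \<partial>lborel)" by simp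
  also have "\<dots> = ennreal (\<integral>x. c * inverse ((1 + norm (x::'a)) ^ (2 * DIM('a))) \<partial>lborel)"
    using assms by (intro nn_integral_eq_integral i) (auto intro!: mult_nonneg_nonneg)
  finally show ?thesis by simp
qed

lemma Lp_times_weight:
  fixes g :: "'a::euclidean_space \<Rightarrow> complex"
  assumes p: "1 \<le> p" and g: "g \<in> borel_measurable lborel" and a: "a > 0" "Lp_norm p g \<le> ennreal a" and c: "c \<ge> 0"
  shows "(\<integral>\<^sup>+x. ennreal (norm (g x) * (c * inverse ((1 + norm (x - y)) ^ (2 * DIM('a))))) \<partial>lborel)
     \<le> ennreal (a * (c + c * (\<integral>x. inverse ((1 + norm (x::'a)) ^ (2 * DIM('a))) \<partial>lborel)))"
proof (rule Lp_norm_weighted_L1[OF p g a, where W = "\<lambda>x. c * inverse ((1 + norm (x - y)) ^ (2 * DIM('a)))"])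
  show "c * inverse ((1 + norm (x - y)) ^ (2 * DIM('a))) \<le> c" for x
  proof -
    have "1 \<le> (1 + norm (x - y)) ^ (2 * DIM('a))" by (rule one_le_power) simp
    then have "inverse ((1 + norm (x - y)) ^ (2 * DIM('a))) \<le> 1" by (rule inverse_le_1_iff[THEN iffD2, OF disjI2])
    from mult_left_mono[OF this c] show ?thesis by simp
  qed
  show "(\<integral>\<^sup>+x. ennreal (c * inverse ((1 + norm (x - y)) ^ (2 * DIM('a)))) \<partial>lborel) \<le> ennreal (c * (\<integral>x. inverse ((1 + norm (x::'a)) ^ (2 * DIM('a))) \<partial>lborel))"
    by (simp only: translated_weight[OF c] order_refl)
  show "0 \<le> c * (\<integral>x. inverse ((1 + norm (x::'a)) ^ (2 * DIM('a))) \<partial>lborel)"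
    using c by (intro mult_nonneg_nonneg Bochner_Integration.integral_nonneg) auto
  show "(\<lambda>x. c * inverse ((1 + norm (x - y)) ^ (2 * DIM('a)))) \<in> borel_measurable lborel" by measurable
qed (use c in simp)

text \<open>Note the reflected argument: \<open>conv g \<eta> y\<close> pairs \<open>g\<close> with the translate of \<open>\<eta>\<close> by \<open>y\<close>.\<close>

definition conv :: "('a::euclidean_space \<Rightarrow> complex) \<Rightarrow> ('a \<Rightarrow> complex) \<Rightarrow> 'a \<Rightarrow> complex" where
  "conv g \<eta> y = (\<integral>x. g x * \<eta> (x - y) \<partial>lborel)"

text \<open>The weight dominating \<eta> has a supremum and a mass that translation does not change,
  hence a bound uniform in \<open>y\<close>.\<close>

lemma conv_nn_bound:
  fixes g \<eta> :: "'a::euclidean_space \<Rightarrow> complex"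
  assumes p: "1 \<le> p" and g[measurable]: "g \<in> borel_measurable lborel" and a: "Lp_norm p g < \<infinity>" and \<eta>: "\<eta> \<in> schwartz_functions"
  shows "\<exists>D\<ge>0. \<forall>y. (\<integral>\<^sup>+x. ennreal (norm (g x * \<eta> (x - y))) \<partial>lborel) \<le> ennreal D"
proof -
  let ?I = "\<integral>x. inverse ((1 + norm (x::'a)) ^ (2 * DIM('a))) \<partial>lborel"
  obtain r where r: "Lp_norm p g = ennreal r" "r \<ge> 0" using a by (cases "Lp_norm p g") auto
  obtain B where B: "sb (2 * DIM('a)) 0 B \<eta>" using schwartz_sb[OF \<eta>] by blast
  have B0: "B \<ge> 0" using sb_nonneg[OF B] .
  have "(\<integral>\<^sup>+x. ennreal (norm (g x * \<eta> (x - y))) \<partial>lborel) \<le> ennreal ((r + 1) * (B + B * ?I))" for y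
  proof -
    have "(\<integral>\<^sup>+x. ennreal (norm (g x * \<eta> (x - y))) \<partial>lborel) \<le> (\<integral>\<^sup>+x. ennreal (norm (g x) * (B * inverse ((1 + norm (x - y)) ^ (2 * DIM('a))))) \<partial>lborel)"
      unfolding norm_mult by (intro nn_integral_mono ennreal_leI mult_left_mono sb_le_weight[OF B]) auto
    also have "\<dots> \<le> ennreal ((r + 1) * (B + B * ?I))"
      by (rule Lp_times_weight[OF p g _ _ B0]) (use r in \<open>auto intro: ennreal_leI\<close>)
    finally show ?thesis .
  qed
  moreover have "0 \<le> (r + 1) * (B + B * ?I)"
    using r B0 by (intro mult_nonneg_nonneg add_nonneg_nonneg Bochner_Integration.integral_nonneg) auto
  ultimately show ?thesis by blast
qed

lemma conv_bounded:
  fixes g \<eta> :: "'a::euclidean_space \<Rightarrow> complex"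
  assumes p: "1 \<le> p" and g: "g \<in> borel_measurable lborel" and a: "Lp_norm p g < \<infinity>" and \<eta>: "\<eta> \<in> schwartz_functions"
  shows "\<exists>D\<ge>0. \<forall>y. norm (conv g \<eta> y) \<le> D"
proof -
  obtain D where D: "D \<ge> 0" "\<And>y. (\<integral>\<^sup>+x. ennreal (norm (g x * \<eta> (x - y))) \<partial>lborel) \<le> ennreal D"
    using conv_nn_bound[OF assms] by blast
  have "norm (conv g \<eta> y) \<le> D" for y
  proof -
    have "ennreal (norm (conv g \<eta> y)) \<le> ennreal D"
      unfolding conv_def by (rule order_trans[OF enn_norm_integral_le D(2)])
    then show ?thesis using D(1) by (simp add: ennreal_le_iff)
  qed
  with D(1) show ?thesis by blast
qed

text \<open>Along a convergent sequence the shifts stay within some R, and such a shift changes 1 +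
  norm x by a factor of at most 1 + R. So one weight centred at the limit dominates the whole
  sequence.\<close>

lemma conv_continuous:
  fixes g \<eta> :: "'a::euclidean_space \<Rightarrow> complex"
  assumes p: "1 \<le> p" and g[measurable]: "g \<in> borel_measurable lborel" and a: "Lp_norm p g < \<infinity>" and \<eta>: "\<eta> \<in> schwartz_functions"
  shows "continuous_on UNIV (conv g \<eta>)"
proof -
  let ?N = "2 * DIM('a)"
  have [measurable]: "\<eta> \<in> borel_measurable borel" by (rule schwartz_measurable[OF \<eta>])
  obtain r where r: "Lp_norm p g = ennreal r" "r \<ge> 0" using a by (cases "Lp_norm p g") auto
  obtain B where B: "sb ?N 0 B \<eta>" using schwartz_sb[OF \<eta>] by blast
  have B0: "B \<ge> 0" using sb_nonneg[OF B] .
  have "(conv g \<eta> \<circ> Y) \<longlonglongrightarrow> conv g \<eta> y" if Y: "Y \<longlonglongrightarrow> y" for Y y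
  proof -
    have "(\<lambda>n. Y n - y) \<longlonglongrightarrow> 0" using Y by (simp add: LIM_zero)
    then have "Bseq (\<lambda>n. Y n - y)" by (intro convergent_imp_Bseq convergentI)
    then obtain R where R: "R > 0" "\<And>n. norm (Y n - y) \<le> R" by (auto simp: Bseq_def)
    have b: "norm (g x * \<eta> (x - Y n)) \<le> norm (g x) * ((B * (1 + R) ^ ?N) * inverse ((1 + norm (x - y)) ^ ?N))" for n x
    proof -
      have "norm (x - y) \<le> norm (x - Y n) + R"
        using norm_triangle_ineq[of "x - Y n" "Y n - y"] R(2)[of n] by simp
      moreover have "1 + s \<le> (1 + R) * (1 + t)" if "s \<le> t + R" "0 \<le> t" for s t
      proof -
        have "0 \<le> R * t" using that R(1) by simp
        then show ?thesis using that by (simp add: algebra_simps)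
      qed
      ultimately have le: "1 + norm (x - y) \<le> (1 + R) * (1 + norm (x - Y n))" by simp
      have le3: "(1 + norm (x - y)) ^ ?N \<le> (1 + R) ^ ?N * (1 + norm (x - Y n)) ^ ?N"
        unfolding power_mult_distrib[symmetric] using le by (rule power_mono) simp
      have "inverse V \<le> k * inverse X" if "X \<le> k * V" "0 < X" "0 < V" for k X V :: real
        using that by (simp add: field_simps)
      from this[OF le3] have inv: "inverse ((1 + norm (x - Y n)) ^ ?N) \<le> (1 + R) ^ ?N * inverse ((1 + norm (x - y)) ^ ?N)"
        by (simp add: add_pos_nonneg)
      have "norm (\<eta> (x - Y n)) \<le> B * inverse ((1 + norm (x - Y n)) ^ ?N)" by (rule sb_le_weight[OF B])
      also have "\<dots> \<le> B * ((1 + R) ^ ?N * inverse ((1 + norm (x - y)) ^ ?N))" by (rule mult_left_mono[OF inv B0])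
      finally show ?thesis unfolding norm_mult by (intro mult_left_mono) (auto simp: mult_ac)
    qed
    have "(\<lambda>n. \<integral>x. g x * \<eta> (x - Y n) \<partial>lborel) \<longlonglongrightarrow> (\<integral>x. g x * \<eta> (x - y) \<partial>lborel)"
    proof (rule integral_dominated_convergence[where w = "\<lambda>x. norm (g x) * ((B * (1 + R) ^ ?N) * inverse ((1 + norm (x - y)) ^ ?N))"])
      have "(\<integral>\<^sup>+x. ennreal (norm (g x) * ((B * (1 + R) ^ ?N) * inverse ((1 + norm (x - y)) ^ ?N))) \<partial>lborel)
         \<le> ennreal ((r + 1) * ((B * (1 + R) ^ ?N) + (B * (1 + R) ^ ?N) * (\<integral>x. inverse ((1 + norm (x::'a)) ^ ?N) \<partial>lborel)))"
        by (rule Lp_times_weight[OF p g]) (use r B0 R in \<open>auto intro: ennreal_leI\<close>)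
      also have "\<dots> < \<infinity>" by simp
      finally have fin: "(\<integral>\<^sup>+x. ennreal (norm (g x) * ((B * (1 + R) ^ ?N) * inverse ((1 + norm (x - y)) ^ ?N))) \<partial>lborel) < \<infinity>" .
      have nn: "0 \<le> norm (g x) * ((B * (1 + R) ^ ?N) * inverse ((1 + norm (x - y)) ^ ?N))" for x
        using b[of x 0] order_trans[OF norm_ge_zero] by blast
      show "integrable lborel (\<lambda>x. norm (g x) * ((B * (1 + R) ^ ?N) * inverse ((1 + norm (x - y)) ^ ?N)))"
      proof (rule integrableI_bounded)
        show "(\<integral>\<^sup>+x. ennreal (norm (norm (g x) * ((B * (1 + R) ^ ?N) * inverse ((1 + norm (x - y)) ^ ?N)))) \<partial>lborel) < \<infinity>"
          using fin by (simp only: real_norm_def abs_of_nonneg[OF nn])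
      qed measurable
      show "AE x in lborel. norm (g x * \<eta> (x - Y n)) \<le> norm (g x) * ((B * (1 + R) ^ ?N) * inverse ((1 + norm (x - y)) ^ ?N))" for n
        by (rule AE_I2, rule b)
      show "AE x in lborel. (\<lambda>n. g x * \<eta> (x - Y n)) \<longlonglongrightarrow> g x * \<eta> (x - y)"
      proof (rule AE_I2)
        fix x
        have "isCont \<eta> (x - y)" using smooth_continuous[OF schwartz_smooth[OF \<eta>], of UNIV] by (simp add: continuous_on_eq_continuous_at)
        moreover have "(\<lambda>n. x - Y n) \<longlonglongrightarrow> x - y" by (intro tendsto_diff tendsto_const Y)
        ultimately have "(\<lambda>n. \<eta> (x - Y n)) \<longlonglongrightarrow> \<eta> (x - y)" by (rule isCont_tendsto_compose)
        then show "(\<lambda>n. g x * \<eta> (x - Y n)) \<longlonglongrightarrow> g x * \<eta> (x - y)" by (rule tendsto_mult_left)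
      qed
    qed measurable
    then show ?thesis by (simp add: comp_def conv_def)
  qed
  then show ?thesis by (simp add: continuous_on_sequentially)
qed

lemma conv_integral_swap:
  fixes g \<eta> :: "'a::euclidean_space \<Rightarrow> complex"
  assumes p: "1 \<le> p" and g[measurable]: "g \<in> borel_measurable lborel" and a: "Lp_norm p g < \<infinity>" and \<eta>: "\<eta> \<in> schwartz_functions"
    and \<phi>: "integrable lborel \<phi>"
  shows "(\<integral>x. g x * (\<integral>y. \<phi> y * \<eta> (x - y) \<partial>lborel) \<partial>lborel) = (\<integral>y. conv g \<eta> y * \<phi> y \<partial>lborel)"
proof -
  note schwartz_kernel_measurable[OF \<eta>, measurable]
  have [measurable]: "\<phi> \<in> borel_measurable lborel" using \<phi> by (rule borel_measurable_integrable)
  obtain D where D: "D \<ge> 0" "\<And>y. (\<integral>\<^sup>+x. ennreal (norm (g x * \<eta> (x - y))) \<partial>lborel) \<le> ennreal D"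
    using conv_nn_bound[OF p g a \<eta>] by blast
  have "(\<integral>\<^sup>+x. \<integral>\<^sup>+y. ennreal (norm (g x * (\<phi> y * \<eta> (x - y)))) \<partial>lborel \<partial>lborel)
     = (\<integral>\<^sup>+y. \<integral>\<^sup>+x. ennreal (norm (g x * (\<phi> y * \<eta> (x - y)))) \<partial>lborel \<partial>lborel)"
    by (rule lborel_pair.Fubini'[symmetric]) measurable
  also have "\<dots> = (\<integral>\<^sup>+y. ennreal (norm (\<phi> y)) * (\<integral>\<^sup>+x. ennreal (norm (g x * \<eta> (x - y))) \<partial>lborel) \<partial>lborel)"
    by (intro nn_integral_cong, subst nn_integral_cmult[symmetric]) (auto simp: norm_mult mult_ac simp flip: ennreal_mult')
  also have "\<dots> \<le> (\<integral>\<^sup>+y. ennreal (norm (\<phi> y)) * ennreal D \<partial>lborel)"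
    by (intro nn_integral_mono mult_left_mono D) auto
  also have "\<dots> < \<infinity>" using \<phi> by (simp add: nn_integral_multc ennreal_mult_less_top integrable_iff_bounded)
  finally have fin: "(\<integral>\<^sup>+x. \<integral>\<^sup>+y. ennreal (norm (g x * (\<phi> y * \<eta> (x - y)))) \<partial>lborel \<partial>lborel) < \<infinity>" .
  have "(\<integral>x. g x * (\<integral>y. \<phi> y * \<eta> (x - y) \<partial>lborel) \<partial>lborel) = (\<integral>x. \<integral>y. g x * (\<phi> y * \<eta> (x - y)) \<partial>lborel \<partial>lborel)"
    by (simp only: integral_mult_right_zero)
  also have "\<dots> = (\<integral>y. \<integral>x. g x * (\<phi> y * \<eta> (x - y)) \<partial>lborel \<partial>lborel)"
    by (rule Fubini_nn[OF _ fin]) measurable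
  also have "\<dots> = (\<integral>y. conv g \<eta> y * \<phi> y \<partial>lborel)"
    unfolding conv_def by (subst integral_mult_left_zero[symmetric]) (simp only: mult_ac)
  finally show ?thesis .
qed

text \<open>Exchanges an arbitrary representative of the piece for a continuous one, whose values on
  hyperplanes make sense.\<close>

lemma dyadic_piece_conv:
  assumes \<Psi>: "cutoff \<Psi>" and p: "1 \<le> p" and u: "u \<in> tempered_distributions"
    and g: "g \<in> borel_measurable lborel" "Lp_norm p g < \<infinity>"
    and eq: "\<And>\<phi>. \<phi> \<in> test_functions \<Longrightarrow> dyadic_piece \<Psi> k u \<phi> = regular_distribution g \<phi>"
    and \<phi>: "\<phi> \<in> test_functions"
  shows "dyadic_piece \<Psi> k u \<phi> = (\<integral>y. conv g (bump_kernel \<Psi> (Suc k)) y * \<phi> y \<partial>lborel)"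
proof -
  have \<phi>s: "\<phi> \<in> schwartz_functions" by (rule test_schwartz[OF \<phi>])
  have \<psi>: "inv_fourier \<phi> \<in> schwartz_functions" by (rule inv_fourier_schwartz[OF \<phi>s])
  have cm: "fourier (\<lambda>\<xi>. cut \<Psi> (Suc k) \<xi> * inv_fourier \<phi> \<xi>) \<in> schwartz_functions"
    by (rule fourier_schwartz[OF test_schwartz[OF cut_mult_test[OF \<Psi> schwartz_smooth[OF \<psi>]]]])
  have "dyadic_piece \<Psi> k u \<phi> = dyadic_piece \<Psi> k u (fourier (\<lambda>\<xi>. cut \<Psi> (Suc k) \<xi> * inv_fourier \<phi> \<xi>))"
    by (rule dyadic_piece_reproduce[OF \<Psi> \<phi>s])
  also have "\<dots> = (\<integral>x. g x * fourier (\<lambda>\<xi>. cut \<Psi> (Suc k) \<xi> * inv_fourier \<phi> \<xi>) x \<partial>lborel)"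
    by (rule tempered_Lp_schwartz[OF \<Psi> p dyadic_piece_tempered[OF \<Psi> u] g _ cm])
       (simp add: eq regular_distribution_def)
  also have "\<dots> = (\<integral>x. g x * (\<integral>y. \<phi> y * bump_kernel \<Psi> (Suc k) (x - y) \<partial>lborel) \<partial>lborel)"
    by (simp only: fourier_cut_inv_fourier[OF \<Psi> \<phi>s])
  also have "\<dots> = (\<integral>y. conv g (bump_kernel \<Psi> (Suc k)) y * \<phi> y \<partial>lborel)"
    by (rule conv_integral_swap[OF p g bump_kernel_schwartz[OF \<Psi>] schwartz_integrable[OF \<phi>s]])
  finally show ?thesis .
qed

lemma conv_slice_continuous:
  fixes F :: "'a::euclidean_space \<times> real \<Rightarrow> complex"
  assumes F: "continuous_on UNIV F" and D: "\<And>z. norm (F z) \<le> D" and \<phi>: "\<phi> \<in> test_functions"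
  shows "continuous_on UNIV (\<lambda>t. \<integral>x. F (x, t) * \<phi> x \<partial>lborel)"
proof -
  have [measurable]: "\<phi> \<in> borel_measurable borel" by (rule test_measurable[OF \<phi>])
  have [measurable]: "(\<lambda>x. F (x, t)) \<in> borel_measurable borel" for t
    by (intro borel_measurable_continuous_onI continuous_on_compose2[OF F]) (auto intro!: continuous_intros)
  have "(\<lambda>n. \<integral>x. F (x, T n) * \<phi> x \<partial>lborel) \<longlonglongrightarrow> (\<integral>x. F (x, t) * \<phi> x \<partial>lborel)" if T: "T \<longlonglongrightarrow> t" for T t
  proof (rule integral_dominated_convergence[where w = "\<lambda>x. D * norm (\<phi> x)"])
    show "integrable lborel (\<lambda>x. D * norm (\<phi> x))"
      by (intro integrable_mult_right integrable_norm schwartz_integrable test_schwartz \<phi>)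
    show "AE x in lborel. norm (F (x, T n) * \<phi> x) \<le> D * norm (\<phi> x)" for n
      unfolding norm_mult by (intro AE_I2 mult_right_mono D) simp
    show "AE x in lborel. (\<lambda>n. F (x, T n) * \<phi> x) \<longlonglongrightarrow> F (x, t) * \<phi> x"
    proof (rule AE_I2)
      fix x
      have "isCont F (x, t)" using F by (simp add: continuous_on_eq_continuous_at)
      moreover have "(\<lambda>n. (x, T n)) \<longlonglongrightarrow> (x, t)" by (intro tendsto_Pair tendsto_const T)
      ultimately have "(\<lambda>n. F (x, T n)) \<longlonglongrightarrow> F (x, t)" by (rule isCont_tendsto_compose)
      then show "(\<lambda>n. F (x, T n) * \<phi> x) \<longlonglongrightarrow> F (x, t) * \<phi> x" by (rule tendsto_mult_right)
    qed
  qed measurable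
  then show ?thesis by (simp add: continuous_on_sequentially comp_def)
qed

text \<open>The Plancherel-Polya-Nikolskii inequality for restrictions to hyperplanes.\<close>

lemma conv_slice_Lp:
  assumes \<Psi>: "cutoff \<Psi>" and p: "1 \<le> p"
  shows "\<exists>C>0. \<forall>j (g :: 'a::euclidean_space \<times> real \<Rightarrow> complex) a t. g \<in> borel_measurable lborel \<longrightarrow> a > 0 \<longrightarrow> Lp_norm p g \<le> ennreal a \<longrightarrow>
    Lp_norm p (\<lambda>x. conv g (bump_kernel \<Psi> j) (x, t)) \<le> ennreal (C * 2 powr (enn2real (1 / p) * real j) * a)"
proof -
  let ?s = "enn2real (1 / p)"
  obtain A where A: "A > 0" "\<And>j (z::'a \<times> real). (\<integral>\<^sup>+x. ennreal (norm (bump_kernel \<Psi> j (x - z))) \<partial>lborel) \<le> ennreal A"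
    using bump_kernel_L1[OF \<Psi>, where 'a="'a \<times> real"] by blast
  obtain B where B: "B > 0" "\<And>j (z::'a \<times> real) t. (\<integral>\<^sup>+y. ennreal (norm (bump_kernel \<Psi> j (z - (y, t)))) \<partial>lborel) \<le> ennreal (2 ^ j * B)"
    using bump_kernel_slice_L1[OF \<Psi>, where 'a='a] by blast
  have "Lp_norm p (\<lambda>x. conv g (bump_kernel \<Psi> j) (x, t)) \<le> ennreal ((A powr (1 - ?s) * B powr ?s) * 2 powr (?s * real j) * a)"
    if g: "g \<in> borel_measurable lborel" "a > 0" "Lp_norm p g \<le> ennreal a" for j and g :: "'a \<times> real \<Rightarrow> complex" and a and t :: real
  proof -
    have [measurable]: "bump_kernel \<Psi> j \<in> borel_measurable (borel :: ('a \<times> real) measure)"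
      by (rule schwartz_measurable[OF bump_kernel_schwartz[OF \<Psi>]])
    have "Lp_norm p (\<lambda>y. \<integral>x. g x * bump_kernel \<Psi> j (x - (y, t)) \<partial>lborel)
       \<le> ennreal (A powr (1 - ?s) * (2 ^ j * B) powr ?s * a)"
    \<comment> \<open>Schur's test from the whole space to the hyperplane: integration over the
      whole space costs \<open>A\<close>, integration over the hyperplane costs 2^j B, and the
      latter enters with the power 1/p.\<close>
    proof (rule Schur_test(2)[OF p g(1,2,3), where K = "\<lambda>x y. bump_kernel \<Psi> j (x - (y, t))"])
      show "(\<lambda>(x, y::'a). bump_kernel \<Psi> j (x - (y, t))) \<in> borel_measurable (lborel \<Otimes>\<^sub>M lborel)"
      proof -
        have "(\<lambda>z :: ('a \<times> real) \<times> 'a. (snd z, t)) \<in> borel_measurable (lborel \<Otimes>\<^sub>M lborel)"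
          by (intro borel_measurable_Pair) measurable
        moreover have "(\<lambda>z :: ('a \<times> real) \<times> 'a. fst z) \<in> borel_measurable (lborel \<Otimes>\<^sub>M lborel)"
          by measurable
        ultimately have "(\<lambda>z :: ('a \<times> real) \<times> 'a. fst z - (snd z, t)) \<in> borel_measurable (lborel \<Otimes>\<^sub>M lborel)"
          by (rule borel_measurable_diff[rotated])
        from measurable_compose[OF this schwartz_measurable[OF bump_kernel_schwartz[OF \<Psi>, of j]]]
        show ?thesis unfolding case_prod_beta by simp
      qed
    qed (use A B in auto)
    moreover have "(2 ^ j * B) powr ?s = B powr ?s * 2 powr (?s * real j)"
      using B(1) by (simp add: powr_mult powr_powr mult.commute flip: powr_realpow)
    ultimately show ?thesis by (simp add: conv_def mult_ac)
  qed
  moreover have "A powr (1 - ?s) * B powr ?s > 0" using A B by simp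
  ultimately show ?thesis by blast
qed

text \<open>Write x = x^(1-q) x^q. Every term x^q is at most the total S, so the first factor is at
  most S^((1-q)/q).\<close>

lemma lq_le_l1:
  fixes x :: "nat \<Rightarrow> real"
  assumes x: "\<And>k. x k \<ge> 0" and q: "0 < q" "q \<le> 1" and s: "summable (\<lambda>k. x k powr q)"
  shows "summable x" "(\<Sum>k. x k) \<le> (\<Sum>k. x k powr q) powr (1 / q)"
proof -
  define S where "S = (\<Sum>k. x k powr q)"
  have le: "x k \<le> S powr ((1 - q) / q) * x k powr q" for k
  proof (cases "x k = 0")
    case False
    have "x k powr q \<le> S" unfolding S_def using sum_le_suminf[OF s, of "{k}"] by simp
    then have "(x k powr q) powr ((1 - q) / q) \<le> S powr ((1 - q) / q)" using q by (intro powr_mono2) auto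
    then have "x k powr (1 - q) * x k powr q \<le> S powr ((1 - q) / q) * x k powr q"
      using q by (intro mult_right_mono) (auto simp: powr_powr)
    then show ?thesis using x[of k] by (simp add: powr_add[symmetric])
  qed simp
  show sx: "summable x"
    by (rule summable_comparison_test'[OF summable_mult[OF s]]) (use le x in auto)
  have S0: "S \<ge> 0" unfolding S_def by (intro suminf_nonneg s) auto
  have "(\<Sum>k. x k) \<le> (\<Sum>k. S powr ((1 - q) / q) * x k powr q)" by (intro suminf_le le sx summable_mult s)
  also have "\<dots> = S powr ((1 - q) / q) * S" unfolding S_def by (rule suminf_mult[OF s])
  also have "\<dots> = S powr (1 / q)"
  proof (cases "S = 0")
    case False
    then have "S powr ((1 - q) / q) * S powr 1 = S powr (1 / q)" using q by (subst powr_add[symmetric]) (simp add: field_simps)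
    then show ?thesis using S0 by simp
  qed simp
  finally show "(\<Sum>k. x k) \<le> (\<Sum>k. x k powr q) powr (1 / q)" by (simp add: S_def)
qed

lemma ennreal_powr_real: "0 \<le> r \<Longrightarrow> ennreal_powr (ennreal r) b = ennreal (r powr b)"
  by (simp add: ennreal_powr_def)

text \<open>The place where \<open>q \<le> 1\<close> acts on the boundedness of the trace. Every
  piece has finite norm, because one infinite term would make the Besov sum infinite.\<close>

lemma besov_l1:
  fixes u :: "('a::euclidean_space \<Rightarrow> complex) \<Rightarrow> complex"
  assumes q: "0 < q" "q \<le> 1" and fin: "besov_norm \<Psi> s p q u < \<infinity>"
  obtains l where "\<And>k. Lp_norm_dist p (dyadic_piece \<Psi> k u) = ennreal (l k)" "\<And>k. l k \<ge> 0"
    "summable (\<lambda>k. 2 powr (s * real k) * l k)" "ennreal (\<Sum>k. 2 powr (s * real k) * l k) \<le> besov_norm \<Psi> s p q u"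
proof -
  obtain Q where Q: "q = ennreal Q" "Q > 0" "Q \<le> 1"
    using q by (cases q) (auto simp: top_unique simp flip: ennreal_1)
  let ?L = "\<lambda>k. Lp_norm_dist p (dyadic_piece \<Psi> k u)"
  let ?S = "\<Sum>k. ennreal (2 powr (s * real k * Q)) * ennreal_powr (?L k) Q"
  have norm: "besov_norm \<Psi> s p q u = ennreal_powr ?S (1 / Q)" using Q by (simp add: besov_norm_def)
  have S: "?S \<noteq> \<infinity>" using fin unfolding norm by (auto simp: ennreal_powr_def)
  have Lfin: "?L k \<noteq> \<infinity>" for k
  proof
    assume "?L k = \<infinity>"
    then have "ennreal (2 powr (s * real k * Q)) * ennreal_powr (?L k) Q = \<infinity>" by (simp add: ennreal_powr_def ennreal_mult_top)
    moreover have "ennreal (2 powr (s * real k * Q)) * ennreal_powr (?L k) Q \<le> ?S"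
      using sum_le_suminf[of "\<lambda>k. ennreal (2 powr (s * real k * Q)) * ennreal_powr (?L k) Q" "{k}"] by simp
    ultimately show False using S by (simp add: top_unique)
  qed
  define l where "l k = enn2real (?L k)" for k
  have l: "?L k = ennreal (l k)" "l k \<ge> 0" for k using Lfin[of k] by (auto simp: l_def less_top)
  let ?x = "\<lambda>k. 2 powr (s * real k) * l k"
  have trm: "ennreal (2 powr (s * real k * Q)) * ennreal_powr (?L k) Q = ennreal (?x k powr Q)" for k
    using l by (simp add: ennreal_powr_real powr_mult powr_powr flip: ennreal_mult')
  have sm: "summable (\<lambda>k. ?x k powr Q)" using S unfolding trm by (intro summable_suminf_not_top) auto
  have SS: "?S = ennreal (\<Sum>k. ?x k powr Q)" unfolding trm by (rule suminf_ennreal2) (auto intro: sm)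
  have x0: "\<And>k. ?x k \<ge> 0" using l by simp
  have "ennreal (\<Sum>k. ?x k) \<le> besov_norm \<Psi> s p q u"
    unfolding norm SS using lq_le_l1(2)[OF x0 Q(2,3) sm]
    by (subst ennreal_powr_real) (auto intro!: suminf_nonneg sm ennreal_leI)
  then show ?thesis using that[of l] l lq_le_l1(1)[OF x0 Q(2,3) sm] by blast
qed

theorem trace_bounded:
  fixes q :: ennreal
  assumes \<Psi>: "cutoff \<Psi>" and p: "1 \<le> p" and q: "0 < q" "q \<le> 1"
  shows "\<exists>c::real. \<forall>u\<in>besov_space \<Psi> (enn2real (1 / p)) p q. (u :: ('a::euclidean_space \<times> real \<Rightarrow> complex) \<Rightarrow> complex) \<in> trace_domain \<and>
     distributional_trace u \<in> Lp_space p \<and>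
     Lp_norm_dist p (distributional_trace u) \<le> ennreal c * besov_norm \<Psi> (enn2real (1 / p)) p q u"
proof -
  let ?s = "enn2real (1 / p)"
  obtain C where C: "C > 0" "\<And>j (g :: 'a \<times> real \<Rightarrow> complex) a t. g \<in> borel_measurable lborel \<Longrightarrow> a > 0 \<Longrightarrow> Lp_norm p g \<le> ennreal a \<Longrightarrow>
    Lp_norm p (\<lambda>x. conv g (bump_kernel \<Psi> j) (x, t)) \<le> ennreal (C * 2 powr (?s * real j) * a)"
    using conv_slice_Lp[OF \<Psi> p, where 'a='a] by metis
  \<comment> \<open>The factor 2^s arises because piece \<open>k\<close> is reproduced by the kernel
    of index \<open>Suc k\<close>.\<close>
  define c where "c = C * 2 powr ?s"
  have c: "c > 0" using C by (simp add: c_def)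
  have "u \<in> trace_domain \<and> distributional_trace u \<in> Lp_space p \<and>
     Lp_norm_dist p (distributional_trace u) \<le> ennreal c * besov_norm \<Psi> ?s p q u"
    if u: "u \<in> besov_space \<Psi> ?s p q" for u :: "('a \<times> real \<Rightarrow> complex) \<Rightarrow> complex"
  proof -
    have ut: "u \<in> tempered_distributions" and fin: "besov_norm \<Psi> ?s p q u < \<infinity>" using u by (auto simp: besov_space_def)
    obtain l where l: "\<And>k. Lp_norm_dist p (dyadic_piece \<Psi> k u) = ennreal (l k)" "\<And>k. l k \<ge> 0"
      "summable (\<lambda>k. 2 powr (?s * real k) * l k)" "ennreal (\<Sum>k. 2 powr (?s * real k) * l k) \<le> besov_norm \<Psi> ?s p q u"
      by (rule besov_l1[OF q fin]) (rule that)
    have key: "u \<in> trace_domain \<and> distributional_trace u \<in> Lp_space p \<and>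
      Lp_norm_dist p (distributional_trace u) \<le> ennreal (c * ((\<Sum>k. 2 powr (?s * real k) * l k) + 2 * \<epsilon>))" if \<epsilon>: "\<epsilon> > 0" for \<epsilon> :: real
    proof -
      \<comment> \<open>The norm of a piece is an infimum over representatives, so one is chosen
        within a slack, which also makes the bounds positive. The slack is scaled so that after
        multiplication by 2^(sk) it sums to 2 \<epsilon>.\<close>
      define \<alpha> where "\<alpha> k = l k + \<epsilon> * (1/2) ^ k * 2 powr (- (?s * real k))" for k
      have \<alpha>: "\<alpha> k > 0" for k unfolding \<alpha>_def using l \<epsilon> by (intro add_nonneg_pos mult_pos_pos) auto
      have "\<exists>g. g \<in> borel_measurable lborel \<and> (\<forall>\<phi>\<in>test_functions. dyadic_piece \<Psi> k u \<phi> = regular_distribution g \<phi>) \<and> Lp_norm p g \<le> ennreal (\<alpha> k)" for k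
      proof -
        have "Lp_norm_dist p (dyadic_piece \<Psi> k u) < ennreal (\<alpha> k)"
          unfolding l(1) using l(2)[of k] \<epsilon> by (intro ennreal_lessI \<alpha>) (simp add: \<alpha>_def)
        then show ?thesis unfolding Lp_norm_dist_def Inf_less_iff
          by (auto simp: locally_integrable_def intro: less_imp_le)
      qed
      then have "\<forall>k. \<exists>g. g \<in> borel_measurable lborel \<and> (\<forall>\<phi>\<in>test_functions. dyadic_piece \<Psi> k u \<phi> = regular_distribution g \<phi>) \<and> Lp_norm p g \<le> ennreal (\<alpha> k)" ..
      from choice[OF this] obtain g where "\<forall>k. g k \<in> borel_measurable lborel \<and> (\<forall>\<phi>\<in>test_functions. dyadic_piece \<Psi> k u \<phi> = regular_distribution (g k) \<phi>) \<and> Lp_norm p (g k) \<le> ennreal (\<alpha> k)" ..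
      then have g: "\<And>k. g k \<in> borel_measurable lborel"
        "\<And>k \<phi>. \<phi> \<in> test_functions \<Longrightarrow> dyadic_piece \<Psi> k u \<phi> = regular_distribution (g k) \<phi>" "\<And>k. Lp_norm p (g k) \<le> ennreal (\<alpha> k)"
        by blast+
      have gf: "Lp_norm p (g k) < \<infinity>" for k using g(3)[of k] by (rule le_less_trans) simp
      define G where "G k x t = conv (g k) (bump_kernel \<Psi> (Suc k)) (x, t)" for k x t
      define a where "a k = c * (2 powr (?s * real k) * l k + \<epsilon> * (1/2) ^ k)" for k
      have a_eq: "C * 2 powr (?s * real (Suc k)) * \<alpha> k = a k" for k
      proof -
        have "2 powr (?s * real (Suc k)) = 2 powr ?s * 2 powr (?s * real k)" by (simp add: powr_add[symmetric] distrib_left)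
        moreover have "2 powr (?s * real k) * 2 powr (- (?s * real k)) = 1" by (simp add: powr_add[symmetric])
        ultimately show ?thesis by (simp add: a_def \<alpha>_def c_def distrib_left mult_ac)
      qed
      have sg: "(\<lambda>k. \<epsilon> * (1/2) ^ k) sums (\<epsilon> * 2)"
        using sums_mult[OF geometric_sums[of "1/2::real"], of \<epsilon>] by simp
      have sa: "a sums (c * ((\<Sum>k. 2 powr (?s * real k) * l k) + \<epsilon> * 2))"
        unfolding a_def by (intro sums_mult sums_add summable_sums l sg)
      have cont: "continuous_on UNIV (conv (g k) (bump_kernel \<Psi> (Suc k)))" for k
        by (rule conv_continuous[OF p g(1) gf bump_kernel_schwartz[OF \<Psi>]])
      interpret trace_series p G a u
      proof
        show "1 \<le> p" by (rule p)
        show "(\<lambda>(x, t). G k x t) \<in> borel_measurable (lborel \<Otimes>\<^sub>M lborel)" for k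
          using borel_measurable_continuous_onI[OF cont[of k]] by (simp add: G_def lborel_prod)
        show "a k > 0" for k unfolding a_eq[symmetric] using C \<alpha> by simp
        show "summable a" using sa by (rule sums_summable)
        show "Lp_norm p (\<lambda>x. G k x t) \<le> ennreal (a k)" for k t
          unfolding G_def a_eq[symmetric] by (rule C(2)[OF g(1) \<alpha> g(3)])
        show "continuous_on UNIV (\<lambda>t. \<integral>x. G k x t * \<phi> x \<partial>lborel)" if \<phi>: "\<phi> \<in> test_functions" for k \<phi>
        proof -
          obtain D where "\<And>z. norm (conv (g k) (bump_kernel \<Psi> (Suc k)) z) \<le> D"
            using conv_bounded[OF p g(1) gf bump_kernel_schwartz[OF \<Psi>]] by metis
          then show ?thesis unfolding G_def by (rule conv_slice_continuous[OF cont _ \<phi>])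
        qed
        show "(\<lambda>k. \<integral>z. G k (fst z) (snd z) * \<phi> z \<partial>lborel) sums u \<phi>" if \<phi>: "\<phi> \<in> test_functions" for \<phi>
          using dyadic_sums[OF \<Psi> ut test_schwartz[OF \<phi>]]
          by (simp add: dyadic_piece_conv[OF \<Psi> p ut g(1) gf g(2) \<phi>] G_def)
      qed
      have m: "(\<lambda>x. \<Sum>k. G k x 0) \<in> borel_measurable lborel" by measurable
      have "Lp_norm p (\<lambda>x. \<Sum>k. G k x 0) < \<infinity>"
        using trace_Lp(2)[OF \<Psi>] by (rule le_less_trans) simp
      then have "distributional_trace u \<in> Lp_space p"
        unfolding trace_Lp(1)[OF \<Psi>] Lp_space_def using m by blast
      moreover have "Lp_norm_dist p (distributional_trace u) \<le> ennreal (\<Sum>k. a k)"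
        unfolding trace_Lp(1)[OF \<Psi>] by (rule order_trans[OF Lp_norm_dist_regular[OF p m] trace_Lp(2)[OF \<Psi>]])
      ultimately show ?thesis using trace_domain sums_unique[OF sa] by (simp add: mult.commute)
    qed
    \<comment> \<open>The trace and \<open>c\<close> do not depend on \<epsilon>, so the slack may
      tend to 0; the choice e / (2 c) makes its total contribution equal to
      \<open>e\<close>.\<close>
    have "Lp_norm_dist p (distributional_trace u) \<le> ennreal (c * (\<Sum>k. 2 powr (?s * real k) * l k))"
    proof (rule ennreal_le_epsilon)
      fix e :: real assume e: "0 < e"
      have "Lp_norm_dist p (distributional_trace u) \<le> ennreal (c * ((\<Sum>k. 2 powr (?s * real k) * l k) + 2 * (e / (2 * c))))"
        using key[of "e / (2 * c)"] e c by simp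
      also have "c * ((\<Sum>k. 2 powr (?s * real k) * l k) + 2 * (e / (2 * c))) = c * (\<Sum>k. 2 powr (?s * real k) * l k) + e"
        using c by (simp add: field_simps)
      also have "ennreal \<dots> = ennreal (c * (\<Sum>k. 2 powr (?s * real k) * l k)) + ennreal e"
        using e c l by (intro ennreal_plus mult_nonneg_nonneg suminf_nonneg) auto
      finally show "Lp_norm_dist p (distributional_trace u) \<le> ennreal (c * (\<Sum>k. 2 powr (?s * real k) * l k)) + ennreal e" .
    qed
    also have "\<dots> = ennreal c * ennreal (\<Sum>k. 2 powr (?s * real k) * l k)" using c by (simp add: ennreal_mult')
    also have "\<dots> \<le> ennreal c * besov_norm \<Psi> ?s p q u" by (intro mult_left_mono l) simp
    finally show ?thesis using key[of 1] by simp
  qed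
  then show ?thesis by blast
qed

section \<open>Approximation by band-limited functions\<close>

lemma integrable_translate:
  fixes f :: "'a::euclidean_space \<Rightarrow> 'b::{banach, second_countable_topology}"
  assumes "integrable lborel f"
  shows "integrable lborel (\<lambda>y. f (y + v))" "(\<integral>y. f (y + v) \<partial>lborel) = (\<integral>y. f y \<partial>lborel)"
proof -
  show "integrable lborel (\<lambda>y. f (y + v))" using integrable_affine[OF assms, of 1 v] by (simp add: add.commute)
  show "(\<integral>y. f (y + v) \<partial>lborel) = (\<integral>y. f y \<partial>lborel)"
    using integral_affine[of 1 f v] borel_measurable_integrable[OF assms] by (simp add: add.commute)
qed

text \<open>The L_1 modulus of continuity of \<open>f\<close> at the shift \<open>v\<close>.\<close>

definition osc :: "('a::euclidean_space \<Rightarrow> complex) \<Rightarrow> 'a \<Rightarrow> real" where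
  "osc f v = (\<integral>y. norm (f (y + v) - f y) \<partial>lborel)"

lemma osc_integrable:
  fixes f :: "'a::euclidean_space \<Rightarrow> complex"
  shows "integrable lborel f \<Longrightarrow> integrable lborel (\<lambda>y. norm (f (y + v) - f y))"
  by (intro integrable_norm Bochner_Integration.integrable_diff integrable_translate(1))

lemma osc_nonneg: "0 \<le> osc f v"
  unfolding osc_def by (rule Bochner_Integration.integral_nonneg) simp

lemma osc_le:
  assumes "integrable lborel f" shows "osc f v \<le> 2 * (\<integral>y. norm (f y) \<partial>lborel)"
proof -
  have i: "integrable lborel (\<lambda>y. norm (f y))" using assms by simp
  have "osc f v \<le> (\<integral>y. norm (f (y + v)) + norm (f y) \<partial>lborel)"
    unfolding osc_def using integrable_translate(1)[OF i] i
    by (intro integral_mono osc_integrable assms Bochner_Integration.integrable_add norm_triangle_ineq4)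
  also have "\<dots> = 2 * (\<integral>y. norm (f y) \<partial>lborel)"
    by (subst Bochner_Integration.integral_add[OF integrable_translate(1)[OF i] i]) (simp add: integrable_translate(2)[OF i])
  finally show ?thesis .
qed

lemma osc_add:
  assumes f: "integrable lborel f" and g: "integrable lborel g"
  shows "osc (\<lambda>x. f x + g x) v \<le> osc f v + osc g v"
proof -
  have "osc (\<lambda>x. f x + g x) v \<le> (\<integral>y. norm (f (y + v) - f y) + norm (g (y + v) - g y) \<partial>lborel)"
    unfolding osc_def
  proof (intro integral_mono osc_integrable[of "\<lambda>x. f x + g x"] Bochner_Integration.integrable_add osc_integrable f g)
    fix y show "norm (f (y + v) + g (y + v) - (f y + g y)) \<le> norm (f (y + v) - f y) + norm (g (y + v) - g y)"
      using norm_triangle_ineq[of "f (y + v) - f y" "g (y + v) - g y"] by (simp add: algebra_simps)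
  qed
  also have "\<dots> = osc f v + osc g v"
    unfolding osc_def by (rule Bochner_Integration.integral_add[OF osc_integrable[OF f] osc_integrable[OF g]])
  finally show ?thesis .
qed

text \<open>For an open set the translates of the indicator converge from below, and since they all have
  the same integral this already forces convergence in the mean (Scheffe's argument).\<close>

lemma osc_indicator_open:
  fixes U :: "'a::euclidean_space set"
  assumes U: "open U" and fin: "emeasure lborel U < \<infinity>" and V: "V \<longlonglongrightarrow> 0"
  shows "(\<lambda>n. osc (indicator U) (V n)) \<longlonglongrightarrow> 0"
proof -
  have [measurable]: "U \<in> sets borel" using U by simp
  have i: "integrable lborel (indicator U :: 'a \<Rightarrow> real)" using fin by (intro integrable_real_indicator) auto
  define F where "F n y = max 0 (indicator U y - indicator U (y + V n) :: real)" for n y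
  have iF: "integrable lborel (F n)" for n
    unfolding F_def by (intro integrable_max integrable_zero Bochner_Integration.integrable_diff i integrable_translate(1))
  have "(\<lambda>n. \<integral>y. F n y \<partial>lborel) \<longlonglongrightarrow> (\<integral>y. 0 \<partial>(lborel :: 'a measure))"
  proof (rule integral_dominated_convergence[where w = "indicator U"])
    show "AE y in lborel. (\<lambda>n. F n y) \<longlonglongrightarrow> 0"
    proof (rule AE_I2)
      fix y
      have "eventually (\<lambda>n. F n y = 0) sequentially"
      proof (cases "y \<in> U")
        case True
        have "(\<lambda>n. y + V n) \<longlonglongrightarrow> y + 0" by (intro tendsto_add tendsto_const V)
        then have "eventually (\<lambda>n. y + V n \<in> U) sequentially" using True U by (simp add: topological_tendstoD)
        then show ?thesis by eventually_elim (simp add: F_def True)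
      qed (simp add: F_def)
      then show "(\<lambda>n. F n y) \<longlonglongrightarrow> 0" by (rule tendsto_eventually)
    qed
    show "AE y in lborel. norm (F n y) \<le> indicator U y" for n
      by (rule AE_I2) (auto simp: F_def indicator_def)
  qed (use iF i in auto)
  moreover have "osc (indicator U) (V n) = 2 * (\<integral>y. F n y \<partial>lborel)" for n
  proof -
    have e: "norm (indicator U (y + V n) - indicator U y :: complex) = 2 * F n y + (indicator U (y + V n) - indicator U y)" for y
      by (auto simp: F_def indicator_def)
    have "(\<integral>y. (2 * F n y + (indicator U (y + V n) - indicator U y)) \<partial>lborel) = 2 * (\<integral>y. F n y \<partial>lborel)"
      using iF[of n] i integrable_translate[OF i, of "V n"] by simp
    then show ?thesis unfolding osc_def e .
  qed
  ultimately show ?thesis using tendsto_mult_left[of _ "0::real" sequentially 2] by simp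
qed

lemma integrable_indicator_complex:
  assumes "A \<in> sets lborel" "emeasure lborel A < \<infinity>"
  shows "integrable lborel (indicator A :: 'a::euclidean_space \<Rightarrow> complex)"
proof -
  have "integrable lborel (\<lambda>x. complex_of_real (indicator A x))"
    using integrable_real_indicator[OF assms] by (rule integrable_of_real)
  moreover have "(\<lambda>x. complex_of_real (indicator A x)) = indicator A" by (auto simp: indicator_def fun_eq_iff)
  ultimately show ?thesis by simp
qed

text \<open>By \<open>osc_add\<close> and \<open>osc_le\<close>, a change of \<open>f\<close> alters
  \<open>osc\<close> by at most twice the L_1 norm of the change, so the claim passes to limits. For
  an indicator, outer regularity supplies an open set of slightly larger measure.\<close>

lemma osc_tendsto_0:
  fixes f :: "'a::euclidean_space \<Rightarrow> complex"
  assumes "integrable lborel f"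
  shows "\<And>V. V \<longlonglongrightarrow> 0 \<Longrightarrow> (\<lambda>n. osc f (V n)) \<longlonglongrightarrow> 0"
  using assms
proof (induction rule: integrable_induct)
  case (base A c)
  have A[measurable]: "A \<in> sets borel" using base by simp
  have "(\<lambda>n. osc (indicator A) (V n)) \<longlonglongrightarrow> 0"
  proof (rule LIMSEQ_I)
    fix e :: real assume e: "0 < e"
    obtain U where U: "open U" "A \<subseteq> U" "emeasure lborel (U - A) < ennreal (e / 4)"
      by (rule outer_regular_lborel[OF A, of "e / 4"]) (use e in auto)
    have [measurable]: "U \<in> sets borel" using U by simp
    have "emeasure lborel U \<le> emeasure lborel A + emeasure lborel (U - A)"
      using emeasure_subadditive[of A lborel "U - A"] U(2) by (simp add: Un_absorb1)
    also have "\<dots> < \<infinity>" using base(2) U(3) by (auto simp: less_top[symmetric] intro: order.strict_trans)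
    finally have Ufin: "emeasure lborel U < \<infinity>" .
    have i: "integrable lborel (indicator U :: 'a \<Rightarrow> complex)" "integrable lborel (\<lambda>y. - indicator (U - A) y :: complex)"
    proof -
      show "integrable lborel (indicator U :: 'a \<Rightarrow> complex)" by (rule integrable_indicator_complex[OF _ Ufin]) simp
      have "emeasure lborel (U - A) < \<infinity>" using U(3) by (rule order.strict_trans) simp
      then show "integrable lborel (\<lambda>y. - indicator (U - A) y :: complex)"
        by (intro Bochner_Integration.integrable_minus integrable_indicator_complex) simp_all
    qed
    have m: "(\<integral>y. norm (- indicator (U - A) y :: complex) \<partial>lborel) < e / 4"
    proof -
      have "(\<lambda>y. norm (- indicator (U - A) y :: complex)) = indicator (U - A)" by (auto simp: indicator_def fun_eq_iff)
      then have "(\<integral>y. norm (- indicator (U - A) y :: complex) \<partial>lborel) = measure lborel (U - A)" by simp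
      also have "\<dots> < e / 4"
      proof -
        have "emeasure lborel (U - A) = ennreal (measure lborel (U - A))"
          by (rule emeasure_eq_ennreal_measure) (use U(3) in auto)
        then show ?thesis using U(3) e by (simp add: ennreal_less_iff)
      qed
      finally show ?thesis .
    qed
    obtain N where N: "\<And>n. n \<ge> N \<Longrightarrow> norm (osc (indicator U) (V n)) < e / 2"
      using LIMSEQ_D[OF osc_indicator_open[OF U(1) Ufin base(3)], of "e / 2"] e by auto
    have "norm (osc (indicator A) (V n) - 0) < e" if "n \<ge> N" for n
    proof -
      have "(indicator A :: 'a \<Rightarrow> complex) = (\<lambda>y. indicator U y + - indicator (U - A) y)"
        using U(2) by (auto simp: indicator_def fun_eq_iff)
      then have "osc (indicator A) (V n) \<le> osc (indicator U) (V n) + osc (\<lambda>y. - indicator (U - A) y) (V n)"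
        using osc_add[OF i] by metis
      also have "\<dots> < e / 2 + 2 * (e / 4)" using N[OF that] osc_le[OF i(2), of "V n"] m by simp
      finally show ?thesis using osc_nonneg[of "indicator A" "V n"] by simp
    qed
    then show "\<exists>N. \<forall>n\<ge>N. norm (osc (indicator A) (V n) - 0) < e" by blast
  qed
  then have "(\<lambda>n. osc (indicator A) (V n) * norm c) \<longlonglongrightarrow> 0 * norm c" by (rule tendsto_mult_right)
  moreover have "osc (\<lambda>x. indicator A x *\<^sub>R c) v = osc (indicator A) v * norm c" for v
  proof -
    have "norm (indicator A (y + v) *\<^sub>R c - indicator A y *\<^sub>R c) = norm (indicator A (y + v) - indicator A y :: complex) * norm c" for y
      by (auto simp: indicator_def)
    then show ?thesis unfolding osc_def by simp
  qed
  ultimately show ?case by simp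
next
  case (add f g)
  have "(\<lambda>n. osc f (V n) + osc g (V n)) \<longlonglongrightarrow> 0 + 0" by (intro tendsto_add add)
  then have lim: "(\<lambda>n. osc f (V n) + osc g (V n)) \<longlonglongrightarrow> 0" by simp
  show ?case
    by (rule tendsto_sandwich[OF _ _ tendsto_const lim]) (auto intro!: always_eventually osc_nonneg osc_add add)
next
  case (lim f s)
  have fi: "integrable lborel f" by (rule lim.hyps(4))
  have "(\<lambda>i. \<integral>y. norm (f y + (-1) * s i y) \<partial>lborel) \<longlonglongrightarrow> (\<integral>y. norm (f y + (-1) * f y) \<partial>lborel)"
  proof (rule integral_dominated_convergence[where w = "\<lambda>y. 3 * norm (f y)"])
    show "AE y in lborel. (\<lambda>i. norm (f y + (-1) * s i y)) \<longlonglongrightarrow> norm (f y + (-1) * f y)"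
      by (intro AE_I2 tendsto_norm tendsto_add tendsto_mult tendsto_const lim.hyps(2)) simp
    show "AE y in lborel. norm (norm (f y + (-1) * s i y)) \<le> 3 * norm (f y)" for i
    proof (rule AE_I2)
      fix y
      show "norm (norm (f y + (-1) * s i y)) \<le> 3 * norm (f y)"
        using norm_triangle_ineq4[of "f y" "s i y"] lim.hyps(3)[of y i] by simp
    qed
  qed (use lim.hyps(1)[THEN borel_measurable_integrable] lim.hyps(4) in auto)
  then have conv: "(\<lambda>i. \<integral>y. norm (f y + (-1) * s i y) \<partial>lborel) \<longlonglongrightarrow> 0" by simp
  show ?case
  proof (rule LIMSEQ_I)
    fix e :: real assume e: "0 < e"
    obtain i where i: "(\<integral>y. norm (f y + (-1) * s i y) \<partial>lborel) < e / 4"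
      using LIMSEQ_D[OF conv, of "e / 4"] e by force
    obtain N where N: "\<And>n. n \<ge> N \<Longrightarrow> norm (osc (s i) (V n)) < e / 2"
      using LIMSEQ_D[OF lim.IH[OF lim.prems], of "e / 2"] e by auto
    have r: "integrable lborel (\<lambda>y. f y + (-1) * s i y)"
      using fi lim.hyps(1)[of i] by (intro Bochner_Integration.integrable_add integrable_mult_right) auto
    have "norm (osc f (V n) - 0) < e" if "n \<ge> N" for n
    proof -
      have "osc (\<lambda>y. s i y + (f y + (-1) * s i y)) (V n) \<le> osc (s i) (V n) + osc (\<lambda>y. f y + (-1) * s i y) (V n)"
        by (rule osc_add[OF lim.hyps(1) r])
      also have "\<dots> < e / 2 + 2 * (e / 4)" using N[OF that] osc_le[OF r, of "V n"] i by simp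
      finally show ?thesis using osc_nonneg[of f "V n"] by simp
    qed
    then show "\<exists>N. \<forall>n\<ge>N. norm (osc f (V n) - 0) < e" by blast
  qed
qed

section \<open>Approximation in L_p by convolution\<close>

lemma bump_kernel_integral:
  assumes \<Psi>: "cutoff \<Psi>" shows "(\<integral>z. bump_kernel \<Psi> 0 (z::'a::euclidean_space) \<partial>lborel) = 1"
proof -
  have c: "(cut \<Psi> 0 :: 'a \<Rightarrow> complex) \<in> schwartz_functions" by (rule test_schwartz[OF cut_test[OF \<Psi>]])
  have "(\<integral>z. bump_kernel \<Psi> 0 (z::'a) \<partial>lborel) = of_real (1 / (2 * pi) ^ DIM('a)) * FT 1 (FT (-1) (cut \<Psi> 0)) (0::'a)"
    unfolding bump_kernel_def integral_mult_right_zero by (simp add: FT_def[of 1])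
  \<comment> \<open>By inversion the mass of the kernel is the value of the cut-off at the origin,
    which is 1.\<close>
  also have "FT 1 (FT (-1) (cut \<Psi> 0)) (0::'a) = of_real ((2 * pi) ^ DIM('a)) * cut \<Psi> 0 (0::'a)"
    using FT_inversion[OF _ c, of "-1" 0] by simp
  finally show ?thesis by (simp add: cut_1[OF \<Psi>])
qed

lemma conv_bump_kernel_eq:
  fixes f :: "'a::euclidean_space \<Rightarrow> complex"
  assumes \<Psi>: "cutoff \<Psi>" and f[measurable]: "f \<in> borel_measurable borel"
  shows "conv f (bump_kernel \<Psi> m) y = (\<integral>z. f (y + inverse (2 ^ m) *\<^sub>R z) * bump_kernel \<Psi> 0 z \<partial>lborel)"
proof -
  have [measurable]: "bump_kernel \<Psi> m \<in> borel_measurable (borel :: 'a measure)"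
    by (rule schwartz_measurable[OF bump_kernel_schwartz[OF \<Psi>]])
  have "conv f (bump_kernel \<Psi> m) y = \<bar>inverse (2 ^ m)\<bar> ^ DIM('a) *\<^sub>R
     (\<integral>z. f (y + inverse (2 ^ m) *\<^sub>R z) * bump_kernel \<Psi> m ((y + inverse (2 ^ m) *\<^sub>R z) - y) \<partial>lborel)"
    unfolding conv_def by (rule integral_affine) auto
  also have "\<dots> = (\<integral>z. of_real (inverse (2 ^ m) ^ DIM('a)) * (f (y + inverse (2 ^ m) *\<^sub>R z) * bump_kernel \<Psi> m (inverse (2 ^ m) *\<^sub>R z)) \<partial>lborel)"
    by (subst integral_mult_right_zero) (simp add: scaleR_conv_of_real)
  also have "\<dots> = (\<integral>z. f (y + inverse (2 ^ m) *\<^sub>R z) * bump_kernel \<Psi> 0 z \<partial>lborel)"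
  proof (rule Bochner_Integration.integral_cong[OF refl])
    fix z :: 'a
    have e: "complex_of_real (inverse (2 ^ m) ^ DIM('a)) * of_real ((2 ^ m) ^ DIM('a)) = 1"
      unfolding of_real_mult[symmetric] power_mult_distrib[symmetric] by simp
    have "bump_kernel \<Psi> m (inverse (2 ^ m) *\<^sub>R z) = of_real ((2 ^ m) ^ DIM('a)) * bump_kernel \<Psi> 0 z"
      by (subst bump_kernel_scale[OF \<Psi>]) simp
    then have "of_real (inverse (2 ^ m) ^ DIM('a)) * (f (y + inverse (2 ^ m) *\<^sub>R z) * bump_kernel \<Psi> m (inverse (2 ^ m) *\<^sub>R z))
      = (complex_of_real (inverse (2 ^ m) ^ DIM('a)) * of_real ((2 ^ m) ^ DIM('a))) * (f (y + inverse (2 ^ m) *\<^sub>R z) * bump_kernel \<Psi> 0 z)"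
      by (simp only: mult_ac)
    then show "of_real (inverse (2 ^ m) ^ DIM('a)) * (f (y + inverse (2 ^ m) *\<^sub>R z) * bump_kernel \<Psi> m (inverse (2 ^ m) *\<^sub>R z))
      = f (y + inverse (2 ^ m) *\<^sub>R z) * bump_kernel \<Psi> 0 z" by (simp only: e mult_1_left)
  qed
  finally show ?thesis .
qed

text \<open>The kernel has integral 1, so the error at \<open>y\<close> is the integral of f(y + v)
  - f(y) against it, over shifts v that shrink with \<open>m\<close>. Tonelli bounds its L_1 norm by
  an integral of \<open>osc f\<close>, which tends to 0 by domination.\<close>

lemma conv_approx_L1:
  fixes f :: "'a::euclidean_space \<Rightarrow> complex"
  assumes \<Psi>: "cutoff \<Psi>" and f: "integrable lborel f" and R: "\<And>x. norm (f x) \<le> R"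
  shows "(\<lambda>m. \<integral>\<^sup>+y. ennreal (norm (f y - conv f (bump_kernel \<Psi> m) y)) \<partial>lborel) \<longlonglongrightarrow> 0"
proof -
  let ?\<eta> = "bump_kernel \<Psi> 0 :: 'a \<Rightarrow> complex"
  have [measurable]: "f \<in> borel_measurable borel" using f by auto
  have \<eta>i: "integrable lborel ?\<eta>" by (rule schwartz_integrable[OF bump_kernel_schwartz[OF \<Psi>]])
  have [measurable]: "?\<eta> \<in> borel_measurable borel" using \<eta>i by auto
  define h where "h m z = inverse (2 ^ m) *\<^sub>R z" for m and z :: 'a
  have [measurable]: "h m \<in> borel_measurable borel" for m unfolding h_def by measurable
  have b: "(\<integral>\<^sup>+y. ennreal (norm (f y - conv f (bump_kernel \<Psi> m) y)) \<partial>lborel) \<le> (\<integral>\<^sup>+z. ennreal (norm (?\<eta> z) * osc f (h m z)) \<partial>lborel)" for m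
  proof -
    have "norm (f y - conv f (bump_kernel \<Psi> m) y) = norm (\<integral>z. (f (y + h m z) - f y) * ?\<eta> z \<partial>lborel)" for y
    proof -
      have i1: "integrable lborel (\<lambda>z. f (y + h m z) * ?\<eta> z)"
      proof (rule Bochner_Integration.integrable_bound[where f = "\<lambda>z. R * norm (?\<eta> z)"])
        show "integrable lborel (\<lambda>z. R * norm (?\<eta> z))" by (intro integrable_mult_right integrable_norm \<eta>i)
        show "AE z in lborel. norm (f (y + h m z) * ?\<eta> z) \<le> norm (R * norm (?\<eta> z))"
        proof (rule AE_I2)
          fix z
          have "norm (f (y + h m z) * ?\<eta> z) \<le> R * norm (?\<eta> z)" unfolding norm_mult by (intro mult_right_mono R) simp
          then show "norm (f (y + h m z) * ?\<eta> z) \<le> norm (R * norm (?\<eta> z))" by simp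
        qed
      qed measurable
      have "f y = (\<integral>z. f y * ?\<eta> z \<partial>lborel)" by (simp add: bump_kernel_integral[OF \<Psi>])
      moreover have "(\<integral>z. (f (y + h m z) - f y) * ?\<eta> z \<partial>lborel) = (\<integral>z. f (y + h m z) * ?\<eta> z \<partial>lborel) - (\<integral>z. f y * ?\<eta> z \<partial>lborel)"
        unfolding left_diff_distrib by (intro Bochner_Integration.integral_diff i1 integrable_mult_right \<eta>i)
      ultimately have "(\<integral>z. (f (y + h m z) - f y) * ?\<eta> z \<partial>lborel) = conv f (bump_kernel \<Psi> m) y - f y"
        by (simp add: conv_bump_kernel_eq[OF \<Psi>] h_def)
      then show ?thesis by (simp add: norm_minus_commute)
    qed
    then have "(\<integral>\<^sup>+y. ennreal (norm (f y - conv f (bump_kernel \<Psi> m) y)) \<partial>lborel)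
       \<le> (\<integral>\<^sup>+y. \<integral>\<^sup>+z. ennreal (norm ((f (y + h m z) - f y) * ?\<eta> z)) \<partial>lborel \<partial>lborel)"
      by (simp only:) (intro nn_integral_mono enn_norm_integral_le)
    also have "\<dots> = (\<integral>\<^sup>+z. \<integral>\<^sup>+y. ennreal (norm ((f (y + h m z) - f y) * ?\<eta> z)) \<partial>lborel \<partial>lborel)"
      by (rule lborel_pair.Fubini'[symmetric]) measurable
    also have "\<dots> = (\<integral>\<^sup>+z. ennreal (norm (?\<eta> z) * osc f (h m z)) \<partial>lborel)"
    proof (rule nn_integral_cong)
      fix z
      have "(\<integral>\<^sup>+y. ennreal (norm (f (y + h m z) - f y)) \<partial>lborel) = ennreal (osc f (h m z))"
        unfolding osc_def by (rule nn_integral_eq_integral[OF osc_integrable[OF f]]) simp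
      then show "(\<integral>\<^sup>+y. ennreal (norm ((f (y + h m z) - f y) * ?\<eta> z)) \<partial>lborel) = ennreal (norm (?\<eta> z) * osc f (h m z))"
        by (simp add: norm_mult mult.commute ennreal_mult osc_nonneg nn_integral_cmult)
    qed
    finally show ?thesis .
  qed
  have [measurable]: "(\<lambda>z. osc f (h m z)) \<in> borel_measurable lborel" for m
    unfolding osc_def by measurable
  have hl: "(\<lambda>m. h m z) \<longlonglongrightarrow> 0" for z
  proof -
    have "(\<lambda>m. inverse ((2::real) ^ m)) \<longlonglongrightarrow> 0" using LIMSEQ_inverse_realpow_zero[of 2] by simp
    then have "(\<lambda>m. inverse (2 ^ m) *\<^sub>R z) \<longlonglongrightarrow> 0 *\<^sub>R z" by (intro tendsto_scaleR tendsto_const)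
    then show ?thesis by (simp add: h_def)
  qed
  have "(\<lambda>m. \<integral>\<^sup>+z. ennreal (norm (?\<eta> z) * osc f (h m z)) \<partial>lborel) \<longlonglongrightarrow> (\<integral>\<^sup>+z. 0 \<partial>(lborel::'a measure))"
  proof (rule nn_integral_dominated_convergence[where w = "\<lambda>z. ennreal (norm (?\<eta> z) * (2 * (\<integral>y. norm (f y) \<partial>lborel)))"])
    have "integrable lborel (\<lambda>z. norm (?\<eta> z) * (2 * (\<integral>y. norm (f y) \<partial>lborel)))"
      by (intro integrable_mult_left integrable_norm \<eta>i)
    then show "(\<integral>\<^sup>+z. ennreal (norm (?\<eta> z) * (2 * (\<integral>y. norm (f y) \<partial>lborel))) \<partial>lborel) < \<infinity>"
      by (subst nn_integral_eq_integral) (auto intro!: AE_I2 mult_nonneg_nonneg)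
    show "AE z in lborel. ennreal (norm (?\<eta> z) * osc f (h m z)) \<le> ennreal (norm (?\<eta> z) * (2 * (\<integral>y. norm (f y) \<partial>lborel)))" for m
      by (intro AE_I2 ennreal_leI mult_left_mono osc_le f) simp
    show "AE z in lborel. (\<lambda>m. ennreal (norm (?\<eta> z) * osc f (h m z))) \<longlonglongrightarrow> 0"
    proof (rule AE_I2)
      fix z
      have "(\<lambda>m. norm (?\<eta> z) * osc f (h m z)) \<longlonglongrightarrow> norm (?\<eta> z) * 0"
        by (intro tendsto_mult tendsto_const osc_tendsto_0[OF f] hl)
      then have "(\<lambda>m. ennreal (norm (?\<eta> z) * osc f (h m z))) \<longlonglongrightarrow> ennreal 0" by (intro tendsto_ennrealI) simp
      then show "(\<lambda>m. ennreal (norm (?\<eta> z) * osc f (h m z))) \<longlonglongrightarrow> 0" by simp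
    qed
  qed measurable
  then have lim: "(\<lambda>m. \<integral>\<^sup>+z. ennreal (norm (?\<eta> z) * osc f (h m z)) \<partial>lborel) \<longlonglongrightarrow> 0" by simp
  show ?thesis
    by (rule tendsto_sandwich[OF _ _ tendsto_const lim]) (auto intro!: always_eventually b)
qed

text \<open>A triangle inequality up to the factor 4: |f + g| is at most twice the larger of the
  two, and adding the two integrals costs at most another factor 2. It is only ever applied to a
  fixed number of terms, so the loss is harmless.\<close>

lemma Lp_norm_add_le:
  fixes f g :: "'a::euclidean_space \<Rightarrow> complex"
  assumes p: "1 \<le> p" "p \<noteq> \<infinity>" and [measurable]: "f \<in> borel_measurable lborel" "g \<in> borel_measurable lborel" and c: "0 \<le> c"
    and f: "Lp_norm p f \<le> ennreal c" and g: "Lp_norm p g \<le> ennreal c"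
  shows "Lp_norm p (\<lambda>x. f x + g x) \<le> ennreal (4 * c)"
proof -
  define P where "P = enn2real p"
  have P: "P \<ge> 1" using enn2real_inverse[OF p] by (simp add: P_def)
  have If: "(\<integral>\<^sup>+x. ennreal (norm (f x) powr P) \<partial>lborel) \<le> ennreal (c powr P)"
    and Ig: "(\<integral>\<^sup>+x. ennreal (norm (g x) powr P) \<partial>lborel) \<le> ennreal (c powr P)"
    using f g by (simp_all add: Lp_norm_le_iff[OF p c] P_def)
  have pt: "norm (f x + g x) powr P \<le> 2 powr P * norm (f x) powr P + 2 powr P * norm (g x) powr P" for x
  proof -
    define M where "M = max (norm (f x)) (norm (g x))"
    have "norm (f x + g x) \<le> 2 * M" unfolding M_def by (rule order_trans[OF norm_triangle_ineq]) linarith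
    then have "norm (f x + g x) powr P \<le> (2 * M) powr P" using P by (intro powr_mono2) auto
    also have "\<dots> = 2 powr P * M powr P" by (simp add: powr_mult M_def)
    also have "M powr P \<le> norm (f x) powr P + norm (g x) powr P" by (auto simp: M_def max_def)
    finally show ?thesis by (simp add: distrib_left)
  qed
  have "(\<integral>\<^sup>+x. ennreal (norm (f x + g x) powr P) \<partial>lborel)
    \<le> (\<integral>\<^sup>+x. ennreal (2 powr P) * ennreal (norm (f x) powr P) + ennreal (2 powr P) * ennreal (norm (g x) powr P) \<partial>lborel)"
    by (intro nn_integral_mono) (auto simp flip: ennreal_mult' ennreal_plus intro!: ennreal_leI pt)
  also have "\<dots> = ennreal (2 powr P) * (\<integral>\<^sup>+x. ennreal (norm (f x) powr P) \<partial>lborel) + ennreal (2 powr P) * (\<integral>\<^sup>+x. ennreal (norm (g x) powr P) \<partial>lborel)"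
    by (subst nn_integral_add) (auto simp: nn_integral_cmult)
  also have "\<dots> \<le> ennreal (2 powr P) * ennreal (c powr P) + ennreal (2 powr P) * ennreal (c powr P)"
    by (intro add_mono mult_left_mono If Ig) auto
  also have "\<dots> = ennreal (2 * (2 powr P * c powr P))" by (simp flip: ennreal_mult' ennreal_plus)
  also have "\<dots> \<le> ennreal (2 powr P * (2 powr P * c powr P))"
    using P powr_mono[of 1 P 2] by (intro ennreal_leI mult_right_mono) auto
  also have "2 powr P * (2 powr P * c powr P) = (4 * c) powr P" using c by (simp add: powr_mult[symmetric])
  finally show ?thesis using c by (simp add: Lp_norm_le_iff[OF p] P_def)
qed

text \<open>Schur's test with the same bound \<open>A\<close> for both marginals, so the powers 1 -
  1/p and 1/p recombine to \<open>A\<close>, at every scale \<open>m\<close>.\<close>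

lemma conv_Lp:
  assumes \<Psi>: "cutoff \<Psi>" and p: "1 \<le> p"
  shows "\<exists>A>0. \<forall>m (g :: 'a::euclidean_space \<Rightarrow> complex) a. g \<in> borel_measurable lborel \<longrightarrow> a > 0 \<longrightarrow> Lp_norm p g \<le> ennreal a \<longrightarrow>
    Lp_norm p (conv g (bump_kernel \<Psi> m)) \<le> ennreal (A * a)"
proof -
  let ?s = "enn2real (1 / p)"
  obtain A where A: "A > 0" "\<And>j (z::'a). (\<integral>\<^sup>+x. ennreal (norm (bump_kernel \<Psi> j (x - z))) \<partial>lborel) \<le> ennreal A"
     "\<And>j (z::'a). (\<integral>\<^sup>+x. ennreal (norm (bump_kernel \<Psi> j (z - x))) \<partial>lborel) \<le> ennreal A"
    using bump_kernel_L1[OF \<Psi>, where 'a='a] by blast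
  have "Lp_norm p (conv g (bump_kernel \<Psi> m)) \<le> ennreal (A * a)"
    if g: "g \<in> borel_measurable lborel" "a > 0" "Lp_norm p g \<le> ennreal a" for m a and g :: "'a \<Rightarrow> complex"
  proof -
    have "Lp_norm p (\<lambda>y. \<integral>x. g x * bump_kernel \<Psi> m (x - y) \<partial>lborel) \<le> ennreal (A powr (1 - ?s) * A powr ?s * a)"
      by (rule Schur_test(2)[OF p g(1,2,3), where K = "\<lambda>x y. bump_kernel \<Psi> m (x - y)"])
         (use A schwartz_kernel_measurable[OF bump_kernel_schwartz[OF \<Psi>], of m] in auto)
    moreover have "A powr (1 - ?s) * A powr ?s = A" using A(1) by (simp add: powr_add[symmetric])
    ultimately show ?thesis unfolding conv_def by (simp only:)
  qed
  with A(1) show ?thesis by blast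
qed

lemma conv_add:
  fixes f g :: "'a::euclidean_space \<Rightarrow> complex"
  assumes p: "1 \<le> p" and f: "f \<in> borel_measurable lborel" "Lp_norm p f < \<infinity>" and g: "g \<in> borel_measurable lborel" "Lp_norm p g < \<infinity>"
    and \<eta>: "\<eta> \<in> schwartz_functions"
  shows "conv (\<lambda>x. f x + g x) \<eta> y = conv f \<eta> y + conv g \<eta> y"
proof -
  have "integrable lborel (\<lambda>x. h x * \<eta> (x - y))" if h[measurable]: "h \<in> borel_measurable lborel" "Lp_norm p h < \<infinity>" for h
  proof (rule integrableI_bounded)
    have [measurable]: "\<eta> \<in> borel_measurable borel" by (rule schwartz_measurable[OF \<eta>])
    show "(\<lambda>x. h x * \<eta> (x - y)) \<in> borel_measurable lborel" by measurable
    obtain D where "\<And>y. (\<integral>\<^sup>+x. ennreal (norm (h x * \<eta> (x - y))) \<partial>lborel) \<le> ennreal D"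
      using conv_nn_bound[OF p h \<eta>] by blast
    then show "(\<integral>\<^sup>+x. ennreal (norm (h x * \<eta> (x - y))) \<partial>lborel) < \<infinity>" by (rule le_less_trans) simp
  qed
  then show ?thesis using f g by (simp add: conv_def distrib_right)
qed

text \<open>Interpolation between L_1 and the supremum: the error d is bounded by \<open>S\<close>
  for all \<open>m\<close> and tends to 0 in L_1, and |d|^p \<le> S^(p-1) |d|.\<close>

lemma conv_approx_bounded:
  fixes f :: "'a::euclidean_space \<Rightarrow> complex"
  assumes \<Psi>: "cutoff \<Psi>" and p: "1 \<le> p" "p \<noteq> \<infinity>" and f: "integrable lborel f" and R: "\<And>x. norm (f x) \<le> R" and e: "e > 0"
  shows "\<exists>m. Lp_norm p (\<lambda>y. f y - conv f (bump_kernel \<Psi> m) y) \<le> ennreal e"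
proof -
  define P where "P = enn2real p"
  have P: "P \<ge> 1" using enn2real_inverse[OF p] by (simp add: P_def)
  have fm[measurable]: "f \<in> borel_measurable lborel" using f by auto
  have R0: "R \<ge> 0" using R order_trans[OF norm_ge_zero] by blast
  obtain A where A: "A > 0" "\<And>m g a. g \<in> borel_measurable lborel \<Longrightarrow> a > 0 \<Longrightarrow> Lp_norm \<infinity> g \<le> ennreal a \<Longrightarrow>
    Lp_norm \<infinity> (conv (g::'a \<Rightarrow> complex) (bump_kernel \<Psi> m)) \<le> ennreal (A * a)"
    using conv_Lp[OF \<Psi>, of \<infinity>, where 'a='a] by auto
  have fi: "Lp_norm \<infinity> f \<le> ennreal (R + 1)"
  proof (subst Lp_norm_top_iff)
    show "AE x in lborel. norm (f x) \<le> R + 1" by (rule AE_I2, rule order_trans[OF R]) simp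
  qed (use R0 in auto)
  have cm[measurable]: "conv f (bump_kernel \<Psi> m) \<in> borel_measurable lborel" for m
  proof -
    have "continuous_on UNIV (conv f (bump_kernel \<Psi> m))"
      by (rule conv_continuous[of \<infinity>]) (use fi in \<open>auto intro: bump_kernel_schwartz \<Psi> le_less_trans\<close>)
    then show ?thesis by (simp add: borel_measurable_continuous_onI)
  qed
  \<comment> \<open>Dominates \<open>R\<close> for the function plus A (R + 1) for its
    convolution.\<close>
  define S where "S = (A + 1) * (R + 1)"
  have S: "S > 0" unfolding S_def using A R0 by simp
  have ae: "AE y in lborel. norm (f y - conv f (bump_kernel \<Psi> m) y) \<le> S" for m
  proof -
    have "Lp_norm \<infinity> (conv f (bump_kernel \<Psi> m)) \<le> ennreal (A * (R + 1))" by (rule A(2)) (use fi R0 in auto)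
    then have "AE y in lborel. norm (conv f (bump_kernel \<Psi> m) y) \<le> A * (R + 1)" using A R0 by (subst (asm) Lp_norm_top_iff) auto
    then show ?thesis
    proof (rule AE_mp, intro AE_I2 impI)
      fix y assume "norm (conv f (bump_kernel \<Psi> m) y) \<le> A * (R + 1)"
      then show "norm (f y - conv f (bump_kernel \<Psi> m) y) \<le> S"
        using norm_triangle_ineq4[of "f y" "conv f (bump_kernel \<Psi> m) y"] R[of y] by (simp add: S_def algebra_simps)
    qed
  qed
  have "e powr P / S powr (P - 1) > 0" using e S by simp
  then have "eventually (\<lambda>m. (\<integral>\<^sup>+y. ennreal (norm (f y - conv f (bump_kernel \<Psi> m) y)) \<partial>lborel) < ennreal (e powr P / S powr (P - 1))) sequentially"
    by (intro order_tendstoD[OF conv_approx_L1[OF \<Psi> f R]]) simp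
  then obtain m where m: "(\<integral>\<^sup>+y. ennreal (norm (f y - conv f (bump_kernel \<Psi> m) y)) \<partial>lborel) < ennreal (e powr P / S powr (P - 1))"
    by (auto simp: eventually_sequentially)
  have "(\<integral>\<^sup>+y. ennreal (norm (f y - conv f (bump_kernel \<Psi> m) y) powr P) \<partial>lborel)
     \<le> (\<integral>\<^sup>+y. ennreal (S powr (P - 1)) * ennreal (norm (f y - conv f (bump_kernel \<Psi> m) y)) \<partial>lborel)"
  proof (rule nn_integral_mono_AE, rule AE_mp[OF ae], intro AE_I2 impI)
    fix y assume le: "norm (f y - conv f (bump_kernel \<Psi> m) y) \<le> S"
    let ?n = "norm (f y - conv f (bump_kernel \<Psi> m) y)"
    have "?n powr P = ?n powr (P - 1) * ?n"
    proof (cases "?n = 0")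
      case False then show ?thesis by (simp add: powr_diff)
    qed simp
    also have "\<dots> \<le> S powr (P - 1) * ?n" using le P by (intro mult_right_mono powr_mono2) auto
    finally show "ennreal (?n powr P) \<le> ennreal (S powr (P - 1)) * ennreal ?n" by (simp add: ennreal_leI flip: ennreal_mult')
  qed
  also have "\<dots> = ennreal (S powr (P - 1)) * (\<integral>\<^sup>+y. ennreal (norm (f y - conv f (bump_kernel \<Psi> m) y)) \<partial>lborel)"
    by (rule nn_integral_cmult) measurable
  also have "\<dots> \<le> ennreal (S powr (P - 1)) * ennreal (e powr P / S powr (P - 1))"
    using m by (intro mult_left_mono less_imp_le) auto
  also have "\<dots> = ennreal (e powr P)" using S by (simp flip: ennreal_mult')
  finally have "Lp_norm p (\<lambda>y. f y - conv f (bump_kernel \<Psi> m) y) \<le> ennreal e"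
    using e by (subst Lp_norm_le_iff[OF p]) (simp_all add: P_def)
  then show ?thesis by blast
qed

text \<open>Large values and large arguments are cut off together; the p-th power of the error is
  dominated by |h|^p and vanishes eventually at each point.\<close>

lemma Lp_truncate:
  fixes h :: "'a::euclidean_space \<Rightarrow> complex"
  assumes p: "1 \<le> p" "p \<noteq> \<infinity>" and h[measurable]: "h \<in> borel_measurable lborel" and fin: "Lp_norm p h < \<infinity>" and e: "e > 0"
  shows "\<exists>f R. integrable lborel f \<and> (\<forall>x. norm (f x) \<le> R) \<and> Lp_norm p (\<lambda>x. h x - f x) \<le> ennreal e"
proof -
  define P where "P = enn2real p"
  have P: "P \<ge> 1" using enn2real_inverse[OF p] by (simp add: P_def)
  define T where "T n = {x. norm (h x) \<le> real n \<and> norm x \<le> real n}" for n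
  have [measurable]: "T n \<in> sets borel" for n unfolding T_def using h by measurable
  define f where "f n x = indicator (T n) x *\<^sub>R h x" for n x
  have [measurable]: "f n \<in> borel_measurable lborel" for n unfolding f_def by measurable
  have fb: "norm (f n x) \<le> real n" for n x by (auto simp: f_def T_def indicator_def)
  obtain r where r: "Lp_norm p h = ennreal r" "r \<ge> 0" using fin by (cases "Lp_norm p h") auto
  have hfin: "(\<integral>\<^sup>+x. ennreal (norm (h x) powr P) \<partial>lborel) < \<infinity>"
    using Lp_norm_le_iff[OF p r(2), of h] r by (auto simp: P_def intro: le_less_trans)
  have fi: "integrable lborel (f n)" for n
  proof (rule Bochner_Integration.integrable_bound[where f = "\<lambda>x. real n * indicator (cball (0::'a) (real n)) x"])
    have "integrable lborel (indicator (cball (0::'a) (real n)) :: 'a \<Rightarrow> real)"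
      by (intro integrable_real_indicator) (use emeasure_lborel_cball_finite[of "0::'a" "real n"] in auto)
    then show "integrable lborel (\<lambda>x. real n * indicator (cball (0::'a) (real n)) x)" by (rule integrable_mult_right)
    show "AE x in lborel. norm (f n x) \<le> norm (real n * indicator (cball (0::'a) (real n)) x)"
      by (rule AE_I2) (auto simp: f_def T_def indicator_def)
  qed measurable
  have "(\<lambda>n. \<integral>\<^sup>+x. ennreal (norm (h x - f n x) powr P) \<partial>lborel) \<longlonglongrightarrow> (\<integral>\<^sup>+x. 0 \<partial>(lborel::'a measure))"
  proof (rule nn_integral_dominated_convergence[where w = "\<lambda>x. ennreal (norm (h x) powr P)"])
    show "AE x in lborel. ennreal (norm (h x - f n x) powr P) \<le> ennreal (norm (h x) powr P)" for n
      by (rule AE_I2) (auto simp: f_def indicator_def)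
    show "AE x in lborel. (\<lambda>n. ennreal (norm (h x - f n x) powr P)) \<longlonglongrightarrow> 0"
    proof (rule AE_I2)
      fix x
      obtain n0 where n0: "max (norm (h x)) (norm x) \<le> real n0" using real_arch_simple by blast
      have "x \<in> T n" if "n \<ge> n0" for n using n0 that by (auto simp: T_def)
      then have "eventually (\<lambda>n. ennreal (norm (h x - f n x) powr P) = 0) sequentially"
        unfolding eventually_sequentially by (intro exI[of _ n0]) (auto simp: f_def)
      then show "(\<lambda>n. ennreal (norm (h x - f n x) powr P)) \<longlonglongrightarrow> 0" by (rule tendsto_eventually)
    qed
  qed (use hfin in measurable)
  then have "eventually (\<lambda>n. (\<integral>\<^sup>+x. ennreal (norm (h x - f n x) powr P) \<partial>lborel) < ennreal (e powr P)) sequentially"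
    using e by (intro order_tendstoD) auto
  then obtain n where "(\<integral>\<^sup>+x. ennreal (norm (h x - f n x) powr P) \<partial>lborel) < ennreal (e powr P)"
    by (auto simp: eventually_sequentially)
  then have "Lp_norm p (\<lambda>x. h x - f n x) \<le> ennreal e"
    using e by (subst Lp_norm_le_iff[OF p]) (auto simp: P_def intro: less_imp_le)
  with fi fb show ?thesis by blast
qed

lemma Lp_norm_minus: "Lp_norm p (\<lambda>x. - f x) = Lp_norm p f"
  by (simp add: Lp_norm_def)

text \<open>Split \<open>h\<close> into a bounded integrable \<open>f\<close> and a small
  \<open>g\<close>. The previous approximation handles \<open>f\<close>, and convolution, being
  bounded on L_p uniformly in \<open>m\<close>, keeps \<open>g\<close> small.\<close>

lemma conv_approx:
  fixes h :: "'a::euclidean_space \<Rightarrow> complex"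
  assumes \<Psi>: "cutoff \<Psi>" and p: "1 \<le> p" "p \<noteq> \<infinity>" and h[measurable]: "h \<in> borel_measurable lborel" and fin: "Lp_norm p h < \<infinity>" and e: "e > 0"
  shows "\<exists>m. Lp_norm p (\<lambda>y. h y - conv h (bump_kernel \<Psi> m) y) \<le> ennreal e"
proof -
  obtain A where A: "A > 0" "\<And>m g a. g \<in> borel_measurable lborel \<Longrightarrow> a > 0 \<Longrightarrow> Lp_norm p g \<le> ennreal a \<Longrightarrow>
    Lp_norm p (conv (g::'a \<Rightarrow> complex) (bump_kernel \<Psi> m)) \<le> ennreal (A * a)"
    using conv_Lp[OF \<Psi> p(1), where 'a='a] by auto
  \<comment> \<open>Each addition below costs the factor 4: two terms of size e/16 give e/4, then
    two of size e/4 give \<open>e\<close>. Dividing by \<open>A + 1\<close> makes both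
    \<open>d\<close> and A d at most e/16.\<close>
  define d where "d = e / (16 * (A + 1))"
  have d: "d > 0" "d \<le> e / 16" "A * d \<le> e / 16" "4 * (e / 16) \<le> e / 4"
    using e A by (auto simp: d_def field_simps)
  obtain f R where f: "integrable lborel f" "\<And>x. norm (f x) \<le> R" "Lp_norm p (\<lambda>x. h x - f x) \<le> ennreal d"
    using Lp_truncate[OF p h fin d(1)] by auto
  obtain m where m: "Lp_norm p (\<lambda>y. f y - conv f (bump_kernel \<Psi> m) y) \<le> ennreal (e / 4)"
    using conv_approx_bounded[OF \<Psi> p f(1,2), of "e / 4"] e by auto
  have [measurable]: "f \<in> borel_measurable lborel" using f(1) by auto
  define g where "g x = h x - f x" for x
  have gm[measurable]: "g \<in> borel_measurable lborel" unfolding g_def by measurable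
  have gL: "Lp_norm p g \<le> ennreal d" using f(3) by (simp add: g_def[abs_def])
  have gfin: "Lp_norm p g < \<infinity>" using gL by (rule le_less_trans) simp
  have ffin: "Lp_norm p f < \<infinity>"
  proof -
    obtain r where r: "Lp_norm p h = ennreal r" "r \<ge> 0" using fin by (cases "Lp_norm p h") auto
    have "Lp_norm p (\<lambda>x. h x + - g x) \<le> ennreal (4 * (r + d))"
      by (rule Lp_norm_add_le[OF p]) (use r d gL in \<open>auto simp: Lp_norm_minus intro!: order_trans[OF gL] ennreal_leI\<close>)
    moreover have "(\<lambda>x. h x + - g x) = f" by (simp add: g_def)
    ultimately show ?thesis by (auto intro: le_less_trans)
  qed
  have cc: "conv h (bump_kernel \<Psi> m) y = conv g (bump_kernel \<Psi> m) y + conv f (bump_kernel \<Psi> m) y" for y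
    using conv_add[OF p(1) gm gfin _ ffin bump_kernel_schwartz[OF \<Psi>], of m y] by (simp add: g_def)
  have cm: "conv k (bump_kernel \<Psi> m) \<in> borel_measurable lborel" if "k \<in> borel_measurable lborel" "Lp_norm p k < \<infinity>" for k :: "'a \<Rightarrow> complex"
    using conv_continuous[OF p(1) that bump_kernel_schwartz[OF \<Psi>]] by (simp add: borel_measurable_continuous_onI)
  note cm[OF gm gfin, measurable]
  have [measurable]: "conv f (bump_kernel \<Psi> m) \<in> borel_measurable lborel" by (rule cm[OF _ ffin]) measurable
  have "Lp_norm p (conv g (bump_kernel \<Psi> m)) \<le> ennreal (A * d)" by (rule A(2)[OF gm d(1) gL])
  then have "Lp_norm p (\<lambda>y. - conv g (bump_kernel \<Psi> m) y) \<le> ennreal (e / 16)"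
    using d by (auto simp: Lp_norm_minus intro: order_trans ennreal_leI)
  moreover have "Lp_norm p g \<le> ennreal (e / 16)" using gL d by (auto intro: order_trans ennreal_leI)
  ultimately have "Lp_norm p (\<lambda>y. g y + - conv g (bump_kernel \<Psi> m) y) \<le> ennreal (4 * (e / 16))"
    using e by (intro Lp_norm_add_le[OF p]) auto
  then have "Lp_norm p (\<lambda>y. (g y + - conv g (bump_kernel \<Psi> m) y) + (f y - conv f (bump_kernel \<Psi> m) y)) \<le> ennreal (4 * (e / 4))"
    using m e by (intro Lp_norm_add_le[OF p]) auto
  moreover have "(\<lambda>y. (g y + - conv g (bump_kernel \<Psi> m) y) + (f y - conv f (bump_kernel \<Psi> m) y)) = (\<lambda>y. h y - conv h (bump_kernel \<Psi> m) y)"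
    by (rule ext) (simp add: cc g_def)
  ultimately show ?thesis by auto
qed

section \<open>Tensor products and surjectivity\<close>

lemma integral_prod_lborel:
  fixes F :: "'a::euclidean_space \<times> 'b::euclidean_space \<Rightarrow> complex"
  assumes "integrable lborel F"
  shows "integrable lborel (\<lambda>x. \<integral>t. F (x, t) \<partial>lborel)" "(\<integral>z. F z \<partial>lborel) = (\<integral>x. \<integral>t. F (x, t) \<partial>lborel \<partial>lborel)"
proof -
  have i: "integrable (lborel \<Otimes>\<^sub>M lborel) F" using assms by (simp add: lborel_prod)
  show "integrable lborel (\<lambda>x. \<integral>t. F (x, t) \<partial>lborel)" by (rule lborel_pair.integrable_fst'[OF i])
  show "(\<integral>z. F z \<partial>lborel) = (\<integral>x. \<integral>t. F (x, t) \<partial>lborel \<partial>lborel)"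
    using lborel_pair.integral_fst'[OF i] by (simp add: lborel_prod)
qed

lemma integral_tensor:
  fixes f :: "'a::euclidean_space \<Rightarrow> complex" and g :: "'b::euclidean_space \<Rightarrow> complex"
  assumes f: "integrable lborel f" and g: "integrable lborel g"
  shows "integrable lborel (\<lambda>z. f (fst z) * g (snd z))"
    and "(\<integral>z. f (fst z) * g (snd z) \<partial>lborel) = (\<integral>x. f x \<partial>lborel) * (\<integral>t. g t \<partial>lborel)"
proof -
  have [measurable]: "f \<in> borel_measurable lborel" "g \<in> borel_measurable lborel" using f g by auto
  have "(\<integral>\<^sup>+x. \<integral>\<^sup>+t. ennreal (norm (f x * g t)) \<partial>lborel \<partial>lborel) = (\<integral>\<^sup>+x. ennreal (norm (f x)) \<partial>lborel) * (\<integral>\<^sup>+t. ennreal (norm (g t)) \<partial>lborel)"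
    by (simp add: norm_mult ennreal_mult' nn_integral_cmult nn_integral_multc)
  also have "\<dots> < \<infinity>" using f g by (simp add: integrable_iff_bounded ennreal_mult_less_top)
  finally have "integrable (lborel \<Otimes>\<^sub>M lborel) (\<lambda>(x, t). f x * g t)" by (intro integrable_pair_nn) measurable
  then show i: "integrable lborel (\<lambda>z. f (fst z) * g (snd z))" by (simp add: lborel_prod case_prod_unfold)
  show "(\<integral>z. f (fst z) * g (snd z) \<partial>lborel) = (\<integral>x. f x \<partial>lborel) * (\<integral>t. g t \<partial>lborel)"
    using integral_prod_lborel(2)[OF i] by simp
qed

lemma FT_tensor:
  fixes f :: "'a::euclidean_space \<Rightarrow> complex" and g :: "'b::euclidean_space \<Rightarrow> complex"
  assumes f: "integrable lborel f" and g: "integrable lborel g"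
  shows "FT \<sigma> (\<lambda>z. f (fst z) * g (snd z)) z = FT \<sigma> f (fst z) * FT \<sigma> g (snd z)"
proof -
  have e: "exp (\<i> * complex_of_real (\<sigma> * (\<zeta> \<bullet> z))) * (f (fst \<zeta>) * g (snd \<zeta>))
     = (exp (\<i> * complex_of_real (\<sigma> * (fst \<zeta> \<bullet> fst z))) * f (fst \<zeta>)) * (exp (\<i> * complex_of_real (\<sigma> * (snd \<zeta> \<bullet> snd z))) * g (snd \<zeta>))" for \<zeta>
    by (simp add: inner_prod_def distrib_left exp_add)
  show ?thesis unfolding FT_def e
    by (rule integral_tensor(2)[OF integrable_exp_mult[OF f, of \<sigma> "fst z"] integrable_exp_mult[OF g, of \<sigma> "snd z"]])
qed

text \<open>\<open>bump_freq \<Psi> N\<close> lives on \<open>2 ^ N\<close> times the interval \<open>[0.72, 0.98]\<close>. Since \<open>part \<Psi> N\<close> equals 1 for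
  \<open>0.65 * 2 ^ N \<le> |\<xi>| \<le> 1.1 * 2 ^ N\<close>, this leaves room for a small tangential frequency.\<close>

definition bump_freq :: "(real \<Rightarrow> real) \<Rightarrow> nat \<Rightarrow> real \<Rightarrow> complex" where
  "bump_freq \<Psi> N \<tau> = of_real (10 / 2 ^ N) / (\<integral>s. bump \<Psi> s \<partial>lborel) * bump \<Psi> ((10 / 2 ^ N) * \<tau> - 17/2)"

text \<open>\<open>bump_freq\<close> has integral 1 and the transform carries no factor, so the
  value at 0 is 1: multiplication by this oscillation does not change the trace.\<close>

definition osc_fun :: "(real \<Rightarrow> real) \<Rightarrow> nat \<Rightarrow> real \<Rightarrow> complex" where
  "osc_fun \<Psi> N = FT 1 (bump_freq \<Psi> N)"

lemma bump_freq_integrable: assumes "cutoff \<Psi>" shows "integrable lborel (bump_freq \<Psi> N)"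
proof -
  have "integrable lborel (\<lambda>\<tau>. bump \<Psi> ((- 17/2) + (10 / 2 ^ N) * \<tau>))"
    by (rule lborel_integrable_real_affine[OF bump_integrable[OF assms]]) simp
  then show ?thesis unfolding bump_freq_def by (intro integrable_mult_right) simp
qed

text \<open>With \<tau> = 2^N (0.85 + s/10), the range |s| \<le> 1.3 outside which the bump vanishes
  becomes the band from 0.72 to 0.98 times 2^N.\<close>

lemma bump_freq_0:
  assumes \<Psi>: "cutoff \<Psi>" and nz: "bump_freq \<Psi> N \<tau> \<noteq> 0"
  shows "72/100 * 2 ^ N \<le> \<tau>" "\<tau> \<le> 98/100 * 2 ^ N"
proof -
  have "cut \<Psi> 0 ((10 / 2 ^ N) * \<tau> - 17/2) \<noteq> 0" using nz by (auto simp: bump_freq_def bump_def)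
  then have "\<bar>(10 / 2 ^ N) * \<tau> - 17/2\<bar> \<le> 13/10" using cut_0[OF \<Psi>, of 0 "(10 / 2 ^ N) * \<tau> - 17/2"] by (auto simp: not_less[symmetric])
  then have "72/10 \<le> (10 / 2 ^ N) * \<tau>" "(10 / 2 ^ N) * \<tau> \<le> 98/10" by linarith+
  then show "72/100 * 2 ^ N \<le> \<tau>" "\<tau> \<le> 98/100 * 2 ^ N" by (auto simp: field_simps)
qed

text \<open>A unimodular factor times a dilate of one fixed Schwartz function, so all norms in
  \<open>t\<close> follow by scaling.\<close>

lemma osc_fun_eq:
  assumes \<Psi>: "cutoff \<Psi>"
  shows "osc_fun \<Psi> N t = exp (\<i> * of_real (17/2 * (2 ^ N / 10 * t))) * FT 1 (bump \<Psi>) (2 ^ N / 10 * t) / (\<integral>s. bump \<Psi> s \<partial>lborel)"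
proof -
  let ?I = "\<integral>s. bump \<Psi> s \<partial>lborel" and ?c = "2 ^ N / 10 :: real"
  have [measurable]: "bump_freq \<Psi> N \<in> borel_measurable borel" using bump_freq_integrable[OF \<Psi>, of N] by auto
  have "osc_fun \<Psi> N t = \<bar>?c\<bar> *\<^sub>R (\<integral>s. exp (\<i> * of_real (1 * ((17/2 * ?c + ?c * s) \<bullet> t))) * bump_freq \<Psi> N (17/2 * ?c + ?c * s) \<partial>lborel)"
    unfolding osc_fun_def FT_def by (rule lborel_integral_real_affine) simp
  also have "(\<lambda>s. exp (\<i> * of_real (1 * ((17/2 * ?c + ?c * s) \<bullet> t))) * bump_freq \<Psi> N (17/2 * ?c + ?c * s))
     = (\<lambda>s. (exp (\<i> * of_real (17/2 * (?c * t))) / ?I / of_real ?c) * (exp (\<i> * of_real (1 * (s \<bullet> (?c * t)))) * bump \<Psi> s))"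
  proof
    fix s
    have "exp (\<i> * complex_of_real (1 * ((17/2 * ?c + ?c * s) \<bullet> t))) = exp (\<i> * of_real (17/2 * (?c * t))) * exp (\<i> * of_real (1 * (s \<bullet> (?c * t))))"
      by (simp add: exp_add[symmetric] algebra_simps)
    moreover have "(10 / 2 ^ N) * (17/2 * ?c + ?c * s) - 17/2 = s" by (simp add: field_simps)
    ultimately show "exp (\<i> * of_real (1 * ((17/2 * ?c + ?c * s) \<bullet> t))) * bump_freq \<Psi> N (17/2 * ?c + ?c * s)
      = (exp (\<i> * of_real (17/2 * (?c * t))) / ?I / of_real ?c) * (exp (\<i> * of_real (1 * (s \<bullet> (?c * t)))) * bump \<Psi> s)"
      by (simp only: bump_freq_def) (simp add: field_simps)
  qed
  also have "\<bar>?c\<bar> *\<^sub>R (\<integral>s. (exp (\<i> * of_real (17/2 * (?c * t))) / ?I / of_real ?c) * (exp (\<i> * of_real (1 * (s \<bullet> (?c * t)))) * bump \<Psi> s) \<partial>lborel)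
     = exp (\<i> * of_real (17/2 * (?c * t))) * FT 1 (bump \<Psi>) (?c * t) / ?I"
    unfolding integral_mult_right_zero FT_def[symmetric] by (simp add: scaleR_conv_of_real)
  finally show ?thesis .
qed

lemma osc_fun_0: assumes \<Psi>: "cutoff \<Psi>" shows "osc_fun \<Psi> N 0 = 1"
  using bump_integral_nonzero[OF \<Psi>] by (simp add: osc_fun_eq[OF \<Psi>] FT_def)

lemma osc_fun_continuous: assumes \<Psi>: "cutoff \<Psi>" shows "continuous_on UNIV (osc_fun \<Psi> N)"
proof -
  have "continuous_on UNIV (\<lambda>t. FT 1 (bump \<Psi>) (2 ^ N / 10 * t))"
    by (rule continuous_on_compose2[OF smooth_continuous[OF FT_smooth[OF test_schwartz[OF bump_test[OF \<Psi>]]], of UNIV]])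
       (auto intro!: continuous_intros)
  then show ?thesis using bump_integral_nonzero[OF \<Psi>]
    unfolding osc_fun_eq[OF \<Psi>, abs_def] by (intro continuous_intros) auto
qed

text \<open>The supremum does not depend on \<open>N\<close>, while the L_1 norm scales like 2^(-N);
  the inequality |v|^P \<le> D^(P-1) |v| carries the latter over to the integral of the P-th
  power.\<close>

lemma osc_fun_bounds:
  assumes \<Psi>: "cutoff \<Psi>" and P: "1 \<le> (P::real)"
  shows "\<exists>M>0. (\<forall>N t. norm (osc_fun \<Psi> N t) \<le> M) \<and> (\<forall>N. (\<integral>\<^sup>+t. ennreal (norm (osc_fun \<Psi> N t) powr P) \<partial>lborel) \<le> ennreal (M / 2 ^ N))"
proof -
  let ?I = "norm (\<integral>s. bump \<Psi> s \<partial>lborel)" and ?F = "FT 1 (bump \<Psi>)"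
  have I: "?I > 0" using bump_integral_nonzero[OF \<Psi>] by simp
  have F: "?F \<in> schwartz_functions" by (intro FT_schwartz test_schwartz bump_test \<Psi>) simp
  have [measurable]: "?F \<in> borel_measurable borel" by (rule schwartz_measurable[OF F])
  obtain B where "sb 0 0 B ?F" using schwartz_sb[OF F] by blast
  then have B: "norm (?F s) \<le> B" for s using sbD[of 0 0 B ?F "[]" s] by simp
  have B0: "B \<ge> 0" using B order_trans[OF norm_ge_zero] by blast
  define J where "J = (\<integral>s. norm (?F s) \<partial>lborel)"
  have J0: "J \<ge> 0" unfolding J_def by (rule Bochner_Integration.integral_nonneg) simp
  have nn: "(\<integral>\<^sup>+s. ennreal (norm (?F s)) \<partial>lborel) = ennreal J"
    unfolding J_def by (intro nn_integral_eq_integral integrable_norm schwartz_integrable F) auto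
  have n: "norm (osc_fun \<Psi> N t) = norm (?F (2 ^ N / 10 * t)) / ?I" for N t
    by (simp add: osc_fun_eq[OF \<Psi>] norm_mult norm_divide)
  have 1: "norm (osc_fun \<Psi> N t) \<le> B / ?I" for N t unfolding n using I B by (intro divide_right_mono) auto
  define D where "D = B / ?I"
  have D0: "D \<ge> 0" unfolding D_def using B0 I by simp
  have 2: "(\<integral>\<^sup>+t. ennreal (norm (osc_fun \<Psi> N t) powr P) \<partial>lborel) \<le> ennreal ((10 * D powr (P - 1) * J / ?I) / 2 ^ N)" for N
  proof -
    have "norm (osc_fun \<Psi> N t) powr P \<le> (D powr (P - 1) / ?I) * norm (?F (0 + 2 ^ N / 10 * t))" for t
    proof (cases "osc_fun \<Psi> N t = 0")
      case False
      then have "norm (osc_fun \<Psi> N t) powr P = norm (osc_fun \<Psi> N t) powr (P - 1) * norm (osc_fun \<Psi> N t)" by (simp add: powr_diff)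
      also have "\<dots> \<le> D powr (P - 1) * norm (osc_fun \<Psi> N t)" using 1 P by (intro mult_right_mono powr_mono2) (auto simp: D_def)
      finally show ?thesis by (simp add: n)
    qed (use I in \<open>simp add: divide_nonneg_pos\<close>)
    then have "(\<integral>\<^sup>+t. ennreal (norm (osc_fun \<Psi> N t) powr P) \<partial>lborel)
      \<le> (\<integral>\<^sup>+t. ennreal (D powr (P - 1) / ?I) * ennreal (norm (?F (0 + 2 ^ N / 10 * t))) \<partial>lborel)"
      using I by (intro nn_integral_mono) (simp add: ennreal_leI flip: ennreal_mult')
    also have "\<dots> = ennreal (D powr (P - 1) / ?I) * (\<integral>\<^sup>+t. ennreal (norm (?F (0 + 2 ^ N / 10 * t))) \<partial>lborel)"
      by (rule nn_integral_cmult) measurable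
    also have "(\<integral>\<^sup>+t. ennreal (norm (?F (0 + 2 ^ N / 10 * t))) \<partial>lborel) = ennreal (10 / 2 ^ N * J)"
    proof -
      have "ennreal J = ennreal \<bar>2 ^ N / 10\<bar> * (\<integral>\<^sup>+t. ennreal (norm (?F (0 + 2 ^ N / 10 * t))) \<partial>lborel)"
        unfolding nn[symmetric] by (rule nn_integral_real_affine) auto
      then have "ennreal (10 / 2 ^ N) * ennreal J = (ennreal (10 / 2 ^ N) * ennreal (2 ^ N / 10)) * (\<integral>\<^sup>+t. ennreal (norm (?F (0 + 2 ^ N / 10 * t))) \<partial>lborel)"
        by (simp only: mult.assoc abs_of_nonneg[of "2 ^ N / 10 :: real"] zero_le_divide_iff) simp
      moreover have "ennreal (10 / 2 ^ N) * ennreal (2 ^ N / 10) = 1" by (simp flip: ennreal_mult')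
      moreover have "ennreal (10 / 2 ^ N * J) = ennreal (10 / 2 ^ N) * ennreal J" using J0 by (intro ennreal_mult) auto
      ultimately show ?thesis by (simp only: mult_1_left)
    qed
    also have "ennreal (D powr (P - 1) / ?I) * ennreal (10 / 2 ^ N * J) = ennreal ((10 * D powr (P - 1) * J / ?I) / 2 ^ N)"
      using I by (simp add: ennreal_mult'[symmetric] mult_ac)
    finally show ?thesis .
  qed
  define M where "M = D + 10 * D powr (P - 1) * J / ?I + 1"
  have pos: "0 \<le> 10 * D powr (P - 1) * J / ?I" using J0 I by simp
  have DM: "D \<le> M" and "M > 0" unfolding M_def using pos D0 by linarith+
  moreover have "norm (osc_fun \<Psi> N t) \<le> M" for N t
    using order_trans[OF 1[folded D_def] DM] .
  moreover have "(\<integral>\<^sup>+t. ennreal (norm (osc_fun \<Psi> N t) powr P) \<partial>lborel) \<le> ennreal (M / 2 ^ N)" for N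
  proof -
    have "10 * D powr (P - 1) * J / ?I \<le> M" unfolding M_def using D0 by linarith
    then show ?thesis by (intro order_trans[OF 2] ennreal_leI divide_right_mono) simp_all
  qed
  ultimately show ?thesis by blast
qed

text \<open>The lower bound exceeds 0.65 * 2^N = 1.3 * 2^(N-1), beyond which the cut-off of index N
  - 1 is 0; below 1.1 * 2^N that of index N is still 1. So exactly one member of the partition sees
  these frequencies.\<close>

lemma part_value:
  assumes \<Psi>: "cutoff \<Psi>" and z: "72/100 * 2 ^ N \<le> norm z" "norm z < 11/10 * 2 ^ N"
  shows "part \<Psi> k z = (if k = N then 1 else 0)"
proof -
  have c: "cut \<Psi> j z = (if N \<le> j then 1 else 0)" for j
  proof (cases "N \<le> j")
    case True
    then have "(2::real) ^ N \<le> 2 ^ j" by simp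
    then have "norm z < 11/10 * 2 ^ j" using z(2) by linarith
    then show ?thesis using True by (simp add: cut_1[OF \<Psi>])
  next
    case False
    then have "(2::real) ^ Suc j \<le> 2 ^ N" by (intro power_increasing) auto
    moreover have "(0::real) < 2 ^ j" by simp
    ultimately have "13/10 * 2 ^ j < norm z" using z(1) unfolding power_Suc by linarith
    then show ?thesis using False by (simp add: cut_0[OF \<Psi>])
  qed
  show ?thesis by (cases k) (auto simp: part_0 part_Suc c)
qed

text \<open>The gap 4 makes the tangential frequency at most 1.3 * 2^m \<le> 0.1 * 2^N. Added to a
  normal frequency of at most 0.98 * 2^N it stays below 1.1 * 2^N, and the normal frequency alone
  keeps the norm above 0.72 * 2^N.\<close>

lemma freq_localized:
  fixes \<zeta> :: "'a::euclidean_space \<times> real"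
  assumes \<Psi>: "cutoff \<Psi>" and N: "m + 4 \<le> N"
  shows "part \<Psi> k \<zeta> * (cut \<Psi> m (fst \<zeta>) * bump_freq \<Psi> N (snd \<zeta>)) = (if k = N then cut \<Psi> m (fst \<zeta>) * bump_freq \<Psi> N (snd \<zeta>) else 0)"
proof (cases "cut \<Psi> m (fst \<zeta>) = 0 \<or> bump_freq \<Psi> N (snd \<zeta>) = 0")
  case False
  then have t: "72/100 * 2 ^ N \<le> snd \<zeta>" "snd \<zeta> \<le> 98/100 * 2 ^ N" using bump_freq_0[OF \<Psi>] by auto
  have "norm (fst \<zeta>) \<le> 13/10 * 2 ^ m" using False cut_0[OF \<Psi>, of m "fst \<zeta>"] by (auto simp: not_less[symmetric])
  moreover have "(16::real) * 2 ^ m \<le> 2 ^ N" using power_increasing[OF N, of "2::real"] by (simp add: power_add)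
  moreover have "(0::real) < 2 ^ m" by simp
  ultimately have "norm (fst \<zeta>) \<le> 1/10 * 2 ^ N" by linarith
  moreover have "(0::real) < 2 ^ N" by simp
  moreover have "norm \<zeta> \<le> norm (fst \<zeta>) + norm (snd \<zeta>)" using norm_Pair_le[of "fst \<zeta>" "snd \<zeta>"] by simp
  moreover have "norm (snd \<zeta>) \<le> norm \<zeta>" using norm_snd_le[of "snd \<zeta>" "fst \<zeta>"] by simp
  ultimately have "72/100 * 2 ^ N \<le> norm \<zeta>" "norm \<zeta> < 11/10 * 2 ^ N" using t unfolding real_norm_def by linarith+
  then show ?thesis by (simp add: part_value[OF \<Psi>])
qed auto

section \<open>Dyadic pieces of band-limited products\<close>

lemma FT_piece:
  fixes \<phi> :: "'a::euclidean_space \<Rightarrow> complex"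
  assumes \<Psi>: "cutoff \<Psi>" and \<phi>: "\<phi> \<in> schwartz_functions"
  shows "FT 1 (fourier (\<lambda>\<xi>. part \<Psi> k \<xi> * inv_fourier \<phi> \<xi>)) \<zeta> = part \<Psi> k \<zeta> * FT 1 \<phi> \<zeta>"
proof -
  have "inv_fourier (fourier (\<lambda>\<xi>. part \<Psi> k \<xi> * inv_fourier \<phi> \<xi>)) \<zeta> = part \<Psi> k \<zeta> * inv_fourier \<phi> \<zeta>"
    by (simp add: inv_fourier_fourier[OF part_mult_schwartz[OF \<Psi> inv_fourier_schwartz[OF \<phi>]]])
  then show ?thesis by (simp add: inv_fourier_FT)
qed

lemma integrable_bounded_mult:
  assumes \<theta>: "integrable lborel \<theta>" and [measurable]: "F \<in> borel_measurable lborel" and b: "\<And>z. norm (F z :: complex) \<le> D"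
  shows "integrable lborel (\<lambda>z. F z * \<theta> z)"
proof (rule Bochner_Integration.integrable_bound[where f = "\<lambda>z. D * norm (\<theta> z)"])
  have [measurable]: "\<theta> \<in> borel_measurable lborel" using \<theta> by auto
  show "integrable lborel (\<lambda>z. D * norm (\<theta> z))" by (intro integrable_mult_right integrable_norm \<theta>)
  show "(\<lambda>z. F z * \<theta> z) \<in> borel_measurable lborel" by measurable
  show "AE z in lborel. norm (F z * \<theta> z) \<le> norm (D * norm (\<theta> z))"
  proof (rule AE_I2)
    fix z
    have "norm (F z * \<theta> z) \<le> D * norm (\<theta> z)" unfolding norm_mult by (intro mult_right_mono b) simp
    then show "norm (F z * \<theta> z) \<le> norm (D * norm (\<theta> z))" by simp
  qed
qed

lemma measurable_tensor_continuous:
  fixes w :: "'a::euclidean_space \<Rightarrow> complex" and v :: "'b::euclidean_space \<Rightarrow> complex"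
  assumes "continuous_on UNIV w" "continuous_on UNIV v"
  shows "(\<lambda>z. w (fst z) * v (snd z)) \<in> borel_measurable lborel"
proof -
  have "continuous_on UNIV (\<lambda>z :: 'a \<times> 'b. w (fst z) * v (snd z))"
    by (intro continuous_on_mult continuous_on_compose2[OF assms(1)] continuous_on_compose2[OF assms(2)]) (auto intro!: continuous_intros)
  then show ?thesis by (simp add: borel_measurable_continuous_onI)
qed

lemma bump_kernel_bounded:
  assumes "cutoff \<Psi>" obtains D where "\<And>z::'a::euclidean_space. norm (bump_kernel \<Psi> m z) \<le> D"
proof -
  obtain B where "sb 0 0 B (bump_kernel \<Psi> m :: 'a \<Rightarrow> complex)" using schwartz_sb[OF bump_kernel_schwartz[OF assms]] by blast
  then have "norm (bump_kernel \<Psi> m z) \<le> B" for z :: 'a using sbD[of 0 0 B _ "[]" z] by fastforce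
  then show ?thesis by (rule that)
qed

text \<open>A general \<open>h\<close> in L_p has no Fourier transform that is a function, so the
  localisation is carried out on the other factor: the pairing is rewritten as an integral of
  \<open>h\<close> against \<open>J\<close>, and \<open>J\<close> is evaluated on the frequency
  side, where \<open>freq_localized\<close> applies.\<close>

lemma conv_tensor_piece:
  fixes h :: "'a::euclidean_space \<Rightarrow> complex" and \<phi> :: "'a \<times> real \<Rightarrow> complex"
  assumes \<Psi>: "cutoff \<Psi>" and p: "1 \<le> p" and h: "h \<in> borel_measurable lborel" "Lp_norm p h < \<infinity>"
    and N: "m + 4 \<le> N" and \<phi>: "\<phi> \<in> schwartz_functions"
  shows "(\<integral>z. conv h (bump_kernel \<Psi> m) (fst z) * osc_fun \<Psi> N (snd z) * fourier (\<lambda>\<xi>. part \<Psi> k \<xi> * inv_fourier \<phi> \<xi>) z \<partial>lborel)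
    = (if k = N then \<integral>z. conv h (bump_kernel \<Psi> m) (fst z) * osc_fun \<Psi> N (snd z) * \<phi> z \<partial>lborel else 0)"
proof -
  let ?\<eta> = "bump_kernel \<Psi> m :: 'a \<Rightarrow> complex" and ?\<theta> = "fourier (\<lambda>\<xi>. part \<Psi> k \<xi> * inv_fourier \<phi> \<xi>)"
  have \<eta>S: "?\<eta> \<in> schwartz_functions" by (rule bump_kernel_schwartz[OF \<Psi>])
  have \<theta>: "?\<theta> \<in> schwartz_functions" by (intro fourier_schwartz part_mult_schwartz \<Psi> inv_fourier_schwartz \<phi>)
  obtain M where M: "\<And>t. norm (osc_fun \<Psi> N t) \<le> M" using osc_fun_bounds[OF \<Psi>, of 1] by auto
  obtain D where D: "\<And>z. norm (conv h ?\<eta> z) \<le> D" using conv_bounded[OF p h \<eta>S] by metis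
  obtain E where E: "\<And>z. norm (?\<eta> z) \<le> E" using bump_kernel_bounded[OF \<Psi>, where 'a='a] by metis
  have D0: "D \<ge> 0" using D order_trans[OF norm_ge_zero] by blast
  have E0: "E \<ge> 0" using E order_trans[OF norm_ge_zero] by blast
  define J where "J \<theta> y = (\<integral>z. ?\<eta> (y - fst z) * osc_fun \<Psi> N (snd z) * \<theta> z \<partial>lborel)" for \<theta> y
  have Q: "(\<integral>z. conv h ?\<eta> (fst z) * osc_fun \<Psi> N (snd z) * \<theta> z \<partial>lborel) = (\<integral>y. h y * J \<theta> y \<partial>lborel)"
    if \<theta>: "\<theta> \<in> schwartz_functions" for \<theta> :: "'a \<times> real \<Rightarrow> complex"
  proof -
    have \<theta>i: "integrable lborel \<theta>" by (rule schwartz_integrable[OF \<theta>])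
    have om: "(\<lambda>z :: 'a \<times> real. osc_fun \<Psi> N (snd z)) \<in> borel_measurable lborel"
      using measurable_tensor_continuous[of "\<lambda>x::'a. 1" "osc_fun \<Psi> N"] osc_fun_continuous[OF \<Psi>] by simp
    have o\<theta>: "integrable lborel (\<lambda>z. osc_fun \<Psi> N (snd z) * \<theta> z)"
      by (rule integrable_bounded_mult[OF \<theta>i om M])
    \<comment> \<open>Integrating out the normal variable leaves an integrable function on the
      hyperplane, to which \<open>conv_integral_swap\<close> applies.\<close>
    define \<phi>' where "\<phi>' x = (\<integral>t. osc_fun \<Psi> N t * \<theta> (x, t) \<partial>lborel)" for x
    have \<phi>'i: "integrable lborel \<phi>'" unfolding \<phi>'_def using integral_prod_lborel(1)[OF o\<theta>] by simp
    have split: "(\<integral>z. w (fst z) * osc_fun \<Psi> N (snd z) * \<theta> z \<partial>lborel) = (\<integral>x. w x * \<phi>' x \<partial>lborel)"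
      if w: "continuous_on UNIV w" "\<And>x. norm (w x) \<le> d" for w and d :: real
    proof -
      have "(\<lambda>z :: 'a \<times> real. w (fst z)) \<in> borel_measurable lborel"
        using measurable_tensor_continuous[of w "\<lambda>t::real. 1"] w by simp
      from integrable_bounded_mult[OF o\<theta> this w(2)]
      have i: "integrable lborel (\<lambda>z. w (fst z) * (osc_fun \<Psi> N (snd z) * \<theta> z))" .
      show ?thesis using integral_prod_lborel(2)[OF i] by (simp add: \<phi>'_def mult.assoc)
    qed
    have "continuous_on UNIV (\<lambda>x. ?\<eta> (y - x))" for y
      by (intro continuous_on_compose2[OF smooth_continuous[OF schwartz_smooth[OF \<eta>S], of UNIV]]) (auto intro!: continuous_intros)
    then have JJ: "J \<theta> y = (\<integral>x. \<phi>' x * ?\<eta> (y - x) \<partial>lborel)" for y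
      unfolding J_def using split[OF _ E] by (simp add: mult.commute)
    have "(\<integral>z. conv h ?\<eta> (fst z) * osc_fun \<Psi> N (snd z) * \<theta> z \<partial>lborel) = (\<integral>x. conv h ?\<eta> x * \<phi>' x \<partial>lborel)"
      by (rule split[OF conv_continuous[OF p h \<eta>S] D])
    also have "\<dots> = (\<integral>y. h y * J \<theta> y \<partial>lborel)"
      unfolding JJ by (rule conv_integral_swap[OF p h \<eta>S \<phi>'i, symmetric])
    finally show ?thesis .
  qed
  have "J ?\<theta> y = (if k = N then J \<phi> y else 0)" for y
  proof -
    let ?c = "complex_of_real (1 / (2 * pi) ^ DIM('a))"
    \<comment> \<open>Chosen so that its transform is the kernel at y - x. Then \<open>J\<close> is
      the pairing of \<theta> with the transform of a tensor product, and the multiplication formula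
      moves that transform to \<theta>.\<close>
    define f where "f \<xi> = exp (\<i> * of_real (-1 * (\<xi> \<bullet> y))) * (?c * cut \<Psi> m \<xi>)" for \<xi> :: 'a
    have fi: "integrable lborel f" unfolding f_def by (intro integrable_exp_mult integrable_mult_right cut_integrable \<Psi>)
    have Ff: "FT 1 f x = ?\<eta> (y - x)" for x
    proof -
      have "exp (\<i> * complex_of_real (1 * (\<xi> \<bullet> x))) * f \<xi> = ?c * (exp (\<i> * of_real (-1 * (\<xi> \<bullet> (y - x)))) * cut \<Psi> m \<xi>)" for \<xi>
      proof -
        have "exp (\<i> * complex_of_real (1 * (\<xi> \<bullet> x))) * exp (\<i> * of_real (-1 * (\<xi> \<bullet> y))) = exp (\<i> * of_real (-1 * (\<xi> \<bullet> (y - x))))"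
          by (simp add: exp_add[symmetric] inner_diff_right algebra_simps)
        moreover have "exp (\<i> * complex_of_real (1 * (\<xi> \<bullet> x))) * f \<xi> = ?c * ((exp (\<i> * complex_of_real (1 * (\<xi> \<bullet> x))) * exp (\<i> * of_real (-1 * (\<xi> \<bullet> y)))) * cut \<Psi> m \<xi>)"
          unfolding f_def by (simp only: mult_ac)
        ultimately show ?thesis by (simp only:)
      qed
      then show ?thesis unfolding FT_def[of 1] bump_kernel_def FT_def[of "-1"] by (simp only: integral_mult_right_zero)
    qed
    note gi = bump_freq_integrable[OF \<Psi>, of N]
    have K: "J \<theta> y = (\<integral>\<zeta>. (f (fst \<zeta>) * bump_freq \<Psi> N (snd \<zeta>)) * FT 1 \<theta> \<zeta> \<partial>lborel)"
      if "\<theta> \<in> schwartz_functions" for \<theta> :: "'a \<times> real \<Rightarrow> complex"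
      using FT_multiplication[OF integral_tensor(1)[OF fi gi] schwartz_integrable[OF that], of 1]
      by (simp add: J_def FT_tensor[OF fi gi] Ff osc_fun_def)
    have loc: "(f (fst \<zeta>) * bump_freq \<Psi> N (snd \<zeta>)) * FT 1 ?\<theta> \<zeta>
        = (if k = N then (f (fst \<zeta>) * bump_freq \<Psi> N (snd \<zeta>)) * FT 1 \<phi> \<zeta> else 0)" for \<zeta>
    proof -
      have "(f (fst \<zeta>) * bump_freq \<Psi> N (snd \<zeta>)) * FT 1 ?\<theta> \<zeta>
         = exp (\<i> * of_real (-1 * (fst \<zeta> \<bullet> y))) * ?c * (part \<Psi> k \<zeta> * (cut \<Psi> m (fst \<zeta>) * bump_freq \<Psi> N (snd \<zeta>))) * FT 1 \<phi> \<zeta>"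
        unfolding FT_piece[OF \<Psi> \<phi>] f_def by (simp only: mult_ac)
      also have "\<dots> = exp (\<i> * of_real (-1 * (fst \<zeta> \<bullet> y))) * ?c * (if k = N then cut \<Psi> m (fst \<zeta>) * bump_freq \<Psi> N (snd \<zeta>) else 0) * FT 1 \<phi> \<zeta>"
        by (simp only: freq_localized[OF \<Psi> N])
      also have "\<dots> = (if k = N then (f (fst \<zeta>) * bump_freq \<Psi> N (snd \<zeta>)) * FT 1 \<phi> \<zeta> else 0)"
        by (cases "k = N") (simp_all add: f_def)
      finally show ?thesis .
    qed
    show ?thesis unfolding K[OF \<theta>] K[OF \<phi>] loc by simp
  qed
  then show ?thesis unfolding Q[OF \<theta>] Q[OF \<phi>] by simp
qed

text \<open>The decay of \<phi> is shared out: \<open>2 * DIM('a)\<close> powers for the tangential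
  variable, paired with \<open>w\<close> in L_p, and 2 powers for the normal variable, where
  \<open>v\<close> is merely bounded. The constant is uniform in all data, so series of such
  products converge as tempered distributions.\<close>

lemma tensor_weight_bound:
  fixes w :: "'a::euclidean_space \<Rightarrow> complex" and v :: "real \<Rightarrow> complex"
  assumes p: "1 \<le> p"
  shows "\<exists>K\<ge>0. \<forall>(w :: 'a::euclidean_space \<Rightarrow> complex) (v :: real \<Rightarrow> complex) \<phi> a M B.
    continuous_on UNIV w \<longrightarrow> continuous_on UNIV v \<longrightarrow> a > 0 \<longrightarrow> Lp_norm p w \<le> ennreal a \<longrightarrow> M \<ge> 0 \<longrightarrow> (\<forall>t. norm (v t) \<le> M) \<longrightarrow>
    \<phi> \<in> schwartz_functions \<longrightarrow> sb (2 * DIM('a) + 2) 0 B \<phi> \<longrightarrow>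
    integrable lborel (\<lambda>z. w (fst z) * v (snd z) * \<phi> z) \<and> norm (\<integral>z. w (fst z) * v (snd z) * \<phi> z \<partial>lborel) \<le> K * M * a * B"
proof -
  let ?I = "\<integral>x. inverse ((1 + norm (x::'a)) ^ (2 * DIM('a))) \<partial>lborel" and ?J = "\<integral>t. inverse ((1 + norm (t::real)) ^ 2) \<partial>lborel"
  have I0: "?I \<ge> 0" and J0: "?J \<ge> 0" by (auto intro!: Bochner_Integration.integral_nonneg)
  have J: "(\<integral>\<^sup>+t. ennreal (inverse ((1 + norm (t::real)) ^ 2)) \<partial>lborel) = ennreal ?J"
    using integrable_weight[where 'a=real, of 2] by (intro nn_integral_eq_integral) auto
  have "integrable lborel (\<lambda>z. w (fst z) * v (snd z) * \<phi> z) \<and> norm (\<integral>z. w (fst z) * v (snd z) * \<phi> z \<partial>lborel) \<le> ((1 + ?I) * ?J) * M * a * B"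
    if w: "continuous_on UNIV w" and v: "continuous_on UNIV v" and a: "a > 0" "Lp_norm p w \<le> ennreal a" and M: "M \<ge> 0" "\<And>t. norm (v t) \<le> M"
      and \<phi>: "\<phi> \<in> schwartz_functions" and B: "sb (2 * DIM('a) + 2) 0 B \<phi>"
    for w :: "'a \<Rightarrow> complex" and v :: "real \<Rightarrow> complex" and \<phi> a M B
  proof -
    have B0: "B \<ge> 0" using sb_nonneg[OF B] .
    have [measurable]: "w \<in> borel_measurable borel" by (rule borel_measurable_continuous_onI[OF w])
    have [measurable]: "\<phi> \<in> borel_measurable borel" by (rule schwartz_measurable[OF \<phi>])
    have [measurable]: "(\<lambda>z :: 'a \<times> real. w (fst z) * v (snd z)) \<in> borel_measurable lborel" by (rule measurable_tensor_continuous[OF w v])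
    have pt: "norm (w x * v t * \<phi> (x, t)) \<le> (norm (w x) * (1 * inverse ((1 + norm (x - 0)) ^ (2 * DIM('a))))) * (M * B * inverse ((1 + norm t) ^ 2))" for x t
    proof -
      have "norm (\<phi> (x, t)) \<le> B * inverse ((1 + norm (x, t)) ^ (2 * DIM('a) + 2))" by (rule sb_le_weight[OF B])
      also have "\<dots> \<le> B * (inverse ((1 + norm x) ^ (2 * DIM('a))) * inverse ((1 + norm t) ^ 2))"
      proof (rule mult_left_mono[OF _ B0])
        have "(1 + norm x) ^ (2 * DIM('a)) * (1 + norm t) ^ 2 \<le> (1 + norm (x, t)) ^ (2 * DIM('a)) * (1 + norm (x, t)) ^ 2"
          using norm_fst_le[of x t] norm_snd_le[of t x] by (intro mult_mono power_mono) auto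
        then have "inverse ((1 + norm (x, t)) ^ (2 * DIM('a) + 2)) \<le> inverse ((1 + norm x) ^ (2 * DIM('a)) * (1 + norm t) ^ 2)"
          unfolding power_add by (intro le_imp_inverse_le) (auto intro!: mult_pos_pos zero_less_power add_pos_nonneg)
        then show "inverse ((1 + norm (x, t)) ^ (2 * DIM('a) + 2)) \<le> inverse ((1 + norm x) ^ (2 * DIM('a))) * inverse ((1 + norm t) ^ 2)"
          by (simp only: inverse_mult_distrib)
      qed
      finally have "norm (w x) * norm (v t) * norm (\<phi> (x, t)) \<le> norm (w x) * M * (B * (inverse ((1 + norm x) ^ (2 * DIM('a))) * inverse ((1 + norm t) ^ 2)))"
        using M by (intro mult_mono) (auto intro!: mult_nonneg_nonneg)
      then show ?thesis by (simp add: norm_mult mult_ac)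
    qed
    have pt': "ennreal (norm (w x * v t * \<phi> (x, t))) \<le> ennreal (norm (w x) * (1 * inverse ((1 + norm (x - 0)) ^ (2 * DIM('a))))) * ennreal (M * B * inverse ((1 + norm t) ^ 2))" for x t
    proof -
      have "0 \<le> norm (w x) * (1 * inverse ((1 + norm (x - 0)) ^ (2 * DIM('a))))" by simp
      from ennreal_leI[OF pt[of x t], unfolded ennreal_mult'[OF this]] show ?thesis .
    qed
    have "(\<integral>\<^sup>+z. ennreal (norm (w (fst z) * v (snd z) * \<phi> z)) \<partial>lborel) = (\<integral>\<^sup>+x. \<integral>\<^sup>+t. ennreal (norm (w x * v t * \<phi> (x, t))) \<partial>lborel \<partial>lborel)"
      unfolding lborel_prod[symmetric] by (subst lborel.nn_integral_fst[symmetric]) (simp_all add: lborel_prod)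
    also have "\<dots> \<le> (\<integral>\<^sup>+x. \<integral>\<^sup>+t. ennreal (norm (w x) * (1 * inverse ((1 + norm (x - 0)) ^ (2 * DIM('a))))) * ennreal (M * B * inverse ((1 + norm (t::real)) ^ 2)) \<partial>lborel \<partial>lborel)"
      by (intro nn_integral_mono pt')
    also have "\<dots> = (\<integral>\<^sup>+x. ennreal (norm (w x) * (1 * inverse ((1 + norm (x - 0)) ^ (2 * DIM('a))))) \<partial>lborel) * (\<integral>\<^sup>+t. ennreal (M * B * inverse ((1 + norm (t::real)) ^ 2)) \<partial>lborel)"
      by (simp add: nn_integral_cmult nn_integral_multc)
    also have "(\<integral>\<^sup>+t. ennreal (M * B * inverse ((1 + norm (t::real)) ^ 2)) \<partial>lborel) = ennreal (M * B) * ennreal ?J"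
      unfolding J[symmetric] using M B0 by (subst nn_integral_cmult[symmetric]) (auto simp: ennreal_mult')
    also have "(\<integral>\<^sup>+x. ennreal (norm (w x) * (1 * inverse ((1 + norm (x - 0)) ^ (2 * DIM('a))))) \<partial>lborel) * (ennreal (M * B) * ennreal ?J)
       \<le> ennreal (a * (1 + 1 * ?I)) * (ennreal (M * B) * ennreal ?J)"
      by (intro mult_right_mono Lp_times_weight[OF p _ a]) auto
    also have "\<dots> = ennreal (((1 + ?I) * ?J) * M * a * B)"
      using a M B0 I0 J0 by (simp add: ennreal_mult'[symmetric] mult_ac)
    finally have nn: "(\<integral>\<^sup>+z. ennreal (norm (w (fst z) * v (snd z) * \<phi> z)) \<partial>lborel) \<le> ennreal (((1 + ?I) * ?J) * M * a * B)" .
    have "integrable lborel (\<lambda>z. w (fst z) * v (snd z) * \<phi> z)"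
    proof (rule integrableI_bounded)
      show "(\<integral>\<^sup>+z. ennreal (norm (w (fst z) * v (snd z) * \<phi> z)) \<partial>lborel) < \<infinity>" using nn by (rule le_less_trans) simp
    qed measurable
    moreover have "ennreal (norm (\<integral>z. w (fst z) * v (snd z) * \<phi> z \<partial>lborel)) \<le> ennreal (((1 + ?I) * ?J) * M * a * B)"
      by (rule order_trans[OF enn_norm_integral_le nn])
    moreover have "0 \<le> ((1 + ?I) * ?J) * M * a * B" using a M B0 I0 J0 by simp
    ultimately show ?thesis by (simp add: ennreal_le_iff)
  qed
  moreover have "0 \<le> (1 + ?I) * ?J" using I0 J0 by simp
  ultimately show ?thesis by (intro exI[of _ "(1 + ?I) * ?J"]) blast
qed

lemma Lp_norm_mult_const:
  assumes p: "1 \<le> p" "p \<noteq> \<infinity>" and [measurable]: "w \<in> borel_measurable lborel" and a: "0 \<le> a" "Lp_norm p w \<le> ennreal a" and c: "norm c \<le> M"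
  shows "Lp_norm p (\<lambda>x. w x * c) \<le> ennreal (a * M)"
proof -
  define P where "P = enn2real p"
  have P: "P \<ge> 1" using enn2real_inverse[OF p] by (simp add: P_def)
  have M: "M \<ge> 0" using c order_trans[OF norm_ge_zero] by blast
  have I: "(\<integral>\<^sup>+x. ennreal (norm (w x) powr P) \<partial>lborel) \<le> ennreal (a powr P)" using a by (simp add: Lp_norm_le_iff[OF p a(1)] P_def)
  have "(\<integral>\<^sup>+x. ennreal (norm (w x * c) powr P) \<partial>lborel) = (\<integral>\<^sup>+x. ennreal (norm (w x) powr P) \<partial>lborel) * ennreal (norm c powr P)"
    by (simp add: norm_mult powr_mult ennreal_mult' nn_integral_multc)
  also have "\<dots> \<le> ennreal (a powr P) * ennreal (M powr P)"
    using c P by (intro mult_mono I ennreal_leI powr_mono2) auto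
  also have "\<dots> = ennreal ((a * M) powr P)" using a M by (simp add: powr_mult flip: ennreal_mult')
  finally show ?thesis using a M by (subst Lp_norm_le_iff[OF p]) (simp_all add: P_def)
qed

lemma Lp_norm_tensor:
  fixes w :: "'a::euclidean_space \<Rightarrow> complex" and v :: "real \<Rightarrow> complex"
  assumes p: "1 \<le> p" "p \<noteq> \<infinity>" and [measurable]: "w \<in> borel_measurable lborel" "v \<in> borel_measurable lborel" and a: "0 \<le> a" "Lp_norm p w \<le> ennreal a"
    and b: "0 \<le> b" "(\<integral>\<^sup>+t. ennreal (norm (v t) powr enn2real p) \<partial>lborel) \<le> ennreal (b powr enn2real p)"
  shows "Lp_norm p (\<lambda>z. w (fst z) * v (snd z)) \<le> ennreal (a * b)"
proof -
  define P where "P = enn2real p"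
  have I: "(\<integral>\<^sup>+x. ennreal (norm (w x) powr P) \<partial>lborel) \<le> ennreal (a powr P)" using a by (simp add: Lp_norm_le_iff[OF p a(1)] P_def)
  have "(\<integral>\<^sup>+z. ennreal (norm (w (fst z) * v (snd z)) powr P) \<partial>lborel) = (\<integral>\<^sup>+x. \<integral>\<^sup>+t. ennreal (norm (w x * v t) powr P) \<partial>lborel \<partial>lborel)"
    unfolding lborel_prod[symmetric] by (subst lborel.nn_integral_fst[symmetric]) simp_all
  also have "\<dots> = (\<integral>\<^sup>+x. ennreal (norm (w x) powr P) \<partial>lborel) * (\<integral>\<^sup>+t. ennreal (norm (v t) powr P) \<partial>lborel)"
    by (simp add: norm_mult powr_mult ennreal_mult' nn_integral_cmult nn_integral_multc)
  also have "\<dots> \<le> ennreal (a powr P) * ennreal (b powr P)" using b by (intro mult_mono I) (auto simp: P_def)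
  also have "\<dots> = ennreal ((a * b) powr P)" using a b by (simp add: powr_mult flip: ennreal_mult')
  finally show ?thesis using a b by (subst Lp_norm_le_iff[OF p]) (simp_all add: P_def)
qed

lemma Lp_norm_dist_le:
  assumes p: "1 \<le> p" and g: "g \<in> borel_measurable lborel"
    and eq: "\<And>\<phi>. \<phi> \<in> test_functions \<Longrightarrow> w \<phi> = (\<integral>x. g x * \<phi> x \<partial>lborel)"
  shows "Lp_norm_dist p w \<le> Lp_norm p g"
proof -
  have "Lp_norm_dist p w = Lp_norm_dist p (regular_distribution g)"
    unfolding Lp_norm_dist_def by (simp add: eq regular_distribution_def)
  then show ?thesis using Lp_norm_dist_regular[OF p g] by simp
qed

text \<open>The extension operator: the data are cut into pieces \<open>w j\<close> of frequency at most \<open>2 ^ m j\<close>, and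
  each piece is multiplied by an oscillation of frequency \<open>2 ^ Nf j\<close> in the normal direction. Since
  \<open>Nf\<close> is strictly increasing and \<open>m j + 4 \<le> Nf j\<close>, the dyadic decomposition separates the products.\<close>

theorem trace_surjective:
  fixes h :: "'a::euclidean_space \<Rightarrow> complex"
  assumes \<Psi>: "cutoff \<Psi>" and p: "1 \<le> p" "p \<noteq> \<infinity>" and q: "0 < q" "q \<le> 1"
    and h[measurable]: "h \<in> borel_measurable lborel" and fin: "Lp_norm p h < \<infinity>"
  shows "\<exists>u\<in>besov_space \<Psi> (enn2real (1 / p)) p q. distributional_trace u = regular_distribution h"
proof -
  note p_fin = p
  define P where "P = enn2real p"
  define s where "s = enn2real (1 / p)"
  have P: "P \<ge> 1" and s: "s = 1 / P" using enn2real_inverse[OF p] by (auto simp: P_def s_def)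
  obtain r where r: "Lp_norm p h = ennreal r" "r \<ge> 0" using fin by (cases "Lp_norm p h") auto
  have "\<forall>j. \<exists>m. Lp_norm p (\<lambda>y. h y - conv h (bump_kernel \<Psi> m) y) \<le> ennreal ((1/2) ^ j)"
    by (intro allI conv_approx[OF \<Psi> p h fin]) simp
  from choice[OF this] obtain m where m: "\<And>j::nat. Lp_norm p (\<lambda>y. h y - conv h (bump_kernel \<Psi> (m j)) y) \<le> ennreal ((1/2) ^ j)"
    by blast
  define c where "c j = conv h (bump_kernel \<Psi> (m j))" for j
  have cc: "continuous_on UNIV (c j)" for j unfolding c_def by (rule conv_continuous[OF p(1) h fin bump_kernel_schwartz[OF \<Psi>]])
  have [measurable]: "c j \<in> borel_measurable borel" for j by (rule borel_measurable_continuous_onI[OF cc])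
  obtain A where A: "A > 0" "\<And>n g a. g \<in> borel_measurable lborel \<Longrightarrow> a > 0 \<Longrightarrow> Lp_norm p g \<le> ennreal a \<Longrightarrow>
    Lp_norm p (conv (g :: 'a \<Rightarrow> complex) (bump_kernel \<Psi> n)) \<le> ennreal (A * a)"
    using conv_Lp[OF \<Psi> p(1), where 'a='a] by auto
  have cL: "Lp_norm p (c j) \<le> ennreal (A * (r + 1))" for j
    unfolding c_def using r by (intro A(2)[OF h]) (auto intro: ennreal_leI)
  have Ar: "A * (r + 1) > 0" using A r by simp
  \<comment> \<open>Telescoping: the partial sums are the approximants \<open>c J\<close>, and
    successive differences inherit the rate 2^(-j).\<close>
  define w where "w j = (case j of 0 \<Rightarrow> c 0 | Suc i \<Rightarrow> (\<lambda>x. c (Suc i) x + (-1) * c i x))" for j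
  have w0: "w 0 = c 0" and wS: "w (Suc i) = (\<lambda>x. c (Suc i) x + (-1) * c i x)" for i by (auto simp: w_def)
  have wc: "continuous_on UNIV (w j)" for j
    by (cases j) (auto simp only: w0 wS intro!: cc continuous_on_add continuous_on_mult continuous_on_const)
  have [measurable]: "w j \<in> borel_measurable borel" for j by (rule borel_measurable_continuous_onI[OF wc])
  \<comment> \<open>The first summand covers \<open>w 0\<close>; the 8 covers the differences, since
    the addition constant 4 times 2^(-i) is 8 times 2^(-(i+1)).\<close>
  define c0 where "c0 = A * (r + 1) + 8"
  have c0: "c0 > 0" using Ar by (simp add: c0_def)
  have wL: "Lp_norm p (w j) \<le> ennreal (c0 * (1/2) ^ j)" for j
  proof (cases j)
    case 0
    show ?thesis unfolding 0 w0 by (rule order_trans[OF cL]) (simp add: c0_def ennreal_leI)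
  next
    case (Suc i)
    have half: "Lp_norm p (\<lambda>x. - (h x - c (Suc i) x)) \<le> ennreal ((1/2) ^ i)"
      unfolding Lp_norm_minus c_def by (rule order_trans[OF m]) (simp add: ennreal_leI)
    have "w (Suc i) = (\<lambda>x. (h x - c i x) + - (h x - c (Suc i) x))" unfolding wS by (rule ext) simp
    then have "Lp_norm p (w (Suc i)) \<le> ennreal (4 * (1/2) ^ i)"
      using half m[of i] by (simp only:) (intro Lp_norm_add_le[OF p], auto simp: c_def[symmetric])
    also have "\<dots> \<le> ennreal (c0 * (1/2) ^ Suc i)" using Ar by (intro ennreal_leI) (simp add: c0_def)
    finally show ?thesis by (simp only: Suc)
  qed
  have sumw: "(\<Sum>j\<le>J. w j x) = c J x" for J x by (induction J) (auto simp: w0 wS)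
  \<comment> \<open>Summing makes the sequence strictly increasing whatever \<open>m\<close> is,
    while each term still exceeds \<open>m j\<close> by at least 4.\<close>
  define Nf where "Nf j = (\<Sum>i\<le>j. m i + 4)" for j
  have Nmono: "strict_mono Nf" unfolding strict_mono_Suc_iff Nf_def by simp
  have N1: "m j + 4 \<le> Nf j" for j unfolding Nf_def by (rule member_le_sum[of j "{..j}" "\<lambda>i. m i + 4"]) auto
  \<comment> \<open>\<open>w (Suc j)\<close> contains \<open>c j\<close> besides
    \<open>c (Suc j)\<close>, so the frequency \<open>Nf (Suc j)\<close> has to clear both.\<close>
  have N2: "m j + 4 \<le> Nf (Suc j)" for j using N1[of j] strict_monoD[OF Nmono, of j "Suc j"] by simp
  define V where "V j = osc_fun \<Psi> (Nf j)" for j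
  have Vc: "continuous_on UNIV (V j)" for j unfolding V_def by (rule osc_fun_continuous[OF \<Psi>])
  have [measurable]: "V j \<in> borel_measurable borel" for j by (rule borel_measurable_continuous_onI[OF Vc])
  obtain M where M: "M > 0" "\<And>j t. norm (V j t) \<le> M" "\<And>j. (\<integral>\<^sup>+t. ennreal (norm (V j t) powr P) \<partial>lborel) \<le> ennreal (M / 2 ^ Nf j)"
    using osc_fun_bounds[OF \<Psi> P] unfolding V_def by metis
  let ?k0 = "2 * DIM('a) + 2"
  obtain K where K: "K \<ge> 0" "\<And>(w :: 'a \<Rightarrow> complex) (v :: real \<Rightarrow> complex) \<phi> a M B.
    continuous_on UNIV w \<Longrightarrow> continuous_on UNIV v \<Longrightarrow> a > 0 \<Longrightarrow> Lp_norm p w \<le> ennreal a \<Longrightarrow> M \<ge> 0 \<Longrightarrow> (\<And>t. norm (v t) \<le> M) \<Longrightarrow>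
    \<phi> \<in> schwartz_functions \<Longrightarrow> sb ?k0 0 B \<phi> \<Longrightarrow>
    integrable lborel (\<lambda>z. w (fst z) * v (snd z) * \<phi> z) \<and> norm (\<integral>z. w (fst z) * v (snd z) * \<phi> z \<partial>lborel) \<le> K * M * a * B"
    using tensor_weight_bound[OF p(1), where 'a='a] by blast
  define T where "T j \<phi> = (\<integral>z. w j (fst z) * V j (snd z) * \<phi> z \<partial>lborel)" for j \<phi>
  have wa: "c0 * (1/2) ^ j > 0" for j :: nat using c0 by simp
  have Tb: "norm (T j \<phi>) \<le> (K * M * c0 * B) * (1/2) ^ j" if "\<phi> \<in> schwartz_functions" "sb ?k0 0 B \<phi>" for j \<phi> B
    using K(2)[OF wc Vc wa wL less_imp_le[OF M(1)] M(2) that] by (simp add: T_def mult_ac)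
  have Ti: "integrable lborel (\<lambda>z. w j (fst z) * V j (snd z) * \<phi> z)" if \<phi>: "\<phi> \<in> schwartz_functions" for j \<phi>
    using K(2)[OF wc Vc wa wL less_imp_le[OF M(1)] M(2) \<phi>] schwartz_sb[OF \<phi>] by blast
  have geo: "summable (\<lambda>j. b * (1/2::real) ^ j)" for b by (intro summable_mult summable_geometric) simp
  have Ts: "summable (\<lambda>j. T j \<phi>)" if \<phi>: "\<phi> \<in> schwartz_functions" for \<phi>
  proof -
    obtain B where B: "sb ?k0 0 B \<phi>" using schwartz_sb[OF \<phi>] by blast
    show ?thesis by (rule summable_comparison_test'[OF geo]) (rule Tb[OF \<phi> B])
  qed
  define u where "u \<phi> = (if \<phi> \<in> schwartz_functions then \<Sum>j. T j \<phi> else 0)" for \<phi>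
  have ut: "u \<in> tempered_distributions"
  proof (rule temperedI[of _ "K * M * c0 * 2" ?k0 0])
    show "linear_functional_on schwartz_functions u"
      unfolding linear_functional_on_def
    proof safe
      fix \<phi> \<psi> :: "'a \<times> real \<Rightarrow> complex" assume *: "\<phi> \<in> schwartz_functions" "\<psi> \<in> schwartz_functions"
      have "T j (\<lambda>x. \<phi> x + \<psi> x) = T j \<phi> + T j \<psi>" for j
        unfolding T_def distrib_left by (rule Bochner_Integration.integral_add[OF Ti[OF *(1)] Ti[OF *(2)]])
      then show "u (\<lambda>x. \<phi> x + \<psi> x) = u \<phi> + u \<psi>"
        using * schwartz_add[OF *] by (simp add: u_def suminf_add[OF Ts Ts])
    next
      fix \<phi> :: "'a \<times> real \<Rightarrow> complex" and b assume *: "\<phi> \<in> schwartz_functions"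
      have "T j (\<lambda>x. b * \<phi> x) = b * T j \<phi>" for j
        unfolding T_def by (subst integral_mult_right_zero[symmetric]) (simp only: mult_ac)
      then show "u (\<lambda>x. b * \<phi> x) = b * u \<phi>"
        using * schwartz_cmult[OF *] by (simp add: u_def suminf_mult[OF Ts])
    qed (simp add: u_def)
    fix \<phi> :: "'a \<times> real \<Rightarrow> complex" and B assume \<phi>: "\<phi> \<in> schwartz_functions" and B: "sb ?k0 0 B \<phi>"
    have "norm (u \<phi>) \<le> (\<Sum>j. (K * M * c0 * B) * (1/2) ^ j)"
      using \<phi> by (simp only: u_def if_True) (intro norm_suminf_le Tb[OF \<phi> B] geo)
    also have "\<dots> = (K * M * c0 * B) * 2" by (subst suminf_mult) (simp_all add: suminf_geometric)
    finally show "norm (u \<phi>) \<le> K * M * c0 * 2 * B" by (simp add: mult_ac)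
  qed (use K M c0 in simp)
  define G where "G j x t = w j x * V j t" for j x t
  define a where "a j = (c0 * M) * (1/2) ^ j" for j :: nat
  interpret trace_series p G a u
  proof
    show "(\<lambda>(x, t). G j x t) \<in> borel_measurable (lborel \<Otimes>\<^sub>M lborel)" for j unfolding G_def by measurable
    show "a j > 0" for j using c0 M by (simp add: a_def)
    show "summable a" unfolding a_def by (rule geo)
    show "Lp_norm p (\<lambda>x. G j x t) \<le> ennreal (a j)" for j t
    proof -
      have "Lp_norm p (\<lambda>x. w j x * V j t) \<le> ennreal ((c0 * (1/2) ^ j) * M)"
        by (rule Lp_norm_mult_const[OF p _ less_imp_le[OF wa] wL M(2)]) simp
      then show ?thesis by (simp add: G_def a_def mult_ac)
    qed
    show "continuous_on UNIV (\<lambda>t. \<integral>x. G j x t * \<phi> x \<partial>lborel)" if "\<phi> \<in> test_functions" for j \<phi>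
    proof -
      have "(\<integral>x. G j x t * \<phi> x \<partial>lborel) = V j t * (\<integral>x. w j x * \<phi> x \<partial>lborel)" for t
        unfolding G_def by (subst integral_mult_right_zero[symmetric]) (simp only: mult_ac)
      then show ?thesis by (simp only:) (intro continuous_on_mult continuous_on_const Vc)
    qed
    show "(\<lambda>j. \<integral>z. G j (fst z) (snd z) * \<phi> z \<partial>lborel) sums u \<phi>" if "\<phi> \<in> test_functions" for \<phi>
      using summable_sums[OF Ts[OF test_schwartz[OF that]]] test_schwartz[OF that] by (simp add: u_def T_def G_def)
  qed (rule p)
  \<comment> \<open>At t = 0 every oscillation equals 1, so the partial sums are pairings with
    \<open>c J\<close>; these converge to the pairing with \<open>h\<close>, because h - c J has
    norm at most 2^(-J).\<close>
  have "path 0 = regular_distribution h"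
  proof
    fix \<phi> :: "'a \<Rightarrow> complex"
    show "path 0 \<phi> = regular_distribution h \<phi>"
    proof (cases "\<phi> \<in> test_functions")
      case \<phi>: True
      have \<phi>i: "integrable lborel \<phi>" by (intro schwartz_integrable test_schwartz \<phi>)
      have [measurable]: "\<phi> \<in> borel_measurable borel" by (rule test_measurable[OF \<phi>])
      obtain B where B: "\<And>x. norm (\<phi> x) \<le> B" using test_bounded[OF \<phi>] by metis
      define D where "D = (\<integral>x. norm (\<phi> x) \<partial>lborel)"
      have D0: "D \<ge> 0" unfolding D_def by (rule Bochner_Integration.integral_nonneg) simp
      have B0: "B \<ge> 0" using B order_trans[OF norm_ge_zero] by blast
      have Dn: "(\<integral>\<^sup>+x. ennreal (norm (\<phi> x)) \<partial>lborel) \<le> ennreal D"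
        unfolding D_def by (subst nn_integral_eq_integral) (use \<phi>i in auto)
      have G0: "G j x 0 = w j x" for j x by (simp add: G_def V_def osc_fun_0[OF \<Psi>])
      have wi: "integrable lborel (\<lambda>x. w j x * \<phi> x)" for j using slice_integrable[OF \<phi>, of j 0] by (simp add: G0)
      have hi: "integrable lborel (\<lambda>x. h x * \<phi> x)" by (rule Lp_times_schwartz[OF p(1) h fin test_schwartz[OF \<phi>]])
      have ps: "(\<Sum>j\<le>J. \<integral>x. w j x * \<phi> x \<partial>lborel) = (\<integral>x. c J x * \<phi> x \<partial>lborel)" for J
        by (simp add: Bochner_Integration.integral_sum[OF wi, symmetric] sumw flip: sum_distrib_right)
      have ci: "integrable lborel (\<lambda>x. c J x * \<phi> x)" for J
      proof -
        have "integrable lborel (\<lambda>x. \<Sum>j\<le>J. w j x * \<phi> x)" by (rule Bochner_Integration.integrable_sum) (rule wi)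
        then show ?thesis by (simp add: sumw flip: sum_distrib_right)
      qed
      have bound: "norm ((\<Sum>j\<le>J. \<integral>x. w j x * \<phi> x \<partial>lborel) - (\<integral>x. h x * \<phi> x \<partial>lborel)) \<le> (B + D) * (1/2) ^ J" for J
      proof -
        have "(\<integral>x. (h x - c J x) * \<phi> x \<partial>lborel) = (\<integral>x. h x * \<phi> x \<partial>lborel) - (\<integral>x. c J x * \<phi> x \<partial>lborel)"
          unfolding left_diff_distrib by (rule Bochner_Integration.integral_diff[OF hi ci])
        then have "norm ((\<Sum>j\<le>J. \<integral>x. w j x * \<phi> x \<partial>lborel) - (\<integral>x. h x * \<phi> x \<partial>lborel)) = norm (\<integral>x. (h x - c J x) * \<phi> x \<partial>lborel)"
          by (simp add: ps norm_minus_commute)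
        moreover have "ennreal (norm (\<integral>x. (h x - c J x) * \<phi> x \<partial>lborel)) \<le> ennreal ((1/2) ^ J * (B + D))"
        proof -
          have "(\<integral>\<^sup>+x. ennreal (norm (h x - c J x) * norm (\<phi> x)) \<partial>lborel) \<le> ennreal ((1/2) ^ J * (B + D))"
            by (rule Lp_norm_weighted_L1[OF p(1), where W = "\<lambda>x. norm (\<phi> x)"]) (use m[of J] B Dn D0 in \<open>auto simp: c_def[symmetric]\<close>)
          then show ?thesis using enn_norm_integral_le[of lborel "\<lambda>x. (h x - c J x) * \<phi> x"] by (simp add: norm_mult)
        qed
        ultimately show ?thesis using B0 D0 by (simp add: mult.commute)
      qed
      have lim0: "(\<lambda>J. (B + D) * (1/2) ^ J) \<longlonglongrightarrow> 0"
        using tendsto_mult[OF tendsto_const[of "B + D"] LIMSEQ_realpow_zero[of "1/2::real"]] by simp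
      have "(\<lambda>J. (\<Sum>j\<le>J. \<integral>x. w j x * \<phi> x \<partial>lborel) - (\<integral>x. h x * \<phi> x \<partial>lborel)) \<longlonglongrightarrow> 0"
        by (rule Lim_null_comparison[OF _ lim0]) (rule always_eventually, rule allI, rule bound)
      then have "(\<lambda>j. \<integral>x. w j x * \<phi> x \<partial>lborel) sums (\<integral>x. h x * \<phi> x \<partial>lborel)"
        by (simp add: sums_def_le LIM_zero_iff)
      then show ?thesis using \<phi> by (simp add: path_def G0 regular_distribution_def sums_iff)
    qed (simp add: path_def regular_distribution_def)
  qed
  then have tr: "distributional_trace u = regular_distribution h" using trace_eq[OF \<Psi>] by simp
  have piece: "dyadic_piece \<Psi> k u \<phi> = (\<Sum>j. if k = Nf j then T j \<phi> else 0)" if \<phi>: "\<phi> \<in> schwartz_functions" for k \<phi>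
  proof -
    let ?\<theta> = "fourier (\<lambda>\<xi>. part \<Psi> k \<xi> * inv_fourier \<phi> \<xi>)"
    have \<theta>: "?\<theta> \<in> schwartz_functions" by (intro fourier_schwartz part_mult_schwartz \<Psi> inv_fourier_schwartz \<phi>)
    have cp: "(\<integral>z. c i (fst z) * V j (snd z) * ?\<theta> z \<partial>lborel) = (if k = Nf j then \<integral>z. c i (fst z) * V j (snd z) * \<phi> z \<partial>lborel else 0)"
      if "m i + 4 \<le> Nf j" for i j
      unfolding c_def V_def by (rule conv_tensor_piece[OF \<Psi> p(1) h fin that \<phi>])
    have ci: "integrable lborel (\<lambda>z. c i (fst z) * V j (snd z) * \<psi> z)" if \<psi>: "\<psi> \<in> schwartz_functions" for i j \<psi>
      using K(2)[OF cc Vc Ar cL less_imp_le[OF M(1)] M(2) \<psi>] schwartz_sb[OF \<psi>] by blast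
    \<comment> \<open>The localisation is known for convolutions of \<open>h\<close>, so a
      difference \<open>w (Suc i)\<close> is split into its two approximants, both localised at the
      same index \<open>Nf (Suc i)\<close>.\<close>
    have Tc: "T (Suc i) \<psi> = (\<integral>z. c (Suc i) (fst z) * V (Suc i) (snd z) * \<psi> z \<partial>lborel) - (\<integral>z. c i (fst z) * V (Suc i) (snd z) * \<psi> z \<partial>lborel)"
      if \<psi>: "\<psi> \<in> schwartz_functions" for i \<psi>
      unfolding T_def wS Bochner_Integration.integral_diff[OF ci[OF \<psi>] ci[OF \<psi>], symmetric]
      by (intro Bochner_Integration.integral_cong refl) (simp add: algebra_simps)
    have "T j ?\<theta> = (if k = Nf j then T j \<phi> else 0)" for j
    proof (cases j)
      case 0 then show ?thesis using cp[OF N1[of 0]] by (simp only: T_def w0)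
    next
      case (Suc i)
      show ?thesis unfolding Suc Tc[OF \<theta>] Tc[OF \<phi>] cp[OF N1] cp[OF N2] by simp
    qed
    then show ?thesis using \<theta> by (simp add: dyadic_piece_eq[OF \<Psi> \<phi>] u_def)
  qed
  define L where "L k = Lp_norm_dist p (dyadic_piece \<Psi> k u)" for k
  have L0: "L k = 0" if "k \<notin> range Nf" for k
  proof -
    have "L k \<le> Lp_norm p (\<lambda>z::'a \<times> real. 0)"
      unfolding L_def
    proof (rule Lp_norm_dist_le[OF p(1)])
      fix \<phi> :: "'a \<times> real \<Rightarrow> complex" assume "\<phi> \<in> test_functions"
      from piece[OF test_schwartz[OF this], of k] show "dyadic_piece \<Psi> k u \<phi> = (\<integral>z. 0 * \<phi> z \<partial>lborel)"
        using that by (auto simp: image_iff)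
    qed simp
    also have "\<dots> \<le> ennreal 0" using P by (subst Lp_norm_le_iff[OF p_fin]) (auto simp: P_def)
    finally show ?thesis by simp
  qed
  have LN: "L (Nf j) \<le> ennreal ((c0 * M powr s) * (1/2) ^ j * 2 powr (- (s * real (Nf j))))" for j
  proof -
    \<comment> \<open>Injectivity of \<open>Nf\<close> leaves a single term of the series, so the
      piece is exactly one product.\<close>
    have inj: "Nf j = Nf i \<longleftrightarrow> i = j" for i using strict_mono_eq[OF Nmono] by auto
    have "dyadic_piece \<Psi> (Nf j) u \<phi> = T j \<phi>" if "\<phi> \<in> test_functions" for \<phi>
      unfolding piece[OF test_schwartz[OF that]] inj using sums_unique[OF sums_single[of j "\<lambda>i. T i \<phi>"]] by simp
    then have "L (Nf j) \<le> Lp_norm p (\<lambda>z. w j (fst z) * V j (snd z))"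
      unfolding L_def by (intro Lp_norm_dist_le[OF p(1)] measurable_tensor_continuous wc Vc) (simp add: T_def)
    also have "\<dots> \<le> ennreal ((c0 * (1/2) ^ j) * (M / 2 ^ Nf j) powr s)"
    proof (rule Lp_norm_tensor[OF p_fin _ _ less_imp_le[OF wa] wL])
      have "((M / 2 ^ Nf j) powr s) powr P = M / 2 ^ Nf j" using P M(1) by (simp add: powr_powr s)
      then show "(\<integral>\<^sup>+t. ennreal (norm (V j t) powr enn2real p) \<partial>lborel) \<le> ennreal (((M / 2 ^ Nf j) powr s) powr enn2real p)"
        using M(3)[of j] by (simp add: P_def)
    qed simp_all
    also have "(M / 2 ^ Nf j) powr s = M powr s * 2 powr (- (s * real (Nf j)))"
    proof -
      have "(2 ^ Nf j) powr s = 2 powr (s * real (Nf j))" by (simp add: powr_powr mult.commute flip: powr_realpow)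
      moreover have "(M / 2 ^ Nf j) powr s = M powr s / (2 ^ Nf j) powr s" using M(1) by (simp add: powr_divide)
      ultimately show ?thesis by (simp only: powr_minus divide_inverse)
    qed
    finally show ?thesis by (simp add: mult_ac)
  qed
  obtain Q where Q: "q = ennreal Q" "Q > 0" "Q \<le> 1"
    using q by (cases q) (auto simp: top_unique simp flip: ennreal_1)
  define F where "F k = ennreal (2 powr (s * real k * Q)) * ennreal_powr (L k) Q" for k
  have F0: "F k = 0" if "k \<notin> range Nf" for k using Q by (simp add: F_def L0[OF that] ennreal_powr_def)
  define b where "b = c0 * M powr s"
  have b: "b > 0" using c0 M by (simp add: b_def)
  \<comment> \<open>The Besov weight cancels against the norm of the oscillation, leaving the
    geometric sequence of ratio (1/2)^Q, which is summable for every Q > 0.\<close>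
  have FN: "F (Nf j) \<le> ennreal (b powr Q * ((1/2) powr Q) ^ j)" for j
  proof -
    have "L (Nf j) \<noteq> \<infinity>" using LN[of j] by (auto simp: top_unique)
    then obtain l where l: "L (Nf j) = ennreal l" "l \<ge> 0" by (metis ennreal_cases infinity_ennreal_def)
    have "l \<le> b * (1/2) ^ j * 2 powr (- (s * real (Nf j)))"
      using LN[of j] l b by (simp add: b_def[symmetric])
    then have "2 powr (s * real (Nf j)) * l \<le> 2 powr (s * real (Nf j)) * (b * (1/2) ^ j * 2 powr (- (s * real (Nf j))))"
      by (intro mult_left_mono) auto
    also have "\<dots> = b * (1/2) ^ j" by (simp add: powr_minus)
    finally have "(2 powr (s * real (Nf j)) * l) powr Q \<le> (b * (1/2) ^ j) powr Q"
      using l Q by (intro powr_mono2) auto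
    moreover have "(2 powr (s * real (Nf j)) * l) powr Q = 2 powr (s * real (Nf j) * Q) * l powr Q"
      using l by (simp add: powr_mult powr_powr)
    moreover have "(b * (1/2) ^ j) powr Q = b powr Q * ((1/2) powr Q) ^ j"
      using b by (simp add: powr_mult powr_powr mult.commute[of Q] flip: powr_realpow)
    ultimately show ?thesis using l by (simp add: F_def ennreal_powr_real ennreal_leI flip: ennreal_mult')
  qed
  have "(\<lambda>j. F (Nf j)) sums (\<Sum>j. F (Nf j))" by (intro summable_sums summableI)
  \<comment> \<open>\<open>F\<close> is 0 off the range of the strictly increasing
    \<open>Nf\<close>, so the sum over all indices is the sum along \<open>Nf\<close>.\<close>
  then have "F sums (\<Sum>j. F (Nf j))" using sums_mono_reindex[of Nf F, OF Nmono F0] by simp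
  then have "(\<Sum>k. F k) = (\<Sum>j. F (Nf j))" by (rule sums_unique[symmetric])
  also have "\<dots> \<le> (\<Sum>j. ennreal (b powr Q * ((1/2) powr Q) ^ j))" by (intro suminf_le FN summableI)
  also have "\<dots> = ennreal (\<Sum>j. b powr Q * ((1/2) powr Q) ^ j)"
  proof (rule suminf_ennreal2)
    have "(1/2::real) powr Q < 1" using Q powr_less_mono2[of Q "1/2" 1] by simp
    then show "summable (\<lambda>j. b powr Q * ((1/2) powr Q) ^ j)" by (intro summable_mult summable_geometric) simp
  qed simp
  finally have "(\<Sum>k. F k) < \<infinity>" by (rule le_less_trans) simp
  then have "besov_norm \<Psi> s p q u < \<infinity>"
    using Q by (auto simp: besov_norm_def F_def L_def ennreal_powr_def)
  then have "u \<in> besov_space \<Psi> (enn2real (1 / p)) p q" using ut by (simp add: besov_space_def s_def)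
  with tr show ?thesis by blast
qed

text \<open>The index type of the hyperplane is nonempty, so its product with \<open>real\<close>
  stands for R^n with n \<ge> 2. For \<open>p = \<infinity>\<close> the smoothness
  \<open>enn2real (1 / p)\<close> is 0, in line with the convention for 1/\<infinity>.\<close>

theorem theorem1p3:
  fixes \<Psi> :: "real \<Rightarrow> real" and p q :: ennreal
    and B :: "(((real ^ 'm::finite) \<times> real \<Rightarrow> complex) \<Rightarrow> complex) set"
  assumes "cutoff \<Psi>" and "1 \<le> p" and "0 < q" and "q \<le> 1"
    and "B = besov_space \<Psi> (enn2real (1 / p)) p q"
  shows "B \<subseteq> trace_domain \<and>
    distributional_trace ` B \<subseteq> Lp_space p \<and>
    (\<exists>c::real. \<forall>u\<in>B. Lp_norm_dist p (distributional_trace u)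
       \<le> ennreal c * besov_norm \<Psi> (enn2real (1 / p)) p q u) \<and>
    (p < \<infinity> \<longrightarrow> distributional_trace ` B = Lp_space p)"
proof -
  obtain c :: real where c: "\<And>u. u \<in> B \<Longrightarrow> u \<in> trace_domain \<and> distributional_trace u \<in> Lp_space p \<and>
     Lp_norm_dist p (distributional_trace u) \<le> ennreal c * besov_norm \<Psi> (enn2real (1 / p)) p q u"
    using trace_bounded[OF assms(1-4), where 'a = "real ^ 'm"] unfolding assms(5) by blast
  moreover have "Lp_space p \<subseteq> distributional_trace ` B" if "p < \<infinity>"
  proof
    fix v :: "(real ^ 'm \<Rightarrow> complex) \<Rightarrow> complex" assume "v \<in> Lp_space p"
    then obtain h where h: "h \<in> borel_measurable lborel" "Lp_norm p h < \<infinity>" "v = regular_distribution h"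
      unfolding Lp_space_def by blast
    have "p \<noteq> \<infinity>" using that by auto
    from trace_surjective[OF assms(1,2) this assms(3,4) h(1,2)]
    show "v \<in> distributional_trace ` B" unfolding assms(5) h(3) by (metis image_eqI)
  qed
  ultimately show ?thesis by blast
qed

end
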